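(* Let $n\ge1$, $0<p,q\le\infty$, $m\in\mathbb{R}$, $s>\tau_{p,q}:=n\left(\frac{1}{\min(1,p,q)}-1\right)$ and $\sigma\in BS^m_{1,1}(\mathbb{R}^n)$. For each $i\in\{1,2\}$ let either $0<\tilde p_i<\infty$ and $0<\tilde q_i\le\infty$, or $\tilde p_i=\infty$ and $0<\tilde q_i\le2$. Let $r=\max\{1,\tilde p_1,\tilde p_2\}$, let $r'$ be its conjugate exponent ($1/r'=1-1/r$, with $1/\infty=0$), and let $w(t)=(1+\log_+(1/t))^{1/r'}$ for $t>0$. Then there exist a constant $C>0$ and a positive integer $N$ such that $$\|T_\sigma(f,g)\|_{F^{s,1/w}_{p,q}(\mathbb{R}^n)}\le C\|\sigma\|_{BS^m_{1,1;N}}\left(\|f\|_{F^{s+m}_{p,q}(\mathbb{R}^n)}\|g\|_{F^{n/\tilde p_1}_{\tilde p_1,\tilde q_1}(\mathbb{R}^n)}+\|f\|_{F^{n/\tilde p_2}_{\tilde p_2,\tilde q_2}(\mathbb{R}^n)}\|g\|_{F^{s+m}_{p,q}(\mathbb{R}^n)}\right)$$ for all Schwartz functions $f,g\in\mathcal S(\mathbb{R}^n)$ (where $n/\tilde p_i=0$ if $\tilde p_i=\infty$).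
   Context: Notation: $\log_+t=\max\{\log t,0\}$; $\widehat f(\xi)=\int_{\mathbb{R}^n} f(x)e^{-ix\xi}\,dx$; for a symbol $a$, $a(D)f$ is the inverse Fourier transform of $a(\xi)\widehat f(\xi)$. Bilinear operators: $T_\sigma(f,g)(x)=(2\pi)^{-2n}\iint\sigma(x,\xi,\eta)\widehat f(\xi)\widehat g(\eta)e^{ix(\xi+\eta)}\,d\xi\,d\eta$ for $f,g\in\mathcal S(\mathbb{R}^n)$. The class $BS^m_{1,1}(\mathbb{R}^n)$ consists of smooth $\sigma$ on $\mathbb{R}^{3n}$ such that for all multi-indices $\alpha,\beta,\gamma$ there is $C_{\alpha,\beta,\gamma}>0$ with $|\partial_x^\alpha\partial_\xi^\beta\partial_\eta^\gamma\sigma(x,\xi,\eta)|\le C_{\alpha,\beta,\gamma}(1+|\xi|+|\eta|)^{m+|\alpha|-|\beta|-|\gamma|}$ for all $(x,\xi,\eta)$; for $N\in\mathbb{N}$, $\|\sigma\|_{BS^m_{1,1;N}}=\max_{|\alpha|,|\beta|,|\gamma|\le N}\sup_{x,\xi,\eta}(1+|\xi|+|\eta|)^{-(m+|\alpha|-|\beta|-|\gamma|)}|\partial_x^\alpha\partial_\xi^\beta\partial_\eta^\gamma\sigma(x,\xi,\eta)|$. Triebel–Lizorkin spaces of generalised smoothness: let $\varphi_0$ be a nonnegative radially decreasing Schwartz function supported in $\{|\xi|\le3/2\}$, identically one on $\{|\xi|\le1\}$; $\varphi(\xi)=\varphi_0(\xi)-\varphi_0(2\xi)$, $\varphi_j(\xi)=\varphi(2^{-j}\xi)$,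 $j\ge1$. For $s\in\mathbb{R}$, a weight $w:(0,\infty)\to(0,\infty)$ (here a power of $1+\log_+(1/t)$), $0<p<\infty$, $0<q\le\infty$: $\|f\|_{F^{s,w}_{p,q}}=\big\|\big(\sum_{j\ge0}2^{jsq}w(2^{-j})^q|\varphi_j(D)f|^q\big)^{1/q}\big\|_{L^p}$ (usual modification if $q=\infty$). For $p=\infty$, $0<q<\infty$: $\|f\|_{F^{s,w}_{\infty,q}}=\|\varphi_0(D)f\|_\infty+\sup_{Q}\big(\frac1{|Q|}\int_Q\sum_{j=-\log_2\ell(Q)}^\infty2^{sjq}w(2^{-j})^q|\varphi_j(D)f(x)|^q\,dx\big)^{1/q}$, supremum over dyadic cubes $Q$ with side length $\ell(Q)\le1$. For $p=q=\infty$: $\|f\|_{F^{s,w}_{\infty,\infty}}=\sup_{j\ge0}2^{sj}w(2^{-j})\|\varphi_j(D)f\|_\infty$. The space $F^{s,w}_{p,q}(\mathbb{R}^n)$ is the set of tempered distributions with finite quasi-norm, and $F^s_{p,q}:=F^{s,1}_{p,q}$ (weight $w\equiv1$). *)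

theory Defs
  imports "HOL-Analysis.Analysis" "HOL-Probability.Essential_Supremum"
begin

type_synonym 'n multiindex = "'n \<Rightarrow> nat"

definition msize :: "'n::finite multiindex \<Rightarrow> nat" where
  "msize \<alpha> = (\<Sum>i\<in>UNIV. \<alpha> i)"

definition dir_deriv ::
  "'a::real_normed_vector \<Rightarrow> ('a \<Rightarrow> 'b::real_normed_vector) \<Rightarrow> 'a \<Rightarrow> 'b" where
  "dir_deriv v f x = frechet_derivative f (at x) v"

text \<open>A function is smooth if all its iterated partial derivatives, taken in any order, exist and
  are differentiable everywhere (so that, in particular, they are continuous).\<close>

definition smooth :: "('a::euclidean_space \<Rightarrow> 'b::real_normed_vector) \<Rightarrow> bool" where
  "smooth f \<longleftrightarrow> (\<forall>vs. set vs \<subseteq> Basis \<longrightarrow> (foldr dir_deriv vs f) differentiable_on UNIV)"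

text \<open>The index type carries no order, so some enumeration of it is fixed in order to compose the
  powers of the partial derivatives. For smooth functions the order is irrelevant.\<close>

definition index_enum :: "'n::finite list" where
  "index_enum = (SOME xs. distinct xs \<and> set xs = UNIV)"

text \<open>The derivative of multi-index \<open>\<alpha>\<close> in the directions \<open>e i\<close>. On \<open>real ^ 'n\<close> one takes
  \<open>e i = axis i 1\<close>; on a product of copies of \<open>real ^ 'n\<close>, the embedding of \<open>axis i 1\<close>
  into one factor.\<close>

definition mderiv ::
  "('n::finite \<Rightarrow> 'a::real_normed_vector) \<Rightarrow> 'n multiindex \<Rightarrow>
    ('a \<Rightarrow> 'b::real_normed_vector) \<Rightarrow> 'a \<Rightarrow> 'b" where
  "mderiv e \<alpha> = foldr (\<lambda>i. dir_deriv (e i) ^^ \<alpha> i) index_enum"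

definition schwartz_seminorm ::
  "nat \<Rightarrow> (real ^ 'n::finite \<Rightarrow> 'b::real_normed_vector) \<Rightarrow> ennreal" where
  "schwartz_seminorm N f =
    (SUP \<beta>\<in>{\<beta>. msize \<beta> \<le> N}. SUP x. ennreal ((1 + norm x) ^ N * norm (mderiv (\<lambda>i. axis i 1) \<beta> f x)))"

definition schwartz :: "(real ^ 'n::finite \<Rightarrow> 'b::real_normed_vector) set" where
  "schwartz = {f. smooth f \<and> (\<forall>N. schwartz_seminorm N f < \<infinity>)}"

definition fourier :: "(real ^ 'n::finite \<Rightarrow> complex) \<Rightarrow> real ^ 'n \<Rightarrow> complex" where
  "fourier f \<xi> = (LINT x|lborel. f x * exp (- \<i> * of_real (x \<bullet> \<xi>)))"

definition inv_fourier :: "(real ^ 'n::finite \<Rightarrow> complex) \<Rightarrow> real ^ 'n \<Rightarrow> complex" where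
  "inv_fourier f x =
    of_real ((2 * pi) powr (- real CARD('n))) * (LINT \<xi>|lborel. f \<xi> * exp (\<i> * of_real (x \<bullet> \<xi>)))"

type_synonym 'n functional = "(real ^ 'n \<Rightarrow> complex) \<Rightarrow> complex"

text \<open>Only the values of a functional on \<open>schwartz\<close> are relevant.\<close>

definition tempered_distribution :: "'n::finite functional \<Rightarrow> bool" where
  "tempered_distribution u \<longleftrightarrow>
     (\<forall>\<psi>\<in>schwartz. \<forall>\<theta>\<in>schwartz. u (\<lambda>x. \<psi> x + \<theta> x) = u \<psi> + u \<theta>) \<and>
     (\<forall>c. \<forall>\<psi>\<in>schwartz. u (\<lambda>x. c * \<psi> x) = c * u \<psi>) \<and>
     (\<exists>C N. \<forall>\<psi>\<in>schwartz. ennreal (norm (u \<psi>)) \<le> ennreal C * schwartz_seminorm N \<psi>)"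

definition dist_of :: "(real ^ 'n::finite \<Rightarrow> complex) \<Rightarrow> 'n functional" where
  "dist_of h \<psi> = (LINT x|lborel. h x * \<psi> x)"

definition dist_fourier :: "'n::finite functional \<Rightarrow> 'n functional" where
  "dist_fourier u \<psi> = u (fourier \<psi>)"

definition dist_inv_fourier :: "'n::finite functional \<Rightarrow> 'n functional" where
  "dist_inv_fourier u \<psi> = u (inv_fourier \<psi>)"

definition dist_mult :: "(real ^ 'n::finite \<Rightarrow> complex) \<Rightarrow> 'n functional \<Rightarrow> 'n functional" where
  "dist_mult a u \<psi> = u (\<lambda>\<xi>. a \<xi> * \<psi> \<xi>)"

definition multiplier :: "(real ^ 'n::finite \<Rightarrow> complex) \<Rightarrow> 'n functional \<Rightarrow> 'n functional" where
  "multiplier a u = dist_inv_fourier (dist_mult a (dist_fourier u))"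

text \<open>The continuous function that represents a distribution. It is used only for \<open>a(D)u\<close> with \<open>u\<close>
  tempered and \<open>a\<close> smooth with compact support; such a distribution is given by a unique
  continuous (indeed smooth) function of polynomial growth.\<close>

definition fun_of_dist :: "'n::finite functional \<Rightarrow> real ^ 'n \<Rightarrow> complex" where
  "fun_of_dist u = (THE h. continuous_on UNIV h \<and>
     (\<forall>\<psi>\<in>schwartz. integrable lborel (\<lambda>x. h x * \<psi> x) \<and> u \<psi> = (LINT x|lborel. h x * \<psi> x)))"

type_synonym 'n symbol = "(real ^ 'n) \<times> (real ^ 'n) \<times> (real ^ 'n) \<Rightarrow> complex"

definition symbol_deriv ::
  "'n::finite multiindex \<Rightarrow> 'n multiindex \<Rightarrow> 'n multiindex \<Rightarrow> 'n symbol \<Rightarrow> 'n symbol" where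
  "symbol_deriv \<alpha> \<beta> \<gamma> \<sigma> =
     mderiv (\<lambda>i. (axis i 1, 0, 0)) \<alpha>
       (mderiv (\<lambda>i. (0, axis i 1, 0)) \<beta>
         (mderiv (\<lambda>i. (0, 0, axis i 1)) \<gamma> \<sigma>))"

definition BS11 :: "real \<Rightarrow> 'n::finite symbol set" where
  "BS11 m = {\<sigma>. smooth \<sigma> \<and>
     (\<forall>\<alpha> \<beta> \<gamma>. \<exists>C>0. \<forall>x \<xi> \<eta>. norm (symbol_deriv \<alpha> \<beta> \<gamma> \<sigma> (x, \<xi>, \<eta>))
        \<le> C * (1 + norm \<xi> + norm \<eta>) powr (m + real (msize \<alpha>) - real (msize \<beta>) - real (msize \<gamma>)))}"

definition BS11_norm :: "real \<Rightarrow> nat \<Rightarrow> 'n::finite symbol \<Rightarrow> ennreal" where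
  "BS11_norm m N \<sigma> =
     (SUP (\<alpha>, \<beta>, \<gamma>) \<in> {(\<alpha>, \<beta>, \<gamma>). msize \<alpha> \<le> N \<and> msize \<beta> \<le> N \<and> msize \<gamma> \<le> N}.
        SUP (x, \<xi>, \<eta>).
          ennreal ((1 + norm \<xi> + norm \<eta>) powr
                     (- (m + real (msize \<alpha>) - real (msize \<beta>) - real (msize \<gamma>)))
                   * norm (symbol_deriv \<alpha> \<beta> \<gamma> \<sigma> (x, \<xi>, \<eta>))))"

definition bilinear_op ::
  "'n::finite symbol \<Rightarrow> (real ^ 'n \<Rightarrow> complex) \<Rightarrow> (real ^ 'n \<Rightarrow> complex) \<Rightarrow> real ^ 'n \<Rightarrow> complex" where
  "bilinear_op \<sigma> f g x =
     of_real ((2 * pi) powr (- 2 * real CARD('n))) *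
     (LINT (\<xi>, \<eta>)|lborel. \<sigma> (x, \<xi>, \<eta>) * fourier f \<xi> * fourier g \<eta> * exp (\<i> * of_real (x \<bullet> (\<xi> + \<eta>))))"

text \<open>Monotonicity with respect to the norm includes radial symmetry.\<close>

definition LP_generator :: "(real ^ 'n::finite \<Rightarrow> real) \<Rightarrow> bool" where
  "LP_generator \<phi>0 \<longleftrightarrow> \<phi>0 \<in> schwartz \<and> (\<forall>\<xi>. 0 \<le> \<phi>0 \<xi>) \<and>
     (\<forall>\<xi> \<eta>. norm \<xi> \<le> norm \<eta> \<longrightarrow> \<phi>0 \<eta> \<le> \<phi>0 \<xi>) \<and>
     (\<forall>\<xi>. norm \<xi> > 3 / 2 \<longrightarrow> \<phi>0 \<xi> = 0) \<and> (\<forall>\<xi>. norm \<xi> \<le> 1 \<longrightarrow> \<phi>0 \<xi> = 1)"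

definition LP_cutoff :: "(real ^ 'n::finite \<Rightarrow> real) \<Rightarrow> nat \<Rightarrow> real ^ 'n \<Rightarrow> real" where
  "LP_cutoff \<phi>0 j \<xi> =
     (if j = 0 then \<phi>0 \<xi> else (let \<phi> = (\<lambda>\<zeta>. \<phi>0 \<zeta> - \<phi>0 (2 *\<^sub>R \<zeta>)) in \<phi> ((2 powr (- real j)) *\<^sub>R \<xi>)))"

definition LP_piece ::
  "(real ^ 'n::finite \<Rightarrow> real) \<Rightarrow> nat \<Rightarrow> 'n functional \<Rightarrow> real ^ 'n \<Rightarrow> complex" where
  "LP_piece \<phi>0 j u = fun_of_dist (multiplier (\<lambda>\<xi>. of_real (LP_cutoff \<phi>0 j \<xi>)) u)"

text \<open>Only meant for exponents \<open>r > 0\<close>, whence the value at infinity.\<close>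

definition epowr :: "ennreal \<Rightarrow> real \<Rightarrow> ennreal" where
  "epowr a r = (if a = \<infinity> then \<infinity> else ennreal (enn2real a powr r))"

definition Linf_norm :: "(real ^ 'n::finite \<Rightarrow> complex) \<Rightarrow> ennreal" where
  "Linf_norm h = esssup lborel (\<lambda>x. ennreal (norm (h x)))"

definition dyadic_cube :: "nat \<Rightarrow> ('n::finite \<Rightarrow> int) \<Rightarrow> (real ^ 'n) set" where
  "dyadic_cube k z = {x. \<forall>i. 2 powr (- real k) * of_int (z i) \<le> x $ i \<and>
                             x $ i < 2 powr (- real k) * (of_int (z i) + 1)}"

text \<open>The quasi-norm of a tempered distribution, so that the space is the set of all \<open>u\<close> with finite
  \<open>F_norm\<close>. In the case \<open>p = \<infinity> > q\<close> the cubes have side length \<open>2 powr (- k)\<close>, and the inner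
  sum is over the indices \<open>k + j \<ge> k\<close>.\<close>

definition F_norm ::
  "(real ^ 'n::finite \<Rightarrow> real) \<Rightarrow> real \<Rightarrow> (real \<Rightarrow> real) \<Rightarrow> ennreal \<Rightarrow> ennreal \<Rightarrow> 'n functional \<Rightarrow> ennreal" where
  "F_norm \<phi>0 s w p q u =
    (let p' = enn2real p; q' = enn2real q;
         a = (\<lambda>j x. ennreal (2 powr (real j * s) * w (2 powr (- real j)) * norm (LP_piece \<phi>0 j u x)));
         b = (\<lambda>j x. ennreal (2 powr (real j * s * q') * w (2 powr (- real j)) powr q'
                              * norm (LP_piece \<phi>0 j u x) powr q'))
     in if \<not> tempered_distribution u then \<infinity>
        else if p < \<infinity> \<and> q < \<infinity> then
          epowr (\<integral>\<^sup>+ x. epowr (epowr (\<Sum>j. b j x) (1 / q')) p' \<partial>lborel) (1 / p')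
        else if p < \<infinity> then
          epowr (\<integral>\<^sup>+ x. epowr (SUP j. a j x) p' \<partial>lborel) (1 / p')
        else if q < \<infinity> then
          Linf_norm (LP_piece \<phi>0 0 u) +
          (SUP (k, z). epowr ((\<integral>\<^sup>+ x \<in> dyadic_cube k z. (\<Sum>j. b (k + j) x) \<partial>lborel)
                                / emeasure lborel (dyadic_cube k z)) (1 / q'))
        else
          (SUP j. ennreal (2 powr (real j * s) * w (2 powr (- real j))) * Linf_norm (LP_piece \<phi>0 j u)))"

definition log_plus :: "real \<Rightarrow> real" where
  "log_plus t = max (ln t) 0"

end

(* Split f (x) g into pairs (phi_j f, low-frequency part of g) and (low-frequency part of f, phi_j g).
   Pieces of T with output frequency k <= j are bounded pointwise by kernel averages at the scales j and k;
   for k > j, moving M derivatives from phi_k onto the symbol (which costs 2^j each in BS_{1,1}) gains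
   2^{-M(k-j)}. Since every factor is band limited, the Peetre trick replaces its averages by t-th power
   averages with t < min(1,p,q), and s > tau_{p,q} leaves geometric decay in |k - j|. The low-frequency
   factor is O((1+j)^{1/r'}) times its critical norm, by Hoelder over the j frequencies; the weight 1/w
   absorbs exactly this. The geometric sums of averages are then summed with vector-valued maximal
   inequalities, or with Carleson-type estimates over dyadic cubes if p is infinite. *)
theory Submission
  imports Defs "HOL-Probability.Characteristic_Functions"
begin

text \<open>All estimates are made for t-th powers, with one t slightly below min(1,p,q). These
  powers are subadditive over the frequency pairs, and p/t and q/t exceed 1, so the quasi-normed
  range is reached through inequalities for nonnegative functions in the normed range. The price is
  paid at coarse scales: for k < j, an average at scale 2^-k of a function of frequency 2^j has to
  be compared with the average of its t-th power, which loses 2^((j-k) n (1-t)). The hypothesis on s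
  is what makes s t > n (1-t) possible. All bounds of an output frequency k by input frequencies j
  take the form of one operator, \<open>Uop\<close>: averages at the coarser of the two scales with
  weights decaying in |k-j|. It is symmetric in (j,k); duality then gives its vector-valued bounds,
  and testing on cubes those for p infinite. The exponent 1/r' comes from an embedding: the pieces
  of a function in F^(n/P)_(P,q) are at each point summable only to the power P. The quotient of the
  weights at j and k is polynomial in |k-j|, so part of the geometric decay pays for it.\<close>

abbreviation enorm :: "'a::real_normed_vector \<Rightarrow> ennreal" where "enorm x \<equiv> ennreal (norm x)"
abbreviation Borel :: "('a::topological_space \<Rightarrow> 'b::topological_space) set" where "Borel \<equiv> borel_measurable borel"
abbreviation L1 :: "('a::euclidean_space \<Rightarrow> 'b::{banach, second_countable_topology}) \<Rightarrow> bool" where "L1 f \<equiv> integrable lborel f"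
abbreviation nn_lborel :: "('a::euclidean_space \<Rightarrow> ennreal) \<Rightarrow> ennreal" (binder "\<integral>" 60)
 where "nn_lborel f \<equiv> nn_integral lborel f"

section \<open>Calculus of smooth functions and iterated directional derivatives\<close>

lemma smooth_imp_differentiable: "smooth f ==> f differentiable (at x)"
 unfolding smooth_def by (drule spec[of _ "[]"]) (auto simp: differentiable_on_def)

lemma smooth_imp_has_derivative:
 "smooth f ==> (f has_derivative (%v. dir_deriv v f x)) (at x)"
 unfolding dir_deriv_def by (metis smooth_imp_differentiable frechet_derivative_works eta_contract_eq)

lemma smooth_imp_continuous: "smooth f ==> continuous_on S f"
 by (meson continuous_at_imp_continuous_on differentiable_imp_continuous_within smooth_imp_differentiable)

lemma smooth_imp_measurable: "smooth f ==> f \<in> Borel"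
 by (simp add: borel_measurable_continuous_onI smooth_imp_continuous)

lemma smooth_dir_deriv: "smooth f ==> b \<in> Basis ==> smooth (dir_deriv b f)"
 unfolding smooth_def
proof (intro allI impI)
 fix vs :: "'a list"
 assume *: "\<forall>vs. set vs \<subseteq> Basis --> foldr dir_deriv vs f differentiable_on UNIV" "b \<in> Basis" "set vs \<subseteq> Basis"
 show "foldr dir_deriv vs (dir_deriv b f) differentiable_on UNIV"
  using *(1)[rule_format, of "vs @ [b]"] *(2,3) by simp
qed

lemma smooth_iter_deriv: "smooth f ==> set vs \<subseteq> Basis ==> smooth (foldr dir_deriv vs f)"
 by (induction vs) (auto intro: smooth_dir_deriv)

text \<open>\<open>smooth\<close> quantifies over all iterated derivatives. A class of
  differentiable functions that is closed under basis derivatives reduces this to a single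
  derivative; each closure property below enlarges its class until it is closed, for instance from
  products to finite sums of products.\<close>

lemma smooth_coinduct:
 assumes "P f" "!!f x. P f ==> f differentiable (at x)" "!!f b. P f ==> b \<in> Basis ==> P (dir_deriv b f)"
 shows "smooth f"
proof -
 have "P (foldr dir_deriv vs f)" if "set vs \<subseteq> Basis" for vs
  using that by (induction vs) (auto intro: assms)
 thus ?thesis unfolding smooth_def differentiable_on_def using assms(2) by auto
qed

lemma bounded_linear_differentiable:
 "bounded_linear T ==> f differentiable (at x) ==> (%x. T (f x)) differentiable (at x)"
 unfolding differentiable_def using bounded_linear.has_derivative by blast

lemma dir_derivI: "(f has_derivative f') (at x) ==> dir_deriv v f x = f' v"
 unfolding dir_deriv_def by (metis frechet_derivative_at)

lemma dir_deriv_add: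
 "smooth f ==> smooth g ==> dir_deriv v (%x. f x + g x) = (%x. dir_deriv v f x + dir_deriv v g x)"
 by (rule ext, rule dir_derivI) (intro has_derivative_add smooth_imp_has_derivative)

lemma dir_deriv_bounded_linear:
 "bounded_linear T ==> smooth f ==> dir_deriv v (%x. T (f x)) = (%x. T (dir_deriv v f x))"
 by (rule ext, rule dir_derivI) (rule bounded_linear.has_derivative, assumption, rule smooth_imp_has_derivative)

lemma dir_deriv_mult:
 fixes f g :: "'a::euclidean_space => 'b::real_normed_algebra"
 shows "smooth f ==> smooth g ==>
  dir_deriv v (%x. f x * g x) = (%x. f x * dir_deriv v g x + dir_deriv v f x * g x)"
 by (rule ext, rule dir_derivI) (intro has_derivative_mult smooth_imp_has_derivative)

lemma dir_deriv_const [simp]: "dir_deriv v (%x. c) = (%x. 0)"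
 by (rule ext, rule dir_derivI) simp

lemma smooth_const: "smooth (%x. c)"
proof (rule smooth_coinduct[where P="%f. \<exists>c. f = (%x. c)"])
 show "!!f b. \<exists>c. f = (%x. c) ==> b \<in> Basis ==> \<exists>c. dir_deriv b f = (%x. c)"
  by (metis dir_deriv_const)
qed auto

lemma smooth_add:
 assumes "smooth f" "smooth g" shows "smooth (%x. f x + g x)"
proof (rule smooth_coinduct[where P="%h. \<exists>f g. smooth f \<and> smooth g \<and> h = (%x. f x + g x)"])
 show "\<exists>f g. smooth f \<and> smooth g \<and> dir_deriv b h = (%x. f x + g x)"
  if h: "\<exists>f g. smooth f \<and> smooth g \<and> h = (%x. f x + g x)" and b: "b \<in> Basis" for h :: "'a => 'b" and b
 proof -
  obtain f g where "smooth f" "smooth g" "h = (%x. f x + g x)" using h by auto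
  thus ?thesis using b
   by (intro exI[of _ "dir_deriv b f"] exI[of _ "dir_deriv b g"]) (auto simp: dir_deriv_add smooth_dir_deriv)
 qed
qed (use assms in \<open>auto intro: smooth_imp_differentiable intro!: differentiable_add\<close>)

lemma smooth_bounded_linear:
 assumes T: "bounded_linear T" and f: "smooth f" shows "smooth (%x. T (f x))"
proof (rule smooth_coinduct[where P="%h. \<exists>f. smooth f \<and> h = (%x. T (f x))"])
 show "\<exists>f. smooth f \<and> dir_deriv b h = (%x. T (f x))"
  if h: "\<exists>f. smooth f \<and> h = (%x. T (f x))" and b: "b \<in> Basis" for h b
 proof -
  obtain f where "smooth f" "h = (%x. T (f x))" using h by auto
  thus ?thesis using b
   by (intro exI[of _ "dir_deriv b f"]) (auto simp: dir_deriv_bounded_linear T smooth_dir_deriv)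
 qed
qed (use assms in \<open>auto intro: smooth_imp_differentiable intro!: bounded_linear_differentiable[OF T]\<close>)

lemma smooth_sum: "finite I ==> (!!i. i \<in> I ==> smooth (f i)) ==> smooth (%x. \<Sum>i\<in>I. f i x)"
 by (induction rule: finite_induct) (auto intro: smooth_add smooth_const)

lemma smooth_mult:
 fixes f g :: "'a::euclidean_space => 'b::real_normed_algebra"
 assumes "smooth f" "smooth g" shows "smooth (%x. f x * g x)"
proof (rule smooth_coinduct[where P="%h. \<exists>n f g. (\<forall>i<n::nat. smooth (f i) \<and> smooth (g i)) \<and>
  h = (%x. \<Sum>i<n. f i x * g i x)"])
 show "\<exists>n fa ga. (\<forall>i<n::nat. smooth (fa i) \<and> smooth (ga i)) \<and> (%x. f x * g x) = (%x. \<Sum>i<n. fa i x * ga i x)"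
  by (rule exI[of _ 1], rule exI[of _ "%_. f"], rule exI[of _ "%_. g"]) (simp add: assms)
next
 fix h :: "'a => 'b" and x
 assume "\<exists>n f g. (\<forall>i<n::nat. smooth (f i) \<and> smooth (g i)) \<and> h = (%x. \<Sum>i<n. f i x * g i x)"
 thus "h differentiable at x"
  by (auto intro: smooth_imp_differentiable intro!: differentiable_sum differentiable_mult)
next
 fix h :: "'a => 'b" and b :: 'a
 assume "\<exists>n f g. (\<forall>i<n::nat. smooth (f i) \<and> smooth (g i)) \<and> h = (%x. \<Sum>i<n. f i x * g i x)" and b: "b \<in> Basis"
 then obtain n f g where s: "!!i. i < n ==> smooth (f i)" "!!i. i < n ==> smooth (g i)"
  and h: "h = (%x. \<Sum>i<(n::nat). f i x * g i x)" by auto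
 have d: "dir_deriv b h = (%x. \<Sum>i<n. f i x * dir_deriv b (g i) x + dir_deriv b (f i) x * g i x)"
  unfolding h by (rule ext, rule dir_derivI)
   (intro has_derivative_sum has_derivative_mult smooth_imp_has_derivative, auto simp: s)
 show "\<exists>n f g. (\<forall>i<n::nat. smooth (f i) \<and> smooth (g i)) \<and> dir_deriv b h = (%x. \<Sum>i<n. f i x * g i x)"
 proof (intro exI conjI)
  \<comment> \<open>The product rule doubles the number of terms: indices below \<open>n\<close>
    carry \<open>f i * dir_deriv b (g i)\<close>, the other \<open>n\<close> carry
    \<open>dir_deriv b (f i) * g i\<close>, shifted.\<close>
  show "\<forall>i<n+n. smooth (if i < n then f i else dir_deriv b (f (i-n))) \<and> smooth (if i < n then dir_deriv b (g i) else g (i-n))"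
   using s b by (auto intro!: smooth_dir_deriv)
  show "dir_deriv b h = (%x. \<Sum>i<n+n. (if i < n then f i else dir_deriv b (f (i-n))) x * (if i < n then dir_deriv b (g i) else g (i-n)) x)"
   unfolding d
  proof (rule ext)
   fix x
   have "(\<Sum>i<n+n. (if i < n then f i else dir_deriv b (f (i-n))) x * (if i < n then dir_deriv b (g i) else g (i-n)) x)
     = (\<Sum>i<n. f i x * dir_deriv b (g i) x) + (\<Sum>i=n..<n+n. dir_deriv b (f (i-n)) x * g (i-n) x)"
    unfolding lessThan_atLeast0 by (subst sum.atLeastLessThan_concat[of 0 n "n+n", symmetric]) auto
   also have "(\<Sum>i=n..<n+n. dir_deriv b (f (i-n)) x * g (i-n) x) = (\<Sum>i<n. dir_deriv b (f i) x * g i x)"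
    using sum.shift_bounds_nat_ivl[of "%i. dir_deriv b (f (i-n)) x * g (i-n) x" 0 n n] by (simp add: lessThan_atLeast0)
   finally show "(\<Sum>i<n. f i x * dir_deriv b (g i) x + dir_deriv b (f i) x * g i x) = (\<Sum>i<n+n. (if i < n then f i else dir_deriv b (f (i-n))) x * (if i < n then dir_deriv b (g i) else g (i-n)) x)"
    by (simp add: sum.distrib)
  qed
 qed
qed

lemma dir_deriv_affine:
 assumes "bounded_linear A" "smooth f" "A b = c *\<^sub>R e"
 shows "dir_deriv b (%x. f (A x + a)) = (%x. c *\<^sub>R dir_deriv e f (A x + a))"
proof (rule ext, rule trans[OF dir_derivI])
 fix x
 have "((%x. f (A x + a)) has_derivative (%v. dir_deriv (A v) f (A x + a))) (at x)"
  by (rule has_derivative_compose[OF _ smooth_imp_has_derivative[OF assms(2)], where f="%x. A x + a"])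
    (auto intro!: derivative_eq_intros bounded_linear_imp_has_derivative assms)
 thus "((%x. f (A x + a)) has_derivative (%v. dir_deriv (A v) f (A x + a))) (at x)" .
 show "dir_deriv (A b) f (A x + a) = c *\<^sub>R dir_deriv e f (A x + a)"
  using linear_cmul[OF has_derivative_linear[OF smooth_imp_has_derivative[OF assms(2)]]]
  by (simp add: assms(3))
qed

text \<open>\<open>smooth\<close> speaks of basis directions only, so \<open>A\<close> has to send
  basis vectors to multiples of basis vectors. Dilations, coordinate embeddings and projections are
  of this kind.\<close>

lemma smooth_affine:
 fixes A :: "'a::euclidean_space => 'b::euclidean_space" and f :: "'b => 'c::real_normed_vector"
 assumes A: "bounded_linear A" and "smooth f" "!!b. b \<in> Basis ==> \<exists>c e. A b = c *\<^sub>R e \<and> e \<in> Basis"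
 shows "smooth (%x. f (A x + a))"
\<comment> \<open>The scalar \<open>c\<close> in the class takes up the chain rule factor that each
  derivative produces.\<close>
proof (rule smooth_coinduct[where P="%h. \<exists>c f. smooth f \<and> h = (%x. c *\<^sub>R f (A x + a))"])
 let ?f = "%c f x. c *\<^sub>R f (A x + a)"
 show "\<exists>c fa. smooth fa \<and> (%x. f (A x + a)) = (%x. c *\<^sub>R fa (A x + a))"
  by (rule exI[of _ 1], rule exI[of _ f]) (simp add: assms)
 have d: "(%x. f (A x + a)) differentiable at x" if "smooth f" for f :: "'b => 'c" and x
  by (rule differentiable_compose[of f, OF smooth_imp_differentiable[OF that]])
   (intro differentiable_add differentiable_const bounded_linear_imp_differentiable[OF A])
 show "h differentiable at x" if h: "\<exists>c f. smooth f \<and> h = (?f c f)" for h :: "'a => 'c" and x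
 proof -
  obtain c f where "smooth f" "h = (?f c f)" using h by auto
  thus ?thesis using differentiable_scaleR[OF differentiable_const d] by auto
 qed
 show "\<exists>c f. smooth f \<and> dir_deriv b h = (?f c f)"
  if h: "\<exists>c f. smooth f \<and> h = (?f c f)" and b: "b \<in> Basis" for h b
 proof -
  obtain c f where f: "smooth f" and h: "h = (?f c f)" using h by auto
  obtain c' e where e: "A b = c' *\<^sub>R e" "e \<in> Basis" using assms(3)[OF b] by auto
  have "dir_deriv b h = (%x. c' *\<^sub>R dir_deriv e (%y. c *\<^sub>R f y) (A x + a))"
   unfolding h by (rule dir_deriv_affine[OF A smooth_bounded_linear[OF bounded_linear_scaleR_right f] e(1)])
  with smooth_dir_deriv[OF smooth_bounded_linear[OF bounded_linear_scaleR_right f] e(2)]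
  show ?thesis by (intro exI[of _ c'] exI[of _ "dir_deriv e (%y. c *\<^sub>R f y)"] conjI)
 qed
qed

lemma smooth_linear: "bounded_linear L ==> smooth (%x. L x)"
proof (rule smooth_coinduct[where P="%h. \<exists>L c. bounded_linear L \<and> h = (%x. L x + c)"])
 assume "bounded_linear L" thus "\<exists>La c. bounded_linear La \<and> L = (%x. La x + c)"
  by (intro exI[of _ L] exI[of _ 0]) auto
next
 fix f :: "'a => 'b" and x assume "\<exists>L c. bounded_linear L \<and> f = (%x. L x + c)"
 then obtain L c where "bounded_linear L" "f = (%x. L x + c)" by auto
 thus "f differentiable at x" using differentiable_add[OF bounded_linear_imp_differentiable differentiable_const] by auto
next
 fix f :: "'a => 'b" and b assume "\<exists>L c. bounded_linear L \<and> f = (%x. L x + c)"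
 then obtain L c where L: "bounded_linear L" and f: "f = (%x. L x + c)" by auto
 have "dir_deriv b f = (%x. L b)" unfolding f
  by (rule ext, rule dir_derivI) (auto intro!: derivative_eq_intros bounded_linear_imp_has_derivative L)
 thus "\<exists>L c. bounded_linear L \<and> dir_deriv b f = (%x. L x + c)"
  by (intro exI[of _ "%_. 0"] exI[of _ "L b"]) (auto intro: bounded_linear_zero)
qed

lemma iter_deriv_add:
 "smooth f ==> smooth g ==> set vs \<subseteq> Basis ==>
  foldr dir_deriv vs (%x. f x + g x) = (%x. foldr dir_deriv vs f x + foldr dir_deriv vs g x)"
 by (induction vs) (auto simp: dir_deriv_add smooth_iter_deriv)

lemma iter_deriv_bounded_linear:
 "bounded_linear T ==> smooth f ==> set vs \<subseteq> Basis ==>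
  foldr dir_deriv vs (%x. T (f x)) = (%x. T (foldr dir_deriv vs f x))"
 by (induction vs) (auto simp: dir_deriv_bounded_linear smooth_iter_deriv)

text \<open>Leibniz rule at the scale \<open>l\<close>: a derivative costs \<open>l\<close> on
  either factor, so the innermost one may fall on \<open>f\<close> or on \<open>g\<close>, whose
  constant becomes \<open>A * l\<close> or \<open>B * l\<close>; the two terms of each product rule
  give the power of 2. The induction removes that innermost derivative, hence
  \<open>rev_induct\<close>.\<close>

lemma iter_deriv_mult_bound:
 fixes f g :: "'a::euclidean_space => 'b::real_normed_algebra"
 assumes "smooth f" "smooth g" "set vs \<subseteq> Basis" "l >= 0" "A >= 0" "B >= 0"
  and "!!ws. set ws \<subseteq> set vs ==> length ws <= length vs ==> norm (foldr dir_deriv ws f x) <= A * l ^ length ws"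
  and "!!ws. set ws \<subseteq> set vs ==> length ws <= length vs ==> norm (foldr dir_deriv ws g x) <= B * l ^ length ws"
 shows "norm (foldr dir_deriv vs (%x. f x * g x) x) <= 2 ^ length vs * A * B * l ^ length vs"
 using assms
proof (induction vs arbitrary: f g A B rule: rev_induct)
 case Nil
 have "norm (f x) <= A" "norm (g x) <= B" using Nil(7,8)[of "[]"] by auto
 hence "norm (f x) * norm (g x) <= A * B" by (intro mult_mono) (use Nil in auto)
 thus ?case using norm_mult_ineq[of "f x" "g x"] by simp
next
 case (snoc v vs)
 have v: "v \<in> Basis" and vs: "set vs \<subseteq> Basis" using snoc.prems by auto
 have sm: "smooth (dir_deriv v f)" "smooth (dir_deriv v g)" using snoc.prems v by (auto intro: smooth_dir_deriv)
 have fb: "norm (foldr dir_deriv ws f x) <= A * l ^ length ws" "norm (foldr dir_deriv ws g x) <= B * l ^ length ws"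
  if "set ws \<subseteq> set vs" "length ws <= length vs" for ws
  using that by (intro snoc.prems(7,8); auto)+
 have db: "norm (foldr dir_deriv ws (dir_deriv v f) x) <= (A * l) * l ^ length ws"
   "norm (foldr dir_deriv ws (dir_deriv v g) x) <= (B * l) * l ^ length ws"
  if "set ws \<subseteq> set vs" "length ws <= length vs" for ws
  using that snoc.prems(7,8)[of "ws @ [v]"] by (auto simp: mult_ac)
 have "foldr dir_deriv (vs @ [v]) (%x. f x * g x) x =
   foldr dir_deriv vs (%x. f x * dir_deriv v g x) x + foldr dir_deriv vs (%x. dir_deriv v f x * g x) x"
  using snoc.prems sm vs by (simp add: dir_deriv_mult iter_deriv_add smooth_mult)
 also have "norm ... <= 2 ^ length vs * A * (B * l) * l ^ length vs + 2 ^ length vs * (A * l) * B * l ^ length vs"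
  using snoc.prems sm vs fb db by (intro norm_triangle_mono snoc.IH) auto
 finally show ?case by (simp add: algebra_simps)
qed

lemma smooth_mixed_real:
 fixes f :: "'a::euclidean_space => real"
 assumes "smooth f" "v \<in> Basis" "w \<in> Basis"
 shows "dir_deriv v (dir_deriv w f) x = dir_deriv w (dir_deriv v f) x"
proof -
 \<comment> \<open>Both mixed derivatives are limits of the same second difference quotient.\<close>
 have mvt: "\<exists>p. norm (p - x) <= 2 * s \<and> f (x + s *\<^sub>R v + s *\<^sub>R w) - f (x + s *\<^sub>R v) - f (x + s *\<^sub>R w) + f x = s * s * dir_deriv w (dir_deriv v f) p"
  if vw: "v \<in> Basis" "w \<in> Basis" and s: "s > 0" for s and v w :: 'a
 proof -
  have line: "((%a. h (c + a *\<^sub>R u)) has_real_derivative dir_deriv u h (c + a *\<^sub>R u)) (at a)"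
   if "smooth h" for h :: "'a => real" and c u a
  proof -
   have "((%a. h (c + a *\<^sub>R u)) has_derivative (%t. dir_deriv (t *\<^sub>R u) h (c + a *\<^sub>R u))) (at a)"
    by (rule has_derivative_compose[OF _ smooth_imp_has_derivative[OF that]]) (auto intro!: derivative_eq_intros)
   moreover have "dir_deriv (t *\<^sub>R u) h (c + a *\<^sub>R u) = dir_deriv u h (c + a *\<^sub>R u) * t" for t
    using linear_cmul[OF has_derivative_linear[OF smooth_imp_has_derivative[OF that]]] by simp
   ultimately show ?thesis unfolding has_field_derivative_def by simp
  qed
  let ?d = "%z. dir_deriv v f ((x + z *\<^sub>R v) + s *\<^sub>R w) - dir_deriv v f ((x + z *\<^sub>R v) + 0 *\<^sub>R w)"
  \<comment> \<open>The increment in direction \<open>w\<close> as a function of the position along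
    \<open>v\<close>. Its own increment is the second difference, which two mean value theorems
    evaluate, along \<open>v\<close> and then along \<open>w\<close>.\<close>
  define \<phi> where "\<phi> = (%a. f ((x + s *\<^sub>R w) + a *\<^sub>R v) - f (x + a *\<^sub>R v))"
  have "\<exists>z. 0 < z \<and> z < s \<and> \<phi> s - \<phi> 0 = (s - 0) * (dir_deriv v f ((x + s *\<^sub>R w) + z *\<^sub>R v) - dir_deriv v f (x + z *\<^sub>R v))"
   by (rule MVT2[OF s]) (auto simp: \<phi>_def intro!: derivative_intros line assms)
  then obtain z where z: "0 < z" "z < s" "\<phi> s - \<phi> 0 = s * (?d z)"
   by (auto simp: add_ac)
  have "\<exists>z'. 0 < z' \<and> z' < s \<and> ?d z = (s - 0) * dir_deriv w (dir_deriv v f) ((x + z *\<^sub>R v) + z' *\<^sub>R w)"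
   by (rule MVT2[OF s]) (auto intro!: line smooth_dir_deriv assms vw)
  then obtain z' where z': "0 < z'" "z' < s"
   "?d z = s * dir_deriv w (dir_deriv v f) ((x + z *\<^sub>R v) + z' *\<^sub>R w)"
   by auto
  show ?thesis
  proof (intro exI conjI)
   have "norm (z *\<^sub>R v + z' *\<^sub>R w) <= z + z'"
    using norm_triangle_ineq[of "z *\<^sub>R v" "z' *\<^sub>R w"] vw z z' by simp
   thus "norm (x + z *\<^sub>R v + z' *\<^sub>R w - x) <= 2 * s" using z z' by (simp add: add.assoc)
   show "f (x + s *\<^sub>R v + s *\<^sub>R w) - f (x + s *\<^sub>R v) - f (x + s *\<^sub>R w) + f x = s * s * dir_deriv w (dir_deriv v f) (x + z *\<^sub>R v + z' *\<^sub>R w)"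
    using z(3) unfolding z'(3) by (simp add: \<phi>_def add_ac)
  qed
 qed
 let ?P = "dir_deriv w (dir_deriv v f)" let ?Q = "dir_deriv v (dir_deriv w f)"
 have "\<exists>p q. norm (p - x) <= 2 * s \<and> norm (q - x) <= 2 * s \<and> ?P p = ?Q q"
  if s: "s > 0" for s
 proof -
  obtain p where p: "norm (p - x) <= 2 * s" "f (x + s *\<^sub>R v + s *\<^sub>R w) - f (x + s *\<^sub>R v) - f (x + s *\<^sub>R w) + f x = s * s * ?P p"
   using mvt[OF assms(2,3) s] by auto
  obtain q where q: "norm (q - x) <= 2 * s" "f (x + s *\<^sub>R w + s *\<^sub>R v) - f (x + s *\<^sub>R w) - f (x + s *\<^sub>R v) + f x = s * s * ?Q q"
   using mvt[OF assms(3,2) s] by auto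
  have e: "x + s *\<^sub>R w + s *\<^sub>R v = x + s *\<^sub>R v + s *\<^sub>R w" by simp
  have "s * s * ?P p = s * s * ?Q q"
   using p(2) q(2)[unfolded e] by linarith
  with s p q show ?thesis by auto
 qed
 from this[of "1 / real (Suc n)" for n]
 have "\<forall>n::nat. \<exists>p q. norm (p - x) <= 2 / Suc n \<and> norm (q - x) <= 2 / Suc n \<and> ?P p = ?Q q"
  by simp
 then obtain p q where pq: "!!n::nat. norm (p n - x) <= 2 / Suc n" "!!n::nat. norm (q n - x) <= 2 / Suc n"
  "!!n. ?P (p n) = ?Q (q n)" by metis
 have lim0: "(%n. 2 / real (Suc n)) \<longlonglongrightarrow> 0"
  by (rule LIMSEQ_Suc) (rule lim_const_over_n)
 have lim: "p \<longlonglongrightarrow> x" "q \<longlonglongrightarrow> x"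
  by (rule LIM_zero_cancel, rule Lim_null_comparison[OF always_eventually lim0], use pq in auto)+
 have c: "isCont (?P) x" "isCont (?Q) x"
  using assms by (auto intro!: differentiable_imp_continuous_within smooth_imp_differentiable smooth_dir_deriv)
 have "(%n. ?P (p n)) \<longlonglongrightarrow> ?P x"
  "(%n. ?Q (q n)) \<longlonglongrightarrow> ?Q x"
  using c lim by (auto simp: isCont_tendsto_compose)
 with pq(3) show ?thesis by (auto dest: LIMSEQ_unique)
qed

lemma smooth_mixed:
 fixes f :: "'a::euclidean_space => complex"
 assumes "smooth f" "v \<in> Basis" "w \<in> Basis"
 shows "dir_deriv v (dir_deriv w f) = dir_deriv w (dir_deriv v f)"
proof (rule ext, rule complex_eqI)
 fix x
 note sb = smooth_bounded_linear[OF bounded_linear_Re assms(1)] smooth_bounded_linear[OF bounded_linear_Im assms(1)]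
 have r: "(%x. Re (dir_deriv v (dir_deriv w f) x)) = dir_deriv v (dir_deriv w (%x. Re (f x)))"
   "(%x. Im (dir_deriv v (dir_deriv w f) x)) = dir_deriv v (dir_deriv w (%x. Im (f x)))" if "v \<in> Basis" "w \<in> Basis" for v w
  using that assms by (simp_all add: dir_deriv_bounded_linear bounded_linear_Re bounded_linear_Im smooth_dir_deriv)
 show "Re (dir_deriv v (dir_deriv w f) x) = Re (dir_deriv w (dir_deriv v f) x)"
  using fun_cong[OF r(1)[OF assms(2,3)], of x] fun_cong[OF r(1)[OF assms(3,2)], of x] smooth_mixed_real[OF sb(1) assms(2,3), of x] by linarith
 show "Im (dir_deriv v (dir_deriv w f) x) = Im (dir_deriv w (dir_deriv v f) x)"
  using fun_cong[OF r(2)[OF assms(2,3)], of x] fun_cong[OF r(2)[OF assms(3,2)], of x] smooth_mixed_real[OF sb(2) assms(2,3), of x] by linarith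
qed

text \<open>The head of \<open>vs\<close> occurs somewhere in \<open>ws\<close> and commutes to the
  front, because mixed derivatives agree. This lets arbitrary lists of directions be sorted into the
  fixed order of \<open>mderiv\<close>.\<close>

lemma iter_deriv_mset:
 fixes f :: "'a::euclidean_space => complex"
 assumes "smooth f" "set vs \<subseteq> Basis" "mset vs = mset ws"
 shows "foldr dir_deriv vs f = foldr dir_deriv ws f"
 using assms(2,3)
proof (induction vs arbitrary: ws)
 case (Cons v vs)
 have "v \<in> set ws" using Cons.prems(2) by (metis list.set_intros(1) mset_eq_setD)
 then obtain as bs where ws: "ws = as @ v # bs" by (meson split_list)
 have m: "mset vs = mset (as @ bs)" using Cons.prems(2) ws by simp
 have B: "set as \<subseteq> Basis" "set bs \<subseteq> Basis" "v \<in> Basis"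
  using Cons.prems(1) mset_eq_setD[OF Cons.prems(2)] ws by auto
 have "foldr dir_deriv (as @ v # bs) f = dir_deriv v (foldr dir_deriv (as @ bs) f)"
  using B(1)
 proof (induction as)
  case (Cons a as)
  hence "dir_deriv a (foldr dir_deriv (as @ v # bs) f) = dir_deriv a (dir_deriv v (foldr dir_deriv (as @ bs) f))"
   by simp
  also have "... = dir_deriv v (dir_deriv a (foldr dir_deriv (as @ bs) f))"
   using Cons.prems B by (intro smooth_mixed smooth_iter_deriv assms(1)) auto
  finally show ?case by simp
 qed simp
 thus ?case using Cons.IH[OF _ m] Cons.prems ws by simp
qed simp

section \<open>Real powers, Young, Hoelder and Jensen inequalities in the extended nonnegative
  reals\<close>

lemma epowr_top [simp]: "epowr top r = top" and epowr_0 [simp]: "epowr 0 r = 0"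
 by (simp_all add: epowr_def)

lemma epowr_ennreal: "x >= 0 ==> epowr (ennreal x) r = ennreal (x powr r)"
 by (simp add: epowr_def)

lemma epowr_1 [simp]: "epowr a 1 = a"
 by (cases a) (auto simp: epowr_ennreal)

lemma epowr_one [simp]: "epowr 1 r = 1"
 using epowr_ennreal[of 1 r] by simp

lemma epowr_mono: "r > 0 ==> a <= b ==> epowr a r <= epowr b r"
 by (cases a; cases b) (auto simp: epowr_ennreal top_unique intro!: ennreal_leI powr_mono2)

lemma epowr_mult: "r > 0 ==> epowr (a * b) r = epowr a r * epowr b r"
proof (cases a; cases b)
 fix x y :: real assume "0 <= x" "0 <= y" "a = ennreal x" "b = ennreal y" "r > 0"
 thus ?thesis by (simp add: epowr_ennreal powr_mult flip: ennreal_mult)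
next
 fix x :: real assume "0 <= x" "a = ennreal x" "b = top" "r > 0"
 thus ?thesis by (cases "x = 0") (auto simp: epowr_ennreal ennreal_mult_top ennreal_eq_0_iff)
next
 fix x :: real assume "0 <= x" "b = ennreal x" "a = top" "r > 0"
 thus ?thesis by (cases "x = 0") (auto simp: epowr_ennreal ennreal_top_mult ennreal_eq_0_iff)
qed auto

lemma epowr_epowr: "r > 0 ==> s > 0 ==> epowr (epowr a r) s = epowr a (r * s)"
 by (cases a) (auto simp: epowr_ennreal powr_powr)

lemma epowr_inverse [simp]:
 "r > 0 ==> epowr (epowr a r) (1 / r) = a" "r > 0 ==> epowr (epowr a (1 / r)) r = a"
 by (simp_all add: epowr_epowr)

lemma epowr_add: "r > 0 ==> s > 0 ==> epowr a (r + s) = epowr a r * epowr a s"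
 by (cases a) (auto simp: epowr_ennreal powr_add ennreal_mult')

lemma epowr_le_iff: "r > 0 ==> epowr a r <= b \<longleftrightarrow> a <= epowr b (1 / r)"
 by (metis epowr_inverse epowr_mono zero_less_divide_1_iff)

lemma epowr_eq_0_iff [simp]: "epowr a r = 0 \<longleftrightarrow> a = 0"
 by (cases a) (auto simp: epowr_ennreal ennreal_eq_0_iff)

lemma epowr_eq_top_iff [simp]: "epowr a r = top \<longleftrightarrow> a = top"
 by (cases a) (auto simp: epowr_ennreal)

text \<open>\<open>epowr_le_iff\<close> is an adjunction, so suprema are preserved without a
  continuity argument.\<close>

lemma epowr_SUP: "r > 0 ==> epowr (SUP i\<in>I. f i) r = (SUP i\<in>I. epowr (f i) r)"
proof (rule antisym)
 assume r: "r > 0"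
 show "epowr (SUP i\<in>I. f i) r <= (SUP i\<in>I. epowr (f i) r)"
  unfolding epowr_le_iff[OF r] by (rule SUP_least) (auto simp: epowr_le_iff[OF r, symmetric] intro: SUP_upper)
 show "(SUP i\<in>I. epowr (f i) r) <= epowr (SUP i\<in>I. f i) r"
  by (rule SUP_least) (auto intro!: epowr_mono r SUP_upper)
qed

lemma measurable_epowr [measurable]:
 assumes [measurable]: "f \<in> borel_measurable M" shows "(%x. epowr (f x) r) \<in> borel_measurable M"
 unfolding epowr_def by measurable

lemma epowr_add_le:
 assumes "0 < r" "r <= 1" shows "epowr (a + b) r <= epowr a r + epowr b r"
proof (cases a; cases b)
 fix x y :: real assume *: "0 <= x" "0 <= y" "a = ennreal x" "b = ennreal y"
 have "(x + y) powr r <= x powr r + y powr r"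
 proof (cases "x + y = 0")
  case False
  hence s: "x + y > 0" using * by auto
  have "z <= z powr r" if "0 <= z" "z <= 1" for z :: real
   using powr_mono'[of r 1 z] assms that by auto
  from this[of "x / (x+y)"] this[of "y / (x+y)"]
  have "x / (x+y) <= (x / (x+y)) powr r" "y / (x+y) <= (y / (x+y)) powr r"
   using s * by (simp_all del: divide_le_eq le_divide_eq)
  moreover have "x / (x+y) + y / (x+y) = 1" using s by (simp add: divide_simps)
  ultimately have "1 <= (x / (x+y)) powr r + (y / (x+y)) powr r" by linarith
  thus ?thesis using s * by (simp add: powr_divide divide_simps split: if_splits)
 qed (use * in auto)
 thus ?thesis using * by (simp add: epowr_ennreal flip: ennreal_plus)
qed auto

lemma epowr_suminf_le:
 assumes "0 < r" "r <= 1" shows "epowr (\<Sum>i. f i) r <= (\<Sum>i. epowr (f i) r)"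
proof -
 have fin: "epowr (\<Sum>i<n. f i) r <= (\<Sum>i<n. epowr (f i) r)" for n
  by (induction n) (auto intro!: order_trans[OF epowr_add_le[OF assms]] add_mono)
 have "(\<Sum>i. f i) = (SUP n. \<Sum>i<n. f i)" by (rule suminf_eq_SUP)
 thus ?thesis
  by (auto intro!: SUP_least simp: epowr_SUP assms intro: order_trans[OF fin sum_le_suminf])
qed

lemma epowr_plus_le:
 assumes "0 < r" shows "epowr (a + b) r <= ennreal (2 powr r) * (epowr a r + epowr b r)"
proof -
 have "a + b <= ennreal 2 * max a b" using add_mono[of a "max a b" b "max a b"] by (simp flip: mult_2)
 hence "epowr (a + b) r <= epowr (ennreal 2 * max a b) r" by (rule epowr_mono[OF assms])
 also have "... = ennreal (2 powr r) * epowr (max a b) r" by (simp only: epowr_mult[OF assms] epowr_ennreal)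
 also have "epowr (max a b) r <= epowr a r + epowr b r" by (auto simp: max_def add_increasing)
 finally show ?thesis by (simp add: mult_left_mono)
qed

text \<open>Without the usual weights 1/p and 1/q a comparison suffices: if b^q <= a^p then b <=
  a^(p/q), so the product is at most a^(1 + p/q) = a^p, and symmetrically otherwise. Infinite values
  are covered as well.\<close>

lemma Young_ennreal:
 assumes "p > 1" "q > 1" "1 / p + 1 / q = 1" shows "a * b <= epowr a p + epowr b q"
proof -
 have pq: "p = 1 + p / q" "q = 1 + q / p" using assms by (auto simp: field_simps)
 have pos: "p / q > 0" "q / p > 0" using assms by auto
 show ?thesis
 proof (cases "epowr b q <= epowr a p")
  case True
  hence "b <= epowr a (p / q)" using assms epowr_epowr[of p "1/q" a] by (simp add: epowr_le_iff)
  hence "a * b <= a * epowr a (p / q)" by (rule mult_left_mono) auto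
  also have "... = epowr a p" using epowr_add[of 1 "p/q" a] pos pq by simp
  finally show ?thesis by (simp add: add_increasing2)
 next
  case False
  hence "epowr a p <= epowr b q" by simp
  hence "a <= epowr b (q / p)" using assms epowr_epowr[of q "1/p" b] by (simp add: epowr_le_iff)
  hence "a * b <= epowr b (q / p) * b" by (rule mult_right_mono) auto
  also have "... = epowr b q" using epowr_add[of 1 "q/p" b] pos pq by (simp add: mult.commute)
  finally show ?thesis by (simp add: add_increasing)
 qed
qed

text \<open>Prepares absorption of the term in \<open>b\<close> into a left-hand side:
  \<open>b\<close> is rescaled by \<open>\<delta> powr (1 / q)\<close> and \<open>a\<close>
  inversely.\<close>

lemma Young_ennreal_eps:
 assumes "p > 1" "q > 1" "1 / p + 1 / q = 1" "\<delta> > 0"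
 obtains K where "K > 0" "!!a b. a * b <= ennreal K * epowr a p + ennreal \<delta> * epowr b q"
proof
 define d where "d = \<delta> powr (1 / q)"
 have d: "d > 0" "d powr q = \<delta>" using assms by (auto simp: d_def powr_powr)
 show "(1 / d) powr p > 0" using d by simp
 fix a b :: ennreal
 have "ennreal (1 / d) * ennreal d = 1" using d by (simp flip: ennreal_mult)
 hence "a * b = (ennreal (1 / d) * a) * (ennreal d * b)" by (metis mult.assoc mult.commute mult.right_neutral)
 also have "... <= epowr (ennreal (1 / d) * a) p + epowr (ennreal d * b) q"
  by (rule Young_ennreal) (use assms in auto)
 also have "... = ennreal ((1 / d) powr p) * epowr a p + ennreal \<delta> * epowr b q"
  using assms d by (simp add: epowr_mult epowr_ennreal)
 finally show "a * b <= ennreal ((1 / d) powr p) * epowr a p + ennreal \<delta> * epowr b q" .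
qed

text \<open>Young's inequality after both norms are normalised to 1; the factor 2 is the price of
  its unweighted form.\<close>

lemma nn_integral_Hoelder:
 assumes "p > 1" "q > 1" "1 / p + 1 / q = 1"
  and [measurable]: "f \<in> borel_measurable M" "g \<in> borel_measurable M"
 shows "(\<integral>\<^sup>+x. f x * g x \<partial>M) <= 2 * (epowr (\<integral>\<^sup>+x. epowr (f x) p \<partial>M) (1 / p) * epowr (\<integral>\<^sup>+x. epowr (g x) q \<partial>M) (1 / q))"
proof -
 define A where "A = (\<integral>\<^sup>+x. epowr (f x) p \<partial>M)"
 define B where "B = (\<integral>\<^sup>+x. epowr (g x) q \<partial>M)"
 consider "A = 0" | "B = 0" | "A ~= 0" "B ~= 0" "A = top \<or> B = top" | "A ~= 0" "B ~= 0" "A ~= top" "B ~= top" by auto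
 thus ?thesis
 proof cases
  case 1
  hence "AE x in M. f x = 0" unfolding A_def by (subst (asm) nn_integral_0_iff_AE) auto
  hence "(\<integral>\<^sup>+x. f x * g x \<partial>M) = (\<integral>\<^sup>+x. 0 \<partial>M)" by (intro nn_integral_cong_AE) auto
  thus ?thesis by simp
 next
  case 2
  hence "AE x in M. g x = 0" unfolding B_def by (subst (asm) nn_integral_0_iff_AE) auto
  hence "(\<integral>\<^sup>+x. f x * g x \<partial>M) = (\<integral>\<^sup>+x. 0 \<partial>M)" by (intro nn_integral_cong_AE) auto
  thus ?thesis by simp
 next
  case 3
  thus ?thesis unfolding A_def[symmetric] B_def[symmetric]
   by (auto simp: ennreal_mult_eq_top_iff ennreal_top_mult ennreal_mult_top)
 next
  case 4
  obtain a where a: "A = ennreal a" "a > 0" using 4 by (cases A) (auto simp: less_le)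
  obtain b where b: "B = ennreal b" "b > 0" using 4 by (cases B) (auto simp: less_le)
  define c where "c = a powr (1 / p)" define d where "d = b powr (1 / q)"
  have cd: "c > 0" "d > 0" "c powr p = a" "d powr q = b" using a b assms by (auto simp: c_def d_def powr_powr)
  have "f x * g x <= ennreal (c * d) * (ennreal (1 / a) * epowr (f x) p + ennreal (1 / b) * epowr (g x) q)" for x
  proof -
   have "ennreal (c * d) * (ennreal (1 / c) * ennreal (1 / d)) = 1" using cd by (simp flip: ennreal_mult)
   hence "f x * g x = ennreal (c * d) * ((ennreal (1 / c) * f x) * (ennreal (1 / d) * g x))"
    by (metis mult.assoc mult.commute mult.right_neutral)
   also have "(ennreal (1 / c) * f x) * (ennreal (1 / d) * g x) <= epowr (ennreal (1 / c) * f x) p + epowr (ennreal (1 / d) * g x) q"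
    by (rule Young_ennreal) (use assms in auto)
   also have "... = ennreal (1 / a) * epowr (f x) p + ennreal (1 / b) * epowr (g x) q"
    using assms cd by (simp add: epowr_mult epowr_ennreal powr_divide)
   finally show ?thesis by (simp add: mult_left_mono)
  qed
  hence "(\<integral>\<^sup>+x. f x * g x \<partial>M) <= (\<integral>\<^sup>+x. ennreal (c * d) * (ennreal (1 / a) * epowr (f x) p + ennreal (1 / b) * epowr (g x) q) \<partial>M)"
   by (intro nn_integral_mono)
  also have "... = ennreal (c * d) * (ennreal (1 / a) * A + ennreal (1 / b) * B)"
   unfolding A_def B_def by (simp add: nn_integral_cmult nn_integral_add)
  also have "... = ennreal (c * d) * 2"
   using a b by (simp flip: ennreal_mult ennreal_plus)
  also have "... = 2 * (epowr A (1 / p) * epowr B (1 / q))"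
   using a b cd by (simp add: epowr_ennreal c_def d_def ennreal_mult' mult_ac)
  finally show ?thesis unfolding A_def B_def .
 qed
qed

text \<open>For every level l > 0, f <= l + l^(1-Q) f^Q, because either f <= l or f/l <= (f/l)^Q.
  Integrating against \<open>k\<close> and balancing the two terms gives the inequality, with
  \<open>2 powr Q\<close> for the two of them.\<close>

lemma nn_integral_Jensen:
 assumes "Q >= 1" "c > 0" and c: "(\<integral>\<^sup>+x. k x \<partial>M) <= ennreal c"
  and [measurable]: "f \<in> borel_measurable M" "k \<in> borel_measurable M"
 shows "epowr (\<integral>\<^sup>+x. k x * f x \<partial>M) Q <= ennreal (2 powr Q * c powr (Q - 1)) * (\<integral>\<^sup>+x. k x * epowr (f x) Q \<partial>M)"
proof -
 let ?I = "(\<integral>\<^sup>+x. k x * f x \<partial>M)"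
 define I where "I = (\<integral>\<^sup>+x. k x * epowr (f x) Q \<partial>M)"
 have Q: "Q > 0" using assms by simp
 have key: "?I <= ennreal (l * c) + ennreal (l powr (1 - Q)) * I" if l: "l > 0" for l
 proof -
  have "f x <= ennreal l + ennreal (l powr (1 - Q)) * epowr (f x) Q" for x
  proof (cases "f x")
   case (real y)
   show ?thesis
   proof (cases "y <= l")
    case False
    have "(y / l) powr 1 <= (y / l) powr Q" using False l assms by (intro powr_mono) auto
    hence "y <= l powr (1 - Q) * y powr Q" using l False
     by (simp add: powr_divide powr_diff divide_simps mult.commute)
    thus ?thesis using real l by (simp add: epowr_ennreal add_increasing flip: ennreal_mult ennreal_plus)
   qed (use real l in \<open>auto simp: add_increasing2 ennreal_leI\<close>)
  qed (use l in \<open>auto simp: ennreal_mult_top\<close>)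
  hence "?I <= (\<integral>\<^sup>+x. ennreal l * k x + ennreal (l powr (1 - Q)) * (k x * epowr (f x) Q) \<partial>M)"
   by (intro nn_integral_mono) (metis distrib_left mult.commute mult.left_commute mult_left_mono zero_le)
  also have "... = ennreal l * (\<integral>\<^sup>+x. k x \<partial>M) + ennreal (l powr (1 - Q)) * I"
   unfolding I_def by (simp add: nn_integral_add nn_integral_cmult)
  also have "... <= ennreal l * ennreal c + ennreal (l powr (1 - Q)) * I"
   by (intro add_right_mono mult_left_mono c) auto
  finally show ?thesis using l assms by (simp add: ennreal_mult)
 qed
 show ?thesis
 proof (cases I)
  case top
  thus ?thesis unfolding I_def using assms by (simp add: ennreal_mult_top)
 next
  case (real i)
  show ?thesis
  proof (cases "i = 0")
   case True
   \<comment> \<open>No balancing level exists when the integral on the right vanishes; the level e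
     / c makes the bound e, which is arbitrary.\<close>
   have "?I <= ennreal e" if "e > 0" for e
    using key[of "e / c"] that assms real True by simp
   hence "?I = 0" by (metis add_0 ennreal_le_epsilon le_zero_eq)
   thus ?thesis by simp
  next
   case False
   hence i: "i > 0" using real by auto
   \<comment> \<open>The level at which l c and l^(1-Q) i coincide.\<close>
   define l where "l = (i / c) powr (1 / Q)"
   have l: "l > 0" using i assms by (auto simp: l_def)
   have lQ: "l powr Q = i / c" using i assms by (simp add: l_def powr_powr)
   have "l powr (1 - Q) * i = l * c" using l lQ i assms by (simp add: powr_diff field_simps)
   with key[OF l] real have "?I <= ennreal (l * c) + ennreal (l * c)"
    by (simp flip: ennreal_mult)
   hence "epowr ?I Q <= epowr (ennreal (2 * (l * c))) Q"
    by (intro epowr_mono Q) (use l assms in \<open>simp flip: ennreal_plus add: mult.commute[of l c]\<close>)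
   also have "... = ennreal (2 powr Q * (l powr Q * c powr Q))"
    using l assms by (simp add: epowr_ennreal powr_mult)
   also have "l powr Q * c powr Q = c powr (Q - 1) * i"
    using assms unfolding lQ by (simp add: powr_diff)
   also have "ennreal (2 powr Q * (c powr (Q - 1) * i)) = ennreal (2 powr Q * c powr (Q - 1)) * I"
    using real by (simp flip: ennreal_mult add: mult_ac)
   finally show ?thesis unfolding I_def .
  qed
 qed
qed

section \<open>Hardy-Littlewood maximal function\<close>

lemma ennreal_divide_mult_cancel:
 assumes "0 < (m::ennreal)" "m < top"
 shows "a / m * m = a" "a * m / m = a"
 using assms by (cases m; simp add: divide_ennreal_def mult.assoc ennreal_less_zero_iff inverse_ennreal flip: ennreal_mult)+

lemma ennreal_le_divide_iff:
 assumes "0 < (m::ennreal)" "m < top"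
 shows "b <= a / m \<longleftrightarrow> b * m <= a" "a / m <= b \<longleftrightarrow> a <= b * m"
 by (metis assms ennreal_divide_mult_cancel divide_right_mono_ennreal mult_right_mono zero_le)+

text \<open>The radii are all integer powers of 2: countably many, which gives measurability, and
  exactly those of the dyadic balls in the kernel bound \<open>ker_dyadic_bound\<close>.\<close>

definition maximal :: "('a::euclidean_space => ennreal) => 'a => ennreal" where
 "maximal h x = (SUP (k, i) \<in> (UNIV :: (nat \<times> nat) set).
   (\<integral>y. h y * indicator (cball x (2 ^ k / 2 ^ i)) y) / emeasure lborel (cball x (2 ^ k / 2 ^ i)))"

lemma emeasure_cball_pos: "r > 0 ==> emeasure lborel (cball (x::'a::euclidean_space) r) > 0"
 by (simp add: emeasure_cball)

lemma measurable_cball_integral [measurable]: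
 fixes h :: "'a::euclidean_space => ennreal"
 assumes [measurable]: "h \<in> Borel"
 shows "(%x. \<integral>y. h y * indicator (cball x r) y) \<in> Borel"
proof -
 have [measurable]: "{p::'a \<times> 'a. dist (fst p) (snd p) <= r} \<in> sets (borel \<Otimes>\<^sub>M borel)"
  unfolding borel_prod by (intro borel_closed closed_Collect_le continuous_intros)
 have "(%x. \<integral>y. h y * indicator {p. dist (fst p) (snd p) <= r} (x, y)) \<in> Borel"
  by (rule lborel.borel_measurable_nn_integral) measurable
 moreover have "indicator {p. dist (fst p) (snd p) <= r} (x, y) = (indicator (cball x r) y :: ennreal)" for x y :: 'a
  by (simp add: indicator_def)
 ultimately show ?thesis by simp
qed

lemma measurable_maximal [measurable]:
 fixes h :: "'a::euclidean_space => ennreal"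
 assumes [measurable]: "h \<in> Borel"
 shows "maximal h \<in> Borel"
proof -
 have "(%x. maximal h x) \<in> Borel"
  unfolding maximal_def by (simp add: emeasure_cball case_prod_beta) measurable
 thus ?thesis by simp
qed

lemma cball_integral_le_maximal:
 fixes h :: "'a::euclidean_space => ennreal"
 shows "(\<integral>y. h y * indicator (cball x (2 ^ k / 2 ^ i)) y) <= emeasure lborel (cball x (2 ^ k / 2 ^ i)) * maximal h x"
proof -
 let ?r = "2 ^ k / 2 ^ i :: real" let ?m = "emeasure lborel (cball x ?r)"
 have m: "?m > 0" "?m < top" by (rule emeasure_cball_pos) (auto simp: emeasure_cball)
 have "(\<integral>y. h y * indicator (cball x ?r) y) / ?m <= maximal h x"
  unfolding maximal_def by (rule SUP_upper2[of "(k, i)"]) auto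
 thus ?thesis unfolding ennreal_le_divide_iff[OF m] by (simp add: mult.commute)
qed

lemma maximal_mono: "(!!x. f x <= g x) ==> maximal f x <= maximal g x"
 unfolding maximal_def
 by (intro SUP_mono') (auto intro!: divide_right_mono_ennreal nn_integral_mono mult_right_mono)

text \<open>Serves to discard the part of a function below a level in the strong type
  estimate.\<close>

lemma maximal_le_add_const:
 fixes h :: "'a::euclidean_space => ennreal"
 assumes [measurable]: "g \<in> Borel" and "!!x. h x <= g x + c"
 shows "maximal h x <= maximal g x + c"
 unfolding maximal_def[of h]
proof (rule SUP_least, clarify)
 fix k i :: nat
 let ?r = "2 ^ k / 2 ^ i :: real" let ?m = "emeasure lborel (cball x ?r)"
 have [measurable]: "cball x ?r \<in> sets borel" by simp
 have m: "?m > 0" "?m < top" by (rule emeasure_cball_pos) (auto simp: emeasure_cball)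
 have "(\<integral>y. h y * indicator (cball x ?r) y) <= (\<integral>y. g y * indicator (cball x ?r) y + c * indicator (cball x ?r) y)"
  using assms(2) by (intro nn_integral_mono) (auto simp: indicator_def)
 also have "... = (\<integral>y. g y * indicator (cball x ?r) y) + c * ?m"
  by (subst nn_integral_add) (auto simp: nn_integral_cmult_indicator)
 also have "... <= (maximal g x + c) * ?m"
  using cball_integral_le_maximal[of g x k i] by (simp add: distrib_right mult.commute)
 finally show "(\<integral>y. h y * indicator (cball x ?r) y) / ?m <= maximal g x + c"
  unfolding ennreal_le_divide_iff[OF m] .
qed

text \<open>Every point of the level set is the centre of a ball on which \<open>h\<close> has
  average at least \<open>l\<close>. Vitali's lemma selects disjoint balls whose fivefold
  enlargements cover the set; 5 ^ DIM is the growth of their volume.\<close>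

lemma maximal_weak_type:
 fixes h :: "'a::euclidean_space => ennreal"
 assumes [measurable]: "h \<in> Borel" and l: "l > (0::real)"
 shows "ennreal l * emeasure lborel {x. maximal h x > ennreal l} <= 5 ^ DIM('a) * (\<integral>x. h x)"
proof (cases "(\<integral>x. h x) = top")
 case True
 thus ?thesis by (simp add: ennreal_mult_top)
next
 case False
 then obtain I where I: "(\<integral>x. h x) = ennreal I" "I >= 0" by (cases "\<integral>x. h x") auto
 define S where "S = {x. maximal h x > ennreal l}"
 define V where "V = unit_ball_vol (real DIM('a))"
 have V: "V > 0" by (simp add: V_def)
 have "\<exists>r>0. (\<integral>y. h y * indicator (cball x r) y) >= ennreal l * emeasure lborel (cball x r)" if x: "x \<in> S" for x
 proof -
  obtain k i :: nat where "(\<integral>y. h y * indicator (cball x (2 ^ k / 2 ^ i)) y) / emeasure lborel (cball x (2 ^ k / 2 ^ i)) > ennreal l"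
   using x unfolding S_def maximal_def by (auto simp: less_SUP_iff)
  moreover define r :: real where "r = 2 ^ k / 2 ^ i"
  ultimately have r: "(\<integral>y. h y * indicator (cball x r) y) / emeasure lborel (cball x r) >= ennreal l" "r > 0" by auto
  have m: "emeasure lborel (cball x r) > 0" "emeasure lborel (cball x r) < top" using emeasure_cball_pos[OF r(2)] r(2) by (auto simp: emeasure_cball)
  show ?thesis using r m by (intro exI[of _ r]) (auto simp: ennreal_le_divide_iff)
 qed
 hence "\<forall>x\<in>S. \<exists>r>0. (\<integral>y. h y * indicator (cball x r) y) >= ennreal l * emeasure lborel (cball x r)" by blast
 from bchoice[OF this] obtain r where r: "!!x. x \<in> S ==> r x > 0"
  "!!x. x \<in> S ==> ennreal l * emeasure lborel (cball x (r x)) <= (\<integral>y. h y * indicator (cball x (r x)) y)"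
  by blast
 \<comment> \<open>Vitali's lemma asks for bounded radii. The finite integral gives l V r^DIM <= I,
   and r <= r^DIM as soon as r > 1.\<close>
 define B where "B = max 1 (I / (l * V))"
 have rB: "r x <= B" if x: "x \<in> S" for x
 proof (cases "r x <= 1")
  case False
  have "ennreal l * emeasure lborel (cball x (r x)) <= (\<integral>y. h y * indicator (cball x (r x)) y)"
   by (rule r[OF x])
  also have "... <= ennreal I" unfolding I(1)[symmetric] by (intro nn_integral_mono) (auto simp: indicator_def)
  finally have "l * (V * r x ^ DIM('a)) <= I"
   using l V r(1)[OF x] I(2) by (simp add: emeasure_cball V_def[symmetric] less_imp_le flip: ennreal_mult)
  moreover have "r x ^ 1 <= r x ^ DIM('a)" using False by (intro power_increasing) (auto simp: Suc_leI)
  hence "l * V * r x <= l * (V * r x ^ DIM('a))" using l V by simp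
  ultimately have "r x * (l * V) <= I" by (simp add: mult_ac)
  hence "r x <= I / (l * V)" using l V by (simp add: pos_le_divide_eq)
  thus ?thesis unfolding B_def by simp
 qed (simp add: B_def)
 have rb: "!!i. i \<in> S ==> 0 < r i \<and> r i <= B" using r(1) rB by blast
 show ?thesis
 proof (rule Vitali_covering_lemma_cballs_balls[of S r B "%x. x", OF rb], assumption, goal_cases)
 case C: (1 C)
 \<comment> \<open>Sums over the countable family are written as integrals over
   \<open>count_space C\<close>, so that they can be interchanged with integrals in space.\<close>
 have "emeasure lborel S = (\<integral>x. indicator S x)"
  by (rule nn_integral_indicator[symmetric]) (simp add: S_def)
 also have "... <= (\<integral>x. \<integral>\<^sup>+j. indicator (ball j (5 * r j)) x \<partial>count_space C)"
 proof (rule nn_integral_mono)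
  fix x
  show "indicator S x <= (\<integral>\<^sup>+j. indicator (ball j (5 * r j)) x \<partial>count_space C)"
  proof (cases "x \<in> S")
   case True
   then obtain j where j: "j \<in> C" "x \<in> ball j (5 * r j)" using C(4)[OF True] r(1)[OF True] by force
   hence "(1::ennreal) <= indicator (ball j (5 * r j)) x" by simp
   also have "... <= (\<integral>\<^sup>+j. indicator (ball j (5 * r j)) x \<partial>count_space C)"
    by (rule nn_integral_ge_point[OF j(1)])
   finally show ?thesis using True by simp
  qed simp
 qed
 also have "... = (\<integral>\<^sup>+j. (\<integral>x. indicator (ball j (5 * r j)) x) \<partial>count_space C)"
  by (rule nn_integral_count_space_nn_integral) (auto intro!: C(1) borel_measurable_indicator borel_measurable_times_ennreal)
 also have "... = (\<integral>\<^sup>+j. 5 ^ DIM('a) * emeasure lborel (cball j (r j)) \<partial>count_space C)"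
 proof (rule nn_integral_cong)
  fix j assume "j \<in> space (count_space C)"
  hence "r j > 0" using C(2) r(1) by auto
  thus "(\<integral>x. indicator (ball j (5 * r j)) x) = 5 ^ DIM('a) * emeasure lborel (cball j (r j))"
   by (simp add: emeasure_ball emeasure_cball power_mult_distrib less_imp_le V_def[symmetric] V mult_ac ennreal_mult' ennreal_power flip: ennreal_numeral)
 qed
 finally have "ennreal l * emeasure lborel S <= ennreal l * (\<integral>\<^sup>+j. 5 ^ DIM('a) * emeasure lborel (cball j (r j)) \<partial>count_space C)"
  by (rule mult_left_mono) simp
 also have "... = 5 ^ DIM('a) * (\<integral>\<^sup>+j. ennreal l * emeasure lborel (cball j (r j)) \<partial>count_space C)"
  by (simp add: nn_integral_cmult mult.left_commute)
 also have "... <= 5 ^ DIM('a) * (\<integral>\<^sup>+j. (\<integral>y. h y * indicator (cball j (r j)) y) \<partial>count_space C)"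
  by (intro mult_left_mono nn_integral_mono r(2)) (use C(2) in auto)
 also have "(\<integral>\<^sup>+j. (\<integral>y. h y * indicator (cball j (r j)) y) \<partial>count_space C)
   = (\<integral>y. (\<integral>\<^sup>+j. h y * indicator (cball j (r j)) y \<partial>count_space C))"
  by (rule nn_integral_count_space_nn_integral[symmetric]) (auto intro!: C(1) borel_measurable_indicator borel_measurable_times_ennreal)
 also have "... <= (\<integral>y. h y)"
 proof (rule nn_integral_mono)
  fix y
  have "(\<integral>\<^sup>+j. h y * indicator (cball j (r j)) y \<partial>count_space C) = h y * (\<integral>\<^sup>+j. indicator {j \<in> C. y \<in> cball j (r j)} j \<partial>count_space C)"
   by (subst nn_integral_cmult[symmetric]) (auto intro!: nn_integral_cong simp: indicator_def)
  hence 1: "(\<integral>\<^sup>+j. h y * indicator (cball j (r j)) y \<partial>count_space C) = h y * (\<integral>\<^sup>+j. indicator {j \<in> C. y \<in> cball j (r j)} j \<partial>count_space C)" .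
  have "(\<integral>\<^sup>+j. indicator {j \<in> C. y \<in> cball j (r j)} j \<partial>count_space C) = emeasure (count_space C) {j \<in> C. y \<in> cball j (r j)}"
   by (rule nn_integral_indicator) auto
  also have "... <= 1"
  proof (cases "\<exists>j0. j0 \<in> C \<and> y \<in> cball j0 (r j0)")
   case True
   then obtain j0 where "j0 \<in> C" "y \<in> cball j0 (r j0)" by auto
   hence "{j \<in> C. y \<in> cball j (r j)} = {j0}" using C(3) unfolding pairwise_def disjnt_def by blast
   thus ?thesis using \<open>j0 \<in> C\<close> by (simp add: emeasure_count_space_finite)
  next
   case False
   hence "{j \<in> C. y \<in> cball j (r j)} = {}" by auto
   thus ?thesis by (simp only: emeasure_empty) simp
  qed
  finally show "(\<integral>\<^sup>+j. h y * indicator (cball j (r j)) y \<partial>count_space C) <= h y"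
   unfolding 1 by (metis mult.right_neutral mult_left_mono zero_le)
 qed
 finally show ?thesis unfolding S_def by (simp add: mult_left_mono)
 qed
qed

lemma ennreal_eq_top_if_bounds_all: "(!!y. y >= 0 ==> ennreal y <= a) ==> a = top"
 by (cases a) (metis ennreal_le_iff le_add_same_cancel1 linorder_not_le less_add_one add_increasing2 zero_le_one, simp)

text \<open>The derivative of t^R is integrated up to \<open>a\<close>; an infinite \<open>a\<close>
  is compared with all finite levels, whose integrals are unbounded.\<close>

lemma epowr_layer_cake:
 assumes "R > 0"
 shows "epowr a R = (\<integral>t. ennreal (R * t powr (R - 1)) * indicator {t. 0 < t \<and> ennreal t < a} t)"
proof -
 let ?I = "%a. \<integral>t. ennreal (R * t powr (R - 1)) * indicator {t. 0 < t \<and> ennreal t < a} t"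
 have fin: "?I (ennreal x) = ennreal (x powr R)"
  if x: "x >= 0" for x
 proof -
  have "((%t. R * t powr (R - 1)) has_integral R * (x powr R / R)) {0..x}"
   using has_integral_mult_right[OF has_integral_powr_from_0[of "R - 1" x], of R] assms x by simp
  hence "((%t. R * t powr (R - 1)) has_integral x powr R) {0..x}" using assms by simp
  hence "((%t. if t \<in> {0..x} then R * t powr (R - 1) else 0) has_integral x powr R) UNIV"
   by (subst has_integral_restrict_UNIV)
  hence "((%t. if t \<in> {0..x} then \<bar>R * t powr (R - 1)\<bar> else 0) has_integral x powr R) UNIV"
   using assms by (simp add: abs_mult if_distrib cong: if_cong)
  hence "(\<integral>t. ennreal (if t \<in> {0..x} then \<bar>R * t powr (R - 1)\<bar> else 0)) = x powr R"
   by (rule nn_integral_has_integral_lborel[rotated 2]) auto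
  moreover have "?I (ennreal x)
   = (\<integral>t. ennreal (if t \<in> {0..x} then \<bar>R * t powr (R - 1)\<bar> else 0))"
  proof (rule nn_integral_cong_AE)
   have "AE t in lborel. t ~= x" by (rule AE_lborel_singleton)
   moreover have "AE t in lborel. t ~= (0::real)" by (rule AE_lborel_singleton)
   ultimately show "AE t in lborel. ennreal (R * t powr (R - 1)) * indicator {t. 0 < t \<and> ennreal t < ennreal x} t
      = ennreal (if t \<in> {0..x} then \<bar>R * t powr (R - 1)\<bar> else 0)"
    using assms x by (elim AE_mp, intro AE_I2) (auto simp: indicator_def ennreal_less_iff abs_mult)
  qed
  ultimately show ?thesis by simp
 qed
 show ?thesis
 proof (cases a)
  case (real x)
  thus ?thesis using fin by (simp add: epowr_ennreal)
 next
  case top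
  have "ennreal y <= ?I (a)" if "y >= 0" for y
  proof -
   have "ennreal y = ennreal ((y powr (1 / R)) powr R)" using assms that by (simp add: powr_powr)
   also have "... = ?I (ennreal (y powr (1/R)))"
    by (rule fin[symmetric]) simp
   also have "... <= ?I (a)"
    using top by (intro nn_integral_mono mult_left_mono) (auto simp: indicator_def)
   finally show ?thesis .
  qed
  hence "?I (a) = top"
   by (rule ennreal_eq_top_if_bounds_all)
  thus ?thesis using top by simp
 qed
qed

text \<open>Marcinkiewicz interpolation between the weak type estimate and the trivial bound for
  bounded functions: at height t only the part of \<open>h\<close> above t / 2 matters.\<close>

lemma maximal_strong_type:
 assumes R: "R > 1"
 obtains C where "C > 0" "!!h :: 'a::euclidean_space => ennreal. h \<in> Borel ==>
   (\<integral>x. epowr (maximal h x) R) <= ennreal C * (\<integral>x. epowr (h x) R)"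
proof
 let ?C = "2 * 5 ^ DIM('a) * (R / (R - 1)) * 2 powr (R - 1) :: real"
 \<comment> \<open>The density R t^(R-1) of the layer cake formula divided by the level t / 2, times
   the weak type constant.\<close>
 let ?w = "%t. 2 * 5 ^ DIM('a) * R * t powr (R - 2)"
 show "?C > 0" using R by simp
 fix h :: "'a => ennreal" assume h[measurable]: "h \<in> Borel"
 have weak: "ennreal (R * t powr (R - 1)) * emeasure lborel {x. maximal h x > ennreal t}
   <= (\<integral>x. ennreal (?w t) * (h x * indicator {x. h x > ennreal (t / 2)} x))" if t: "t > 0" for t
 proof -
  let ?g = "%x. h x * indicator {x. h x > ennreal (t / 2)} x"
  have "maximal h x <= maximal ?g x + ennreal (t / 2)" for x
   by (rule maximal_le_add_const) (auto simp: indicator_def)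
  hence "{x. maximal h x > ennreal t} \<subseteq> {x. maximal ?g x > ennreal (t / 2)}"
  proof safe
   fix x assume "ennreal t < maximal h x"
   also assume "!!x. maximal h x <= maximal ?g x + ennreal (t / 2)" hence "maximal h x <= maximal ?g x + ennreal (t / 2)" .
   finally have "ennreal t < maximal ?g x + ennreal (t / 2)" .
   moreover have "ennreal t = ennreal (t / 2) + ennreal (t / 2)" using t by (simp flip: ennreal_plus)
   ultimately show "ennreal (t / 2) < maximal ?g x" by (metis add_right_mono linorder_not_le)
  qed
  hence "ennreal (t / 2) * emeasure lborel {x. maximal h x > ennreal t} <= ennreal (t / 2) * emeasure lborel {x. maximal ?g x > ennreal (t / 2)}"
   by (intro mult_left_mono emeasure_mono) auto
  also have "... <= 5 ^ DIM('a) * (\<integral>x. ?g x)"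
   by (rule maximal_weak_type) (use t in auto)
  finally have "ennreal (2 * R * t powr (R - 2)) * (ennreal (t / 2) * emeasure lborel {x. maximal h x > ennreal t})
    <= ennreal (2 * R * t powr (R - 2)) * (5 ^ DIM('a) * (\<integral>x. ?g x))"
   by (rule mult_left_mono) simp
  moreover have "ennreal (2 * R * t powr (R - 2)) * (ennreal (t / 2) * m) = ennreal (R * t powr (R - 1)) * m" for m
  proof -
   have "2 * R * t powr (R - 2) * (t / 2) = R * t powr (R - 1)" using t powr_add[of t "R - 2" 1] by (simp add: algebra_simps)
   thus ?thesis using t R by (simp flip: ennreal_mult mult.assoc)
  qed
  moreover have "ennreal (2 * R * t powr (R - 2)) * (5 ^ DIM('a) * I) = ennreal (?w t) * I" for I
   using R by (simp add: ennreal_mult ennreal_power mult_ac flip: ennreal_numeral)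
  ultimately show ?thesis by (simp add: nn_integral_cmult)
 qed
 have "(\<integral>x. epowr (maximal h x) R) = (\<integral>x. \<integral>t. ennreal (R * t powr (R - 1)) * indicator {t. 0 < t \<and> ennreal t < maximal h x} t)"
  using R by (intro nn_integral_cong epowr_layer_cake) auto
 also have "... = (\<integral>t. \<integral>x. ennreal (R * t powr (R - 1)) * indicator {t. 0 < t \<and> ennreal t < maximal h x} t)"
  by (rule lborel_pair.Fubini') (simp add: indicator_def)
 also have "... = (\<integral>t. indicator {0<..} t * (ennreal (R * t powr (R - 1)) * emeasure lborel {x. maximal h x > ennreal t}))"
 proof (rule nn_integral_cong)
  fix t :: real
  have "(\<integral>x. ennreal (R * t powr (R - 1)) * indicator {t. 0 < t \<and> ennreal t < maximal h x} t)
    = (\<integral>x. indicator {0<..} t * ennreal (R * t powr (R - 1)) * indicator {x. maximal h x > ennreal t} x)"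
   by (intro nn_integral_cong) (auto simp: indicator_def)
  thus "(\<integral>x. ennreal (R * t powr (R - 1)) * indicator {t. 0 < t \<and> ennreal t < maximal h x} t)
    = indicator {0<..} t * (ennreal (R * t powr (R - 1)) * emeasure lborel {x. maximal h x > ennreal t})"
   by (simp add: nn_integral_cmult mult.assoc)
 qed
 also have "... <= (\<integral>t. indicator {0<..} t * (\<integral>x. ennreal (?w t) * (h x * indicator {x. h x > ennreal (t / 2)} x)))"
 proof (rule nn_integral_mono)
  show "indicator {0<..} t * (ennreal (R * t powr (R - 1)) * emeasure lborel {x. maximal h x > ennreal t})
    <= indicator {0<..} t * (\<integral>x. ennreal (?w t) * (h x * indicator {x. h x > ennreal (t / 2)} x))" for t
  proof (cases "t > 0")
   case True
   thus ?thesis using weak[of t] by (simp only: indicator_simps greaterThan_iff mult_1)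
  qed simp
 qed
 also have "... = (\<integral>t. \<integral>x. ennreal (?w t) * (h x * (if 0 < t \<and> h x > ennreal (t / 2) then 1 else 0)))"
  by (intro nn_integral_cong, subst nn_integral_cmult[symmetric]) (auto intro!: nn_integral_cong simp: indicator_def)
 also have "... = (\<integral>x. \<integral>t. ennreal (?w t) * (h x * (if 0 < t \<and> h x > ennreal (t / 2) then 1 else 0)))"
  by (rule lborel_pair.Fubini') simp
 \<comment> \<open>The inner integral in t runs up to 2 h(x), so it is the layer cake formula for (2
   h)^(R-1), up to the factor R - 1.\<close>
 also have "... = (\<integral>x. ennreal ?C * epowr (h x) R)"
 proof (rule nn_integral_cong)
  fix x
  define K where "K = 2 * 5 ^ DIM('a) * (R / (R - 1))"
  have K: "K >= 0" using R by (simp add: K_def)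
  have iff: "ennreal (t / 2) < h x \<longleftrightarrow> ennreal t < 2 * h x" if "t > 0" for t
  proof (cases "h x")
   case (real y)
   have "2 * h x = ennreal (2 * y)" using real by (simp add: ennreal_mult)
   thus ?thesis using real that by (simp add: ennreal_less_iff field_simps)
  qed (simp add: ennreal_mult_top)
  have "(\<integral>t. ennreal (?w t) * (h x * (if 0 < t \<and> h x > ennreal (t / 2) then 1 else 0)))
   = (\<integral>t. (ennreal K * h x) * (ennreal ((R - 1) * t powr ((R - 1) - 1)) * indicator {t. 0 < t \<and> ennreal t < 2 * h x} t))"
  proof (rule nn_integral_cong)
   fix t :: real
   have "2 * 5 ^ DIM('a) * R * t powr (R - 2) = K * ((R - 1) * t powr ((R - 1) - 1))"
    using R by (simp add: K_def field_simps)
   hence e: "ennreal (?w t) = ennreal K * ennreal ((R - 1) * t powr ((R - 1) - 1))"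
    by (simp only: ennreal_mult'[OF K])
   show "ennreal (?w t) * (h x * (if 0 < t \<and> h x > ennreal (t / 2) then 1 else 0))
     = (ennreal K * h x) * (ennreal ((R - 1) * t powr ((R - 1) - 1)) * indicator {t. 0 < t \<and> ennreal t < 2 * h x} t)"
    unfolding e by (cases "0 < t") (simp_all add: indicator_def iff mult_ac)
  qed
  also have "... = (ennreal K * h x) * epowr (2 * h x) (R - 1)"
   using R by (subst nn_integral_cmult) (auto simp: epowr_layer_cake[of "R - 1"] indicator_def)
  also have "epowr (2 * h x) (R - 1) = ennreal (2 powr (R - 1)) * epowr (h x) (R - 1)"
   using R epowr_ennreal[of 2 "R - 1"] by (simp add: epowr_mult)
  also have "(ennreal K * h x) * (ennreal (2 powr (R - 1)) * epowr (h x) (R - 1)) = ennreal (K * 2 powr (R - 1)) * epowr (h x) R"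
   using epowr_add[of 1 "R - 1" "h x"] R K by (simp add: ennreal_mult mult_ac)
  finally show "(\<integral>t. ennreal (?w t) * (h x * (if 0 < t \<and> h x > ennreal (t / 2) then 1 else 0)))
    = ennreal ?C * epowr (h x) R" by (simp add: K_def)
 qed
 also have "... = ennreal ?C * (\<integral>x. epowr (h x) R)"
  by (rule nn_integral_cmult) simp
 finally show "(\<integral>x. epowr (maximal h x) R) <= ennreal ?C * (\<integral>x. epowr (h x) R)" .
qed

section \<open>Polynomially decaying kernels and sums over dyadic scales\<close>

definition ker :: "nat => nat => 'a::euclidean_space => real" where
 "ker D i x = 2 ^ (i * DIM('a)) / (1 + 2 ^ i * norm x) ^ D"

definition kavg :: "nat => nat => ('a::euclidean_space => ennreal) => 'a => ennreal" where
 "kavg D i h x = (\<integral>y. ennreal (ker D i (x - y)) * h y)"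

lemma ker_pos: "ker D i x > 0"
 unfolding ker_def by (intro divide_pos_pos zero_less_power add_pos_nonneg) auto

lemma ker_nonneg [simp]: "0 <= ker D i x"
 using ker_pos less_imp_le by blast

lemma ker_minus: "ker D i (- x) = ker D i x" "ker D i (x - y) = ker D i (y - x)"
 by (simp_all add: ker_def norm_minus_commute)

lemma continuous_ker: "continuous_on A (ker D i)"
proof -
 have "1 + 2 ^ i * norm x > 0" for x :: 'a by (intro add_pos_nonneg) auto
 hence "1 + 2 ^ i * norm x ~= 0" for x :: 'a by (metis less_irrefl)
 thus ?thesis unfolding ker_def by (intro continuous_intros) auto
qed

lemma measurable_ker [measurable]: "ker D i \<in> Borel"
 by (intro borel_measurable_continuous_onI continuous_ker)

lemma measurable_kavg [measurable]:
 assumes [measurable]: "h \<in> Borel"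
 shows "kavg D i h \<in> Borel"
 unfolding kavg_def by (rule lborel.borel_measurable_nn_integral) measurable

lemma kavg_mono: "(!!x. f x <= g x) ==> kavg D i f x <= kavg D i g x"
 unfolding kavg_def by (intro nn_integral_mono mult_left_mono) auto

lemma kavg_cmult:
 "h \<in> Borel ==> kavg D i (%y. c * h y) x = c * kavg D i h x"
 unfolding kavg_def by (simp add: nn_integral_cmult mult.left_commute)

text \<open>The kernel is even, so the averaging operator is its own transpose.\<close>

lemma kavg_sym:
 assumes [measurable]: "h \<in> Borel" "g \<in> Borel"
 shows "(\<integral>x. kavg D i h x * g x) = (\<integral>x. h x * kavg D i g x)"
proof -
 have "(\<integral>x. kavg D i h x * g x) = (\<integral>x. \<integral>y. ennreal (ker D i (x - y)) * h y * g x)"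
  unfolding kavg_def by (simp add: nn_integral_multc)
 also have "... = (\<integral>y. \<integral>x. ennreal (ker D i (x - y)) * h y * g x)"
  by (rule lborel_pair.Fubini') measurable
 also have "... = (\<integral>y. h y * kavg D i g y)"
  unfolding kavg_def by (simp add: nn_integral_cmult[symmetric] ker_minus(2)[of D i "_ :: 'a"] mult_ac)
 finally show ?thesis .
qed

text \<open>A single term is enough: for the least \<open>k\<close> with 2^i |y| <= 2^k, minimality
  gives 2^k <= 2 (1 + 2^i |y|), which turns the polynomial tail into 2^D / 2^(k D).\<close>

lemma ker_dyadic_bound:
 fixes y :: "'a::euclidean_space"
 shows "ennreal (ker D i y) <= (\<Sum>k. ennreal (2 ^ (i * DIM('a)) * 2 ^ D / 2 ^ (k * D)) * indicator (cball 0 (2 ^ k / 2 ^ i)) y)"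
proof -
 define z where "z = 2 ^ i * norm y"
 have z: "z >= 0" by (simp add: z_def)
 have "\<exists>k::nat. z <= 2 ^ k \<and> 2 ^ k <= 2 * (1 + z)"
 proof -
  have ex: "\<exists>k::nat. z <= 2 ^ k" using real_arch_pow[of 2 z] by (auto intro: less_imp_le)
  define k where "k = (LEAST k::nat. z <= 2 ^ k)"
  have k: "z <= 2 ^ k" unfolding k_def using LeastI_ex[OF ex] .
  have "2 ^ k <= 2 * (1 + z)"
  proof (cases k)
   case (Suc k')
   hence "\<not> z <= 2 ^ k'" using not_less_Least[of k' "%k. z <= 2 ^ k"] unfolding k_def by auto
   thus ?thesis using Suc by simp
  qed (use z in simp)
  with k show ?thesis by blast
 qed
 then obtain k :: nat where k: "z <= 2 ^ k" "2 ^ k <= 2 * (1 + z)" by auto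
 have "ker D i y = 2 ^ (i * DIM('a)) / (1 + z) ^ D" by (simp add: ker_def z_def)
 also have "... <= 2 ^ (i * DIM('a)) * 2 ^ D / 2 ^ (k * D)"
 proof -
  have "(2 ^ k) ^ D <= (2 * (1 + z)) ^ D" by (rule power_mono[OF k(2)]) simp
  hence "2 ^ (k * D) <= 2 ^ D * (1 + z) ^ D" by (simp only: power_mult power_mult_distrib)
  thus ?thesis using z by (simp add: field_simps)
 qed
 finally have "ennreal (ker D i y) <= ennreal (2 ^ (i * DIM('a)) * 2 ^ D / 2 ^ (k * D)) * indicator (cball 0 (2 ^ k / 2 ^ i)) y"
  using k(1) by (auto simp: z_def indicator_def field_simps intro!: ennreal_leI)
 also have "... <= (\<Sum>k. ennreal (2 ^ (i * DIM('a)) * 2 ^ D / 2 ^ (k * D)) * indicator (cball 0 (2 ^ k / 2 ^ i)) y)"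
  using sum_le_suminf[OF summableI, of "{k}"] by simp
 finally show ?thesis .
qed

text \<open>The power 2^D comes from \<open>ker_dyadic_bound\<close>, the additional factor 2 from
  the sum of the (1/2)^k in \<open>kavg_le_maximal\<close>.\<close>

definition ker_const :: "'a::euclidean_space itself => nat => real" where
 "ker_const T D = 2 ^ Suc D * unit_ball_vol (real DIM('a))"

lemma ker_const_pos: "ker_const T D > 0"
 by (simp add: ker_const_def)

text \<open>The ball of radius 2^k / 2^i has kernel weight 2^(i DIM - k D) and volume 2^((k - i)
  DIM), up to constants, so for D > DIM it contributes at most 2^-k times the maximal
  function.\<close>

lemma kavg_le_maximal:
 fixes h :: "'a::euclidean_space => ennreal"
 assumes D: "D > DIM('a)" and [measurable]: "h \<in> Borel"
 shows "kavg D i h x <= ennreal (ker_const TYPE('a) D) * maximal h x"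
proof -
 let ?h = "%k. \<integral>y. h y * indicator (cball x (2 ^ k / 2 ^ i)) y"
 let ?w = "%k. 2 ^ (i * DIM('a)) * 2 ^ D / 2 ^ (k * D) :: real"
 define V where "V = unit_ball_vol (real DIM('a))"
 have V: "V > 0" by (simp add: V_def)
 have [measurable]: "cball x r \<in> sets borel" for r by simp
 have "kavg D i h x <= (\<integral>y. (\<Sum>k. ennreal (?w k) * indicator (cball 0 (2 ^ k / 2 ^ i)) (x - y)) * h y)"
  unfolding kavg_def by (intro nn_integral_mono mult_right_mono ker_dyadic_bound) auto
 also have "... = (\<integral>y. (\<Sum>k. ennreal (?w k) * (h y * indicator (cball x (2 ^ k / 2 ^ i)) y)))"
  by (simp only: ennreal_suminf_multc[symmetric])
    (auto intro!: nn_integral_cong suminf_cong simp: indicator_def dist_norm norm_minus_commute simp del: ennreal_suminf_multc)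
 also have "... = (\<Sum>k. ennreal (?w k) * ?h k)"
  by (subst nn_integral_suminf) (auto simp: nn_integral_cmult)
 also have "... <= (\<Sum>k. ennreal (2 ^ D * V * (1 / 2) ^ k) * maximal h x)"
 proof (intro suminf_le summableI)
  fix k
  have "ennreal (?w k) * ?h k
   <= ennreal (?w k) * (ennreal (V * (2 ^ k / 2 ^ i) ^ DIM('a)) * maximal h x)"
   using cball_integral_le_maximal[of h x k i] by (intro mult_left_mono) (auto simp: emeasure_cball V_def)
  also have "... = ennreal (2 ^ (i * DIM('a)) * 2 ^ D / 2 ^ (k * D) * (V * (2 ^ k / 2 ^ i) ^ DIM('a))) * maximal h x"
   by (subst ennreal_mult'[of "2 ^ (i * DIM('a)) * 2 ^ D / 2 ^ (k * D)"]) (simp_all only: mult.assoc, simp)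
  also have "2 ^ (i * DIM('a)) * 2 ^ D / 2 ^ (k * D) * (V * (2 ^ k / 2 ^ i) ^ DIM('a)) = 2 ^ D * V * (2 ^ (k * DIM('a)) / 2 ^ (k * D))"
   by (simp add: power_divide power_mult)
  also have "ennreal ... <= ennreal (2 ^ D * V * (1 / 2) ^ k)"
  proof -
   have "k * (DIM('a) + 1) <= k * D" using D by (intro mult_le_mono2) simp
   hence "k * DIM('a) + k <= k * D" by simp
   hence "(2::real) ^ (k * DIM('a) + k) <= 2 ^ (k * D)" by (intro power_increasing) auto
   hence "2 ^ (k * DIM('a)) / 2 ^ (k * D) <= (1 / 2 :: real) ^ k"
    by (simp add: power_add power_divide field_simps)
   thus ?thesis using V by (intro ennreal_leI mult_left_mono) auto
  qed
  finally show "ennreal (?w k) * ?h k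
    <= ennreal (2 ^ D * V * (1 / 2) ^ k) * maximal h x"
   by (simp add: mult_right_mono)
 qed
 also have "... = (\<Sum>k. ennreal (2 ^ D * V * (1 / 2) ^ k)) * maximal h x" by simp
 also have "(\<Sum>k. ennreal (2 ^ D * V * (1 / 2) ^ k)) = ennreal (2 ^ D * V * 2)"
  using V by (intro suminf_ennreal_eq sums_mult) (use geometric_sums[of "1/2::real"] in auto)
 finally show ?thesis by (simp add: ker_const_def V_def mult_ac)
qed

lemma maximal_const: "maximal (%x. c) x <= c"
proof -
 have "(\<integral>y. c * indicator (cball x r) y) / emeasure lborel (cball x r) <= c" if "r > 0" for x :: 'a and r
  using emeasure_cball_pos[OF that, of x] that
  by (subst ennreal_le_divide_iff) (simp_all add: emeasure_cball nn_integral_cmult_indicator)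
 note le = this
 show ?thesis unfolding maximal_def
 proof (rule SUP_least, clarify)
  fix k i :: nat
  show "(\<integral>y. c * indicator (cball x (2 ^ k / 2 ^ i)) y) / emeasure lborel (cball x (2 ^ k / 2 ^ i)) <= c"
   by (rule le) simp
 qed
qed

lemma kavg_const:
 assumes "D > DIM('a)"
 shows "kavg D i (%x. c) (x::'a::euclidean_space) <= ennreal (ker_const TYPE('a) D) * c"
 by (rule order_trans[OF kavg_le_maximal[OF assms] mult_left_mono[OF maximal_const]]) auto

lemma nn_integral_ker:
 fixes x :: "'a::euclidean_space"
 assumes "D > DIM('a)"
 shows "(\<integral>y. ennreal (ker D i (x - y))) <= ennreal (ker_const TYPE('a) D)"
 using kavg_const[OF assms, of i 1 x] by (simp add: kavg_def)

lemma kavg_Jensen: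
 assumes "D > DIM('a)" "Q >= 1" and [measurable]: "h \<in> Borel"
 shows "epowr (kavg D i h (x::'a::euclidean_space)) Q <= ennreal (2 powr Q * ker_const TYPE('a) D powr (Q - 1)) * kavg D i (%y. epowr (h y) Q) x"
 unfolding kavg_def
 by (rule nn_integral_Jensen) (use assms ker_const_pos nn_integral_ker in auto)

definition geo :: "real => nat => nat => ennreal" where
 "geo e k j = ennreal (2 powr (- e * \<bar>real k - real j\<bar>))"

lemma geo_sym: "geo e k j = geo e j k"
 by (simp add: geo_def abs_minus_commute)

definition geo_const :: "real => real" where
 "geo_const e = 2 / (1 - 2 powr (- e))"

lemma geo_const_pos: "e > 0 ==> geo_const e > 0"
 using powr_less_mono[of "- e" 0 2] by (simp add: geo_const_def)

lemma suminf_geo: assumes "e > 0" shows "(\<Sum>j. geo e k j) <= ennreal (geo_const e)"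
proof -
 define r where "r = 2 powr (- e)"
 have r: "0 < r" "r < 1" using powr_less_mono[of "- e" 0 2] assms by (auto simp: r_def)
 have g: "geo e k j = ennreal (r ^ (if j <= k then k - j else j - k))" for j
  by (auto simp: geo_def r_def powr_powr of_nat_diff simp flip: powr_realpow)
 have s: "(\<Sum>j. ennreal (r ^ j)) = ennreal (1 / (1 - r))"
  using r geometric_sums[of r] by (intro suminf_ennreal_eq) auto
 have "(\<Sum>j. geo e k j) = (\<Sum>j. geo e k (j + k)) + (\<Sum>j<k. geo e k j)"
  by (rule suminf_offset[OF summableI])
 also have "(\<Sum>j. geo e k (j + k)) = ennreal (1 / (1 - r))"
 proof -
  have "geo e k (j + k) = ennreal (r ^ j)" for j by (simp add: g)
  thus ?thesis using s by simp
 qed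
 also have "(\<Sum>j<k. geo e k j) = (\<Sum>j<k. ennreal (r ^ (k - j)))" by (auto simp: g)
 also have "... = (\<Sum>j<k. ennreal (r ^ Suc j))"
  by (subst sum.nat_diff_reindex[symmetric]) (auto intro!: sum.cong simp: Suc_diff_Suc)
 also have "... <= (\<Sum>j<k. ennreal (r ^ j))"
  using r by (intro sum_mono ennreal_leI power_decreasing) auto
 also have "... <= ennreal (1 / (1 - r))" unfolding s[symmetric] by (rule sum_le_suminf[OF summableI]) auto
 finally show ?thesis using r by (simp add: geo_const_def r_def add_divide_distrib[symmetric] flip: ennreal_plus)
qed

text \<open>Averaging at the coarser of the two scales makes the operator symmetric in
  \<open>j\<close> and \<open>k\<close>, hence its own transpose (\<open>Uop_dual\<close>); the
  duality arguments below rest on this.\<close>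

definition Uop :: "nat => real => (nat => 'a::euclidean_space => ennreal) => nat => 'a => ennreal" where
 "Uop D e G k x = (\<Sum>j. geo e k j * kavg D (min j k) (G j) x)"

lemma measurable_Uop [measurable]:
 assumes [measurable]: "!!j. G j \<in> Borel"
 shows "Uop D e G k \<in> Borel"
 unfolding Uop_def by measurable

text \<open>Jensen twice: over \<open>j\<close> with the summable weights \<open>geo\<close>, and
  over space with the integrable kernel.\<close>

lemma Uop_power:
 fixes G :: "nat => 'a::euclidean_space => ennreal"
 assumes "D > DIM('a)" "Q >= 1" "e > 0"
 obtains C where "C > 0" "!!(G :: nat => 'a => ennreal) k x. (!!j. G j \<in> Borel) ==>
  epowr (Uop D e G k x) Q <= ennreal C * Uop D e (%j y. epowr (G j y) Q) k x"
proof
 let ?A = "2 powr Q * geo_const e powr (Q - 1)" let ?B = "2 powr Q * ker_const TYPE('a) D powr (Q - 1)"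
 show "?A * ?B > 0" using geo_const_pos[OF assms(3)] ker_const_pos[of "TYPE('a)" D] by simp
 fix G :: "nat => 'a => ennreal" and k x
 assume [measurable]: "!!j. G j \<in> Borel"
 have "epowr (Uop D e G k x) Q = epowr (\<integral>\<^sup>+j. geo e k j * kavg D (min j k) (G j) x \<partial>count_space UNIV) Q"
  by (simp add: Uop_def nn_integral_count_space_nat)
 also have "... <= ennreal ?A * (\<integral>\<^sup>+j. geo e k j * epowr (kavg D (min j k) (G j) x) Q \<partial>count_space UNIV)"
  using assms geo_const_pos suminf_geo by (intro nn_integral_Jensen) (auto simp: nn_integral_count_space_nat)
 also have "... <= ennreal ?A * (\<integral>\<^sup>+j. geo e k j * (ennreal ?B * kavg D (min j k) (%y. epowr (G j y) Q) x) \<partial>count_space UNIV)"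
  using assms by (intro mult_left_mono nn_integral_mono kavg_Jensen) auto
 also have "... = ennreal ?A * (ennreal ?B * (\<integral>\<^sup>+j. geo e k j * kavg D (min j k) (%y. epowr (G j y) Q) x \<partial>count_space UNIV))"
  by (subst nn_integral_cmult[symmetric]) (auto simp: mult_ac)
 also have "... = ennreal (?A * ?B) * Uop D e (%j y. epowr (G j y) Q) k x"
  by (simp add: Uop_def nn_integral_count_space_nat ennreal_mult mult_ac)
 finally show "epowr (Uop D e G k x) Q <= ennreal (?A * ?B) * Uop D e (%j y. epowr (G j y) Q) k x" .
qed

lemma Uop_dual:
 fixes G H :: "nat => 'a::euclidean_space => ennreal"
 assumes [measurable]: "!!j. G j \<in> Borel" "!!j. H j \<in> Borel"
 shows "(\<integral>x. (\<Sum>k. Uop D e G k x * H k x)) = (\<integral>x. (\<Sum>k. G k x * Uop D e H k x))"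
proof -
 have "(\<integral>x. (\<Sum>k. Uop D e G k x * H k x)) = (\<Sum>k. \<integral>x. (\<Sum>j. geo e k j * (kavg D (min j k) (G j) x * H k x)))"
  by (subst nn_integral_suminf) (auto simp: Uop_def mult.assoc simp flip: ennreal_suminf_multc)
 also have "... = (\<Sum>k. \<Sum>j. geo e k j * (\<integral>x. kavg D (min j k) (G j) x * H k x))"
  by (subst nn_integral_suminf) (auto simp: nn_integral_cmult)
 also have "... = (\<Sum>k. \<Sum>j. geo e k j * (\<integral>x. G j x * kavg D (min j k) (H k) x))"
  by (simp add: kavg_sym)
 also have "... = (\<Sum>j. \<Sum>k. geo e k j * (\<integral>x. G j x * kavg D (min j k) (H k) x))"
  unfolding nn_integral_count_space_nat[symmetric]
  by (rule nn_integral_count_space_nn_integral) auto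
 also have "... = (\<Sum>j. \<Sum>k. (\<integral>x. G j x * (geo e j k * kavg D (min k j) (H k) x)))"
  by (simp add: nn_integral_cmult[symmetric] mult.left_commute geo_sym[of e _ ] min.commute)
 also have "... = (\<Sum>j. \<integral>x. (\<Sum>k. G j x * (geo e j k * kavg D (min k j) (H k) x)))"
  by (subst nn_integral_suminf) auto
 also have "... = (\<integral>x. (\<Sum>j. G j x * Uop D e H j x))"
  by (subst nn_integral_suminf) (auto simp: Uop_def)
 finally show ?thesis .
qed

text \<open>An inequality of Fefferman-Stein type: after Jensen, duality moves the operator to the
  weight, where the constant sequence \<open>\<phi>\<close> is averaged at several scales and each
  average stays below a multiple of \<open>maximal \<phi>\<close>.\<close>

lemma Uop_weighted:
 assumes "D > DIM('a::euclidean_space)" "Q >= 1" "e > 0"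
 obtains C where "C > 0" "!!(G :: nat => 'a => ennreal) \<phi>. (!!j. G j \<in> Borel) ==> \<phi> \<in> Borel ==>
  (\<integral>x. (\<Sum>k. epowr (Uop D e G k x) Q) * \<phi> x) <= ennreal C * (\<integral>x. (\<Sum>j. epowr (G j x) Q) * maximal \<phi> x)"
proof -
 obtain C where C: "C > 0" "!!(G :: nat => 'a => ennreal) k x. (!!j. G j \<in> Borel) ==>
  epowr (Uop D e G k x) Q <= ennreal C * Uop D e (%j y. epowr (G j y) Q) k x"
  using Uop_power[OF assms] by metis
 let ?B = "geo_const e * ker_const TYPE('a) D"
 have B: "?B > 0" using geo_const_pos[OF assms(3)] ker_const_pos[of "TYPE('a)" D] by simp
 show thesis
 proof
  show "C * ?B > 0" using C(1) B by simp
  fix G :: "nat => 'a => ennreal" and \<phi> :: "'a => ennreal"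
  assume [measurable]: "!!j. G j \<in> Borel" "\<phi> \<in> Borel"
  have "(\<integral>x. (\<Sum>k. epowr (Uop D e G k x) Q) * \<phi> x) <= (\<integral>x. (\<Sum>k. (ennreal C * Uop D e (%j y. epowr (G j y) Q) k x) * \<phi> x))"
   by (subst ennreal_suminf_multc[symmetric]) (intro nn_integral_mono suminf_le summableI mult_right_mono C(2); simp)
  also have "... = ennreal C * (\<integral>x. (\<Sum>k. Uop D e (%j y. epowr (G j y) Q) k x * \<phi> x))"
   by (subst nn_integral_cmult[symmetric]) (auto simp: mult.assoc)
  also have "(\<integral>x. (\<Sum>k. Uop D e (%j y. epowr (G j y) Q) k x * \<phi> x)) = (\<integral>x. (\<Sum>j. epowr (G j x) Q * Uop D e (%_. \<phi>) j x))"
   by (rule Uop_dual) auto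
  also have "... <= (\<integral>x. (\<Sum>j. epowr (G j x) Q * (ennreal ?B * maximal \<phi> x)))"
  proof (intro nn_integral_mono suminf_le summableI mult_left_mono)
   fix x j
   have "Uop D e (%_. \<phi>) j x <= (\<Sum>k. geo e j k * (ennreal (ker_const TYPE('a) D) * maximal \<phi> x))"
    unfolding Uop_def using assms by (intro suminf_le summableI mult_left_mono kavg_le_maximal) auto
   also have "... = (\<Sum>k. geo e j k) * (ennreal (ker_const TYPE('a) D) * maximal \<phi> x)" by simp
   also have "... <= ennreal (geo_const e) * (ennreal (ker_const TYPE('a) D) * maximal \<phi> x)"
    by (intro mult_right_mono suminf_geo assms) auto
   finally show "Uop D e (%_. \<phi>) j x <= ennreal ?B * maximal \<phi> x"
    using geo_const_pos[OF assms(3)] ker_const_pos[of "TYPE('a)" D] by (simp add: ennreal_mult mult.assoc)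
  qed auto
  also have "... = ennreal ?B * (\<integral>x. (\<Sum>j. epowr (G j x) Q) * maximal \<phi> x)"
   by (subst nn_integral_cmult[symmetric]) (auto simp: mult.left_commute)
  finally show "(\<integral>x. (\<Sum>k. epowr (Uop D e G k x) Q) * \<phi> x) <= ennreal (C * ?B) * (\<integral>x. (\<Sum>j. epowr (G j x) Q) * maximal \<phi> x)"
   using C(1) B by (simp add: ennreal_mult mult.assoc mult_left_mono)
 qed
qed

section \<open>Vector-valued maximal inequalities by duality and absorption\<close>

definition trunc :: "nat => nat => ('a::euclidean_space => ennreal) => 'a => ennreal" where
 "trunc N k u x = (if k < N \<and> norm x <= real N then min (u x) (ennreal (real N)) else 0)"

lemma trunc_le: "trunc N k u x <= u x"
 by (auto simp: trunc_def)

lemma trunc_mono: "N <= M ==> trunc N k u x <= trunc M k u x"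
 by (auto simp: trunc_def intro!: min.mono ennreal_leI intro: order_trans[OF min.cobounded2])

lemma measurable_trunc [measurable]:
 assumes [measurable]: "u \<in> Borel"
 shows "trunc N k u \<in> Borel"
 unfolding trunc_def by measurable

lemma SUP_trunc: "(SUP N. trunc N k u x) = u x"
proof (rule antisym)
 show "(SUP N. trunc N k u x) <= u x" by (rule SUP_least) (rule trunc_le)
 show "u x <= (SUP N. trunc N k u x)"
 proof (rule ccontr)
  assume "\<not> ?thesis"
  hence "(SUP N. trunc N k u x) < u x" by simp
  then obtain b where b: "(SUP N. trunc N k u x) < b" "b < u x" using dense by blast
  obtain y where y: "b = ennreal y" "y >= 0" using b(2) by (cases b) auto
  obtain N :: nat where N: "real N >= max y (norm x) + real k + 1" using real_arch_simple by blast
  have "k < N" using N y(2) by linarith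
  hence "b <= trunc N k u x"
   using N b(2) y(1) by (auto simp: trunc_def less_imp_le intro!: ennreal_leI)
  also have "... <= (SUP N. trunc N k u x)" by (rule SUP_upper) simp
  finally show False using b(1) by simp
 qed
qed

text \<open>Truncation in index, position and height makes all mixed norms finite, as absorption
  requires; monotone convergence removes it.\<close>

lemma trunc_limit:
 fixes U :: "nat => 'a::euclidean_space => ennreal"
 assumes [measurable]: "!!k. U k \<in> Borel" and PQ: "P > 0" "Q > 0"
  and "!!N. (\<integral>x. epowr (\<Sum>k. epowr (trunc N k (U k) x) Q) (P / Q)) <= B"
 shows "(\<integral>x. epowr (\<Sum>k. epowr (U k x) Q) (P / Q)) <= B"
proof -
 have mono: "incseq (%N. %x. epowr (\<Sum>k. epowr (trunc N k (U k) x) Q) (P / Q))"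
  using PQ by (auto simp: incseq_def le_fun_def intro!: epowr_mono suminf_le summableI trunc_mono)
 have "epowr (\<Sum>k. epowr (U k x) Q) (P / Q) = (SUP N. epowr (\<Sum>k. epowr (trunc N k (U k) x) Q) (P / Q))" for x
 proof -
  have "(\<Sum>k. epowr (U k x) Q) = (\<Sum>k. SUP N. epowr (trunc N k (U k) x) Q)"
   using PQ by (simp add: epowr_SUP[symmetric] SUP_trunc)
  also have "... = (SUP N. \<Sum>k. epowr (trunc N k (U k) x) Q)"
   by (rule ennreal_suminf_SUP_eq) (use PQ in \<open>auto simp: incseq_def intro!: epowr_mono trunc_mono\<close>)
  finally show ?thesis using PQ by (simp add: epowr_SUP)
 qed
 hence "(\<integral>x. epowr (\<Sum>k. epowr (U k x) Q) (P / Q)) = (SUP N. \<integral>x. epowr (\<Sum>k. epowr (trunc N k (U k) x) Q) (P / Q))"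
  by (simp, subst nn_integral_monotone_convergence_SUP[OF mono]) auto
 also have "... <= B" by (rule SUP_least) (rule assms(4))
 finally show ?thesis .
qed

lemma suminf_trunc:
 assumes "Q > 0"
 shows "(\<Sum>k. epowr (trunc N k (U k) x) Q) <= ennreal (real N * real N powr Q) * indicator (cball 0 (real N)) x"
proof -
 have "(\<Sum>k. epowr (trunc N k (U k) x) Q) = (\<Sum>k<N. epowr (trunc N k (U k) x) Q)"
  by (rule suminf_finite) (auto simp: trunc_def)
 also have "... <= (\<Sum>k<N. ennreal (real N powr Q) * indicator (cball 0 (real N)) x)"
 proof (rule sum_mono)
  fix k
  have "epowr (min (U k x) (ennreal (real N))) Q <= epowr (ennreal (real N)) Q"
   by (rule epowr_mono[OF assms]) simp
  thus "epowr (trunc N k (U k) x) Q <= ennreal (real N powr Q) * indicator (cball 0 (real N)) x"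
   by (auto simp: trunc_def epowr_ennreal)
 qed
 also have "... = ennreal (real N * real N powr Q) * indicator (cball 0 (real N)) x"
  by (simp add: ennreal_mult ennreal_of_nat_eq_real_of_nat mult.assoc)
 finally show ?thesis .
qed

lemma suminf_trunc_finite: "Q > 0 ==> (\<Sum>k. epowr (trunc N k (U k) x) Q) < top"
 by (rule le_less_trans[OF suminf_trunc]) (auto simp: indicator_def)

lemma nn_integral_trunc_finite:
 fixes U :: "nat => 'a::euclidean_space => ennreal"
 assumes "P > 0" "Q > 0"
 shows "(\<integral>x. epowr (\<Sum>k. epowr (trunc N k (U k) x) Q) (P / Q)) < top"
proof -
 let ?c = "real N * real N powr Q"
 have "(\<integral>x. epowr (\<Sum>k. epowr (trunc N k (U k) x) Q) (P / Q)) <= (\<integral>x. ennreal (?c powr (P / Q)) * indicator (cball (0::'a) (real N)) x)"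
 proof (rule nn_integral_mono)
  fix x :: 'a
  have "epowr (\<Sum>k. epowr (trunc N k (U k) x) Q) (P / Q) <= epowr (ennreal ?c * indicator (cball 0 (real N)) x) (P / Q)"
   by (rule epowr_mono[OF _ suminf_trunc]) (use assms in auto)
  thus "epowr (\<Sum>k. epowr (trunc N k (U k) x) Q) (P / Q) <= ennreal (?c powr (P / Q)) * indicator (cball 0 (real N)) x"
   by (cases "x \<in> cball 0 (real N)") (auto simp: epowr_ennreal)
 qed
 also have "... = ennreal (?c powr (P / Q)) * emeasure lborel (cball (0::'a) (real N))"
  by (rule nn_integral_cmult_indicator) simp
 also have "... < top" by (simp add: emeasure_cball ennreal_mult_less_top)
 finally show ?thesis .
qed

lemma ennreal_absorb:
 assumes "X <= A + ennreal (1 / 2) * X" "X < top" shows "X <= 2 * A"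
proof (cases A)
 case (real a)
 obtain x where x: "X = ennreal x" "x >= 0" using assms(2) by (cases X) auto
 have "ennreal (1 / 2) * ennreal x = ennreal (1 / 2 * x)" by (rule ennreal_mult[symmetric]) (use x in auto)
 hence "ennreal x <= ennreal (a + 1 / 2 * x)"
  using assms(1) x real by (simp only: ennreal_plus[of a "1 / 2 * x"])
 hence "x <= a + 1 / 2 * x" using x real by (subst (asm) ennreal_le_iff) auto
 hence "ennreal x <= ennreal (2 * a)" by (intro ennreal_leI) simp
 thus ?thesis using x real by (simp add: ennreal_mult)
qed (simp add: ennreal_mult_top)

text \<open>Duality in L^s with s = P/Q: the truncated sum of Q-th powers is tested against its own
  power s - 1. The weighted inequality leads to \<open>maximal \<phi>\<close>, and the maximal
  theorem in the conjugate space returns a multiple of the left-hand side that is small enough to be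
  absorbed.\<close>

lemma Uop_vector_ge:
 assumes D: "D > DIM('a::euclidean_space)" and PQ: "Q > 1" "P >= Q" and e: "e > 0"
 obtains C where "C > 0" "!!(G :: nat => 'a => ennreal). (!!j. G j \<in> Borel) ==>
  (\<integral>x. epowr (\<Sum>k. epowr (Uop D e G k x) Q) (P / Q)) <= ennreal C * (\<integral>x. epowr (\<Sum>j. epowr (G j x) Q) (P / Q))"
proof -
 let ?U = "%(G :: nat => 'a => ennreal) x. \<Sum>k. epowr (Uop D e G k x) Q"
 show ?thesis
 proof (rule Uop_weighted[OF D less_imp_le[OF PQ(1)] e], goal_cases)
 case C: (1 C)
 show thesis
 proof (cases "P = Q")
  case True
  show ?thesis
  proof (rule that[OF C(1)])
   fix G :: "nat => 'a => ennreal" assume G: "!!j. G j \<in> Borel"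
   have "(\<integral>x. ?U G x * 1) <= ennreal C * (\<integral>x. (\<Sum>j. epowr (G j x) Q) * maximal (%_. 1) x)"
    by (rule C(2)[OF G]) auto
   also have "... <= ennreal C * (\<integral>x. (\<Sum>j. epowr (G j x) Q) * 1)"
    by (intro mult_left_mono nn_integral_mono maximal_const) auto
   finally show "(\<integral>x. epowr (?U G x) (P / Q)) <= ennreal C * (\<integral>x. epowr (\<Sum>j. epowr (G j x) Q) (P / Q))"
    using True PQ by simp
  qed
 next
  case False
  define s where "s = P / Q" define s' where "s' = s / (s - 1)"
  have s: "s > 1" using False PQ by (simp add: s_def)
  have s': "s' > 1" "1 / s + 1 / s' = 1" "(s - 1) * s' = s" using s by (auto simp: s'_def field_simps)
  obtain M where M: "M > 0" "!!h :: 'a => ennreal. h \<in> Borel ==>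
    (\<integral>x. epowr (maximal h x) s') <= ennreal M * (\<integral>x. epowr (h x) s')"
   using maximal_strong_type[OF s'(1)] by blast
  \<comment> \<open>Makes the coefficient \<open>C * \<delta> * M\<close> of the absorbed term equal
    to 1/2.\<close>
  define \<delta> where "\<delta> = 1 / (2 * C * M)"
  have \<delta>: "\<delta> > 0" using C(1) M(1) by (simp add: \<delta>_def)
  obtain K where K: "K > 0" "!!a b. a * b <= ennreal K * epowr a s + ennreal \<delta> * epowr b s'"
   using Young_ennreal_eps[OF s s'(1,2) \<delta>] by blast
  show ?thesis
  proof (rule that[of "2 * (C * K)"])
   show "2 * (C * K) > 0" using C K by simp
   fix G :: "nat => 'a => ennreal" assume G[measurable]: "!!j. G j \<in> Borel"
   let ?S = "%x. \<Sum>j. epowr (G j x) Q"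
   let ?J = "(\<integral>x. epowr (?S x) s)"
   show "(\<integral>x. epowr (?U G x) (P / Q)) <= ennreal (2 * (C * K)) * (\<integral>x. epowr (?S x) (P / Q))"
   proof (rule trunc_limit)
    fix N
    define V where "V = (%x. \<Sum>k. epowr (trunc N k (Uop D e G k) x) Q)"
    define \<phi> where "\<phi> = (%x. epowr (V x) (s - 1))"
    define X where "X = (\<integral>x. epowr (V x) s)"
    have [measurable]: "V \<in> Borel" "\<phi> \<in> Borel" unfolding V_def \<phi>_def by measurable
    have fin: "X < top" unfolding X_def V_def s_def by (rule nn_integral_trunc_finite) (use PQ in auto)
    have "X = (\<integral>x. V x * \<phi> x)"
     unfolding X_def \<phi>_def using epowr_add[of 1 "s - 1"] s by simp
    also have "... <= (\<integral>x. ?U G x * \<phi> x)"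
     unfolding V_def using PQ by (intro nn_integral_mono mult_right_mono suminf_le summableI epowr_mono trunc_le) auto
    also have "... <= ennreal C * (\<integral>x. ?S x * maximal \<phi> x)"
     by (rule C(2)) auto
    also have "... <= ennreal C * (\<integral>x. ennreal K * epowr (?S x) s + ennreal \<delta> * epowr (maximal \<phi> x) s')"
     by (intro mult_left_mono nn_integral_mono K(2)) auto
    also have "... = ennreal C * (ennreal K * ?J + ennreal \<delta> * (\<integral>x. epowr (maximal \<phi> x) s'))"
     by (simp add: nn_integral_add nn_integral_cmult)
    also have "... <= ennreal C * (ennreal K * ?J + ennreal \<delta> * (ennreal M * (\<integral>x. epowr (\<phi> x) s')))"
     by (intro mult_left_mono add_left_mono M(2)) auto
    also have "(\<integral>x. epowr (\<phi> x) s') = X"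
     unfolding \<phi>_def X_def using s s' by (simp add: epowr_epowr)
    also have "ennreal C * (ennreal K * ?J + ennreal \<delta> * (ennreal M * X))
      = ennreal (C * K) * ?J + ennreal (C * \<delta> * M) * X"
     using C(1) K(1) M(1) \<delta> by (simp add: distrib_left ennreal_mult mult.assoc)
    also have "C * \<delta> * M = 1 / 2" using C(1) M(1) by (simp add: \<delta>_def)
    finally have "X <= 2 * (ennreal (C * K) * ?J)"
     using fin by (rule ennreal_absorb)
    thus "(\<integral>x. epowr (\<Sum>k. epowr (trunc N k (Uop D e G k) x) Q) (P / Q)) <= ennreal (2 * (C * K)) * (\<integral>x. epowr (?S x) (P / Q))"
     using C(1) K(1) unfolding X_def V_def s_def by (simp add: ennreal_mult mult.assoc)
   qed (use PQ in auto)
  qed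
 qed
 qed
qed

lemma suminf_Hoelder:
 assumes "p > 1" "q > 1" "1 / p + 1 / q = 1"
 shows "(\<Sum>j. f j * g j) <= 2 * (epowr (\<Sum>j. epowr (f j) p) (1 / p) * epowr (\<Sum>j. epowr (g j) q) (1 / q))"
 using nn_integral_Hoelder[OF assms, of f "count_space UNIV" g] by (simp add: nn_integral_count_space_nat)

text \<open>For P < Q the conjugate exponents satisfy P' >= Q', and the operator is its own
  transpose, so the previous case applies to an extremal dual sequence.\<close>

lemma Uop_vector:
 assumes D: "D > DIM('a::euclidean_space)" and PQ: "Q > 1" "P > 1" and e: "e > 0"
 obtains C where "C > 0" "!!(G :: nat => 'a => ennreal). (!!j. G j \<in> Borel) ==>
  (\<integral>x. epowr (\<Sum>k. epowr (Uop D e G k x) Q) (P / Q)) <= ennreal C * (\<integral>x. epowr (\<Sum>j. epowr (G j x) Q) (P / Q))"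
proof (cases "P >= Q")
 case True
 show ?thesis using Uop_vector_ge[OF D PQ(1) True e] that by blast
next
 case False
 define P' where "P' = P / (P - 1)" define Q' where "Q' = Q / (Q - 1)"
 have PQ': "Q' > 1" "P' >= Q'" "P' > 1" "1 / P + 1 / P' = 1" "1 / Q + 1 / Q' = 1"
  using PQ False by (auto simp: P'_def Q'_def field_simps)
 show ?thesis
 proof (rule Uop_vector_ge[OF D PQ'(1,2) e], goal_cases)
 case C: (1 C)
 \<comment> \<open>With the factor 2 of \<open>suminf_Hoelder\<close> the absorbed coefficient
   becomes \<open>2 * \<delta> * C\<close>, that is 1/2.\<close>
 define \<delta> where "\<delta> = 1 / (4 * C)"
 have \<delta>: "\<delta> > 0" using C(1) by (simp add: \<delta>_def)
 obtain K where K: "K > 0" "!!a b. a * b <= ennreal K * epowr a P + ennreal \<delta> * epowr b P'"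
  using Young_ennreal_eps[OF PQ(2) PQ'(3,4) \<delta>] by blast
 show ?thesis
 proof (rule that[of "4 * K"])
  show "4 * K > 0" using K by simp
  fix G :: "nat => 'a => ennreal" assume G[measurable]: "!!j. G j \<in> Borel"
  let ?S = "%x. \<Sum>j. epowr (G j x) Q"
  let ?J = "(\<integral>x. epowr (?S x) (P / Q))"
  show "(\<integral>x. epowr (\<Sum>k. epowr (Uop D e G k x) Q) (P / Q)) <= ennreal (4 * K) * ?J"
  proof (rule trunc_limit)
   fix N
   define V where "V = (%x. \<Sum>k. epowr (trunc N k (Uop D e G k) x) Q)"
   have [measurable]: "V \<in> Borel" unfolding V_def by measurable
   \<comment> \<open>The exponent is negative here. Since 0 raised to any exponent by
     \<open>powr\<close> is 0, \<open>h\<close> vanishes where \<open>V\<close> does, and the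
     truncation keeps \<open>V\<close> finite.\<close>
   define h where "h = (%x. ennreal (enn2real (V x) powr ((P - Q) / Q)))"
   have [measurable]: "h \<in> Borel" unfolding h_def by measurable
   define g where "g = (%k x. epowr (trunc N k (Uop D e G k) x) (Q - 1) * h x)"
   have [measurable]: "g k \<in> Borel" for k unfolding g_def by measurable
   define X where "X = (\<integral>x. epowr (V x) (P / Q))"
   have fin: "X < top" unfolding X_def V_def by (rule nn_integral_trunc_finite) (use PQ in auto)
   have Vfin: "V x < top" for x unfolding V_def by (rule suminf_trunc_finite) (use PQ in auto)
   \<comment> \<open>The sequence \<open>g\<close> is extremal: its pairing with the truncated
     sequence and its dual mixed norm have the same integrand.\<close>
   have 1: "(\<Sum>k. trunc N k (Uop D e G k) x * g k x) = epowr (V x) (P / Q)" for x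
   proof -
    have "(\<Sum>k. trunc N k (Uop D e G k) x * g k x) = (\<Sum>k. epowr (trunc N k (Uop D e G k) x) Q * h x)"
     unfolding g_def using epowr_add[of 1 "Q - 1"] PQ by (simp add: mult.assoc)
    also have "... = V x * h x" unfolding V_def by simp
    also have "... = epowr (V x) (P / Q)"
    proof (cases "V x")
     case (real v)
     have "v * v powr ((P - Q) / Q) = v powr (P / Q)"
     proof (cases "v = 0")
      case False
      have "1 + (P - Q) / Q = P / Q" using PQ by (simp add: field_simps)
      thus ?thesis using powr_add[of v 1 "(P - Q) / Q"] False real by simp
     qed simp
     thus ?thesis using real by (simp add: h_def epowr_ennreal flip: ennreal_mult)
    qed (use Vfin[of x] in simp)
    finally show ?thesis .
   qed
   have 2: "epowr (\<Sum>k. epowr (g k x) Q') (P' / Q') = epowr (V x) (P / Q)" for x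
   proof -
    have "(\<Sum>k. epowr (g k x) Q') = (\<Sum>k. epowr (trunc N k (Uop D e G k) x) Q * epowr (h x) Q')"
    proof -
     have "(Q - 1) * Q' = Q" using PQ by (simp add: Q'_def)
     thus ?thesis unfolding g_def using PQ PQ' by (simp add: epowr_mult epowr_epowr)
    qed
    also have "... = V x * epowr (h x) Q'" unfolding V_def by simp
    also have "epowr ... (P' / Q') = epowr (V x) (P / Q)"
    proof (cases "V x")
     case (real v)
     show ?thesis
     proof (cases "v = 0")
      case False
      hence v: "v > 0" using real by simp
      have "(1 + (P - Q) / Q * Q') * (P' / Q') = P / Q"
      proof -
       have "1 + (P - Q) / Q * Q' = (P - 1) / (Q - 1)" using PQ by (simp add: Q'_def field_simps)
       moreover have "P' / Q' = P / Q * ((Q - 1) / (P - 1))" using PQ by (simp add: P'_def Q'_def)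
       ultimately show ?thesis using PQ by simp
      qed
      hence "(v * (v powr ((P - Q) / Q)) powr Q') powr (P' / Q') = v powr (P / Q)"
       using v powr_add[of v 1 "(P - Q) / Q * Q'"] powr_powr[of v "1 + (P - Q) / Q * Q'" "P' / Q'"] by (simp add: powr_powr)
      thus ?thesis using real v by (simp add: h_def epowr_ennreal flip: ennreal_mult)
     qed (use real in simp)
    qed (use Vfin[of x] in simp)
    finally show ?thesis .
   qed
   have "X = (\<integral>x. (\<Sum>k. trunc N k (Uop D e G k) x * g k x))" unfolding X_def 1 ..
   also have "... <= (\<integral>x. (\<Sum>k. Uop D e G k x * g k x))"
    by (intro nn_integral_mono suminf_le summableI mult_right_mono trunc_le) auto
   also have "... = (\<integral>x. (\<Sum>j. G j x * Uop D e g j x))" by (rule Uop_dual) auto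
   also have "... <= (\<integral>x. 2 * (ennreal K * epowr (?S x) (P / Q) + ennreal \<delta> * epowr (\<Sum>j. epowr (Uop D e g j x) Q') (P' / Q')))"
   proof (rule nn_integral_mono)
    fix x
    have "(\<Sum>j. G j x * Uop D e g j x) <= 2 * (epowr (?S x) (1 / Q) * epowr (\<Sum>j. epowr (Uop D e g j x) Q') (1 / Q'))"
     by (rule suminf_Hoelder) (use PQ PQ' in auto)
    also have "... <= 2 * (ennreal K * epowr (epowr (?S x) (1 / Q)) P + ennreal \<delta> * epowr (epowr (\<Sum>j. epowr (Uop D e g j x) Q') (1 / Q')) P')"
     by (intro mult_left_mono K(2)) auto
    finally show "(\<Sum>j. G j x * Uop D e g j x) <= 2 * (ennreal K * epowr (?S x) (P / Q) + ennreal \<delta> * epowr (\<Sum>j. epowr (Uop D e g j x) Q') (P' / Q'))"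
     using PQ PQ' by (simp add: epowr_epowr)
   qed
   also have "... = 2 * (ennreal K * ?J + ennreal \<delta> * (\<integral>x. epowr (\<Sum>j. epowr (Uop D e g j x) Q') (P' / Q')))"
    by (simp add: nn_integral_add nn_integral_cmult)
   also have "... <= 2 * (ennreal K * ?J + ennreal \<delta> * (ennreal C * (\<integral>x. epowr (\<Sum>j. epowr (g j x) Q') (P' / Q'))))"
    by (intro mult_left_mono add_left_mono C(2)) auto
   also have "(\<integral>x. epowr (\<Sum>j. epowr (g j x) Q') (P' / Q')) = X" unfolding 2 X_def ..
   also have "2 * (ennreal K * ?J + ennreal \<delta> * (ennreal C * X))
     = ennreal (2 * K) * ?J + ennreal (2 * \<delta> * C) * X"
    using C(1) K(1) \<delta> by (simp add: distrib_left ennreal_mult mult.assoc)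
   also have "2 * \<delta> * C = 1 / 2" using C(1) by (simp add: \<delta>_def)
   finally have "X <= 2 * (ennreal (2 * K) * ?J)"
    using fin by (rule ennreal_absorb)
   also have "... = ennreal (4 * K) * ?J"
   proof -
    have "ennreal (4 * K) = 2 * ennreal (2 * K)" using K(1) ennreal_mult[of 2 "2 * K"] by simp
    thus ?thesis by (simp add: mult.assoc)
   qed
   finally show "(\<integral>x. epowr (\<Sum>k. epowr (trunc N k (Uop D e G k) x) Q) (P / Q)) <= ennreal (4 * K) * ?J"
    unfolding X_def V_def .
  qed (use PQ in auto)
 qed
 qed
qed

section \<open>Dyadic cubes and kernel averages\<close>

lemma dyadic_cube_box: 
 "box (\<chi> i. 2 powr (- real k) * of_int (z i)) (\<chi> i. 2 powr (- real k) * (of_int (z i) + 1)) \<subseteq> dyadic_cube k z"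
 "dyadic_cube k z \<subseteq> cbox (\<chi> i. 2 powr (- real k) * of_int (z i)) (\<chi> i. 2 powr (- real k) * (of_int (z i) + 1))"
 by (auto simp: dyadic_cube_def mem_box_cart less_imp_le)

lemma dyadic_cube_measurable [measurable]: "dyadic_cube k z \<in> sets borel"
proof -
 have "dyadic_cube k z = (\<Inter>i. {x. 2 powr (- real k) * of_int (z i) <= x $ i} \<inter> {x. x $ i < 2 powr (- real k) * (of_int (z i) + 1)})"
  by (auto simp: dyadic_cube_def)
 also have "... \<in> sets borel"
  by (intro sets.countable_INT'' sets.Int borel_closed borel_open closed_Collect_le open_Collect_less continuous_intros) auto
 finally show ?thesis .
qed

lemma emeasure_dyadic_cube: "emeasure lborel (dyadic_cube k z :: (real^'n::finite) set) = ennreal ((1 / 2 ^ k) ^ CARD('n))"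
proof -
 let ?a = "\<chi> i. 2 powr (- real k) * of_int (z i) :: real^'n" let ?b = "\<chi> i. 2 powr (- real k) * (of_int (z i) + 1) :: real^'n"
 have le: "!!b. b \<in> Basis ==> ?a \<bullet> b <= ?b \<bullet> b" by (auto simp: Basis_vec_def inner_axis)
 have d: "(?b - ?a) \<bullet> b = 1 / 2 ^ k" if "b \<in> Basis" for b
  using that by (auto simp: Basis_vec_def inner_axis algebra_simps powr_minus powr_realpow divide_inverse)
 have "(\<Prod>b\<in>Basis. (?b - ?a) \<bullet> b) = (\<Prod>b\<in>(Basis::(real^'n) set). 1 / 2 ^ k)"
  by (rule prod.cong) (use d in auto)
 also have "... = (1 / 2 ^ k) ^ CARD('n)" by simp
 finally have "emeasure lborel (box ?a ?b) = ennreal ((1 / 2 ^ k) ^ CARD('n))" "emeasure lborel (cbox ?a ?b) = ennreal ((1 / 2 ^ k) ^ CARD('n))"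
  using le by (simp_all add: emeasure_lborel_box_eq emeasure_lborel_cbox_eq)
 moreover have "emeasure lborel (box ?a ?b) <= emeasure lborel (dyadic_cube k z)"
  by (rule emeasure_mono[OF dyadic_cube_box(1)]) simp
 moreover have "emeasure lborel (dyadic_cube k z) <= emeasure lborel (cbox ?a ?b)"
  by (rule emeasure_mono[OF dyadic_cube_box(2)]) simp
 ultimately show ?thesis by (metis antisym)
qed

text \<open>In each coordinate a ball of radius 2^k side lengths meets at most 2 * 2^k + 1 dyadic
  intervals, and this is at most 2^(k+2).\<close>

lemma cball_dyadic_cover:
 fixes x :: "real^'n::finite" and h :: "real^'n => ennreal"
 assumes [measurable]: "h \<in> Borel"
  and B: "!!z. (\<integral>\<^sup>+y\<in>dyadic_cube i z. h y \<partial>lborel) <= B"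
 shows "(\<integral>y. h y * indicator (cball x (2 ^ k / 2 ^ i)) y) <= 2 ^ ((k + 2) * CARD('n)) * B"
proof -
 define Z where "Z = (\<Pi>\<^sub>E l\<in>(UNIV::'n set). {\<lfloor>2 ^ i * x $ l - 2 ^ k\<rfloor> .. \<lfloor>2 ^ i * x $ l + 2 ^ k\<rfloor>})"
 have fin: "finite Z" unfolding Z_def by (rule finite_PiE) auto
 have "card Z <= (\<Prod>l\<in>(UNIV::'n set). 2 ^ (k + 2))"
  unfolding Z_def
 proof (subst card_PiE, simp, rule prod_mono, safe)
  fix l
  have "\<lfloor>2 ^ i * x $ l + 2 ^ k\<rfloor> <= \<lfloor>2 ^ i * x $ l - 2 ^ k\<rfloor> + 2 * 2 ^ k"
  proof -
   have "2 ^ i * x $ l + 2 ^ k = (2 ^ i * x $ l - 2 ^ k) + of_int (2 * 2 ^ k)" by simp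
   thus ?thesis by (metis floor_add_int order_refl)
  qed
  moreover have "2 * 2 ^ k + 1 <= (2::int) ^ (k + 2)"
  proof -
   have "(2::int) ^ (k + 2) = 4 * 2 ^ k" by (simp add: power_add)
   moreover have "(1::int) <= 2 ^ k" by (rule one_le_power) simp
   ultimately show ?thesis by linarith
  qed
  ultimately show "card {\<lfloor>2 ^ i * x $ l - 2 ^ k\<rfloor> .. \<lfloor>2 ^ i * x $ l + 2 ^ k\<rfloor>} <= 2 ^ (k + 2)"
   by (simp add: nat_le_iff)
 qed
 also have "... = 2 ^ ((k + 2) * CARD('n))" by (simp only: power_mult prod_constant)
 finally have card: "card Z <= 2 ^ ((k + 2) * CARD('n))" .
 have "(\<integral>y. h y * indicator (cball x (2 ^ k / 2 ^ i)) y) <= (\<integral>y. (\<Sum>z\<in>Z. h y * indicator (dyadic_cube i z) y))"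
 proof (rule nn_integral_mono)
  fix y
  show "h y * indicator (cball x (2 ^ k / 2 ^ i)) y <= (\<Sum>z\<in>Z. h y * indicator (dyadic_cube i z) y)"
  proof (cases "y \<in> cball x (2 ^ k / 2 ^ i)")
   case True
   define z where "z = (%l. \<lfloor>2 ^ i * y $ l\<rfloor>)"
   have "\<bar>x $ l - y $ l\<bar> <= 2 ^ k / 2 ^ i" for l
    using True component_le_norm_cart[of "x - y" l] by (simp add: dist_norm)
   hence "2 ^ i * \<bar>x $ l - y $ l\<bar> <= 2 ^ k" for l
    by (simp add: field_simps)
   moreover have "2 ^ i * \<bar>x $ l - y $ l\<bar> = \<bar>2 ^ i * x $ l - 2 ^ i * y $ l\<bar>" for l
    by (simp add: abs_mult flip: right_diff_distrib)
   ultimately have a: "\<bar>2 ^ i * x $ l - 2 ^ i * y $ l\<bar> <= 2 ^ k" for l by simp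
   have le: "2 ^ i * x $ l - 2 ^ k <= 2 ^ i * y $ l" "2 ^ i * y $ l <= 2 ^ i * x $ l + 2 ^ k" for l
    using a[of l] by linarith+
   have "\<lfloor>2 ^ i * x $ l - 2 ^ k\<rfloor> <= z l" "z l <= \<lfloor>2 ^ i * x $ l + 2 ^ k\<rfloor>" for l
    unfolding z_def by (intro floor_mono le)+
   hence z: "z \<in> Z" unfolding Z_def PiE_UNIV_domain Pi_iff atLeastAtMost_iff by blast
   have "y \<in> dyadic_cube i z"
    unfolding dyadic_cube_def z_def
   proof (safe)
    fix l
    have *: "2 powr - real i = 1 / 2 ^ i" by (simp add: powr_minus powr_realpow divide_inverse)
    have "of_int \<lfloor>2 ^ i * y $ l\<rfloor> <= 2 ^ i * y $ l" by simp
    thus "2 powr - real i * of_int \<lfloor>2 ^ i * y $ l\<rfloor> <= y $ l" unfolding * by (simp add: field_simps)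
    have "2 ^ i * y $ l < of_int \<lfloor>2 ^ i * y $ l\<rfloor> + 1" by linarith
    thus "y $ l < 2 powr - real i * (of_int \<lfloor>2 ^ i * y $ l\<rfloor> + 1)" unfolding * by (simp add: field_simps)
   qed
   hence "h y * indicator (cball x (2 ^ k / 2 ^ i)) y = h y * indicator (dyadic_cube i z) y" using True by simp
   also have "... <= (\<Sum>z\<in>Z. h y * indicator (dyadic_cube i z) y)"
    by (rule member_le_sum[OF z]) (use fin in auto)
   finally show ?thesis .
  qed simp
 qed
 also have "... = (\<Sum>z\<in>Z. \<integral>\<^sup>+y\<in>dyadic_cube i z. h y \<partial>lborel)"
  by (subst nn_integral_sum) auto
 also have "... <= (\<Sum>z\<in>Z. B)" by (intro sum_mono B)
 also have "... = of_nat (card Z) * B" by simp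
 also have "... <= of_nat (2 ^ ((k + 2) * CARD('n))) * B"
  by (intro mult_right_mono) (use card of_nat_mono in blast, simp)
 finally show ?thesis by simp
qed

text \<open>For p infinite only averages over cubes are available. The ball of radius 2^k / 2^i
  needs 2^((k+2) n) cubes of side 2^-i, and D > n lets the kernel tail 2^(-k D) outweigh
  them.\<close>

lemma kavg_dyadic:
 assumes D: "D > CARD('n::finite)"
 obtains C where "C > 0" "!!(h :: real^'n => ennreal) i B x. h \<in> Borel ==>
   (!!z. (\<integral>\<^sup>+y\<in>dyadic_cube i z. h y \<partial>lborel) <= B * ennreal ((1 / 2 ^ i) ^ CARD('n))) ==> kavg D i h x <= ennreal C * B"
proof
 let ?C = "2 ^ D * 2 ^ (2 * CARD('n)) * 2 :: real"
 show "?C > 0" by simp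
 fix h :: "real^'n => ennreal" and i B and x :: "real^'n"
 assume [measurable]: "h \<in> Borel"
  and B: "!!z. (\<integral>\<^sup>+y\<in>dyadic_cube i z. h y \<partial>lborel) <= B * ennreal ((1 / 2 ^ i) ^ CARD('n))"
 let ?d = "CARD('n)"
 let ?h = "%k. \<integral>y. h y * indicator (cball x (2 ^ k / 2 ^ i)) y"
 let ?w = "%k. 2 ^ (i * ?d) * 2 ^ D / 2 ^ (k * D) :: real"
 have [measurable]: "cball x r \<in> sets borel" for r by simp
 have "kavg D i h x <= (\<integral>y. (\<Sum>k. ennreal (?w k) * indicator (cball 0 (2 ^ k / 2 ^ i)) (x - y)) * h y)"
  unfolding kavg_def using ker_dyadic_bound[of D i "x - _"] by (intro nn_integral_mono mult_right_mono) auto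
 also have "... = (\<integral>y. (\<Sum>k. ennreal (?w k) * (h y * indicator (cball x (2 ^ k / 2 ^ i)) y)))"
  by (simp only: ennreal_suminf_multc[symmetric])
    (auto intro!: nn_integral_cong suminf_cong simp: indicator_def dist_norm norm_minus_commute simp del: ennreal_suminf_multc)
 also have "... = (\<Sum>k. ennreal (?w k) * ?h k)"
  by (subst nn_integral_suminf) (auto simp: nn_integral_cmult)
 also have "... <= (\<Sum>k. ennreal (2 ^ D * 2 ^ (2 * ?d) * (1 / 2) ^ k) * B)"
 proof (intro suminf_le summableI)
  fix k
  have "ennreal (?w k) * ?h k
   <= ennreal (?w k) * (2 ^ ((k + 2) * ?d) * (B * ennreal ((1 / 2 ^ i) ^ ?d)))"
   by (intro mult_left_mono cball_dyadic_cover B) auto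
  also have "... = (ennreal (?w k) * ennreal (2 ^ ((k + 2) * ?d)) * ennreal ((1 / 2 ^ i) ^ ?d)) * B"
   by (simp add: mult_ac ennreal_power flip: ennreal_numeral)
  also have "... = ennreal (2 ^ (i * ?d) * 2 ^ D / 2 ^ (k * D) * 2 ^ ((k + 2) * ?d) * (1 / 2 ^ i) ^ ?d) * B"
  proof -
   have "ennreal a * ennreal b * ennreal c = ennreal (a * b * c)" if "a >= 0" "b >= 0" for a b c :: real
    using that by (simp add: ennreal_mult')
   note e = this
   show ?thesis by (rule arg_cong[of _ _ "%u. u * B"], rule e) simp_all
  qed
  also have "2 ^ (i * ?d) * 2 ^ D / 2 ^ (k * D) * 2 ^ ((k + 2) * ?d) * (1 / 2 ^ i) ^ ?d = (2::real) ^ D * 2 ^ (2 * ?d) * (2 ^ (k * ?d) / 2 ^ (k * D))"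
  proof -
   have "(1 / 2 ^ i) ^ ?d = 1 / (2::real) ^ (i * ?d)" by (simp add: power_one_over power_mult)
   moreover have "(2::real) ^ ((k + 2) * ?d) = 2 ^ (k * ?d) * 2 ^ (2 * ?d)" by (simp only: add_mult_distrib power_add)
   ultimately show ?thesis by simp
  qed
  also have "ennreal ... <= ennreal (2 ^ D * 2 ^ (2 * ?d) * (1 / 2) ^ k)"
  proof -
   have "k * (?d + 1) <= k * D" using D by (intro mult_le_mono2) simp
   hence "(2::real) ^ (k * ?d + k) <= 2 ^ (k * D)" by (intro power_increasing) auto
   hence "2 ^ (k * ?d) / 2 ^ (k * D) <= (1 / 2 :: real) ^ k"
    by (simp add: power_add power_divide field_simps)
   thus ?thesis by (intro ennreal_leI mult_left_mono) auto
  qed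
  finally show "ennreal (?w k) * ?h k
    <= ennreal (2 ^ D * 2 ^ (2 * ?d) * (1 / 2) ^ k) * B"
   by (simp add: mult_right_mono)
 qed
 also have "... = (\<Sum>k. ennreal (2 ^ D * 2 ^ (2 * ?d) * (1 / 2) ^ k)) * B" by simp
 also have "(\<Sum>k. ennreal (2 ^ D * 2 ^ (2 * ?d) * (1 / 2) ^ k)) = ennreal ?C"
  by (intro suminf_ennreal_eq sums_mult) (use geometric_sums[of "1/2::real"] in auto)
 finally show "kavg D i h x <= ennreal ?C * B" .
qed

section \<open>Sequence-space quasi-norms and the averaging operator on them\<close>

text \<open>Models \<open>F_norm\<close> on sequences of nonnegative functions that already contain
  the factors 2^(js) and w. The separate low-frequency term of the case p = infinity > q is left out
  and is treated at the end.\<close>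

definition tl_norm :: "ennreal => ennreal => (nat => real^'n::finite => ennreal) => ennreal" where
 "tl_norm p q a =
  (let p' = enn2real p; q' = enn2real q in
   if p < \<infinity> \<and> q < \<infinity> then epowr (\<integral>x. epowr (\<Sum>j. epowr (a j x) q') (p' / q')) (1 / p')
   else if p < \<infinity> then epowr (\<integral>x. epowr (SUP j. a j x) p') (1 / p')
   else if q < \<infinity> then
    (SUP (k, z). epowr ((\<integral>\<^sup>+x\<in>dyadic_cube k z. (\<Sum>j. epowr (a (k + j) x) q') \<partial>lborel) / emeasure lborel (dyadic_cube k z)) (1 / q'))
   else (SUP j. esssup lborel (a j)))"

lemma tl_norm_cube:
 fixes a :: "nat => real^'n::finite => ennreal"
 assumes "q < \<infinity>" "q > 0"
 shows "(\<integral>\<^sup>+x\<in>dyadic_cube k z. (\<Sum>j. epowr (a (k + j) x) (enn2real q)) \<partial>lborel) <= epowr (tl_norm \<infinity> q a) (enn2real q) * ennreal ((1 / 2 ^ k) ^ CARD('n))"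
proof -
 have q: "enn2real q > 0" using assms by (simp add: enn2real_positive_iff)
 have "epowr ((\<integral>\<^sup>+x\<in>dyadic_cube k z. (\<Sum>j. epowr (a (k + j) x) (enn2real q)) \<partial>lborel) / emeasure lborel (dyadic_cube k z)) (1 / enn2real q) <= tl_norm \<infinity> q a"
  unfolding tl_norm_def Let_def using assms by (auto intro: SUP_upper2[of "(k, z)"])
 hence "(\<integral>\<^sup>+x\<in>dyadic_cube k z. (\<Sum>j. epowr (a (k + j) x) (enn2real q)) \<partial>lborel) / emeasure lborel (dyadic_cube k z) <= epowr (tl_norm \<infinity> q a) (enn2real q)"
  using q epowr_le_iff[of "1 / enn2real q"] by simp
 thus ?thesis
  by (subst (asm) ennreal_le_divide_iff) (simp_all add: emeasure_dyadic_cube)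
qed

lemma suminf_member_le: "f j <= (\<Sum>i. f i :: ennreal)"
 using sum_le_suminf[OF summableI, of "{j}" f] by simp

text \<open>For finite q, Jensen leaves averages of a_j^q at the scale min j k. As j >= min j k,
  this function is one of the terms of the Carleson sum over cubes of side 2^-(min j k). For
  infinite q a uniform bound is averaged.\<close>

lemma Uop_linfty:
 assumes D: "D > CARD('n::finite)" and e: "e > 0" and q: "q > 0" and t: "0 < t" "ennreal t <= q"
 obtains C where "C > 0" "!!(a :: nat => real^'n => ennreal) k x. (!!j. a j \<in> Borel) ==>
  Uop D e (%j x. epowr (a j x) t) k x <= ennreal C * epowr (tl_norm \<infinity> q a) t"
proof (cases "q < \<infinity>")
 case True
 define Q where "Q = enn2real q / t"
 have qr: "enn2real q > 0" "q = ennreal (enn2real q)" using True q by (simp_all add: enn2real_positive_iff)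
 have tq: "t <= enn2real q" using t qr by (metis ennreal_le_iff less_imp_le)
 have Q: "Q >= 1" "t * Q = enn2real q" "Q > 0" using t tq by (auto simp: Q_def)
 have D': "D > DIM(real^'n)" using D by simp
 show ?thesis
 proof (rule Uop_power[where 'a="real^'n", OF D' Q(1) e], goal_cases)
 case C: (1 C)
 show thesis
 proof (rule kavg_dyadic[OF D], goal_cases)
 case C1: (1 C1)
 let ?K = "C * geo_const e * C1"
 have K: "?K > 0" using C(1) C1(1) geo_const_pos[OF e] by simp
 show ?thesis
 proof (rule that[of "?K powr (1 / Q)"])
  show "?K powr (1 / Q) > 0" using K by (simp only: powr_gt_zero)
  fix a :: "nat => real^'n => ennreal" and k x
  assume [measurable]: "!!j. a j \<in> Borel"
  let ?W = "tl_norm \<infinity> q a"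
  let ?U = "Uop D e (%j x. epowr (a j x) t) k x"
  let ?Z = "epowr ?W (enn2real q)"
  have "epowr ?U Q <= ennreal C * Uop D e (%j y. epowr (epowr (a j y) t) Q) k x"
   by (rule C(2)) simp
  also have "Uop D e (%j y. epowr (epowr (a j y) t) Q) k x <= (\<Sum>j. geo e k j * (ennreal C1 * ?Z))"
   unfolding Uop_def epowr_epowr[OF t(1) Q(3)] Q(2)
  proof (intro suminf_le summableI mult_left_mono C1(2))
   fix j z
   have "(\<integral>\<^sup>+y\<in>dyadic_cube (min j k) z. epowr (a j y) (enn2real q) \<partial>lborel) <= (\<integral>\<^sup>+x\<in>dyadic_cube (min j k) z. (\<Sum>l. epowr (a (min j k + l) x) (enn2real q)) \<partial>lborel)"
    using suminf_member_le[of "%l. epowr (a (min j k + l) _) (enn2real q)" "j - min j k"]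
    by (intro nn_integral_mono mult_right_mono) auto
   also have "... <= ?Z * ennreal ((1 / 2 ^ min j k) ^ CARD('n))"
    by (rule tl_norm_cube[OF True q])
   finally show "(\<integral>\<^sup>+y\<in>dyadic_cube (min j k) z. epowr (a j y) (enn2real q) \<partial>lborel) <= ?Z * ennreal ((1 / 2 ^ min j k) ^ CARD('n))" .
  qed auto
  also have "... = (\<Sum>j. geo e k j) * (ennreal C1 * ?Z)" by simp
  also have "... <= ennreal (geo_const e) * (ennreal C1 * ?Z)"
   by (intro mult_right_mono suminf_geo e) auto
  finally have "epowr ?U Q <= ennreal C * (ennreal (geo_const e) * (ennreal C1 * ?Z))"
   by (simp add: mult_left_mono)
  also have "... = ennreal ?K * ?Z"
   using C(1) C1(1) geo_const_pos[OF e] by (simp add: ennreal_mult mult.assoc)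
  finally have "?U <= epowr (ennreal ?K * ?Z) (1 / Q)"
   using Q by (simp add: epowr_le_iff)
  also have "... = ennreal (?K powr (1 / Q)) * epowr ?W t"
  proof -
   have "enn2real q * (1 / Q) = t" using Q(2,3) by (simp add: field_simps)
   thus ?thesis using Q K qr by (simp only: epowr_mult epowr_epowr epowr_ennreal less_imp_le zero_less_divide_1_iff)
  qed
  finally show "?U <= ennreal (?K powr (1 / Q)) * epowr ?W t" .
 qed
 qed
 qed
next
 case False
 let ?K = "geo_const e * ker_const TYPE(real^'n) D"
 have K: "?K > 0" using geo_const_pos[OF e] ker_const_pos[of "TYPE(real^'n)" D] by simp
 show ?thesis
 proof (rule that[OF K])
  fix a :: "nat => real^'n => ennreal" and k x
  assume [measurable]: "!!j. a j \<in> Borel"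
  let ?W = "tl_norm \<infinity> q a"
  have ae: "AE y in lborel. a j y <= ?W" for j
  proof -
   have "AE y in lborel. a j y <= esssup lborel (a j)" by (rule esssup_AE)
   moreover have "esssup lborel (a j) <= ?W" using False by (auto simp: tl_norm_def intro: SUP_upper)
   ultimately show ?thesis by (auto elim: eventually_mono)
  qed
  have "Uop D e (%j x. epowr (a j x) t) k x <= (\<Sum>j. geo e k j * (ennreal (ker_const TYPE(real^'n) D) * epowr ?W t))"
   unfolding Uop_def
  proof (intro suminf_le summableI mult_left_mono)
   fix j
   have "kavg D (min j k) (%x. epowr (a j x) t) x <= kavg D (min j k) (%_. epowr ?W t) x"
    unfolding kavg_def by (intro nn_integral_mono_AE) (use ae[of j] in \<open>auto elim!: eventually_mono intro!: mult_left_mono epowr_mono t\<close>)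
   also have "... <= ennreal (ker_const TYPE(real^'n) D) * epowr ?W t"
    by (rule kavg_const) (use D in simp)
   finally show "kavg D (min j k) (%x. epowr (a j x) t) x <= ennreal (ker_const TYPE(real^'n) D) * epowr ?W t" .
  qed auto
  also have "... = (\<Sum>j. geo e k j) * (ennreal (ker_const TYPE(real^'n) D) * epowr ?W t)" by simp
  also have "... <= ennreal (geo_const e) * (ennreal (ker_const TYPE(real^'n) D) * epowr ?W t)"
   by (intro mult_right_mono suminf_geo e) auto
  finally show "Uop D e (%j x. epowr (a j x) t) k x <= ennreal ?K * epowr ?W t"
   using geo_const_pos[OF e] ker_const_pos[of "TYPE(real^'n)" D] by (simp add: ennreal_mult mult.assoc)
 qed
qed

text \<open>Half of the decay is kept for integrability at the fine scale, the other half is traded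
  for decay at the coarser scale \<open>k\<close> around \<open>c\<close>. Applied to the points
  \<open>x\<close> of a cube of side 2^-k, it records the distance of \<open>y\<close> from that
  cube.\<close>

lemma ker_split:
 fixes x y c :: "'a::euclidean_space"
 assumes "k <= i" "2 ^ k * norm (c - x) <= b" "b >= 0"
 shows "ker (2 * D) i (y - x) <= ker D i (y - x) * ((1 + b) ^ D * (1 / 2 ^ (k * DIM('a))) * ker D k (c - y))"
proof -
 have 1: "1 + 2 ^ k * norm (c - y) <= (1 + b) * (1 + 2 ^ i * norm (y - x))"
 proof -
  have "norm (c - y) <= norm (c - x) + norm (y - x)"
   using norm_triangle_ineq4[of "c - x" "y - x"] by simp
  hence "2 ^ k * norm (c - y) <= 2 ^ k * norm (c - x) + 2 ^ k * norm (y - x)"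
   by (metis distrib_left mult_left_mono zero_le_power zero_le_numeral)
  also have "2 ^ k * norm (y - x) <= 2 ^ i * norm (y - x)"
   using assms(1) by (intro mult_right_mono power_increasing) auto
  finally have "1 + 2 ^ k * norm (c - y) <= 1 + b + 2 ^ i * norm (y - x)" using assms(2) by linarith
  also have "... <= (1 + b) * (1 + 2 ^ i * norm (y - x))" using assms(3) by (simp add: algebra_simps)
  finally show ?thesis .
 qed
 have pos: "1 + 2 ^ k * norm (c - y) > 0" "1 + 2 ^ i * norm (y - x) > 0" by (auto intro!: add_pos_nonneg)
 have "(1 + 2 ^ k * norm (c - y)) ^ D <= (1 + b) ^ D * (1 + 2 ^ i * norm (y - x)) ^ D"
  unfolding power_mult_distrib[symmetric] by (rule power_mono[OF 1]) (use pos in auto)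
 hence "1 / (1 + 2 ^ i * norm (y - x)) ^ D <= (1 + b) ^ D / (1 + 2 ^ k * norm (c - y)) ^ D"
  using pos by (simp add: divide_simps)
 hence "ker D i (y - x) * (1 / (1 + 2 ^ i * norm (y - x)) ^ D) <= ker D i (y - x) * ((1 + b) ^ D / (1 + 2 ^ k * norm (c - y)) ^ D)"
  by (rule mult_left_mono) simp
 moreover have "ker (2 * D) i (y - x) = ker D i (y - x) * (1 / (1 + 2 ^ i * norm (y - x)) ^ D)"
  by (simp add: ker_def mult_2 power_add)
 moreover have "(1 + b) ^ D / (1 + 2 ^ k * norm (c - y)) ^ D = (1 + b) ^ D * (1 / 2 ^ (k * DIM('a))) * ker D k (c - y)"
  by (simp add: ker_def)
 ultimately show ?thesis by simp
qed

lemma suminf_geo_shift: "e > 0 ==> (\<Sum>l. geo e (k + l) j) <= ennreal (geo_const e)"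
proof -
 assume e: "e > 0"
 have "(\<Sum>l. geo e (k + l) j) = (\<Sum>l. geo e j (l + k))" by (simp add: geo_sym[of e j] add.commute)
 also have "... <= (\<Sum>l. geo e j l)" by (subst (2) suminf_offset[OF summableI, of _ k]) (simp add: add_increasing2)
 also have "... <= ennreal (geo_const e)" by (rule suminf_geo[OF e])
 finally show ?thesis .
qed

lemma suminf_swap: "(\<Sum>i. \<Sum>j. f i j :: ennreal) = (\<Sum>j. \<Sum>i. f i j)"
 unfolding nn_integral_count_space_nat[symmetric]
 by (rule nn_integral_count_space_nn_integral) auto

lemma kavg_suminf:
 assumes [measurable]: "!!j. h j \<in> Borel"
 shows "(\<Sum>j. kavg D i (h j) x) = kavg D i (%y. \<Sum>j. h j y) x"
 unfolding kavg_def by (subst nn_integral_suminf[symmetric]) (auto intro!: nn_integral_cong)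

text \<open>The input frequencies are split at the scale k of the cube. Those below k are bounded
  pointwise by \<open>kavg_dyadic\<close>. For the others the average is moved to the indicator of
  the cube, whose averages decay like a kernel of scale k around the corner \<open>c\<close>; the
  Carleson condition at scale k then applies.\<close>

lemma Uop_carleson:
 assumes D: "D > CARD('n::finite)" and e: "e > 0" and q: "0 < q" "q < \<infinity>"
 obtains C where "C > 0" "!!(a :: nat => real^'n => ennreal) k z. (!!j. a j \<in> Borel) ==>
   (\<integral>\<^sup>+x\<in>dyadic_cube k z. (\<Sum>l. Uop (2 * D) e (%j x. epowr (a j x) (enn2real q)) (k + l) x) \<partial>lborel)
    <= ennreal C * (epowr (tl_norm \<infinity> q a) (enn2real q) * ennreal ((1 / 2 ^ k) ^ CARD('n)))"
proof -
 have D2: "2 * D > CARD('n)" using D by simp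
 show ?thesis
 proof (rule kavg_dyadic[OF D], goal_cases)
 case C1: (1 C1)
 show ?thesis
 proof (rule kavg_dyadic[OF D2], goal_cases)
 case C2: (1 C2)
 define g where "g = geo_const e"
 have g: "g > 0" unfolding g_def by (rule geo_const_pos[OF e])
 define K where "K = ker_const TYPE(real^'n) D * (1 + real CARD('n)) ^ D"
 have K: "K > 0" unfolding K_def using ker_const_pos[of "TYPE(real^'n)" D] by simp
 show ?thesis
 proof (rule that[of "g * g * C2 + g * K * C1"])
  show "g * g * C2 + g * K * C1 > 0" using g K C1(1) C2(1) by (intro add_pos_pos mult_pos_pos)
  fix a :: "nat => real^'n => ennreal" and k z
  assume [measurable]: "!!j. a j \<in> Borel"
  define H where "H = (%j x. epowr (a j x) (enn2real q))"
  have [measurable]: "H j \<in> Borel" for j unfolding H_def by measurable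
  define W where "W = epowr (tl_norm \<infinity> q a) (enn2real q)"
  let ?W = "(ennreal (g * C2) * W)"
  let ?K = "(K * (1 / 2 ^ k) ^ CARD('n))"
  define R where "R = (dyadic_cube k z :: (real^'n) set)"
  have [measurable]: "R \<in> sets borel" unfolding R_def by measurable
  have cube: "(\<integral>\<^sup>+x\<in>dyadic_cube i z. (\<Sum>j. H (i + j) x) \<partial>lborel) <= W * ennreal ((1 / 2 ^ i) ^ CARD('n))" for i z
   unfolding H_def W_def by (rule tl_norm_cube[OF q(2,1)])
  have low: "kavg (2 * D) j (H j) x <= ennreal C2 * W" for j x
  proof (rule C2(2))
   fix z
   have "(\<integral>\<^sup>+y\<in>dyadic_cube j z. H j y \<partial>lborel) <= (\<integral>\<^sup>+x\<in>dyadic_cube j z. (\<Sum>l. H (j + l) x) \<partial>lborel)"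
    using suminf_member_le[of "%l. H (j + l) _" 0] by (intro nn_integral_mono mult_right_mono) auto
   thus "(\<integral>\<^sup>+y\<in>dyadic_cube j z. H j y \<partial>lborel) <= W * ennreal ((1 / 2 ^ j) ^ CARD('n))"
    using cube[of j z] by (rule order_trans)
  qed auto
  \<comment> \<open>The corner of the cube. Every point of the cube is within n 2^-k of it, which
    supplies the \<open>b\<close> of \<open>ker_split\<close>.\<close>
  define c where "c = (\<chi> l. 2 powr (- real k) * of_int (z l) :: real^'n)"
  have p2: "2 powr - real k = 1 / 2 ^ k" by (simp add: powr_minus powr_realpow divide_inverse)
  have cR: "2 ^ k * norm (c - x) <= real CARD('n)" if "x \<in> R" for x
  proof -
   have "norm (c - x) <= (\<Sum>l\<in>UNIV. \<bar>(c - x) $ l\<bar>)" by (rule norm_le_l1_cart)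
   also have "... <= (\<Sum>l\<in>(UNIV::'n set). 1 / 2 ^ k)"
   proof (rule sum_mono)
    fix l
    have "2 powr - real k * of_int (z l) <= x $ l" "x $ l < 2 powr - real k * (of_int (z l) + 1)"
     using that unfolding R_def dyadic_cube_def by auto
    thus "\<bar>(c - x) $ l\<bar> <= 1 / 2 ^ k" unfolding c_def p2 by (simp add: distrib_left)
   qed
   finally show ?thesis by (simp add: field_simps)
  qed
  have ind: "kavg (2 * D) i (indicator R) y <= ennreal ?K * ennreal (ker D k (c - y))" if "k <= i" for i y
  proof -
   let ?b = "(1 + real CARD('n)) ^ D * (1 / 2 ^ (k * CARD('n))) * ker D k (c - y)"
   have "kavg (2 * D) i (indicator R) y <= (\<integral>x. ennreal (ker D i (y - x)) * ennreal ?b)"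
    unfolding kavg_def
   proof (rule nn_integral_mono)
    fix x
    show "ennreal (ker (2 * D) i (y - x)) * indicator R x <= ennreal (ker D i (y - x)) * ennreal ?b"
     using ker_split[OF that cR, of x D y] by (cases "x \<in> R") (auto simp flip: ennreal_mult intro!: ennreal_leI)
   qed
   also have "... = (\<integral>x. ennreal (ker D i (y - x))) * ennreal ?b"
    by (rule nn_integral_multc) simp
   also have "... <= ennreal (ker_const TYPE(real^'n) D) * ennreal ?b"
    using D by (intro mult_right_mono nn_integral_ker) auto
   also have "... = ennreal (ker_const TYPE(real^'n) D * ?b)"
    by (rule ennreal_mult'[symmetric]) (use ker_const_pos[of "TYPE(real^'n)" D] in simp)
   also have "ker_const TYPE(real^'n) D * ?b = ?K * ker D k (c - y)"
    by (simp add: K_def power_one_over power_mult)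
   also have "ennreal ... = ennreal ?K * ennreal (ker D k (c - y))"
    by (rule ennreal_mult') (use K in simp)
   finally show ?thesis .
  qed
  have high: "(\<integral>x. kavg (2 * D) i h x * indicator R x) <= ennreal ?K * kavg D k h c"
   if i: "k <= i" and [measurable]: "h \<in> Borel" for i and h :: "real^'n => ennreal"
  proof -
   have "(\<integral>x. kavg (2 * D) i h x * indicator R x) = (\<integral>y. h y * kavg (2 * D) i (indicator R) y)"
    by (rule kavg_sym) auto
   also have "... <= (\<integral>y. h y * (ennreal ?K * ennreal (ker D k (c - y))))"
    by (intro nn_integral_mono mult_left_mono ind i) auto
   also have "... = ennreal ?K * kavg D k h c"
    unfolding kavg_def by (subst nn_integral_cmult[symmetric]) (auto simp: mult_ac)
   finally show ?thesis .
  qed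
  have U: "Uop (2 * D) e H (k + l) x <= geo e (k + l) k * ?W + (\<Sum>j. geo e (k + l) (k + j) * kavg (2 * D) (k + min j l) (H (k + j)) x)" for l x
  proof -
   have "Uop (2 * D) e H (k + l) x = (\<Sum>j. geo e (k + l) (j + k) * kavg (2 * D) (min (j + k) (k + l)) (H (j + k)) x) + (\<Sum>j<k. geo e (k + l) j * kavg (2 * D) (min j (k + l)) (H j) x)"
    unfolding Uop_def by (rule suminf_offset[OF summableI])
   also have "(\<Sum>j. geo e (k + l) (j + k) * kavg (2 * D) (min (j + k) (k + l)) (H (j + k)) x) = (\<Sum>j. geo e (k + l) (k + j) * kavg (2 * D) (k + min j l) (H (k + j)) x)"
    by (simp add: add.commute[of k] min_add_distrib_left)
   also have "(\<Sum>j<k. geo e (k + l) j * kavg (2 * D) (min j (k + l)) (H j) x) <= (\<Sum>j<k. geo e (k + l) k * geo e k j * (ennreal C2 * W))"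
   proof (intro sum_mono mult_mono)
    \<comment> \<open>For j < k <= k + l the distances between the scales add up, so the weights
      multiply.\<close>
    fix j assume "j \<in> {..<k}"
    thus "geo e (k + l) j <= geo e (k + l) k * geo e k j"
     by (simp add: geo_def of_nat_diff algebra_simps flip: ennreal_mult powr_add)
    show "kavg (2 * D) (min j (k + l)) (H j) x <= ennreal C2 * W" using low[of j x] \<open>j \<in> {..<k}\<close> by (simp add: min_def)
   qed auto
   also have "... = geo e (k + l) k * ((\<Sum>j<k. geo e k j) * (ennreal C2 * W))"
    by (simp add: sum_distrib_left sum_distrib_right mult.assoc)
   also have "... <= geo e (k + l) k * (ennreal g * (ennreal C2 * W))"
    unfolding g_def by (intro mult_left_mono mult_right_mono order_trans[OF sum_le_suminf suminf_geo] e summableI) auto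
   finally show ?thesis using g C2(1) by (simp add: add.commute ennreal_mult mult.assoc add_mono)
  qed
  have "(\<integral>\<^sup>+x\<in>R. (\<Sum>l. Uop (2 * D) e H (k + l) x) \<partial>lborel)
   <= (\<integral>x. (\<Sum>l. geo e (k + l) k) * ?W * indicator R x + (\<Sum>l. \<Sum>j. geo e (k + l) (k + j) * (kavg (2 * D) (k + min j l) (H (k + j)) x * indicator R x)))"
  proof (rule nn_integral_mono)
   fix x
   have "(\<Sum>l. Uop (2 * D) e H (k + l) x) <= (\<Sum>l. geo e (k + l) k * ?W + (\<Sum>j. geo e (k + l) (k + j) * kavg (2 * D) (k + min j l) (H (k + j)) x))"
    by (intro suminf_le summableI U)
   also have "... = (\<Sum>l. geo e (k + l) k) * ?W + (\<Sum>l. \<Sum>j. geo e (k + l) (k + j) * kavg (2 * D) (k + min j l) (H (k + j)) x)"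
    by (subst suminf_add[OF summableI summableI, symmetric]) simp
   finally show "(\<Sum>l. Uop (2 * D) e H (k + l) x) * indicator R x <= (\<Sum>l. geo e (k + l) k) * ?W * indicator R x + (\<Sum>l. \<Sum>j. geo e (k + l) (k + j) * (kavg (2 * D) (k + min j l) (H (k + j)) x * indicator R x))"
    by (auto simp: indicator_def)
  qed
  also have "... = (\<Sum>l. geo e (k + l) k) * ?W * emeasure lborel R + (\<Sum>l. \<Sum>j. geo e (k + l) (k + j) * (\<integral>x. kavg (2 * D) (k + min j l) (H (k + j)) x * indicator R x))"
   by (subst nn_integral_add) (auto simp: nn_integral_cmult_indicator nn_integral_suminf nn_integral_cmult)
  also have "... <= ennreal g * ?W * emeasure lborel R + (\<Sum>l. \<Sum>j. geo e (k + l) (k + j) * (ennreal ?K * kavg D k (H (k + j)) c))"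
   unfolding g_def by (intro add_mono mult_right_mono suminf_geo_shift e suminf_le summableI mult_left_mono high) auto
  also have "(\<Sum>l. \<Sum>j. geo e (k + l) (k + j) * (ennreal ?K * kavg D k (H (k + j)) c))
    = (\<Sum>j. (\<Sum>l. geo e (k + l) (k + j)) * (ennreal ?K * kavg D k (H (k + j)) c))"
   by (subst suminf_swap) simp
  also have "... <= (\<Sum>j. ennreal g * (ennreal ?K * kavg D k (H (k + j)) c))"
   unfolding g_def by (intro suminf_le summableI mult_right_mono suminf_geo_shift e) auto
  also have "... = ennreal g * (ennreal ?K * kavg D k (%y. \<Sum>j. H (k + j) y) c)"
   by (simp add: kavg_suminf)
  also have "kavg D k (%y. \<Sum>j. H (k + j) y) c <= ennreal C1 * W"
   by (rule C1(2)) (auto intro: cube)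
  finally have "(\<integral>\<^sup>+x\<in>R. (\<Sum>l. Uop (2 * D) e H (k + l) x) \<partial>lborel) <= ennreal g * ?W * emeasure lborel R + ennreal g * (ennreal ?K * (ennreal C1 * W))"
   by (simp add: mult_left_mono)
  also have "emeasure lborel R = ennreal ((1 / 2 ^ k) ^ CARD('n))" unfolding R_def by (rule emeasure_dyadic_cube)
  also have "ennreal g * ?W * ennreal ((1 / 2 ^ k) ^ CARD('n)) + ennreal g * (ennreal ?K * (ennreal C1 * W))
    = ennreal (g * g * C2 + g * K * C1) * (W * ennreal ((1 / 2 ^ k) ^ CARD('n)))"
   using g K C1(1) C2(1) by (simp add: ennreal_plus ennreal_mult distrib_right distrib_left mult_ac)
  finally show "(\<integral>\<^sup>+x\<in>dyadic_cube k z. (\<Sum>l. Uop (2 * D) e (%j x. epowr (a j x) (enn2real q)) (k + l) x) \<partial>lborel)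
    <= ennreal (g * g * C2 + g * K * C1) * (epowr (tl_norm \<infinity> q a) (enn2real q) * ennreal ((1 / 2 ^ k) ^ CARD('n)))"
   unfolding R_def H_def W_def .
 qed
 qed
 qed
qed

lemma esssup_least:
 assumes "f \<in> borel_measurable M" "AE x in M. f x <= c" shows "esssup M f <= (c::ennreal)"
 by (rule esssup_I) (use assms in auto)

text \<open>The exponents P = p/t and Q = q/t of the t-th powers exceed 1 when finite. Each of the
  four finiteness cases has its own tool: the vector-valued inequality, the maximal function of the
  supremum, the Carleson estimate, the pointwise bound. The order \<open>2 * D\<close> is the one of
  the Carleson estimate.\<close>

lemma tl_norm_Uop:
 fixes p q :: ennreal
 assumes D: "D > CARD('n::finite)" and e: "e > 0" and t: "t > 0" "ennreal t < p" "ennreal t < q"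
 obtains C where "C > 0" "!!(a :: nat => real^'n => ennreal) b. (!!j. a j \<in> Borel) ==>
  (!!j. b j \<in> Borel) ==>
  (!!k x. epowr (b k x) t <= Uop (2 * D) e (%j x. epowr (a j x) t) k x) ==>
  tl_norm p q b <= ennreal C * tl_norm p q a"
proof -
 define p' where "p' = enn2real p" define q' where "q' = enn2real q"
 define P where "P = p' / t" define Q where "Q = q' / t"
 have D2: "2 * D > DIM(real^'n)" "2 * D > CARD('n)" using D by simp_all
 have pos: "p > 0" "q > 0" using t by (auto intro: le_less_trans[OF zero_le])
 have pf: "p = ennreal p'" "t < p'" "P > 1" "t * P = p'" "p' > 0" if "p < \<infinity>"
 proof -
  show 1: "p = ennreal p'" using that by (simp add: p'_def)
  show 2: "t < p'" using t unfolding 1 by (simp add: ennreal_less_iff)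
  show "P > 1" "t * P = p'" "p' > 0" using t(1) 2 by (auto simp: P_def)
 qed
 have qf: "q = ennreal q'" "t < q'" "Q > 1" "t * Q = q'" "q' > 0" if "q < \<infinity>"
 proof -
  show 1: "q = ennreal q'" using that by (simp add: q'_def)
  show 2: "t < q'" using t unfolding 1 by (simp add: ennreal_less_iff)
  show "Q > 1" "t * Q = q'" "q' > 0" using t(1) 2 by (auto simp: Q_def)
 qed
 consider (ff) "p < \<infinity>" "q < \<infinity>" | (fi) "p < \<infinity>" "q = \<infinity>" | (infi) "p = \<infinity>" "q < \<infinity>" | (ii) "p = \<infinity>" "q = \<infinity>"
  by (metis infinity_ennreal_def less_top)
 thus ?thesis
 proof cases
  case ff
  note pf = pf[OF ff(1)] and qf = qf[OF ff(2)]
  show ?thesis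
  proof (rule Uop_vector[OF D2(1) qf(3) pf(3) e], goal_cases)
  case C: (1 C)
  have PQ: "P / Q = p' / q'" using t(1) by (simp add: P_def Q_def)
  show ?thesis
  proof (rule that[of "C powr (1 / p')"])
   show "C powr (1 / p') > 0" using C(1) by simp
   fix a b :: "nat => real^'n => ennreal"
   assume [measurable]: "!!j. a j \<in> Borel" "!!j. b j \<in> Borel"
    and b: "!!k x. epowr (b k x) t <= Uop (2 * D) e (%j x. epowr (a j x) t) k x"
   have bQ: "epowr (b k x) q' <= epowr (Uop (2 * D) e (%j x. epowr (a j x) t) k x) Q" for k x
    using epowr_mono[OF _ b[of k x], of Q] t qf by (simp add: epowr_epowr)
   have "(\<integral>x. epowr (\<Sum>j. epowr (b j x) q') (p' / q')) <= (\<integral>x. epowr (\<Sum>k. epowr (Uop (2 * D) e (%j x. epowr (a j x) t) k x) Q) (P / Q))"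
    unfolding PQ using pf qf by (intro nn_integral_mono epowr_mono suminf_le summableI bQ) auto
   also have "... <= ennreal C * (\<integral>x. epowr (\<Sum>j. epowr (epowr (a j x) t) Q) (P / Q))"
    by (rule C(2)) measurable
   also have "... = ennreal C * (\<integral>x. epowr (\<Sum>j. epowr (a j x) q') (p' / q'))"
    using t qf by (simp add: epowr_epowr PQ)
   finally have "epowr (\<integral>x. epowr (\<Sum>j. epowr (b j x) q') (p' / q')) (1 / p') <= epowr (ennreal C * (\<integral>x. epowr (\<Sum>j. epowr (a j x) q') (p' / q'))) (1 / p')"
    using pf by (intro epowr_mono) auto
   thus "tl_norm p q b <= ennreal (C powr (1 / p')) * tl_norm p q a"
    using ff pf C(1) unfolding tl_norm_def Let_def p'_def[symmetric] q'_def[symmetric] by (simp add: epowr_mult epowr_ennreal)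
  qed
  qed
 next
  case fi
  note pf = pf[OF fi(1)]
  show ?thesis
  proof (rule maximal_strong_type[where 'a="real^'n", OF pf(3)], goal_cases)
  case C: (1 C)
  define K where "K = geo_const e * ker_const TYPE(real^'n) (2 * D)"
  have K: "K > 0" using geo_const_pos[OF e] ker_const_pos[of "TYPE(real^'n)" "2 * D"] by (simp add: K_def)
  show ?thesis
  proof (rule that[of "(K powr P * C) powr (1 / p')"])
   show "(K powr P * C) powr (1 / p') > 0" using C(1) K by simp
   fix a b :: "nat => real^'n => ennreal"
   assume [measurable]: "!!j. a j \<in> Borel" "!!j. b j \<in> Borel"
    and b: "!!k x. epowr (b k x) t <= Uop (2 * D) e (%j x. epowr (a j x) t) k x"
   define S where "S = (%x. epowr (SUP j. a j x) t)"
   have [measurable]: "S \<in> Borel" unfolding S_def by measurable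
   have bS: "epowr (b k x) t <= ennreal K * maximal S x" for k x
   proof -
    have "epowr (b k x) t <= (\<Sum>j. geo e k j * (ennreal (ker_const TYPE(real^'n) (2 * D)) * maximal S x))"
     unfolding S_def
     by (rule order_trans[OF b], unfold Uop_def, intro suminf_le summableI mult_left_mono order_trans[OF kavg_le_maximal mult_left_mono[OF maximal_mono]])
       (auto intro!: epowr_mono t SUP_upper D2)
    also have "... = (\<Sum>j. geo e k j) * (ennreal (ker_const TYPE(real^'n) (2 * D)) * maximal S x)" by simp
    also have "... <= ennreal (geo_const e) * (ennreal (ker_const TYPE(real^'n) (2 * D)) * maximal S x)"
     by (intro mult_right_mono suminf_geo e) auto
    finally show ?thesis
     using geo_const_pos[OF e] ker_const_pos[of "TYPE(real^'n)" "2 * D"] by (simp add: K_def ennreal_mult mult.assoc)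
   qed
   have bP: "epowr (SUP j. b j x) p' <= ennreal (K powr P) * epowr (maximal S x) P" for x
   proof -
    have "epowr (SUP j. b j x) t <= ennreal K * maximal S x"
     unfolding epowr_SUP[OF t(1)] by (rule SUP_least) (rule bS)
    hence "epowr (epowr (SUP j. b j x) t) P <= epowr (ennreal K * maximal S x) P"
     using pf by (intro epowr_mono) auto
    thus ?thesis using t pf K by (simp add: epowr_epowr epowr_mult epowr_ennreal)
   qed
   have "(\<integral>x. epowr (SUP j. b j x) p') <= (\<integral>x. ennreal (K powr P) * epowr (maximal S x) P)"
    by (intro nn_integral_mono bP)
   also have "... = ennreal (K powr P) * (\<integral>x. epowr (maximal S x) P)"
    by (rule nn_integral_cmult) measurable
   also have "... <= ennreal (K powr P) * (ennreal C * (\<integral>x. epowr (S x) P))"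
    by (intro mult_left_mono C(2)) auto
   also have "(\<integral>x. epowr (S x) P) = (\<integral>x. epowr (SUP j. a j x) p')"
    using t pf by (simp add: S_def epowr_epowr)
   finally have "epowr (\<integral>x. epowr (SUP j. b j x) p') (1 / p') <= epowr (ennreal (K powr P * C) * (\<integral>x. epowr (SUP j. a j x) p')) (1 / p')"
    using pf C(1) by (intro epowr_mono) (auto simp: ennreal_mult mult.assoc)
   thus "tl_norm p q b <= ennreal ((K powr P * C) powr (1 / p')) * tl_norm p q a"
    using fi pf C(1) unfolding tl_norm_def Let_def p'_def[symmetric] by (simp add: epowr_mult[of _ "ennreal _"] epowr_ennreal)
  qed
  qed
 next
  case infi
  note qf = qf[OF infi(2)]
  show ?thesis
  proof (rule Uop_power[OF D2(1) less_imp_le[OF qf(3)] e], goal_cases)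
  case C0: (1 C0)
  show ?thesis
  proof (rule Uop_carleson[OF D e pos(2) infi(2), folded q'_def], goal_cases)
  case C: (1 C)
  show ?thesis
  proof (rule that[of "(C0 * C) powr (1 / q')"])
   show "(C0 * C) powr (1 / q') > 0" using C(1) C0(1) by simp
   fix a b :: "nat => real^'n => ennreal"
   assume [measurable]: "!!j. a j \<in> Borel" "!!j. b j \<in> Borel"
    and b: "!!k x. epowr (b k x) t <= Uop (2 * D) e (%j x. epowr (a j x) t) k x"
   let ?J = "%k z. \<integral>\<^sup>+x\<in>dyadic_cube k z. (\<Sum>j. epowr (b (k + j) x) q') \<partial>lborel"
   have bQ: "epowr (b k x) q' <= ennreal C0 * Uop (2 * D) e (%j x. epowr (a j x) q') k x" for k x
   proof -
    have "epowr (b k x) q' <= epowr (Uop (2 * D) e (%j x. epowr (a j x) t) k x) Q"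
     using epowr_mono[OF _ b[of k x], of Q] t qf by (simp add: epowr_epowr)
    also have "... <= ennreal C0 * Uop (2 * D) e (%j x. epowr (epowr (a j x) t) Q) k x"
     by (rule C0(2)) measurable
    finally show ?thesis using t qf by (simp add: epowr_epowr)
   qed
   show "tl_norm p q b <= ennreal ((C0 * C) powr (1 / q')) * tl_norm p q a"
   proof -
    let ?W = "tl_norm \<infinity> q a"
    have "epowr (?J k z / emeasure lborel (dyadic_cube k z)) (1 / q') <= ennreal ((C0 * C) powr (1 / q')) * ?W" for k z
    proof -
     have "?J k z <= (\<integral>\<^sup>+x\<in>dyadic_cube k z. (\<Sum>j. ennreal C0 * Uop (2 * D) e (%j x. epowr (a j x) q') (k + j) x) \<partial>lborel)"
      by (intro nn_integral_mono mult_right_mono suminf_le summableI bQ) auto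
     also have "... = ennreal C0 * (\<integral>\<^sup>+x\<in>dyadic_cube k z. (\<Sum>j. Uop (2 * D) e (%j x. epowr (a j x) q') (k + j) x) \<partial>lborel)"
      by (subst nn_integral_cmult[symmetric]) (auto simp: mult.assoc)
     also have "... <= ennreal C0 * (ennreal C * (epowr ?W q' * ennreal ((1 / 2 ^ k) ^ CARD('n))))"
      by (intro mult_left_mono C(2)) auto
     also have "... = (ennreal (C0 * C) * epowr ?W q') * emeasure lborel (dyadic_cube k z :: (real^'n) set)"
      using C0(1) C(1) by (simp add: emeasure_dyadic_cube ennreal_mult mult.assoc)
     finally have "?J k z / emeasure lborel (dyadic_cube k z) <= ennreal (C0 * C) * epowr ?W q'"
      by (subst ennreal_le_divide_iff) (simp_all add: emeasure_dyadic_cube)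
     hence "epowr (?J k z / emeasure lborel (dyadic_cube k z)) (1 / q') <= epowr (ennreal (C0 * C) * epowr ?W q') (1 / q')"
      using qf by (intro epowr_mono) auto
     thus ?thesis using qf C0(1) C(1) by (simp add: epowr_mult[of _ "ennreal _"] epowr_ennreal)
    qed
    note le = this
    have "tl_norm p q b = (SUP (k, z). epowr (?J k z / emeasure lborel (dyadic_cube k z)) (1 / q'))"
     unfolding tl_norm_def Let_def q'_def using infi by simp
    also have "... <= ennreal ((C0 * C) powr (1 / q')) * ?W"
     by (rule SUP_least, clarify, rule le)
    finally show ?thesis using infi by simp
   qed
  qed
  qed
  qed
 next
  case ii
  show ?thesis
  proof (rule Uop_linfty[OF D2(2) e pos(2) t(1) less_imp_le[OF t(3)]], goal_cases)
  case C: (1 C)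
  show ?thesis
  proof (rule that[of "C powr (1 / t)"])
   show "C powr (1 / t) > 0" using C(1) by simp
   fix a b :: "nat => real^'n => ennreal"
   assume [measurable]: "!!j. a j \<in> Borel" "!!j. b j \<in> Borel"
    and b: "!!k x. epowr (b k x) t <= Uop (2 * D) e (%j x. epowr (a j x) t) k x"
   have "epowr (b k x) t <= ennreal C * epowr (tl_norm \<infinity> q a) t" for k x
    by (rule order_trans[OF b C(2)]) measurable
   hence "b k x <= ennreal (C powr (1 / t)) * tl_norm \<infinity> q a" for k x
    using t C(1) by (simp add: epowr_le_iff epowr_mult epowr_ennreal)
   hence "esssup lborel (b k) <= ennreal (C powr (1 / t)) * tl_norm \<infinity> q a" for k
    by (intro esssup_least) auto
   thus "tl_norm p q b <= ennreal (C powr (1 / t)) * tl_norm p q a"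
    using ii unfolding tl_norm_def[of p q b] by (auto intro!: SUP_least)
  qed
  qed
 qed
qed

text \<open>For p infinite and q finite the Carleson norm bounds averages, not values. A value whose
  t-th power is dominated by \<open>Uop\<close> is bounded nevertheless; this serves the
  low-frequency factor and the zeroth piece in \<open>F_norm\<close>.\<close>

lemma tl_norm_linfty_pointwise:
 assumes D: "D > CARD('n::finite)" and e: "e > 0" and q: "q > 0" and t: "0 < t" "ennreal t <= q"
 obtains C where "C > 0" "!!(a :: nat => real^'n => ennreal) y k x. (!!j. a j \<in> Borel) ==>
  epowr y t <= Uop D e (%j x. epowr (a j x) t) k x ==> y <= ennreal C * tl_norm \<infinity> q a"
proof -
 show ?thesis
 proof (rule Uop_linfty[OF D e q t], goal_cases)
 case C: (1 C)
 show ?thesis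
 proof (rule that[of "C powr (1 / t)"])
  show "C powr (1 / t) > 0" using C(1) by simp
  fix a :: "nat => real^'n => ennreal" and y k x
  assume a: "!!j. a j \<in> Borel" and y: "epowr y t <= Uop D e (%j x. epowr (a j x) t) k x"
  have "epowr y t <= ennreal C * epowr (tl_norm \<infinity> q a) t"
   by (rule order_trans[OF y C(2)[OF a]])
  thus "y <= ennreal (C powr (1 / t)) * tl_norm \<infinity> q a"
   using t C(1) by (simp add: epowr_le_iff epowr_mult epowr_ennreal)
 qed
 qed
qed

lemma tl_norm_cmult_le:
 fixes a :: "nat => real^'n::finite => ennreal"
 assumes [measurable]: "!!j. a j \<in> Borel" and "p > 0" "q > 0"
 shows "tl_norm p q (%j x. c * a j x) <= c * tl_norm p q a"
proof -
 define p' where "p' = enn2real p" define q' where "q' = enn2real q"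
 have p': "p < \<infinity> ==> p' > 0" and q': "q < \<infinity> ==> q' > 0"
  using assms by (auto simp: p'_def q'_def enn2real_positive_iff)
 note d = tl_norm_def Let_def p'_def[symmetric] q'_def[symmetric]
 consider (ff) "p < \<infinity>" "q < \<infinity>" | (fi) "p < \<infinity>" "q = \<infinity>" | (infi) "p = \<infinity>" "q < \<infinity>" | (ii) "p = \<infinity>" "q = \<infinity>"
  by (metis infinity_ennreal_def less_top)
 thus ?thesis
 proof cases
  case ff
  hence "p' > 0" "q' > 0" using p' q' by auto
  thus ?thesis using ff unfolding d by (simp add: epowr_mult epowr_epowr nn_integral_cmult)
 next
  case fi
  hence "p' > 0" using p' by auto
  thus ?thesis using fi unfolding d by (simp add: SUP_mult_left_ennreal[symmetric] epowr_mult epowr_epowr nn_integral_cmult)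
 next
  case infi
  hence q': "q' > 0" using q' by auto
  have "(\<integral>\<^sup>+x\<in>dyadic_cube k z. (\<Sum>j. epowr (c * a (k + j) x) q') \<partial>lborel) = epowr c q' * (\<integral>\<^sup>+x\<in>dyadic_cube k z. (\<Sum>j. epowr (a (k + j) x) q') \<partial>lborel)" for k and z :: "'n => int"
   using q' by (subst nn_integral_cmult[symmetric]) (auto simp: epowr_mult mult.assoc)
  thus ?thesis using infi q' unfolding d
   by (simp add: ennreal_times_divide[symmetric] epowr_mult epowr_epowr case_prod_beta SUP_mult_left_ennreal)
 next
  case ii
  have "esssup lborel (%x. c * a j x) <= c * esssup lborel (a j)" for j
  proof (rule esssup_least)
   show "AE x in lborel. c * a j x <= c * esssup lborel (a j)"
    using esssup_AE[of "a j" lborel] by (auto elim!: eventually_mono intro: mult_left_mono)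
  qed measurable
  thus ?thesis using ii unfolding d by (simp add: SUP_mult_left_ennreal) (rule SUP_mono, blast)
 qed
qed

lemma epowr_quasi_add:
 assumes r: "r > 0" and c: "c > 0" and z: "z <= ennreal c * (x + y)"
 shows "epowr z r <= ennreal ((2 * c) powr r) * (epowr x r + epowr y r)"
proof -
 have "epowr z r <= ennreal (c powr r) * epowr (x + y) r"
  using epowr_mono[OF r z] c r by (simp add: epowr_mult epowr_ennreal)
 also have "... <= ennreal (c powr r) * (ennreal (2 powr r) * (epowr x r + epowr y r))"
  by (intro mult_left_mono epowr_plus_le r) simp
 finally show ?thesis using c by (simp add: powr_mult ennreal_mult mult_ac)
qed

lemma suminf_epowr_add_le:
 assumes "r > 0"
 shows "(\<Sum>j. epowr (a j + b j) r) <= ennreal (2 powr r) * ((\<Sum>j. epowr (a j) r) + (\<Sum>j. epowr (b j) r))"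
proof -
 have "(\<Sum>j. epowr (a j + b j) r) <= (\<Sum>j. ennreal (2 powr r) * (epowr (a j) r + epowr (b j) r))"
  by (intro suminf_le summableI epowr_plus_le assms)
 thus ?thesis by (simp add: suminf_add[symmetric] summableI)
qed

lemma nn_integral_quasi_add:
 assumes "!!x. f x <= ennreal c * (g x + h x)" and [measurable]: "g \<in> borel_measurable M" "h \<in> borel_measurable M"
 shows "(\<integral>\<^sup>+x. f x \<partial>M) <= ennreal c * ((\<integral>\<^sup>+x. g x \<partial>M) + (\<integral>\<^sup>+x. h x \<partial>M))"
proof -
 have "(\<integral>\<^sup>+x. f x \<partial>M) <= (\<integral>\<^sup>+x. ennreal c * (g x + h x) \<partial>M)" by (intro nn_integral_mono assms)
 thus ?thesis by (simp add: nn_integral_cmult nn_integral_add)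
qed

lemma tl_norm_add:
 fixes p q :: ennreal
 assumes "p > 0" "q > 0"
 obtains C where "C > 0" "!!(a :: nat => real^'n::finite => ennreal) b. (!!j. a j \<in> Borel) ==>
  (!!j. b j \<in> Borel) ==> tl_norm p q (%j x. a j x + b j x) <= ennreal C * (tl_norm p q a + tl_norm p q b)"
proof -
 define p' where "p' = enn2real p" define q' where "q' = enn2real q"
 have p': "p < \<infinity> ==> p' > 0" and q': "q < \<infinity> ==> q' > 0"
  using assms by (auto simp: p'_def q'_def enn2real_positive_iff)
 note d = tl_norm_def Let_def p'_def[symmetric] q'_def[symmetric]
 consider (ff) "p < \<infinity>" "q < \<infinity>" | (fi) "p < \<infinity>" "q = \<infinity>" | (infi) "p = \<infinity>" "q < \<infinity>" | (ii) "p = \<infinity>" "q = \<infinity>"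
  by (metis infinity_ennreal_def less_top)
 thus ?thesis
 proof cases
  case ff
  hence pq: "p' > 0" "q' > 0" "p' / q' > 0" "1 / p' > 0" using p' q' by auto
  show ?thesis
  proof (rule that)
   fix a b :: "nat => real^'n => ennreal"
   assume m[measurable]: "!!j. a j \<in> Borel" "!!j. b j \<in> Borel"
   show "tl_norm p q (%j x. a j x + b j x) <= ennreal ((2 * (2 * 2 powr q') powr (p' / q')) powr (1 / p')) * (tl_norm p q a + tl_norm p q b)"
    unfolding d using ff
    by (simp, intro epowr_quasi_add pq nn_integral_quasi_add suminf_epowr_add_le) auto
  qed simp
 next
  case fi
  hence p: "p' > 0" "1 / p' > 0" using p' by auto
  show ?thesis
  proof (rule that)
   fix a b :: "nat => real^'n => ennreal"
   assume [measurable]: "!!j. a j \<in> Borel" "!!j. b j \<in> Borel"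
   have "epowr (SUP j. a j x + b j x) p' <= ennreal ((2 * 1) powr p') * (epowr (SUP j. a j x) p' + epowr (SUP j. b j x) p')" for x
   proof (rule epowr_quasi_add[OF p(1)])
    have "(SUP j. a j x + b j x) <= (SUP j. a j x) + (SUP j. b j x)" by (rule SUP_least) (intro add_mono SUP_upper; simp)
    thus "(SUP j. a j x + b j x) <= ennreal 1 * ((SUP j. a j x) + (SUP j. b j x))" by simp
   qed simp
   thus "tl_norm p q (%j x. a j x + b j x) <= ennreal ((2 * (2 * 1) powr p') powr (1 / p')) * (tl_norm p q a + tl_norm p q b)"
    unfolding d using fi by (simp, intro epowr_quasi_add p nn_integral_quasi_add) auto
  qed simp
 next
  case infi
  hence q: "q' > 0" "1 / q' > 0" using q' by auto
  show ?thesis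
  proof (rule that)
   fix a b :: "nat => real^'n => ennreal"
   assume [measurable]: "!!j. a j \<in> Borel" "!!j. b j \<in> Borel"
   let ?I = "%a k z. (\<integral>\<^sup>+x\<in>dyadic_cube k z. (\<Sum>j. epowr (a (k + j) x) q') \<partial>lborel) / emeasure lborel (dyadic_cube k z)"
   let ?C = "ennreal ((2 * 2 powr q') powr (1 / q'))"
   have le: "epowr (?I (%j x. a j x + b j x) k z) (1 / q') <= ?C * (tl_norm p q a + tl_norm p q b)" for k z
   proof -
    have "(\<integral>\<^sup>+x\<in>dyadic_cube k z. (\<Sum>j. epowr (a (k + j) x + b (k + j) x) q') \<partial>lborel) <= ennreal (2 powr q') *
     ((\<integral>\<^sup>+x\<in>dyadic_cube k z. (\<Sum>j. epowr (a (k + j) x) q') \<partial>lborel) + (\<integral>\<^sup>+x\<in>dyadic_cube k z. (\<Sum>j. epowr (b (k + j) x) q') \<partial>lborel))"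
     using suminf_epowr_add_le[OF q(1)] by (intro nn_integral_quasi_add) (auto simp: indicator_def)
    hence "?I (%j x. a j x + b j x) k z <= ennreal (2 powr q') * (?I a k z + ?I b k z)"
     by (rule order_trans[OF divide_right_mono_ennreal]) (simp add: divide_ennreal_def distrib_right mult.assoc)
    hence "epowr (?I (%j x. a j x + b j x) k z) (1 / q') <= ?C * (epowr (?I a k z) (1 / q') + epowr (?I b k z) (1 / q'))"
     by (intro epowr_quasi_add q) auto
    also have "... <= ?C * (tl_norm p q a + tl_norm p q b)"
     unfolding d using infi by (intro mult_left_mono add_mono) (auto intro: SUP_upper2[of "(k, z)"])
    finally show ?thesis .
   qed
   have "tl_norm p q (%j x. a j x + b j x) = (SUP (k, z). epowr (?I (%j x. a j x + b j x) k z) (1 / q'))"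
    unfolding d using infi by simp
   also have "... <= ?C * (tl_norm p q a + tl_norm p q b)" by (rule SUP_least, clarify, rule le)
   finally show "tl_norm p q (%j x. a j x + b j x) <= ?C * (tl_norm p q a + tl_norm p q b)" .
  qed simp
 next
  case ii
  show ?thesis
  proof (rule that[of 1])
   fix a b :: "nat => real^'n => ennreal"
   assume [measurable]: "!!j. a j \<in> Borel" "!!j. b j \<in> Borel"
   have "esssup lborel (%x. a j x + b j x) <= tl_norm p q a + tl_norm p q b" for j
   proof (rule esssup_least)
    have le: "esssup lborel (a j) <= tl_norm p q a" "esssup lborel (b j) <= tl_norm p q b"
     using ii unfolding d by (auto intro: SUP_upper)
    have "AE x in lborel. a j x <= esssup lborel (a j)" "AE x in lborel. b j x <= esssup lborel (b j)"
     by (rule esssup_AE)+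
    thus "AE x in lborel. a j x + b j x <= tl_norm p q a + tl_norm p q b"
     by eventually_elim (rule add_mono; erule order_trans, rule le)
   qed measurable
   thus "tl_norm p q (%j x. a j x + b j x) <= ennreal 1 * (tl_norm p q a + tl_norm p q b)"
    using ii unfolding tl_norm_def[of p q "%j x. a j x + b j x"] by (auto intro!: SUP_least)
  qed simp
 qed
qed

text \<open>An l^q sum dominates the supremum, so for every \<open>q\<close> the norm controls the
  same pointwise majorant of all frequencies.\<close>

lemma tl_norm_sup_le:
 fixes a :: "nat => real^'n::finite => ennreal"
 assumes [measurable]: "!!j. a j \<in> Borel" and "0 < p" "p < \<infinity>" "q > 0"
 shows "(\<integral>x. epowr (SUP j. a j x) (enn2real p)) <= epowr (tl_norm p q a) (enn2real p)"
proof -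
 define p' where "p' = enn2real p" define q' where "q' = enn2real q"
 have p': "p' > 0" and q': "q < \<infinity> ==> q' > 0"
  using assms by (auto simp: p'_def q'_def enn2real_positive_iff)
 note d = tl_norm_def Let_def p'_def[symmetric] q'_def[symmetric]
 show ?thesis
 proof (cases "q < \<infinity>")
  case True
  hence q': "q' > 0" using q' by auto
  have "epowr (SUP j. a j x) p' <= epowr (\<Sum>j. epowr (a j x) q') (p' / q')" for x
  proof -
   have "epowr (SUP j. a j x) q' <= (\<Sum>j. epowr (a j x) q')"
    unfolding epowr_SUP[OF q'] by (rule SUP_least) (rule suminf_member_le)
   hence "epowr (epowr (SUP j. a j x) q') (p' / q') <= epowr (\<Sum>j. epowr (a j x) q') (p' / q')"
    using p' q' by (intro epowr_mono) auto
   thus ?thesis using p' q' by (simp add: epowr_epowr)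
  qed
  hence "(\<integral>x. epowr (SUP j. a j x) p') <= (\<integral>x. epowr (\<Sum>j. epowr (a j x) q') (p' / q'))"
   by (rule nn_integral_mono)
  thus ?thesis using assms True p' unfolding d by simp
 next
  case False
  thus ?thesis using assms p' unfolding d by simp
 qed
qed

section \<open>Fourier transforms on Euclidean spaces\<close>

text \<open>The inverse transform without its constant, on any Euclidean space: it is used on
  \<open>real^'n\<close> and, for kernels of bilinear operators, on the product of two
  copies.\<close>

definition ift :: "('a::euclidean_space => complex) => 'a => complex" where
 "ift b y = (LBINT z. b z * iexp (y \<bullet> z))"

lemma integrable_ker: "D > DIM('a::euclidean_space) ==> L1 (ker D i :: 'a => real)"
 using nn_integral_ker[of D i "0::'a"]
 by (intro integrableI_nonneg) (auto simp: ker_minus intro: le_less_trans)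

lemma lborel_integral_translate:
 fixes f :: "'a::euclidean_space => 'b::{banach, second_countable_topology}"
 assumes [measurable]: "f \<in> Borel"
 shows "(LBINT x. f (c + x)) = (LBINT x. f x)"
  "L1 (%x. f (c + x)) \<longleftrightarrow> L1 f"
 by (subst (2) lborel_distr_plus[of c, symmetric], simp add: integral_distr integrable_distr_eq)+

lemma lborel_integral_affine:
 fixes f :: "'a::euclidean_space => 'b::{banach, second_countable_topology}"
 assumes [measurable]: "f \<in> Borel" and c: "c ~= (0::real)"
 shows "(LBINT x. f x) = \<bar>c\<bar> ^ DIM('a) *\<^sub>R (LBINT x. f (t + c *\<^sub>R x))"
  "L1 f \<longleftrightarrow> L1 (%x. f (t + c *\<^sub>R x))"
proof -
 show "(LBINT x. f x) = \<bar>c\<bar> ^ DIM('a) *\<^sub>R (LBINT x. f (t + c *\<^sub>R x))"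
  by (subst lborel_affine[OF c, of t], subst integral_density) (simp_all add: integral_distr)
 have e: "L1 (%x. k *\<^sub>R g x) \<longleftrightarrow> L1 g" if "k ~= 0" for k and g :: "'a => 'b"
  using that integrable_scaleR_right[of "inverse k" lborel "%x. k *\<^sub>R g x"] by auto
 show "L1 f \<longleftrightarrow> L1 (%x. f (t + c *\<^sub>R x))"
  using c by (subst lborel_affine[OF c, of t], subst integrable_density) (simp_all add: integrable_distr_eq e)
qed

lemma lborel_integral_reflect:
 fixes f :: "'a::euclidean_space => 'b::{banach, second_countable_topology}"
 assumes [measurable]: "f \<in> Borel"
 shows "(LBINT x. f (t - x)) = (LBINT x. f x)"
  "L1 (%x. f (t - x)) \<longleftrightarrow> L1 f"
 using lborel_integral_affine[of f "-1" t] by simp_all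

lemma integrable_prod_mult:
 fixes f :: "'a::euclidean_space => complex" and g :: "'b::euclidean_space => complex"
 assumes "L1 f" "L1 g"
 shows "integrable (lborel \<Otimes>\<^sub>M lborel) (%(x, y). f x * g y)"
proof (rule lborel_pair.Fubini_integrable)
 have [measurable]: "f \<in> Borel" "g \<in> Borel" using assms by auto
 show "(%(x, y). f x * g y) \<in> borel_measurable (lborel \<Otimes>\<^sub>M lborel)" by measurable
 show "L1 (%x. LBINT y. norm (case (x, y) of (x, y) => f x * g y))"
  using assms by (simp add: norm_mult integrable_norm)
 show "AE x in lborel. L1 (%y. case (x, y) of (x, y) => f x * g y)" using assms by simp
qed

lemma norm_iexp [simp]: "norm (iexp x) = 1"
 by (simp add: norm_exp_eq_Re)

lemma measurable_iexp_inner [measurable]: "(%z. iexp (y \<bullet> z)) \<in> Borel"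
 by (intro borel_measurable_continuous_onI continuous_intros)

lemma integrable_bounded_mult:
 fixes f g :: "'a => complex"
 assumes "integrable M f" "g \<in> borel_measurable M" "!!x. norm (g x) <= B"
 shows "integrable M (%x. f x * g x)" "integrable M (%x. g x * f x)"
proof -
 have "integrable M (%x. B * norm (f x))" using assms by simp
 thus "integrable M (%x. f x * g x)"
  by (rule Bochner_Integration.integrable_bound)
    (use assms in \<open>auto simp: norm_mult mult.commute[of B] intro!: mult_left_mono order_trans[OF _ abs_ge_self]\<close>)
 thus "integrable M (%x. g x * f x)" by (simp add: mult.commute)
qed

lemma integrable_iexp:
 "L1 f ==> L1 (%z. f z * iexp (y \<bullet> z))"
 by (rule integrable_bounded_mult(1)[where B=1]) auto

lemma norm_ift_le: "L1 f ==> norm (ift f y) <= (LBINT z. norm (f z))"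
 unfolding ift_def by (rule order_trans[OF integral_norm_bound]) (simp add: norm_mult)

lemma measurable_ift [measurable]:
 assumes [measurable]: "f \<in> Borel" shows "ift f \<in> Borel"
proof -
 have "(%(y::'a, z). f z * iexp (y \<bullet> z)) \<in> borel_measurable (borel \<Otimes>\<^sub>M lborel)"
  unfolding case_prod_beta by (intro borel_measurable_times measurable_compose[OF measurable_snd])
   (auto simp: borel_prod intro!: borel_measurable_continuous_onI continuous_intros)
 hence "(%y. LBINT z. f z * iexp (y \<bullet> z)) \<in> Borel"
  by (intro lborel.borel_measurable_lebesgue_integral) auto
 thus ?thesis by (simp add: ift_def[abs_def])
qed

text \<open>Averaging the fundamental theorem of calculus over all segments from \<open>x\<close> to \<open>x + v\<close>.\<close>

lemma integral_dir_deriv_eq_0: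
 fixes F :: "'a::euclidean_space => complex"
 assumes F: "!!x. (F has_derivative F' x) (at x)" and c: "continuous_on UNIV (%x. F' x v)"
  and i: "L1 F" "L1 (%x. F' x v)"
 shows "(LBINT x. F' x v) = 0"
proof -
 have [measurable]: "(%x. F' x v) \<in> Borel" "F \<in> Borel" using i by auto
 have line: "(LBINT s. indicator {0..1} s *\<^sub>R F' (x + s *\<^sub>R v) v) = F (x + v) - F x" for x
 proof -
  have "(LBINT s. indicator {0..1} s *\<^sub>R F' (x + s *\<^sub>R v) v) = F (x + 1 *\<^sub>R v) - F (x + 0 *\<^sub>R v)"
  proof (rule integral_FTC_Icc)
   fix s :: real
   have "((%s. F (x + s *\<^sub>R v)) has_derivative (%t. F' (x + s *\<^sub>R v) (t *\<^sub>R v))) (at s within {0..1})"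
    by (rule has_derivative_compose[OF _ F]) (auto intro!: derivative_eq_intros)
   thus "((%s. F (x + s *\<^sub>R v)) has_vector_derivative F' (x + s *\<^sub>R v) v) (at s within {0..1})"
    unfolding has_vector_derivative_def using linear_cmul[OF has_derivative_linear[OF F]] by simp
   show "continuous_on {0..1} (%s. F' (x + s *\<^sub>R v) v)"
    by (rule continuous_on_compose2[OF c]) (auto intro!: continuous_intros)
  qed simp
  thus ?thesis by simp
 qed
 define G where "G = (%(s::real, x). indicator {0..1} s *\<^sub>R F' (x + s *\<^sub>R v) v)"
 have "(%p::real \<times> 'a. F' (snd p + fst p *\<^sub>R v) v) \<in> borel_measurable (borel \<Otimes>\<^sub>M borel)"
  unfolding borel_prod by (intro borel_measurable_continuous_onI continuous_on_compose2[OF c] continuous_intros) auto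
 hence Gm: "G \<in> borel_measurable (lborel \<Otimes>\<^sub>M lborel)"
  unfolding G_def case_prod_beta by measurable
 have norms: "(LBINT x. norm (G (s, x))) = indicator {0..1} s * (LBINT x. norm (F' x v))" for s
  using lborel_integral_translate(1)[of "%x. norm (F' x v)" "s *\<^sub>R v"] by (simp add: G_def add.commute)
 have "integrable (lborel \<Otimes>\<^sub>M lborel) G"
 proof (rule lborel_pair.Fubini_integrable[OF Gm])
  show "L1 (%s. LBINT x. norm (G (s, x)))" unfolding norms
   by (intro integrable_mult_left) (simp add: integrable_indicator_iff)
  show "AE s in lborel. L1 (%x. G (s, x))"
   using lborel_integral_translate(2)[of "%x. F' x v" "s *\<^sub>R v" for s] i(2) by (simp add: G_def add.commute)
 qed
 hence "(LBINT x. LBINT s. G (s, x)) = (LBINT s. LBINT x. G (s, x))"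
  by (intro lborel_pair.Fubini_integral) (simp add: case_prod_eta)
 moreover have "(LBINT s. LBINT x. G (s, x)) = (LBINT s. indicator {0..1::real} s *\<^sub>R (LBINT x. F' x v))"
 proof (rule Bochner_Integration.integral_cong[OF refl])
  show "(LBINT x. G (s, x)) = indicator {0..1} s *\<^sub>R (LBINT x. F' x v)" for s
   using lborel_integral_translate(1)[of "%x. F' x v" "s *\<^sub>R v"] by (simp add: G_def add.commute)
 qed
 moreover have "... = (LBINT x. F' x v)"
  by (subst integral_scaleR_left) (simp_all add: integrable_indicator_iff)
 moreover have "(LBINT x. LBINT s. G (s, x)) = (LBINT x. F (x + v) - F x)"
  by (simp add: G_def line)
 moreover have "... = 0"
  using lborel_integral_translate[of F v] i(1) by (simp add: add.commute)
 ultimately show ?thesis by simp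
qed

lemma has_derivative_iexp_inner:
 "((%x. iexp (y \<bullet> x)) has_derivative (%u. \<i> * of_real (y \<bullet> u) * iexp (y \<bullet> x))) (at x)"
 by (rule has_derivative_eq_rhs, rule has_derivative_compose[where g=exp, OF _ DERIV_exp[unfolded has_field_derivative_def]])
   (auto intro!: derivative_eq_intros simp: mult_ac)

text \<open>The derivative of \<open>b\<close> times the exponential has integral zero, and the
  product rule splits it into the two sides.\<close>

lemma ift_dir_deriv:
 fixes b :: "'a::euclidean_space => complex"
 assumes "smooth b" "v \<in> Basis" "L1 b" "L1 (dir_deriv v b)"
 shows "ift (dir_deriv v b) y = - \<i> * of_real (y \<bullet> v) * ift b y"
proof -
 define F' where "F' = (%x u. b x * (\<i> * of_real (y \<bullet> u) * iexp (y \<bullet> x)) + dir_deriv u b x * iexp (y \<bullet> x))"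
 have "(LBINT x. F' x v) = 0"
 proof (rule integral_dir_deriv_eq_0)
  show "((%x. b x * iexp (y \<bullet> x)) has_derivative F' x) (at x)" for x
   unfolding F'_def
   by (rule has_derivative_mult[OF smooth_imp_has_derivative[OF assms(1)] has_derivative_iexp_inner])
  show "continuous_on UNIV (%x. F' x v)" unfolding F'_def
   by (intro continuous_intros smooth_imp_continuous smooth_dir_deriv assms(1,2))
  show "L1 (%x. b x * iexp (y \<bullet> x))" by (rule integrable_iexp[OF assms(3)])
  show "L1 (%x. F' x v)" unfolding F'_def
   using integrable_iexp[OF assms(3), of y] integrable_iexp[OF assms(4), of y]
   by (intro Bochner_Integration.integrable_add) (simp_all add: mult.left_commute[of "b _"] mult.assoc)
 qed
 also have "(LBINT x. F' x v) = \<i> * of_real (y \<bullet> v) * ift b y + ift (dir_deriv v b) y"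
  unfolding F'_def ift_def
  using integrable_iexp[OF assms(3), of y] integrable_iexp[OF assms(4), of y]
  by (subst Bochner_Integration.integral_add) (simp_all add: mult.left_commute[of "b _"] mult.assoc)
 finally show ?thesis by (simp add: add_eq_0_iff2)
qed

lemma ift_iter_deriv:
 fixes b :: "'a::euclidean_space => complex"
 assumes "smooth b" "v \<in> Basis" "!!k. k <= N ==> L1 (foldr dir_deriv (replicate k v) b)"
 shows "ift (foldr dir_deriv (replicate N v) b) y = (- \<i> * of_real (y \<bullet> v)) ^ N * ift b y"
 using assms(3)
proof (induction N)
 case (Suc N)
 have "smooth (foldr dir_deriv (replicate N v) b)"
  using assms by (intro smooth_iter_deriv) auto
 hence "ift (foldr dir_deriv (replicate (Suc N) v) b) y = - \<i> * of_real (y \<bullet> v) * ift (foldr dir_deriv (replicate N v) b) y"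
  using Suc.prems[of N] Suc.prems[of "Suc N"] assms(2) by (simp add: ift_dir_deriv)
 thus ?case using Suc by simp
qed simp

text \<open>The largest of 1 and the numbers l |y . v| bounds 1 + l |y| up to the factor DIM + 1,
  and its N-th power is one of the summands.\<close>

lemma power_norm_le_sum:
 fixes y :: "'a::euclidean_space"
 assumes "l >= 0"
 shows "(1 + l * norm y) ^ N <= (real DIM('a) + 1) ^ N * (1 + (\<Sum>v\<in>Basis. (l * \<bar>y \<bullet> v\<bar>) ^ N))"
proof -
 define m where "m = Max (insert 1 ((%v. l * \<bar>y \<bullet> v\<bar>) ` (Basis :: 'a set)))"
 have m1: "1 <= m" and mv: "!!v. v \<in> Basis ==> l * \<bar>y \<bullet> v\<bar> <= m" unfolding m_def by (rule Max_ge; fastforce)+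
 have "norm y <= (\<Sum>v\<in>Basis. \<bar>y \<bullet> v\<bar>)" by (rule norm_le_l1)
 hence "l * norm y <= (\<Sum>v\<in>Basis. l * \<bar>y \<bullet> v\<bar>)" using assms by (simp add: mult_left_mono flip: sum_distrib_left)
 also have "... <= (\<Sum>v\<in>(Basis :: 'a set). m)" by (intro sum_mono mv)
 finally have "1 + l * norm y <= (real DIM('a) + 1) * m" using m1 by (simp add: distrib_right)
 hence "(1 + l * norm y) ^ N <= ((real DIM('a) + 1) * m) ^ N" using assms by (intro power_mono) auto
 also have "m ^ N <= 1 + (\<Sum>v\<in>Basis. (l * \<bar>y \<bullet> v\<bar>) ^ N)"
 proof -
  have "m \<in> insert 1 ((%v. l * \<bar>y \<bullet> v\<bar>) ` (Basis :: 'a set))" unfolding m_def by (rule Max_in) auto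
  moreover have "(l * \<bar>y \<bullet> v\<bar>) ^ N <= (\<Sum>v\<in>Basis. (l * \<bar>y \<bullet> v\<bar>) ^ N)" if "v \<in> Basis" for v
   using that assms by (intro member_le_sum) auto
  moreover have "0 <= (\<Sum>v\<in>(Basis :: 'a set). (l * \<bar>y \<bullet> v\<bar>) ^ N)" using assms by (intro sum_nonneg) auto
  ultimately show ?thesis by fastforce
 qed
 hence "((real DIM('a) + 1) * m) ^ N <= (real DIM('a) + 1) ^ N * (1 + (\<Sum>v\<in>Basis. (l * \<bar>y \<bullet> v\<bar>) ^ N))"
  by (simp add: power_mult_distrib mult_left_mono)
 finally show ?thesis .
qed

text \<open>Each factor \<open>y \<bullet> v\<close> is traded for a derivative of \<open>b\<close>.
  Only pure derivatives in the coordinate directions enter, and \<open>l\<close> is the free scale,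
  later 2^j.\<close>

lemma ift_decay:
 fixes b :: "'a::euclidean_space => complex"
 assumes "smooth b" "!!v k. v \<in> Basis ==> k <= N ==> L1 (foldr dir_deriv (replicate k v) b)"
  and "(LBINT z. norm (b z)) <= A" "l >= 0"
  and "!!v. v \<in> Basis ==> l ^ N * (LBINT z. norm (foldr dir_deriv (replicate N v) b z)) <= A"
 shows "(1 + l * norm y) ^ N * norm (ift b y) <= (real DIM('a) + 1) ^ Suc N * A"
proof -
 have "L1 b" using assms(2)[of "SOME v. v \<in> Basis" 0] by (simp add: SOME_Basis)
 hence 0: "norm (ift b y) <= A" using norm_ift_le[of b y] assms(3) by linarith
 have 1: "(l * \<bar>y \<bullet> v\<bar>) ^ N * norm (ift b y) <= A" if v: "v \<in> Basis" for v
 proof -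
  have "(l * \<bar>y \<bullet> v\<bar>) ^ N * norm (ift b y) = l ^ N * norm (ift (foldr dir_deriv (replicate N v) b) y)"
   using assms(1,2) v by (simp add: ift_iter_deriv norm_mult norm_power power_mult_distrib del: foldr_replicate)
  also have "... <= l ^ N * (LBINT z. norm (foldr dir_deriv (replicate N v) b z))"
   using assms v by (intro mult_left_mono norm_ift_le) auto
  finally show ?thesis using assms(5)[OF v] by linarith
 qed
 have "(1 + l * norm y) ^ N * norm (ift b y) <= (real DIM('a) + 1) ^ N * (1 + (\<Sum>v\<in>Basis. (l * \<bar>y \<bullet> v\<bar>) ^ N)) * norm (ift b y)"
  by (rule mult_right_mono[OF power_norm_le_sum[OF assms(4)]]) simp
 also have "... = (real DIM('a) + 1) ^ N * (norm (ift b y) + (\<Sum>v\<in>Basis. (l * \<bar>y \<bullet> v\<bar>) ^ N * norm (ift b y)))"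
  by (simp only: mult.assoc distrib_right sum_distrib_right mult_1_left)
 also have "... <= (real DIM('a) + 1) ^ N * (A + (\<Sum>v\<in>(Basis :: 'a set). A))"
  by (intro mult_left_mono add_mono sum_mono 0 1) auto
 also have "... = (real DIM('a) + 1) ^ Suc N * A" by (simp add: algebra_simps)
 finally show ?thesis .
qed

lemma ift_mult_ift:
 fixes b U :: "'a::euclidean_space => complex"
 assumes b: "L1 b" and U: "L1 U"
 shows "(LBINT z. b z * ift U (- z) * iexp (x \<bullet> z)) = (LBINT y. ift b (x - y) * U y)"
proof -
 have [measurable]: "b \<in> Borel" "U \<in> Borel" using b U by auto
 let ?f = "%z y. b z * U y * iexp ((x - y) \<bullet> z)"
 have "integrable (lborel \<Otimes>\<^sub>M lborel) (%p. (case p of (z, y) => b z * U y) * iexp ((x - snd p) \<bullet> fst p))"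
  by (rule integrable_bounded_mult(1)[where B=1, OF integrable_prod_mult[OF b U]])
    (auto simp: lborel_prod intro!: borel_measurable_continuous_onI continuous_intros)
 hence int: "integrable (lborel \<Otimes>\<^sub>M lborel) (case_prod ?f)" by (simp add: case_prod_beta')
 have "(LBINT z. b z * ift U (- z) * iexp (x \<bullet> z)) = (LBINT z. LBINT y. ?f z y)"
  unfolding ift_def
  by (simp add: inner_diff_left exp_minus exp_diff divide_inverse algebra_simps inner_commute flip: Bochner_Integration.integral_mult_right_zero)
 also have "... = (LBINT y. LBINT z. ?f z y)"
  by (rule lborel_pair.Fubini_integral[OF int, symmetric])
 also have "... = (LBINT y. ift b (x - y) * U y)"
  unfolding ift_def by (simp add: mult_ac flip: Bochner_Integration.integral_mult_left_zero)
 finally show ?thesis .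
qed

definition gauss :: "'a::euclidean_space => complex" where
 "gauss z = of_real (exp (- (norm z)\<^sup>2 / 2))"

text \<open>Read off from the characteristic function of the standard normal distribution.\<close>

lemma ift_gauss_real: "L1 (%x::real. exp (- x\<^sup>2 / 2) *\<^sub>R iexp (t * x))"
 "(LBINT x. exp (- x\<^sup>2 / 2) *\<^sub>R iexp (t * x)) = of_real (sqrt (2 * pi) * exp (- t\<^sup>2 / 2))"
proof -
 interpret real_distribution std_normal_distribution by (rule real_dist_normal_dist)
 have e: "exp (- x\<^sup>2 / 2) *\<^sub>R iexp (t * x) = sqrt (2 * pi) *\<^sub>R (std_normal_density x *\<^sub>R iexp (t * x))" for x
  by (simp add: std_normal_density_def)
 have "integrable std_normal_distribution (%x. iexp (t * x))"
  by (rule integrable_iexp) auto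
 hence "L1 (%x. std_normal_density x *\<^sub>R iexp (t * x))"
  by (subst (asm) integrable_density) auto
 thus "L1 (%x::real. exp (- x\<^sup>2 / 2) *\<^sub>R iexp (t * x))"
  unfolding e by (intro integrable_scaleR_right)
 have "(LBINT x. std_normal_density x *\<^sub>R iexp (t * x)) = of_real (exp (- (t\<^sup>2) / 2))"
  using fun_cong[OF char_std_normal_distribution, of t] unfolding char_def
  by (subst (asm) integral_density) auto
 thus "(LBINT x. exp (- x\<^sup>2 / 2) *\<^sub>R iexp (t * x)) = of_real (sqrt (2 * pi) * exp (- t\<^sup>2 / 2))"
  unfolding e integral_scaleR_right by (simp add: scaleR_conv_of_real)
qed

text \<open>In coordinates the Gaussian times the exponential is a product of one-dimensional
  factors, and \<open>lborel\<close> is the image of a product measure.\<close>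

lemma ift_gauss:
 fixes y :: "'a::euclidean_space"
 shows "L1 (gauss :: 'a => complex)" "ift gauss y = of_real (sqrt (2 * pi) ^ DIM('a)) * gauss y"
proof -
 interpret product_sigma_finite "%_::'a. lborel :: real measure" by standard
 let ?g = "%y x. \<Prod>b\<in>Basis. exp (- (x b)\<^sup>2 / 2) *\<^sub>R iexp ((y \<bullet> b) * x b)"
 let ?T = "%f. \<Sum>b\<in>Basis. f b *\<^sub>R b :: 'a"
 have T: "?T f \<bullet> b = f b" if "b \<in> Basis" for f b
  using that by (simp add: inner_sum_left inner_Basis sum.delta' if_distrib cong: if_cong)
 have n2: "(norm z)\<^sup>2 = (\<Sum>b\<in>Basis. (z \<bullet> b)\<^sup>2)" for z :: 'a
  unfolding power2_norm_eq_inner by (subst euclidean_inner) (simp add: power2_eq_square)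
 have e: "gauss (?T f) * iexp (y \<bullet> ?T f) = ?g y f" for f and y :: 'a
 proof -
  have "gauss (?T f) * iexp (y \<bullet> ?T f) = exp (\<Sum>b\<in>Basis. of_real (- (f b)\<^sup>2 / 2) + \<i> * of_real ((y \<bullet> b) * f b))"
   unfolding gauss_def n2 exp_of_real[symmetric] exp_add[symmetric]
   by (subst euclidean_inner[of y]) (simp add: T sum.distrib sum_distrib_left sum_negf sum_divide_distrib sum_subtractf)
  also have "... = ?g y f"
   by (subst exp_sum) (simp_all add: exp_add scaleR_conv_of_real exp_of_real[symmetric] flip: of_real_minus of_real_power of_real_divide)
  finally show ?thesis .
 qed
 have m: "?T \<in> measurable (Pi\<^sub>M Basis (%_. lborel)) borel" by measurable
 have gm [measurable]: "gauss \<in> borel_measurable (borel :: 'a measure)"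
  unfolding gauss_def by measurable
 have "integrable (Pi\<^sub>M Basis (%_::'a. lborel)) (?g 0)"
  by (rule product_integrable_prod) (simp_all only: finite_Basis ift_gauss_real)
 hence "integrable (Pi\<^sub>M Basis (%_::'a. lborel)) (%f. gauss (?T f))" using e[of _ 0] by simp
 thus i: "L1 (gauss :: 'a => complex)"
  unfolding lborel_eq[where 'a='a] by (subst integrable_distr_eq[OF m]) simp_all
 have "ift gauss y = (LINT f|Pi\<^sub>M Basis (%_::'a. lborel). gauss (?T f) * iexp (y \<bullet> ?T f))"
  unfolding ift_def lborel_eq[where 'a='a] by (rule integral_distr[OF m]) measurable
 also have "... = (\<Prod>b\<in>Basis. LBINT x. exp (- x\<^sup>2 / 2) *\<^sub>R iexp ((y \<bullet> b) * x))"
  unfolding e by (rule product_integral_prod) (simp_all only: finite_Basis ift_gauss_real)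
 also have "... = (\<Prod>b\<in>Basis. of_real (sqrt (2 * pi)) * exp (of_real (- (y \<bullet> b)\<^sup>2 / 2)))"
  unfolding ift_gauss_real by (simp flip: exp_of_real)
 also have "... = of_real (sqrt (2 * pi)) ^ DIM('a) * exp (\<Sum>b\<in>Basis. of_real (- (y \<bullet> b)\<^sup>2 / 2))"
  by (simp add: prod.distrib exp_sum)
 also have "exp (\<Sum>b\<in>Basis. of_real (- (y \<bullet> b)\<^sup>2 / 2)) = gauss y"
  unfolding gauss_def n2 exp_of_real[symmetric] by (simp add: sum_negf sum_divide_distrib)
 finally show "ift gauss y = of_real (sqrt (2 * pi) ^ DIM('a)) * gauss y" by simp
qed

lemma norm_gauss_le: "norm (gauss z) <= 1"
 by (simp add: gauss_def norm_of_real del: of_real_exp)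

lemma continuous_gauss: "continuous_on A gauss"
 unfolding gauss_def by (intro continuous_intros) auto

text \<open>Gaussian summation: inserting \<open>g k\<close>, which tends to 1, makes Fubini
  available and turns the integral into an average of \<open>h\<close> against a rescaled Gaussian.
  Both sides converge by dominated convergence. The constant is the product of two factors sqrt(2
  pi)^DIM, one from the transform of the Gaussian and one from its integral.\<close>

theorem fourier_inversion:
 fixes h :: "'a::euclidean_space => complex"
 assumes h: "L1 h" "continuous_on UNIV h" "!!x. norm (h x) <= B" and H: "L1 (ift h)"
 shows "ift (%z. ift h (- z)) x = of_real ((2 * pi) ^ DIM('a)) * h x"
  and "ift (ift h) (- x) = of_real ((2 * pi) ^ DIM('a)) * h x"
proof -
 have gm[measurable, simp]: "h \<in> Borel" "(gauss :: 'a => complex) \<in> Borel"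
  using h(1) ift_gauss(1)[where 'a='a] by auto
 have H': "L1 (%z. ift h (- z))" using lborel_integral_reflect(2)[of "ift h" 0] H by simp
 define g where "g = (%k::nat. %z::'a. gauss (inverse (real (Suc k)) *\<^sub>R z))"
 have gi: "L1 (g k)" for k
  unfolding g_def using lborel_integral_affine(2)[of "gauss :: 'a => complex" "inverse (real (Suc k))" 0] ift_gauss(1)[where 'a='a] by simp
 have ig: "ift (g k) w = of_nat (Suc k) ^ DIM('a) * ift gauss (real (Suc k) *\<^sub>R w)" for k and w :: 'a
 proof -
  have "ift (g k) w = \<bar>real (Suc k)\<bar> ^ DIM('a) *\<^sub>R (LBINT x. g k (0 + real (Suc k) *\<^sub>R x) * iexp (w \<bullet> (0 + real (Suc k) *\<^sub>R x)))"
   unfolding ift_def by (rule lborel_integral_affine(1)) (auto simp: g_def)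
  thus ?thesis by (simp add: g_def ift_def scaleR_conv_of_real del: of_nat_Suc)
 qed
 have "(LBINT z. g k z * ift h (- z) * iexp (x \<bullet> z)) = (LBINT u. ift gauss u * h (x - inverse (real (Suc k)) *\<^sub>R u))" for k
 proof -
  have "(LBINT z. g k z * ift h (- z) * iexp (x \<bullet> z)) = (LBINT y. ift (g k) (x - y) * h y)"
   by (rule ift_mult_ift[OF gi h(1)])
  also have "... = \<bar>- inverse (real (Suc k))\<bar> ^ DIM('a) *\<^sub>R (LBINT u. ift (g k) (x - (x + (- inverse (real (Suc k))) *\<^sub>R u)) * h (x + (- inverse (real (Suc k))) *\<^sub>R u))"
   by (rule lborel_integral_affine(1)) (auto simp: g_def)
  also have "... = (LBINT u. ift gauss u * h (x - inverse (real (Suc k)) *\<^sub>R u))"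
   unfolding ig by (simp add: scaleR_conv_of_real mult.assoc power_inverse del: of_nat_Suc)
  finally show ?thesis .
 qed
 moreover have "(%k. LBINT z. g k z * ift h (- z) * iexp (x \<bullet> z)) \<longlonglongrightarrow> (LBINT z. ift h (- z) * iexp (x \<bullet> z))"
 proof (rule integral_dominated_convergence[where w="%z. norm (ift h (- z))"])
  have inv0: "(%k. inverse (real (Suc k)) *\<^sub>R z) \<longlonglongrightarrow> 0 *\<^sub>R z" for z :: 'a
   by (intro tendsto_intros LIMSEQ_inverse_real_of_nat)
  have "(%k. g k z) \<longlonglongrightarrow> gauss (0 :: 'a)" for z
   unfolding g_def using continuous_on_tendsto_compose[OF continuous_gauss[of UNIV] inv0[of z]] by simp
  hence "(%k. g k z * ift h (- z) * iexp (x \<bullet> z)) \<longlonglongrightarrow> gauss (0::'a) * ift h (- z) * iexp (x \<bullet> z)" for z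
   by (intro tendsto_intros)
  thus "AE z in lborel. (%k. g k z * ift h (- z) * iexp (x \<bullet> z)) \<longlonglongrightarrow> ift h (- z) * iexp (x \<bullet> z)"
   by (simp add: gauss_def)
  show "AE z in lborel. norm (g k z * ift h (- z) * iexp (x \<bullet> z)) <= norm (ift h (- z))" for k
   by (rule AE_I2) (simp add: g_def norm_mult mult_left_le_one_le norm_gauss_le)
 qed (use H' in \<open>auto simp: g_def\<close>)
 moreover have "(%k. LBINT u. ift gauss u * h (x - inverse (real (Suc k)) *\<^sub>R u)) \<longlonglongrightarrow> (LBINT u. ift gauss (u::'a) * h x)"
 proof (rule integral_dominated_convergence[where w="%u. norm (ift gauss u) * B"])
  have "(%k. x - inverse (real (Suc k)) *\<^sub>R u) \<longlonglongrightarrow> x - 0 *\<^sub>R u" for u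
   by (intro tendsto_intros LIMSEQ_inverse_real_of_nat)
  from continuous_on_tendsto_compose[OF h(2) this]
  have "(%k. h (x - inverse (real (Suc k)) *\<^sub>R u)) \<longlonglongrightarrow> h x" for u
   by simp
  thus "AE u in lborel. (%k. ift gauss u * h (x - inverse (real (Suc k)) *\<^sub>R u)) \<longlonglongrightarrow> ift gauss u * h x"
   by (auto intro!: tendsto_intros)
  show "L1 (%u::'a. norm (ift gauss u) * B)"
   unfolding ift_gauss(2) using ift_gauss(1)[where 'a='a] by (simp add: norm_mult)
  show "AE u in lborel. norm (ift gauss u * h (x - inverse (real (Suc k)) *\<^sub>R u)) <= norm (ift gauss u) * B" for k
   using h(3) by (auto simp: norm_mult intro!: mult_left_mono)
 qed auto
 ultimately have "ift (%z. ift h (- z)) x = (LBINT u. ift gauss (u::'a) * h x)"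
  unfolding ift_def[of "%z. ift h (- z)"] by (auto dest: LIMSEQ_unique)
 also have "... = of_real (sqrt (2 * pi) ^ DIM('a)) * ift gauss (0::'a) * h x"
 proof -
  have "(LBINT u. gauss (u::'a)) = ift gauss (0::'a)" by (simp add: ift_def)
  thus ?thesis by (simp add: ift_gauss(2)[abs_def] mult.assoc del: of_real_power)
 qed
 also have "... = of_real ((2 * pi) ^ DIM('a)) * h x"
 proof -
  have "sqrt (2 * pi) ^ DIM('a) * sqrt (2 * pi) ^ DIM('a) = (2 * pi) ^ DIM('a)"
   by (subst power_mult_distrib[symmetric]) simp
  hence "of_real (sqrt (2 * pi) ^ DIM('a)) * of_real (sqrt (2 * pi) ^ DIM('a)) = (of_real ((2 * pi) ^ DIM('a)) :: complex)"
   by (metis of_real_mult)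
  thus ?thesis unfolding ift_gauss(2) by (simp add: gauss_def)
 qed
 finally show "ift (%z. ift h (- z)) x = of_real ((2 * pi) ^ DIM('a)) * h x" .
 moreover have "ift (%z. ift h (- z)) x = ift (ift h) (- x)"
  unfolding ift_def[of _ x] ift_def[of _ "- x"]
  using lborel_integral_reflect(1)[of "%z. ift h z * iexp (- x \<bullet> z)" 0] by simp
 ultimately show "ift (ift h) (- x) = of_real ((2 * pi) ^ DIM('a)) * h x" by simp
qed

text \<open>The exponential differs from its linear part by at most a multiple of (u . z)^2, so a
  finite second moment gives an error quadratic in the increment.\<close>

lemma has_derivative_ift:
 fixes b :: "'a::euclidean_space => complex"
 assumes [measurable]: "b \<in> Borel"
  and i: "!!k. k <= 2 ==> L1 (%z. norm z ^ k * norm (b z))"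
 shows "(ift b has_derivative (%u. ift (%z. \<i> * of_real (u \<bullet> z) * b z) y)) (at y)"
proof -
 let ?b = "%u z. \<i> * of_real (u \<bullet> z) * b z"
 define K where "K = (LBINT z. norm z ^ 2 * norm (b z))"
 have K: "K >= 0" unfolding K_def by (intro integral_nonneg_AE) auto
 have i0: "L1 b" using i[of 0] by (subst integrable_norm_iff[symmetric]) auto
 have i1: "L1 (?b u)" for u
 proof (rule Bochner_Integration.integrable_bound[of _ "%z. norm u * (norm z ^ 1 * norm (b z))"])
  show "AE z in lborel. norm (\<i> * of_real (u \<bullet> z) * b z) <= norm (norm u * (norm z ^ 1 * norm (b z)))"
   using Cauchy_Schwarz_ineq2[of u] by (auto simp: norm_mult mult.assoc[symmetric] intro!: mult_right_mono)
 qed (use i[of 1] in auto)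
 have lin: "linear (%u. ift (?b u) y)"
 proof (rule linearI)
  fix u v c
  show "ift (%z. \<i> * of_real ((u + v) \<bullet> z) * b z) y = ift (?b u) y + ift (%z. \<i> * of_real (v \<bullet> z) * b z) y"
   unfolding ift_def using integrable_iexp[OF i1[of u], of y] integrable_iexp[OF i1[of v], of y]
   by (subst Bochner_Integration.integral_add[symmetric]) (auto intro!: Bochner_Integration.integral_cong simp: inner_add_left algebra_simps)
  show "ift (%z. \<i> * of_real ((c *\<^sub>R u) \<bullet> z) * b z) y = c *\<^sub>R ift (?b u) y"
   unfolding ift_def integral_scaleR_right[symmetric] by (rule Bochner_Integration.integral_cong) (simp_all add: scaleR_conv_of_real)
 qed
 show ?thesis
 proof (rule has_derivativeI_sandwich[of 1 _ _ _ _ "%u. K * norm (u - y)"])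
  show "bounded_linear (%u. ift (?b u) y)"
   using lin by (rule linear_conv_bounded_linear[THEN iffD1])
  fix x assume "x ~= y"
  let ?u = "x - y"
  let ?e = "%z. iexp (?u \<bullet> z) - (1 + \<i> * of_real (?u \<bullet> z))"
  have "ift b x - ift b y - ift (%z. \<i> * of_real (?u \<bullet> z) * b z) y
   = (LBINT z. b z * iexp (y \<bullet> z) * (?e z))"
   unfolding ift_def
   using integrable_iexp[OF i0, of x] integrable_iexp[OF i0, of y] integrable_iexp[OF i1[of ?u], of y]
   by (subst (1) Bochner_Integration.integral_diff[symmetric], simp, simp, subst Bochner_Integration.integral_diff[symmetric], simp, simp)
     (auto intro!: Bochner_Integration.integral_cong simp: inner_diff_left exp_diff exp_minus divide_inverse right_diff_distrib algebra_simps)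
  also have "norm ... <= (LBINT z. norm ?u ^ 2 * (norm z ^ 2 * norm (b z)))"
  proof (rule order_trans[OF integral_norm_bound integral_mono], rule integrable_norm)
   have 1: "norm (?e z) <= norm ?u ^ 2 * norm z ^ 2" for z
   proof -
    have "norm (?e z) <= \<bar>?u \<bullet> z\<bar> ^ 2 / 2"
     using iexp_approx1[of "?u \<bullet> z" 1] by (simp add: numeral_2_eq_2)
    also have "... <= \<bar>?u \<bullet> z\<bar> ^ 2" by simp
    also have "... <= (norm ?u * norm z) ^ 2" by (intro power_mono Cauchy_Schwarz_ineq2) auto
    finally show ?thesis by (simp add: power_mult_distrib)
   qed
   show n: "norm (b z * iexp (y \<bullet> z) * (?e z)) <= norm ?u ^ 2 * (norm z ^ 2 * norm (b z))" for z
    using mult_left_mono[OF 1[of z], of "norm (b z)"] by (simp add: norm_mult mult_ac)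
   show int: "L1 (%z. norm ?u ^ 2 * (norm z ^ 2 * norm (b z)))" using i[of 2] by simp
   show "L1 (%z. b z * iexp (y \<bullet> z) * (?e z))"
    by (rule Bochner_Integration.integrable_bound[OF int]) (use n in \<open>auto intro!: order_trans[OF _ abs_ge_self]\<close>)
  qed
  also have "... = K * norm ?u ^ 2" unfolding K_def by simp
  finally show "norm (ift b x - ift b y - ift (%z. \<i> * of_real ((x - y) \<bullet> z) * b z) y) / norm (x - y) <= K * norm (x - y)"
   using \<open>x ~= y\<close> by (simp add: divide_le_eq power2_eq_square mult.assoc)
 next
  have "((%u. K * norm (u - y)) \<longlongrightarrow> K * norm (y - y)) (at y)"
   by (intro tendsto_intros)
  thus "((%u. K * norm (u - y)) \<longlongrightarrow> 0) (at y)" by simp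
 qed simp
qed

section \<open>Multi-indices and Schwartz functions\<close>

lemma iter_deriv_zero:
 assumes "open S" "!!x. x \<in> S ==> f x = 0" "x \<in> S"
 shows "foldr dir_deriv vs f x = 0"
 using assms(3)
proof (induction vs arbitrary: x)
 case (Cons v vs)
 have "(foldr dir_deriv vs f has_derivative (%_. 0)) (at x)"
  by (rule has_derivative_transform_within_open[OF has_derivative_const[of 0] assms(1) Cons.prems]) (simp add: Cons.IH)
 thus ?case by (simp add: dir_derivI)
qed (use assms in simp)

text \<open>Lists of directions allow induction over single derivatives; this is the list of a
  multi-index in the order fixed by \<open>mderiv\<close>.\<close>

definition dirs :: "('n::finite => 'a) => 'n multiindex => 'a list" where
 "dirs e \<alpha> = concat (map (%i. replicate (\<alpha> i) (e i)) index_enum)"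

lemma index_enum: "distinct (index_enum :: 'n::finite list)" "set (index_enum :: 'n list) = UNIV"
proof -
 have "\<exists>xs::'n list. distinct xs \<and> set xs = UNIV" using finite_distinct_list[OF finite_class.finite_UNIV] by blast
 from someI_ex[OF this] show "distinct (index_enum :: 'n::finite list)" "set (index_enum :: 'n list) = UNIV"
  unfolding index_enum_def by auto
qed

lemma mderiv_eq_dirs: "mderiv e \<alpha> f = foldr dir_deriv (dirs e \<alpha>) f"
proof -
 have "foldr (%i. dir_deriv (e i) ^^ \<alpha> i) xs f = foldr dir_deriv (concat (map (%i. replicate (\<alpha> i) (e i)) xs)) f" for xs
  by (induction xs) auto
 thus ?thesis by (simp add: mderiv_def dirs_def)
qed

lemma length_dirs: "length (dirs e (\<alpha> :: 'n::finite multiindex)) = msize \<alpha>"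
 using index_enum[where 'n='n]
 by (simp add: dirs_def msize_def length_concat comp_def sum_list_distinct_conv_sum_set)

lemma set_dirs: "set (dirs e \<alpha>) \<subseteq> range e"
 by (auto simp: dirs_def)

lemma mset_dirs:
 fixes e :: "'n::finite => 'a"
 assumes "inj e" "set vs \<subseteq> range e"
 shows "mset (dirs e (%i. count (mset vs) (e i))) = mset vs"
proof (rule multiset_eqI)
 fix v
 have c: "count (mset (concat (map (%i. replicate (\<alpha> i) (e i)) xs))) v = (\<Sum>i\<leftarrow>xs. if e i = v then \<alpha> i else 0)" for xs and \<alpha> :: "'n => nat"
  by (induction xs) (auto simp: count_replicate_mset)
 have "count (mset (dirs e (%i. count (mset vs) (e i)))) v = (\<Sum>i\<in>UNIV. if e i = v then count (mset vs) (e i) else 0)"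
  unfolding dirs_def c using index_enum[where 'n='n] by (simp add: sum_list_distinct_conv_sum_set)
 also have "... = count (mset vs) v"
 proof (cases "v \<in> range e")
  case True
  then obtain i where i: "v = e i" by auto
  have "(\<Sum>k\<in>UNIV. if e k = v then count (mset vs) (e k) else 0) = (\<Sum>k\<in>UNIV. if k = i then count (mset vs) v else 0)"
   using assms(1) i by (intro sum.cong) (auto simp: inj_eq)
  thus ?thesis by simp
 next
  case False
  hence "count (mset vs) v = 0" using assms(2) by (auto simp: count_eq_zero_iff)
  moreover have "(\<Sum>k\<in>UNIV. if e k = v then count (mset vs) (e k) else 0) = 0" using False by auto
  ultimately show ?thesis by simp
 qed
 finally show "count (mset (dirs e (%i. count (mset vs) (e i)))) v = count (mset vs) v" .
qed

lemma finite_msize: "finite {\<alpha> :: 'n::finite multiindex. msize \<alpha> <= N}"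
proof (rule finite_subset)
 show "{\<alpha> :: 'n multiindex. msize \<alpha> <= N} \<subseteq> (\<Pi>\<^sub>E i\<in>UNIV. {..N})"
 proof (rule subsetI)
  fix \<alpha> :: "'n multiindex" assume "\<alpha> \<in> {\<alpha>. msize \<alpha> <= N}"
  hence "\<alpha> i <= N" for i
   using member_le_sum[of i UNIV \<alpha>] by (auto simp: msize_def intro: order_trans)
  thus "\<alpha> \<in> (\<Pi>\<^sub>E i\<in>UNIV. {..N})" by auto
 qed
 show "finite (\<Pi>\<^sub>E i\<in>(UNIV :: 'n set). {..N})" by (rule finite_PiE) auto
qed

lemma Basis_cart: "(Basis :: (real^'n::finite) set) = range (%i. axis i 1)"
 by (auto simp: Basis_vec_def)

lemma inj_axis: "inj (%i::'n::finite. axis i (1::real))"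
 by (auto simp: inj_def axis_eq_axis)

definition schwartz_bound :: "(real^'n::finite => complex) => nat => real" where
 "schwartz_bound f N = enn2real (schwartz_seminorm N f)"

lemma schwartz_smooth: "f \<in> schwartz ==> smooth f"
 by (simp add: schwartz_def)

text \<open>The list is rearranged into the multi-index with the same counts, which is one of those
  in the seminorm.\<close>

lemma schwartz_deriv_bound:
 fixes f :: "real^'n::finite => complex"
 assumes f: "f \<in> schwartz" and vs: "set vs \<subseteq> Basis" "length vs <= N"
 shows "(1 + norm x) ^ N * norm (foldr dir_deriv vs f x) <= schwartz_bound f N"
proof -
 let ?e = "%i::'n. axis i (1::real)"
 define \<beta> where "\<beta> = (%i. count (mset vs) (?e i))"
 have m: "mset (dirs ?e \<beta>) = mset vs" unfolding \<beta>_def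
  by (rule mset_dirs[OF inj_axis]) (use vs Basis_cart in auto)
 have l: "msize \<beta> <= N" using mset_eq_length[OF m] vs(2) by (simp add: length_dirs)
 have d: "foldr dir_deriv vs f = mderiv ?e \<beta> f"
  unfolding mderiv_eq_dirs by (rule iter_deriv_mset) (use f vs m in \<open>auto simp: schwartz_def\<close>)
 have "ennreal ((1 + norm x) ^ N * norm (mderiv ?e \<beta> f x)) <= schwartz_seminorm N f"
  unfolding schwartz_seminorm_def by (rule SUP_upper2[of \<beta>]) (use l in \<open>auto intro: SUP_upper\<close>)
 moreover have "schwartz_seminorm N f < \<infinity>" using f by (auto simp: schwartz_def)
 ultimately show ?thesis unfolding d schwartz_bound_def
  by (cases "schwartz_seminorm N f") (auto simp: ennreal_le_iff2)
qed

lemma smooth_compact_support_bounded: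
 fixes f :: "'a::euclidean_space => 'b::real_normed_vector"
 assumes "smooth f" "!!x. norm x > R ==> f x = 0" "set vs \<subseteq> Basis"
 obtains C where "C >= 0" "!!x. norm (foldr dir_deriv vs f x) <= C" "!!x. norm x > R ==> foldr dir_deriv vs f x = 0"
proof -
 have z: "foldr dir_deriv vs f x = 0" if "norm x > R" for x
  by (rule iter_deriv_zero[of "{x. norm x > R}"]) (use assms that in \<open>auto intro!: open_Collect_less continuous_intros\<close>)
 have "compact ((%x. norm (foldr dir_deriv vs f x)) ` cball 0 R)"
  by (intro compact_continuous_image continuous_intros smooth_imp_continuous smooth_iter_deriv assms) simp
 then obtain C where C: "!!x. x \<in> cball 0 R ==> norm (foldr dir_deriv vs f x) <= C"
  by (meson bounded_imp_bdd_above bdd_above.E compact_imp_bounded image_eqI)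
 show thesis
 proof (rule that[of "max 0 C"])
  show "norm (foldr dir_deriv vs f x) <= max 0 C" for x
   using C[of x] z[of x] by (cases "norm x <= R") (simp_all add: le_max_iff_disj)
 qed (use z in auto)
qed

lemma smooth_compact_support_schwartz:
 fixes f :: "real^'n::finite => 'b::real_normed_vector"
 assumes "smooth f" "!!x. norm x > R ==> f x = 0"
 shows "f \<in> schwartz"
proof -
 have "schwartz_seminorm N f < \<infinity>" for N
 proof -
  let ?S = "%\<beta>. SUP x. ennreal ((1 + norm x) ^ N * norm (mderiv (%i. axis i 1) \<beta> f x))"
  have fin: "?S \<beta> < \<infinity>" for \<beta>
  proof -
   have vs: "set (dirs (%i::'n. axis i (1::real)) \<beta>) \<subseteq> Basis" unfolding Basis_cart by (rule set_dirs)
   obtain C where C: "C >= 0" "!!x. norm (mderiv (%i. axis i 1) \<beta> f x) <= C" "!!x. norm x > R ==> mderiv (%i. axis i 1) \<beta> f x = 0"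
    using smooth_compact_support_bounded[OF assms vs, folded mderiv_eq_dirs] by blast
   have "(1 + norm x) ^ N * norm (mderiv (%i. axis i 1) \<beta> f x) <= (1 + \<bar>R\<bar>) ^ N * C" for x
   proof (cases "norm x <= R")
    case True thus ?thesis using C(1) by (intro mult_mono power_mono C) auto
   qed (use C in auto)
   hence "?S \<beta> <= ennreal ((1 + \<bar>R\<bar>) ^ N * C)" by (intro SUP_least ennreal_leI)
   thus ?thesis by (rule le_less_trans) simp
  qed
  have "schwartz_seminorm N f = Max (?S ` {\<beta>. msize \<beta> <= N})"
   unfolding schwartz_seminorm_def using finite_msize[where 'n='n]
   by (subst Max_Sup) (auto intro!: exI[of _ "%_. 0"] simp: msize_def)
  also have "... < \<infinity>"
   using finite_msize[where 'n='n] fin by (subst Max_less_iff) (auto intro!: exI[of _ "%_. 0"] simp: msize_def)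
  finally show ?thesis .
 qed
 with assms show ?thesis by (simp add: schwartz_def)
qed

lemma schwartz_integrable_deriv:
 fixes f :: "real^'n::finite => complex"
 assumes f: "f \<in> schwartz" and vs: "set vs \<subseteq> Basis"
 shows "L1 (%x. norm x ^ k * norm (foldr dir_deriv vs f x))" "L1 (foldr dir_deriv vs f)"
proof -
 have [measurable]: "foldr dir_deriv vs f \<in> Borel"
  by (intro smooth_imp_measurable smooth_iter_deriv) (use f vs in \<open>auto simp: schwartz_def\<close>)
 have *: "L1 (%x. norm x ^ k * norm (foldr dir_deriv vs f x))" for k
 proof -
  \<comment> \<open>\<open>length vs\<close> makes the seminorm see this derivative;
    \<open>k + Suc CARD('n)\<close> pays for the factor \<open>norm x ^ k\<close> and leaves an
    integrable kernel.\<close>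
  define N where "N = max (length vs) (k + Suc CARD('n))"
  have "L1 (%x::real^'n. schwartz_bound f N * ker (Suc CARD('n)) 0 x)"
   by (intro integrable_mult_right integrable_ker) simp
  thus ?thesis
  proof (rule Bochner_Integration.integrable_bound)
   have "norm x ^ k * norm (foldr dir_deriv vs f x) <= schwartz_bound f N * ker (Suc CARD('n)) 0 x" for x
   proof -
    have "norm x ^ k * (1 + norm x) ^ Suc CARD('n) <= (1 + norm x) ^ k * (1 + norm x) ^ Suc CARD('n)"
     by (intro mult_right_mono power_mono) auto
    also have "... <= (1 + norm x) ^ N" unfolding power_add[symmetric] N_def by (intro power_increasing) auto
    finally have "norm x ^ k * (1 + norm x) ^ Suc CARD('n) * norm (foldr dir_deriv vs f x) <= (1 + norm x) ^ N * norm (foldr dir_deriv vs f x)"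
     by (rule mult_right_mono) simp
    also have "... <= schwartz_bound f N" using f vs by (intro schwartz_deriv_bound) (auto simp: N_def)
    finally show ?thesis
     using zero_less_power[of "1 + norm x" "Suc CARD('n)"] by (simp add: ker_def pos_le_divide_eq add_pos_nonneg mult_ac)
   qed
   thus "AE x in lborel. norm (norm x ^ k * norm (foldr dir_deriv vs f x)) <= norm (schwartz_bound f N * ker (Suc CARD('n)) 0 x)"
    by (intro AE_I2) (auto intro: order_trans[OF _ abs_ge_self])
  qed measurable
 qed
 thus "L1 (%x. norm x ^ k * norm (foldr dir_deriv vs f x))" .
 show "L1 (foldr dir_deriv vs f)" using *[of 0] by (subst integrable_norm_iff[symmetric]) auto
qed

lemma schwartz_integrable:
 fixes f :: "real^'n::finite => complex"
 shows "f \<in> schwartz ==> L1 f"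
 using schwartz_integrable_deriv(2)[of f "[]"] by simp

lemma schwartz_bounded:
 fixes f :: "real^'n::finite => complex"
 shows "f \<in> schwartz ==> norm (f x) <= schwartz_bound f 0"
 using schwartz_deriv_bound[of f "[]" 0] by simp

lemma ift_schwartz_decay:
 fixes f :: "real^'n::finite => complex"
 assumes f: "f \<in> schwartz"
 obtains C where "C > 0" "!!y. norm (ift f y) <= C * ker D 0 y"
proof -
 define A where "A = 1 + (LBINT z. norm (f z)) + (\<Sum>v\<in>Basis. LBINT z. norm (foldr dir_deriv (replicate D v) f z))"
 have nn: "(LBINT z. norm (f z)) >= 0" "(\<Sum>v\<in>Basis. LBINT z. norm (foldr dir_deriv (replicate D v) f z)) >= 0"
  by (auto intro!: sum_nonneg integral_nonneg_AE)
 have 1: "(LBINT z. norm (foldr dir_deriv (replicate D v) f z)) <= (\<Sum>v\<in>Basis. LBINT z. norm (foldr dir_deriv (replicate D v) f z))" if "v \<in> Basis" for v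
  using that by (intro member_le_sum) (auto intro!: integral_nonneg_AE)
 have "(1 + 1 * norm y) ^ D * norm (ift f y) <= (real DIM(real^'n) + 1) ^ Suc D * A" for y
 proof (rule ift_decay)
  show "smooth f" using f by (simp add: schwartz_def)
  show "L1 (foldr dir_deriv (replicate k v) f)" if "v \<in> Basis" for v k
   by (rule schwartz_integrable_deriv[OF f]) (use that in auto)
  show "1 ^ D * (LBINT z. norm (foldr dir_deriv (replicate D v) f z)) <= A" if "v \<in> Basis" for v
   unfolding A_def power_one mult_1 using 1[OF that] nn by linarith
 qed (use nn in \<open>auto simp: A_def simp del: foldr_replicate\<close>)
 moreover have "(1 + norm y) ^ D > 0" for y :: "real^'n" by (intro zero_less_power add_pos_nonneg) auto
 ultimately have "norm (ift f y) <= (real DIM(real^'n) + 1) ^ Suc D * A * ker D 0 y" for y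
  by (simp add: ker_def pos_le_divide_eq mult.commute)
 moreover have "A > 0" unfolding A_def using nn by linarith
 hence "(real DIM(real^'n) + 1) ^ Suc D * A > 0" by simp
 ultimately show ?thesis using that by blast
qed

lemma fourier_eq_ift: "fourier f \<xi> = ift f (- \<xi>)"
 by (simp add: fourier_def ift_def inner_commute)

lemma inv_fourier_eq_ift: "inv_fourier f x = of_real ((2 * pi) powr (- real CARD('n))) * ift f (x :: real^'n::finite)"
 by (simp add: inv_fourier_def ift_def)

section \<open>Convolutions, multipliers and tempered distributions\<close>

definition conv :: "('a::euclidean_space => complex) => ('a => complex) => 'a => complex" where
 "conv k h x = (LBINT y. k (x - y) * h y)"

lemma integrable_conv:
 fixes k h :: "'a::euclidean_space => complex"
 assumes "L1 k" "h \<in> Borel" "!!x. norm (h x) <= B"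
 shows "L1 (%y. k (x - y) * h y)"
proof -
 have [measurable]: "k \<in> Borel" using assms(1) by auto
 show ?thesis by (rule integrable_bounded_mult(1)[where B=B]) (use assms lborel_integral_reflect(2)[of k x] in auto)
qed

lemma norm_conv_le:
 fixes k h :: "'a::euclidean_space => complex"
 assumes [measurable]: "k \<in> Borel" "h \<in> Borel"
 shows "enorm (conv k h x) <= (\<integral>y. enorm (k (x - y)) * enorm (h y))"
proof (cases "L1 (%y. k (x - y) * h y)")
 case True
 have "enorm (conv k h x) <= ennreal (LBINT y. norm (k (x - y) * h y))"
  unfolding conv_def by (intro ennreal_leI integral_norm_bound)
 also have "... = (\<integral>y. enorm (k (x - y) * h y))"
  using True by (intro nn_integral_eq_integral[symmetric]) auto
 finally show ?thesis by (simp add: norm_mult ennreal_mult)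
qed (simp add: conv_def not_integrable_integral_eq)

lemma conv_bounded:
 assumes "L1 k" "h \<in> Borel" "!!x. norm (h x) <= B"
 shows "norm (conv k h x) <= B * (LBINT y. norm (k y))"
proof -
 have [measurable]: "k \<in> Borel" using assms(1) by auto
 have "norm (conv k h x) <= (LBINT y. norm (k (x - y) * h y))"
  unfolding conv_def by (rule integral_norm_bound)
 also have "... <= (LBINT y. norm (k (x - y)) * B)"
 proof (rule integral_mono)
  show "L1 (%y. norm (k (x - y) * h y))" by (intro integrable_norm integrable_conv[OF assms])
  show "L1 (%y. norm (k (x - y)) * B)"
   using assms(1) lborel_integral_reflect(2)[of k x] by auto
 qed (use assms(3) in \<open>auto simp: norm_mult intro!: mult_left_mono\<close>)
 also have "... = B * (LBINT y. norm (k y))"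
  using lborel_integral_reflect(1)[of "%y. norm (k y)" x] by simp
 finally show ?thesis .
qed

lemma ker_translate:
 "norm (x - x') <= b ==> ker D 0 x' <= (1 + b) ^ D * ker D 0 (x :: 'a::euclidean_space)"
proof -
 assume b: "norm (x - x') <= b"
 hence b0: "b >= 0" using norm_ge_zero order_trans by blast
 have "norm x <= norm x' + b" using b norm_triangle_ineq2[of x x'] by linarith
 hence "1 + norm x <= (1 + b) * (1 + norm x')"     using mult_nonneg_nonneg[OF b0 norm_ge_zero[of x']] by (simp add: distrib_right distrib_left)
 hence "(1 + norm x) ^ D <= (1 + b) ^ D * (1 + norm x') ^ D"
  unfolding power_mult_distrib[symmetric] by (intro power_mono) auto
 moreover have "(1 + norm x) ^ D > 0" "(1 + norm x') ^ D > 0" by (intro zero_less_power add_pos_nonneg; simp)+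
 ultimately show ?thesis by (simp add: ker_def divide_simps)
qed

text \<open>Dominated convergence: for points within distance 1 of \<open>x\<close> the kernel is at
  most 2^D times the one centred at \<open>x\<close>, which supplies an integrable majorant.\<close>

lemma conv_continuous:
 fixes k h :: "'a::euclidean_space => complex"
 assumes k: "continuous_on UNIV k" "!!x. norm (k x) <= C * ker D 0 x" and D: "D > DIM('a)" and C: "C >= 0"
  and h [measurable]: "h \<in> Borel" and hB: "!!x. norm (h x) <= B"
 shows "continuous_on UNIV (conv k h)"
proof (rule continuous_at_imp_continuous_on, rule ballI, subst continuous_at_sequentially, safe)
 fix x :: 'a and X :: "nat => 'a" assume X: "X \<longlonglongrightarrow> x"
 have [measurable]: "k \<in> Borel" using k(1) by (rule borel_measurable_continuous_onI)
 have B: "B >= 0" using hB norm_ge_zero order_trans by blast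
 obtain N where N: "!!n. n >= N ==> norm (X n - x) < 1" using LIMSEQ_D[OF X, of 1] by auto
 have "(%n. conv k h (X (n + N))) \<longlonglongrightarrow> conv k h x"
  unfolding conv_def
 proof (rule integral_dominated_convergence[where w="%y. C * (2 ^ D * ker D 0 (x - y)) * B"])
  have "(%n. k (X (n + N) - y)) \<longlonglongrightarrow> k (x - y)" for y
   by (rule continuous_on_tendsto_compose[OF k(1)]) (auto intro!: tendsto_intros LIMSEQ_ignore_initial_segment X)
  thus "AE y in lborel. (%n. k (X (n + N) - y) * h y) \<longlonglongrightarrow> k (x - y) * h y"
   by (intro AE_I2 tendsto_intros) auto
  show "L1 (%y. C * (2 ^ D * ker D 0 (x - y)) * B)"
   using lborel_integral_reflect(2)[of "ker D 0" x] integrable_ker[OF D] by simp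
  show "AE y in lborel. norm (k (X (n + N) - y) * h y) <= C * (2 ^ D * ker D 0 (x - y)) * B" for n
  proof (rule AE_I2)
   fix y
   have "norm (k (X (n + N) - y)) <= C * ker D 0 (X (n + N) - y)" by (rule k(2))
   also have "... <= C * (2 ^ D * ker D 0 (x - y))"
    using ker_translate[of "x - y" "X (n + N) - y" 1 D] N[of "n + N"] C by (intro mult_left_mono) (auto simp: norm_minus_commute)
   finally show "norm (k (X (n + N) - y) * h y) <= C * (2 ^ D * ker D 0 (x - y)) * B"
    unfolding norm_mult using hB[of y] B C by (intro mult_mono) auto
  qed
 qed simp_all
 thus "(conv k h \<circ> X) \<longlonglongrightarrow> conv k h x" unfolding comp_def by (rule LIMSEQ_offset)
qed

lemma conv_Fubini:
 fixes k h \<psi> :: "'a::euclidean_space => complex"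
 assumes k: "L1 k" and [measurable]: "h \<in> Borel" and hB: "!!x. norm (h x) <= B" and \<psi>: "L1 \<psi>"
 shows "(LBINT x. h x * (LBINT y. k (y - x) * \<psi> y)) = (LBINT y. conv k h y * \<psi> y)"
proof -
 have [measurable]: "k \<in> Borel" "\<psi> \<in> Borel" using k \<psi> by auto
 let ?F = "%(y, x). k (y - x) * h x * \<psi> y"
 have "integrable (lborel \<Otimes>\<^sub>M lborel) ?F"
 proof (rule lborel_pair.Fubini_integrable)
  have "L1 (%y. (LBINT x. norm (k (y - x) * h x)) * norm (\<psi> y))"
  proof (rule Bochner_Integration.integrable_bound)
   show "L1 (%y. (B * (LBINT x. norm (k x))) * norm (\<psi> y))" using \<psi> by simp
   show "AE y in lborel. norm ((LBINT x. norm (k (y - x) * h x)) * norm (\<psi> y)) <= norm ((B * (LBINT x. norm (k x))) * norm (\<psi> y))"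
   proof (rule AE_I2)
    fix y
    have "(LBINT x. norm (k (y - x) * h x)) <= (LBINT x. norm (k (y - x)) * B)"
     using k lborel_integral_reflect(2)[of k y] integrable_conv[OF k _ hB, where x=y]
     by (intro integral_mono) (auto simp: norm_mult hB intro!: mult_left_mono integrable_norm[of _ "%x. k (y - x) * h x", unfolded norm_mult])
    also have "... = B * (LBINT x. norm (k x))" using lborel_integral_reflect(1)[of "%x. norm (k x)" y] by simp
    finally show "norm ((LBINT x. norm (k (y - x) * h x)) * norm (\<psi> y)) <= norm ((B * (LBINT x. norm (k x))) * norm (\<psi> y))"
     using order_trans[OF norm_ge_zero hB] by (simp add: abs_mult mult_right_mono)
   qed
  qed measurable
  thus "L1 (%y. LBINT x. norm (?F (y, x)))" by (simp add: norm_mult)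
  show "AE y in lborel. L1 (%x. ?F (y, x))"
   using integrable_conv[OF k _ hB] by simp
 qed measurable
 hence "(LBINT x. LBINT y. k (y - x) * h x * \<psi> y) = (LBINT y. LBINT x. k (y - x) * h x * \<psi> y)"
  by (rule lborel_pair.Fubini_integral)
 thus ?thesis unfolding conv_def
  by (simp add: mult.left_commute[of "h _"] mult.assoc flip: Bochner_Integration.integral_mult_right_zero Bochner_Integration.integral_mult_left_zero)
qed

lemma ift_mult_ift2:
 fixes b U :: "'a::euclidean_space => complex"
 assumes b: "L1 b" and U: "L1 U"
 shows "(LBINT z. b z * ift U z * iexp (x \<bullet> z)) = (LBINT y. ift b (x + y) * U y)"
proof -
 have [measurable]: "b \<in> Borel" "U \<in> Borel" using b U by auto
 have "ift (%y. U (- y)) (- z) = ift U z" for z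
  using lborel_integral_reflect(1)[of "%y. U y * iexp (z \<bullet> y)" 0] by (simp add: ift_def)
 moreover have "L1 (%y. U (- y))" using lborel_integral_reflect(2)[of U 0] U by simp
 ultimately have "(LBINT z. b z * ift U z * iexp (x \<bullet> z)) = (LBINT y. ift b (x - y) * U (- y))"
  using ift_mult_ift[OF b, of "%y. U (- y)" x] by simp
 also have "... = (LBINT y. ift b (x + y) * U y)"
  using lborel_integral_reflect(1)[of "%y. ift b (x + y) * U y" 0] by simp
 finally show ?thesis .
qed

text \<open>Unfolding the dual definitions leaves \<open>h\<close> tested against the transform of
  \<open>a\<close> times the inverse transform of \<open>\<psi>\<close>. This is a convolution of
  \<open>\<psi>\<close> with the reflected kernel, and Fubini moves it to \<open>h\<close>.\<close>

lemma multiplier_dist_of: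
 fixes a h \<psi> :: "real^'n::finite => complex"
 assumes a: "L1 a" "L1 (inv_fourier a)"
  and h: "h \<in> Borel" "!!x. norm (h x) <= B" and \<psi>: "L1 \<psi>"
 shows "multiplier a (dist_of h) \<psi> = (LBINT x. conv (inv_fourier a) h x * \<psi> x)"
proof -
 define c where "c = complex_of_real ((2 * pi) powr (- real CARD('n)))"
 have "fourier (%\<xi>. a \<xi> * inv_fourier \<psi> \<xi>) x = (LBINT y. inv_fourier a (y - x) * \<psi> y)" for x
 proof -
  have "fourier (%\<xi>. a \<xi> * inv_fourier \<psi> \<xi>) x = c * (LBINT z. a z * ift \<psi> z * iexp ((- x) \<bullet> z))"
   unfolding fourier_eq_ift inv_fourier_eq_ift ift_def[of _ "- x"] c_def[symmetric]
   by (simp add: mult_ac flip: Bochner_Integration.integral_mult_right_zero)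
  also have "... = c * (LBINT y. ift a (- x + y) * \<psi> y)"
   by (subst ift_mult_ift2[OF a(1) \<psi>]) simp
  finally show ?thesis unfolding inv_fourier_eq_ift c_def[symmetric]
   by (simp add: mult.assoc)
 qed
 hence "multiplier a (dist_of h) \<psi> = (LBINT x. h x * (LBINT y. inv_fourier a (y - x) * \<psi> y))"
  by (simp add: multiplier_def dist_inv_fourier_def dist_mult_def dist_fourier_def dist_of_def)
 also have "... = (LBINT x. conv (inv_fourier a) h x * \<psi> x)"
  by (rule conv_Fubini[OF a(2) h \<psi>])
 finally show ?thesis .
qed

lemma dist_of_tempered:
 fixes h :: "real^'n::finite => complex"
 assumes [measurable]: "h \<in> Borel" and h: "!!x. norm (h x) <= B"
 shows "tempered_distribution (dist_of h)"
proof -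
 have i: "L1 (%x. h x * \<psi> x)" if "\<psi> \<in> schwartz" for \<psi> :: "real^'n => complex"
  by (rule integrable_bounded_mult(2)[OF schwartz_integrable[OF that]]) (use h in auto)
 have B: "B >= 0" using h norm_ge_zero order_trans by blast
 define N where "N = Suc CARD('n)"
 define K where "K = (LBINT x. ker N 0 (x :: real^'n))"
 have ik: "L1 (ker N 0 :: real^'n => real)" unfolding N_def by (rule integrable_ker) simp
 have K: "K >= 0" unfolding K_def by (rule integral_nonneg_AE) simp
 have b: "enorm (dist_of h \<psi>) <= ennreal (B * K) * schwartz_seminorm N \<psi>" if \<psi>: "\<psi> \<in> schwartz" for \<psi>
 proof -
  have p: "norm (\<psi> x) <= schwartz_bound \<psi> N * ker N 0 x" for x
   using schwartz_deriv_bound[OF \<psi>, of "[]" N x] zero_less_power[of "1 + norm x" N]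
   by (simp add: ker_def pos_le_divide_eq add_pos_nonneg mult.commute)
  have "norm (dist_of h \<psi>) <= (LBINT x. norm (h x * \<psi> x))" unfolding dist_of_def by (rule integral_norm_bound)
  also have "... <= (LBINT x. B * (schwartz_bound \<psi> N * ker N 0 (x :: real^'n)))"
  proof (rule integral_mono)
   show "L1 (%x. norm (h x * \<psi> x))" by (rule integrable_norm[OF i[OF \<psi>]])
   show "norm (h x * \<psi> x) <= B * (schwartz_bound \<psi> N * ker N 0 x)" for x
    unfolding norm_mult using h p B by (intro mult_mono) auto
  qed (use ik in simp)
  also have "... = B * K * schwartz_bound \<psi> N" unfolding K_def by simp
  finally have "enorm (dist_of h \<psi>) <= ennreal (B * K * schwartz_bound \<psi> N)" by (rule ennreal_leI)
  also have "... = ennreal (B * K) * schwartz_seminorm N \<psi>"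
   using \<psi> B K unfolding schwartz_bound_def schwartz_def by (subst ennreal_mult) auto
  finally show ?thesis .
 qed
 show ?thesis unfolding tempered_distribution_def
 proof (intro conjI)
  show "\<forall>\<psi>\<in>schwartz. \<forall>\<theta>\<in>schwartz. dist_of h (%x. \<psi> x + \<theta> x) = dist_of h \<psi> + dist_of h \<theta>"
   using i by (auto simp: dist_of_def distrib_left)
  show "\<forall>c. \<forall>\<psi>\<in>schwartz. dist_of h (%x. c * \<psi> x) = c * dist_of h \<psi>"
   by (auto simp: dist_of_def mult.left_commute)
 qed (use b in blast)
qed

section \<open>Littlewood-Paley cutoffs and the functions that represent their action\<close>

locale LP =
 fixes \<phi>0 :: "real^'n::finite => real"
 assumes gen: "LP_generator \<phi>0"
begin

lemma smooth_gen: "smooth \<phi>0" and gen_support: "norm \<xi> > 3/2 ==> \<phi>0 \<xi> = 0"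
 and gen_one: "norm \<xi> <= 1 ==> \<phi>0 \<xi> = 1" and gen_nonneg: "0 <= \<phi>0 \<xi>"
 using gen by (auto simp: LP_generator_def schwartz_def)

lemma gen_le_1: "\<phi>0 \<xi> <= 1"
proof -
 have "\<forall>\<xi> \<eta>. norm \<xi> <= norm \<eta> --> \<phi>0 \<eta> <= \<phi>0 \<xi>" using gen by (simp add: LP_generator_def)
 hence "\<phi>0 \<xi> <= \<phi>0 0" by simp
 thus ?thesis using gen_one[of 0] by simp
qed

definition dil :: "real => real^'n => complex" where
 "dil c \<xi> = of_real (\<phi>0 (c *\<^sub>R \<xi>))"

lemma smooth_dil_translate: "smooth (%\<xi>. complex_of_real (\<phi>0 (c *\<^sub>R \<xi> + a)))"
proof -
 have "smooth (%\<xi>. \<phi>0 (c *\<^sub>R \<xi> + a))"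
  by (rule smooth_affine[OF bounded_linear_scaleR_right smooth_gen]) auto
 thus ?thesis by (rule smooth_bounded_linear[OF bounded_linear_of_real])
qed

lemma smooth_dil: "smooth (dil c)"
 using smooth_dil_translate[of c 0] by (simp add: dil_def[abs_def])

lemma dil_zero: "\<bar>c\<bar> * norm \<xi> > 3/2 ==> dil c \<xi> = 0" and dil_one: "\<bar>c\<bar> * norm \<xi> <= 1 ==> dil c \<xi> = 1"
 and norm_dil_le: "norm (dil c \<xi>) <= 1"
 using gen_support[of "c *\<^sub>R \<xi>"] gen_one[of "c *\<^sub>R \<xi>"] gen_le_1[of "c *\<^sub>R \<xi>"] gen_nonneg[of "c *\<^sub>R \<xi>"]
 by (auto simp: dil_def)

lemma bump_schwartz: "c ~= 0 ==> (%x. complex_of_real (\<phi>0 (c *\<^sub>R (x - a)))) \<in> schwartz"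
proof (rule smooth_compact_support_schwartz[where R="norm a + 3/2 / \<bar>c\<bar>"])
 show "smooth (%x. complex_of_real (\<phi>0 (c *\<^sub>R (x - a))))"
  using smooth_dil_translate[of c "- (c *\<^sub>R a)"] by (simp add: scaleR_diff_right)
 fix x :: "real^'n" assume c: "c ~= 0" "norm x > norm a + 3/2 / \<bar>c\<bar>"
 hence "3/2 / \<bar>c\<bar> < norm (x - a)" using norm_triangle_ineq2[of x a] by linarith
 hence "3/2 < \<bar>c\<bar> * norm (x - a)" using c by (simp add: field_simps)
 thus "complex_of_real (\<phi>0 (c *\<^sub>R (x - a))) = 0" using gen_support by simp
qed

lemma dil_schwartz: "c ~= 0 ==> dil c \<in> schwartz"
 using bump_schwartz[of c 0] by (simp add: dil_def[abs_def])

text \<open>Continuous representatives are unique: if two of them differ at \<open>a\<close>, a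
  constant multiple of the difference has positive real part near \<open>a\<close>, and testing with
  a bump supported there contradicts the equality of the integrals.\<close>

lemma fun_of_dist_eq:
 fixes h :: "real^'n => complex"
 assumes h: "continuous_on UNIV h" "!!\<psi>. \<psi> \<in> schwartz ==> L1 (%x. h x * \<psi> x)"
  "!!\<psi>. \<psi> \<in> schwartz ==> u \<psi> = (LBINT x. h x * \<psi> x)"
 shows "fun_of_dist u = h"
 unfolding fun_of_dist_def
proof (rule the_equality)
 fix g assume g: "continuous_on UNIV g \<and> (\<forall>\<psi>\<in>schwartz. L1 (%x. g x * \<psi> x) \<and> u \<psi> = (LBINT x. g x * \<psi> x))"
 show "g = h"
 proof (rule ccontr)
  assume "g ~= h"
  then obtain a where a: "g a ~= h a" by auto
  define c where "c = cnj (g a - h a)"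
  define d where "d = (%x. Re (c * (g x - h x)))"
  have "c * (g a - h a) = of_real ((cmod (g a - h a))\<^sup>2)"
   unfolding c_def by (subst mult.commute) (rule complex_norm_square[symmetric])
  hence da: "d a > 0" using a unfolding d_def by simp
  have dc: "continuous_on UNIV d" unfolding d_def using g h(1) by (intro continuous_intros) auto
  then obtain r where r: "r > 0" "!!x. dist x a < r ==> d x > 0"
  proof -
   have "open {x. 0 < d x}" by (rule open_Collect_less) (use dc in auto)
   thus ?thesis using da that unfolding open_dist by blast
  qed
  \<comment> \<open>The bump is 1 on the ball of radius r / 2 and vanishes beyond 3 r / 4, inside
    the region where \<open>d\<close> is positive.\<close>
  define k where "k = 2 / r"
  have k: "k > 0" using r by (simp add: k_def)
  let ?b = "%x. \<phi>0 (k *\<^sub>R (x - a))"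
  have b: "(%x. complex_of_real (?b x)) \<in> schwartz" using k by (intro bump_schwartz) simp
  have "(LBINT x. g x * of_real (?b x)) = (LBINT x. h x * of_real (?b x))"
   using bspec[OF conjunct2[OF g] b] h(3)[OF b] by simp
  moreover have gi: "L1 (%x. g x * of_real (?b x))" using bspec[OF conjunct2[OF g] b] by simp
  ultimately have "(LBINT x. (g x - h x) * of_real (?b x)) = 0"
   using h(2)[OF b] by (simp add: left_diff_distrib)
  hence z: "(LBINT x. c * ((g x - h x) * of_real (?b x))) = 0" by simp
  have int: "L1 (%x. c * ((g x - h x) * of_real (?b x)))"
   using gi h(2)[OF b] by (simp add: left_diff_distrib)
  have "(LBINT x. Re (c * ((g x - h x) * of_real (?b x)))) = 0"
   unfolding integral_Re[OF int] z by simp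
  moreover have e: "Re (c * ((g x - h x) * of_real (?b x))) = d x * ?b x" for x
   by (simp add: d_def algebra_simps)
  ultimately have I0: "(LBINT x. d x * ?b x) = 0" by simp
  have int': "L1 (%x. d x * ?b x)" using integrable_Re[OF int] by (simp only: e)
  have nn: "d x * ?b x >= 0" for x
  proof (cases "dist x a < r")
   case True thus ?thesis using r(2)[of x] gen_nonneg by simp
  next
   case False
   hence "norm (k *\<^sub>R (x - a)) > 3/2" using r(1) by (simp add: k_def dist_norm divide_simps)
   thus ?thesis using gen_support by simp
  qed
  hence "AE x in lborel. d x * ?b x = 0" using I0 int' by (subst (asm) integral_nonneg_eq_0_iff_AE) auto
  hence "AE x in lborel. x \<notin> ball a (r / 2)"
  proof (rule eventually_mono)
   fix x assume 0: "d x * ?b x = 0"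
   show "x \<notin> ball a (r / 2)"
   proof
    assume x: "x \<in> ball a (r / 2)"
    hence "d x > 0" using r by (simp add: dist_commute)
    moreover have "norm (k *\<^sub>R (x - a)) <= 1" using x r(1) by (simp add: k_def dist_norm norm_minus_commute divide_simps)
    hence "?b x = 1" by (rule gen_one)
    ultimately show False using 0 by simp
   qed
  qed
  hence "emeasure lborel (ball a (r / 2)) = 0"
   by (subst (asm) AE_iff_measurable[where N="ball a (r / 2)"]) auto
  thus False using r(1) unit_ball_vol_pos[of "real CARD('n)"] by (simp add: emeasure_ball)
 qed
qed (use h in auto)

lemma LP_piece_eq:
 fixes a h :: "real^'n => complex"
 assumes a: "a \<in> schwartz" and h: "h \<in> Borel" "!!x. norm (h x) <= B"
 shows "fun_of_dist (multiplier a (dist_of h)) = conv (inv_fourier a) h"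
  and "continuous_on UNIV (conv (inv_fourier a) h)"
proof -
 define c where "c = (2 * pi) powr (- real CARD('n))"
 obtain C where C: "C > 0" "!!y. norm (ift a y) <= C * ker (Suc CARD('n)) 0 y" using ift_schwartz_decay[OF a] by blast
 have b: "norm (inv_fourier a y) <= (c * C) * ker (Suc CARD('n)) 0 y" for y :: "real^'n"
  unfolding inv_fourier_eq_ift using C(2)[of y] by (simp add: norm_mult c_def mult.assoc mult_left_mono)
 have ai: "L1 a" by (rule schwartz_integrable[OF a])
 have cont: "continuous_on UNIV (inv_fourier a)"
 proof -
  have "isCont (ift a) y" for y
   by (rule has_derivative_continuous, rule has_derivative_ift)
     (use schwartz_integrable_deriv(1)[OF a, of "[]"] smooth_imp_measurable[OF schwartz_smooth[OF a]] in auto)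
  thus ?thesis unfolding inv_fourier_eq_ift by (auto intro!: continuous_intros continuous_at_imp_continuous_on)
 qed
 have i: "L1 (inv_fourier a)"
 proof (rule Bochner_Integration.integrable_bound)
  show "L1 (%y::real^'n. (c * C) * ker (Suc CARD('n)) 0 y)" by (intro integrable_mult_right integrable_ker) simp
  show "AE y in lborel. norm (inv_fourier a y) <= norm ((c * C) * ker (Suc CARD('n)) 0 y)"
   using b by (intro AE_I2) (auto intro: order_trans[OF _ abs_ge_self])
 qed (use borel_measurable_continuous_onI[OF cont] in simp)
 show cc: "continuous_on UNIV (conv (inv_fourier a) h)"
  by (rule conv_continuous[OF cont b _ _ h]) (use C in \<open>auto simp: c_def\<close>)
 show "fun_of_dist (multiplier a (dist_of h)) = conv (inv_fourier a) h"
 proof (rule fun_of_dist_eq[OF cc])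
  fix \<psi> :: "real^'n => complex" assume \<psi>: "\<psi> \<in> schwartz"
  show "L1 (%x. conv (inv_fourier a) h x * \<psi> x)"
   by (rule integrable_bounded_mult(2)[OF schwartz_integrable[OF \<psi>] _ conv_bounded[OF i h]])
     (use borel_measurable_continuous_onI[OF cc] in simp)
  show "multiplier a (dist_of h) \<psi> = (LBINT x. conv (inv_fourier a) h x * \<psi> x)"
   by (rule multiplier_dist_of[OF ai i h schwartz_integrable[OF \<psi>]])
 qed
qed

end

section \<open>Symbol classes in terms of single derivatives\<close>

definition wt :: "(real^'n::finite) \<times> (real^'n) => real" where
 "wt \<nu> = 1 + norm (fst \<nu>) + norm (snd \<nu>)"

definition vord :: "(real^'n::finite) \<times> (real^'n) \<times> (real^'n) => real" where
 "vord v = (if fst v ~= 0 then 1 else - 1)"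

text \<open>Derivatives are listed one by one instead of being collected in three multi-indices, so
  that one derivative keeps the form of the estimate and shifts the order by \<open>vord\<close>
  (\<open>symb_dir_deriv\<close>). The real bound \<open>B\<close> stands for the extended
  norm.\<close>

definition symb :: "real => nat => real => 'n::finite symbol => bool" where
 "symb m N B \<sigma> \<longleftrightarrow> smooth \<sigma> \<and> (\<forall>vs x \<nu>. set vs \<subseteq> Basis --> length vs <= N -->
   norm (foldr dir_deriv vs \<sigma> (x, \<nu>)) <= B * wt \<nu> powr (m + sum_list (map vord vs)))"

lemma wt_ge_1: "wt \<nu> >= 1"
 by (simp add: wt_def)

lemma Basis_triple:
 "(Basis :: ((real^'n::finite) \<times> (real^'n) \<times> (real^'n)) set) =
  range (%i. (axis i 1, 0, 0)) \<union> range (%i. (0, axis i 1, 0)) \<union> range (%i. (0, 0, axis i 1))"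
 by (simp add: Basis_prod_def Basis_cart image_Un image_image zero_prod_def Un_assoc)

text \<open>The list is sorted into its x, \<xi> and \<eta> directions; as mixed derivatives
  commute, only the counts matter.\<close>

lemma iter_deriv_symbol_deriv:
 fixes \<sigma> :: "'n::finite symbol"
 assumes "smooth \<sigma>" "set vs \<subseteq> Basis" "length vs <= N"
 obtains \<alpha> \<beta> \<gamma> where "msize \<alpha> <= N" "msize \<beta> <= N" "msize \<gamma> <= N"
  "foldr dir_deriv vs \<sigma> = symbol_deriv \<alpha> \<beta> \<gamma> \<sigma>"
  "sum_list (map vord vs) = real (msize \<alpha>) - real (msize \<beta>) - real (msize \<gamma>)"
proof -
 let ?e1 = "%i::'n. (axis i (1::real), 0::real^'n, 0::real^'n)" and ?e2 = "%i::'n. (0::real^'n, axis i (1::real), 0::real^'n)"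
  and ?e3 = "%i::'n. (0::real^'n, 0::real^'n, axis i (1::real))"
 define xs where "xs = filter (%v. fst v ~= 0) vs"
 define ys where "ys = filter (%v. fst v = 0 \<and> fst (snd v) ~= 0) vs"
 define zs where "zs = filter (%v. fst v = 0 \<and> fst (snd v) = 0) vs"
 define \<alpha> where "\<alpha> = (%i. count (mset xs) (?e1 i))"
 define \<beta> where "\<beta> = (%i. count (mset ys) (?e2 i))"
 define \<gamma> where "\<gamma> = (%i. count (mset zs) (?e3 i))"
 have ax: "axis i (1::real) ~= 0" for i :: 'n by (metis axis_eq_0_iff zero_neq_one)
 have inj: "inj ?e1" "inj ?e2" "inj ?e3" by (auto simp: inj_def axis_eq_axis)
 have sub: "set xs \<subseteq> range ?e1" "set ys \<subseteq> range ?e2" "set zs \<subseteq> range ?e3"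
  using assms(2) unfolding Basis_triple xs_def ys_def zs_def by (auto simp: ax)
 have m: "mset (dirs ?e1 \<alpha>) = mset xs" "mset (dirs ?e2 \<beta>) = mset ys" "mset (dirs ?e3 \<gamma>) = mset zs"
  unfolding \<alpha>_def \<beta>_def \<gamma>_def by (rule mset_dirs; use inj sub in blast)+
 have part: "mset xs + (mset ys + mset zs) = mset vs"
 proof -
  have "mset ys + mset zs = filter_mset (%v. fst v = 0) (mset vs)"
   unfolding ys_def zs_def by (induction vs) auto
  thus ?thesis unfolding xs_def using multiset_partition[of "mset vs" "%v. fst v ~= 0"] by simp
 qed
 have len: "msize \<alpha> = length xs" "msize \<beta> = length ys" "msize \<gamma> = length zs"
  using m[THEN mset_eq_length] by (simp_all add: length_dirs)
 have "length xs <= length vs" "length ys <= length vs" "length zs <= length vs"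
  by (auto simp: xs_def ys_def zs_def)
 hence 1: "msize \<alpha> <= N" "msize \<beta> <= N" "msize \<gamma> <= N" using len assms(3) by auto
 have "foldr dir_deriv vs \<sigma> = foldr dir_deriv (dirs ?e1 \<alpha> @ dirs ?e2 \<beta> @ dirs ?e3 \<gamma>) \<sigma>"
  by (rule iter_deriv_mset) (use assms m part in auto)
 also have "... = symbol_deriv \<alpha> \<beta> \<gamma> \<sigma>" by (simp add: symbol_deriv_def mderiv_eq_dirs)
 finally have 2: "foldr dir_deriv vs \<sigma> = symbol_deriv \<alpha> \<beta> \<gamma> \<sigma>" .
 have "sum_list (map vord vs) = real (length xs) - real (length ys) - real (length zs)"
  unfolding xs_def ys_def zs_def by (induction vs) (auto simp: vord_def)
 hence 3: "sum_list (map vord vs) = real (msize \<alpha>) - real (msize \<beta>) - real (msize \<gamma>)" using len by simp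
 show thesis by (rule that[OF 1 2 3])
qed

text \<open>Only finitely many multi-indices enter the norm and each supremum is finite, so the norm
  is finite and \<open>enn2real\<close> loses nothing.\<close>

lemma BS11_symb:
 fixes \<sigma> :: "'n::finite symbol"
 assumes \<sigma>: "\<sigma> \<in> BS11 m"
 shows "BS11_norm m N \<sigma> < \<infinity>" "symb m N (enn2real (BS11_norm m N \<sigma>)) \<sigma>"
proof -
 let ?I = "{(\<alpha>, \<beta>, \<gamma>). msize (\<alpha> :: 'n multiindex) <= N \<and> msize (\<beta> :: 'n multiindex) <= N \<and> msize (\<gamma> :: 'n multiindex) <= N}"
 let ?h = "%\<alpha> \<beta> \<gamma> x \<xi> \<eta>. (1 + norm \<xi> + norm \<eta>) powr (- (m + real (msize \<alpha>) - real (msize \<beta>) - real (msize \<gamma>))) * norm (symbol_deriv \<alpha> \<beta> \<gamma> \<sigma> (x, \<xi>, \<eta>))"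
 let ?S = "%(\<alpha>, \<beta>, \<gamma>). SUP (x, \<xi>, \<eta>). ennreal (?h \<alpha> \<beta> \<gamma> x \<xi> \<eta>)"
 have fin: "?S p < \<infinity>" for p
 proof (cases p)
  case (fields \<alpha> \<beta> \<gamma>)
  let ?k = "m + real (msize \<alpha>) - real (msize \<beta>) - real (msize \<gamma>)"
  obtain C where C: "!!x \<xi> \<eta>. norm (symbol_deriv \<alpha> \<beta> \<gamma> \<sigma> (x, \<xi>, \<eta>)) <= C * (1 + norm \<xi> + norm \<eta>) powr ?k"
   using \<sigma> unfolding BS11_def by blast
  have "?h \<alpha> \<beta> \<gamma> x \<xi> \<eta> <= C" for x \<xi> \<eta>
  proof -
   have pos: "1 + norm \<xi> + norm \<eta> > 0" by (simp add: add_pos_nonneg)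
   have "?h \<alpha> \<beta> \<gamma> x \<xi> \<eta> <= (1 + norm \<xi> + norm \<eta>) powr (- ?k) * (C * (1 + norm \<xi> + norm \<eta>) powr ?k)"
    by (rule mult_left_mono[OF C]) simp
   also have "... = C" using powr_add[of "1 + norm \<xi> + norm \<eta>" "- ?k" ?k] pos by simp
   finally show ?thesis .
  qed
  hence "?S p <= ennreal C" unfolding fields by (auto intro!: SUP_least ennreal_leI)
  thus ?thesis by (rule le_less_trans) simp
 qed
 have finI: "finite ?I"
 proof (rule finite_subset)
  show "?I \<subseteq> {\<alpha>. msize \<alpha> <= N} \<times> {\<alpha>. msize \<alpha> <= N} \<times> {\<alpha>. msize \<alpha> <= N}" by auto
 qed (intro finite_cartesian_product finite_msize)
 have ne: "?I ~= {}" by (auto intro!: exI[of _ "%_. 0"] simp: msize_def)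
 have "BS11_norm m N \<sigma> = Max (?S ` ?I)" unfolding BS11_norm_def
  using finI ne by (subst Max_Sup) auto
 also have "... < \<infinity>" using finI ne fin by (subst Max_less_iff) auto
 finally show f: "BS11_norm m N \<sigma> < \<infinity>" .
 have sm: "smooth \<sigma>" using \<sigma> by (simp add: BS11_def)
 show "symb m N (enn2real (BS11_norm m N \<sigma>)) \<sigma>"
  unfolding symb_def
 proof (intro conjI sm allI impI)
  fix vs :: "((real^'n) \<times> (real^'n) \<times> (real^'n)) list" and x :: "real^'n" and \<nu> :: "(real^'n) \<times> (real^'n)" assume vs: "set vs \<subseteq> Basis" "length vs <= N"
  obtain \<alpha> \<beta> \<gamma> where abc: "msize \<alpha> <= N" "msize \<beta> <= N" "msize \<gamma> <= N"
   "foldr dir_deriv vs \<sigma> = symbol_deriv \<alpha> \<beta> \<gamma> \<sigma>"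
   "sum_list (map vord vs) = real (msize \<alpha>) - real (msize \<beta>) - real (msize \<gamma>)"
   by (rule iter_deriv_symbol_deriv[OF sm vs])
  obtain \<xi> \<eta> where z: "\<nu> = (\<xi>, \<eta>)" by (cases \<nu>)
  let ?k = "m + real (msize \<alpha>) - real (msize \<beta>) - real (msize \<gamma>)"
  have "ennreal (?h \<alpha> \<beta> \<gamma> x \<xi> \<eta>) <= ?S (\<alpha>, \<beta>, \<gamma>)"
   by (auto intro: SUP_upper2[of "(x, \<xi>, \<eta>)"])
  also have "... <= BS11_norm m N \<sigma>" unfolding BS11_norm_def
   by (rule SUP_upper2[of "(\<alpha>, \<beta>, \<gamma>)"]) (use abc in auto)
  finally have h: "?h \<alpha> \<beta> \<gamma> x \<xi> \<eta> <= enn2real (BS11_norm m N \<sigma>)"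
   using f by (cases "BS11_norm m N \<sigma>") (auto simp: ennreal_le_iff2)
  have pos: "wt \<nu> > 0" using wt_ge_1[of \<nu>] by linarith
  have "norm (symbol_deriv \<alpha> \<beta> \<gamma> \<sigma> (x, \<nu>)) = ?h \<alpha> \<beta> \<gamma> x \<xi> \<eta> * wt \<nu> powr ?k"
   using powr_add[of "wt \<nu>" "- ?k" ?k] pos unfolding z wt_def by (simp add: mult_ac)
  also have "... <= enn2real (BS11_norm m N \<sigma>) * wt \<nu> powr ?k" by (rule mult_right_mono[OF h]) simp
  finally show "norm (foldr dir_deriv vs \<sigma> (x, \<nu>)) <= enn2real (BS11_norm m N \<sigma>) * wt \<nu> powr (m + sum_list (map vord vs))"
   unfolding abc by (simp add: algebra_simps)
 qed
qed

lemma symbD: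
 "symb m N B \<sigma> ==> set vs \<subseteq> Basis ==> length vs <= N ==>
  norm (foldr dir_deriv vs \<sigma> (x, \<nu>)) <= B * wt \<nu> powr (m + sum_list (map vord vs))"
 unfolding symb_def by blast

lemma symb_smooth: "symb m N B \<sigma> ==> smooth \<sigma>"
 by (simp add: symb_def)

lemma symb_bound: "symb m N B \<sigma> ==> norm (\<sigma> (x, \<nu>)) <= B * wt \<nu> powr m"
 using symbD[of m N B \<sigma> "[]"] by simp

lemma symb_nonneg: "symb m N B \<sigma> ==> B >= 0"
 using symb_bound[of m N B \<sigma> 0 0] by (auto simp: wt_def intro: order_trans[OF norm_ge_zero])

lemma symb_dir_deriv:
 fixes \<sigma> :: "'n::finite symbol"
 assumes "symb m (Suc N) B \<sigma>" "v \<in> Basis" shows "symb (m + vord v) N B (dir_deriv v \<sigma>)"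
 unfolding symb_def
proof (intro conjI allI impI)
 show "smooth (dir_deriv v \<sigma>)" using assms by (auto intro: smooth_dir_deriv symb_smooth)
 fix vs :: "((real^'n) \<times> (real^'n) \<times> (real^'n)) list" and x :: "real^'n" and \<nu> :: "(real^'n) \<times> (real^'n)" assume "set vs \<subseteq> Basis" "length vs <= N"
 thus "norm (foldr dir_deriv vs (dir_deriv v \<sigma>) (x, \<nu>)) <= B * wt \<nu> powr (m + vord v + sum_list (map vord vs))"
  using symbD[OF assms(1), of "vs @ [v]" x \<nu>] assms(2) by (simp add: algebra_simps)
qed

lemma symb_add: "symb m N A \<sigma> ==> symb m N B \<tau> ==> symb m N (A + B) (%p. \<sigma> p + \<tau> p)"
 unfolding symb_def by (auto intro!: smooth_add simp: iter_deriv_add distrib_right intro!: norm_triangle_mono)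

lemma symb_mono:
 fixes \<sigma> :: "'n::finite symbol"
 shows "symb m N A \<sigma> ==> A <= B ==> M <= N ==> symb m M B \<sigma>"
 unfolding symb_def[of m M]
proof (intro conjI allI impI)
 fix vs :: "((real^'n) \<times> (real^'n) \<times> (real^'n)) list" and x :: "real^'n" and \<nu> :: "(real^'n) \<times> (real^'n)" assume *: "symb m N A \<sigma>" "A <= B" "M <= N" "set vs \<subseteq> Basis" "length vs <= M"
 have "norm (foldr dir_deriv vs \<sigma> (x, \<nu>)) <= A * wt \<nu> powr (m + sum_list (map vord vs))"
  by (rule symbD[OF *(1)]) (use * in auto)
 also have "... <= B * wt \<nu> powr (m + sum_list (map vord vs))" using * by (intro mult_right_mono) auto
 finally show "norm (foldr dir_deriv vs \<sigma> (x, \<nu>)) <= B * wt \<nu> powr (m + sum_list (map vord vs))" .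
qed (rule symb_smooth)

lemma symb_cmult:
 fixes \<sigma> :: "'n::finite symbol"
 shows "symb m N B \<sigma> ==> norm c <= 1 ==> symb m N B (%p. c * \<sigma> p)"
 unfolding symb_def[of m N B "%p. c * \<sigma> p"]
proof (intro conjI allI impI)
 assume *: "symb m N B \<sigma>" "norm c <= 1"
 note sm = symb_smooth[OF *(1)]
 show "smooth (%p. c * \<sigma> p)" by (rule smooth_bounded_linear[OF bounded_linear_mult_right sm])
 fix vs :: "((real^'n) \<times> (real^'n) \<times> (real^'n)) list" and x :: "real^'n" and \<nu> :: "(real^'n) \<times> (real^'n)" assume vs: "set vs \<subseteq> Basis" "length vs <= N"
 have "norm (foldr dir_deriv vs (%p. c * \<sigma> p) (x, \<nu>)) = norm c * norm (foldr dir_deriv vs \<sigma> (x, \<nu>))"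
  by (simp only: iter_deriv_bounded_linear[OF bounded_linear_mult_right sm vs(1)] norm_mult)
 also have "... <= norm (foldr dir_deriv vs \<sigma> (x, \<nu>))" using *(2) by (intro mult_left_le_one_le) auto
 also have "... <= B * wt \<nu> powr (m + sum_list (map vord vs))" by (rule symbD[OF *(1) vs])
 finally show "norm (foldr dir_deriv vs (%p. c * \<sigma> p) (x, \<nu>)) <= B * wt \<nu> powr (m + sum_list (map vord vs))" .
qed

text \<open>A derivative of the linear form is constant, so at most one of N derivatives falls on
  it, which gives N + 1 terms. When a frequency derivative does, one power of \<open>wt\<close> is
  lost, in agreement with its \<open>vord\<close>; derivatives in x do not see the form.\<close>

lemma symb_mult_linear:
 fixes \<sigma> :: "'n::finite symbol" and l :: "(real^'n) \<times> (real^'n) \<times> (real^'n) => real"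
 assumes l: "bounded_linear l" "!!x \<nu>. \<bar>l (x, \<nu>)\<bar> <= wt \<nu>" "!!v. v \<in> Basis ==> \<bar>l v\<bar> <= 1" "!!v. v \<in> Basis ==> fst v ~= 0 ==> l v = 0"
 shows "symb m N B \<sigma> ==> symb (m + 1) N ((1 + real N) * B) (%p. of_real (l p) * \<sigma> p)"
proof (induction N arbitrary: m \<sigma>)
 have bl: "bounded_linear (%p. complex_of_real (l p))" by (rule bounded_linear_compose[OF bounded_linear_of_real l(1)])
 have sl: "smooth (%p. complex_of_real (l p))" by (rule smooth_linear[OF bl])
 have base: "norm (of_real (l (x, \<nu>)) * \<sigma> (x, \<nu>)) <= B * wt \<nu> powr (m + 1)" if "symb m N B \<sigma>" for m N x \<nu> and \<sigma> :: "'n symbol"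
 proof -
  have "norm (of_real (l (x, \<nu>)) * \<sigma> (x, \<nu>)) <= wt \<nu> * (B * wt \<nu> powr m)"
   unfolding norm_mult norm_of_real using l(2) symb_bound[OF that] wt_ge_1[of \<nu>] by (intro mult_mono) auto
  also have "... = B * wt \<nu> powr (m + 1)" using wt_ge_1[of \<nu>] by (simp add: powr_add)
  finally show ?thesis .
 qed
 {
  case 0
  thus ?case unfolding symb_def[of "m + 1"]
   using base[OF 0] by (auto intro!: smooth_mult sl symb_smooth[OF 0] simp del: split_paired_All)
 next
  case (Suc N)
  have B: "B >= 0" by (rule symb_nonneg[OF Suc.prems])
  show ?case unfolding symb_def[of "m + 1"]
  proof (intro conjI allI impI)
   show "smooth (%p. of_real (l p) * \<sigma> p)" by (intro smooth_mult sl symb_smooth[OF Suc.prems])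
   fix vs :: "((real^'n) \<times> (real^'n) \<times> (real^'n)) list" and x :: "real^'n" and \<nu> :: "(real^'n) \<times> (real^'n)" assume vs: "set vs \<subseteq> Basis" "length vs <= Suc N"
   have w: "wt \<nu> >= 1" by (rule wt_ge_1)
   show "norm (foldr dir_deriv vs (%p. of_real (l p) * \<sigma> p) (x, \<nu>)) <= (1 + real (Suc N)) * B * wt \<nu> powr (m + 1 + sum_list (map vord vs))"
   proof (cases vs rule: rev_cases)
    case Nil
    have "B * wt \<nu> powr (m + 1) <= (1 + real (Suc N)) * B * wt \<nu> powr (m + 1)"
     using B by (intro mult_right_mono) (auto simp: algebra_simps)
    thus ?thesis using base[OF Suc.prems, of x \<nu>] Nil by simp
   next
    case (snoc us v)
    have v: "v \<in> Basis" and us: "set us \<subseteq> Basis" "length us <= N" using vs snoc by auto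
    have "dir_deriv v (%p. complex_of_real (l p)) = (%p. of_real (l v))"
     by (rule ext, rule dir_derivI) (rule bounded_linear_imp_has_derivative[OF bl])
    hence d: "dir_deriv v (%p. of_real (l p) * \<sigma> p) = (%p. of_real (l p) * dir_deriv v \<sigma> p + of_real (l v) * \<sigma> p)"
     by (simp add: dir_deriv_mult sl symb_smooth[OF Suc.prems])
    have sm: "smooth (%p. of_real (l p) * dir_deriv v \<sigma> p)" "smooth (%p. of_real (l v) * \<sigma> p)"
     using v by (auto intro!: smooth_mult sl smooth_dir_deriv smooth_const symb_smooth[OF Suc.prems])
    let ?k = "m + 1 + sum_list (map vord vs)"
    have 1: "norm (foldr dir_deriv us (%p. of_real (l p) * dir_deriv v \<sigma> p) (x, \<nu>)) <= (1 + real N) * B * wt \<nu> powr ?k"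
     using symbD[OF Suc.IH[OF symb_dir_deriv[OF Suc.prems v]] us, of x \<nu>] unfolding snoc by (simp add: algebra_simps)
    have 2: "norm (foldr dir_deriv us (%p. of_real (l v) * \<sigma> p) (x, \<nu>)) <= B * wt \<nu> powr ?k"
    proof (cases "fst v = 0")
     case True
     have "norm (foldr dir_deriv us (%p. of_real (l v) * \<sigma> p) (x, \<nu>)) = \<bar>l v\<bar> * norm (foldr dir_deriv us \<sigma> (x, \<nu>))"
      using us by (simp add: iter_deriv_bounded_linear[OF bounded_linear_mult_right] symb_smooth[OF Suc.prems] norm_mult)
     also have "... <= 1 * (B * wt \<nu> powr (m + sum_list (map vord us)))"
      using symbD[OF Suc.prems us(1), of x \<nu>] us(2) l(3)[OF v] by (intro mult_mono) auto
     finally show ?thesis using True by (simp add: snoc vord_def)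
    next
     case False
     hence "l v = 0" using l(4)[OF v] by blast
     hence "foldr dir_deriv us (%p. of_real (l v) * \<sigma> p) = (%p. of_real (l v) * foldr dir_deriv us \<sigma> p)"
      using us by (intro iter_deriv_bounded_linear[OF bounded_linear_mult_right] symb_smooth[OF Suc.prems]) auto
     thus ?thesis using \<open>l v = 0\<close> B by simp
    qed
    have "norm (foldr dir_deriv vs (%p. of_real (l p) * \<sigma> p) (x, \<nu>)) <= (1 + real N) * B * wt \<nu> powr ?k + B * wt \<nu> powr ?k"
     unfolding snoc using us sm by (simp add: d iter_deriv_add) (intro norm_triangle_mono 1[unfolded snoc, simplified] 2[unfolded snoc, simplified])
    thus ?thesis by (simp add: algebra_simps)
   qed
  qed
 }
qed

text \<open>The \<open>b\<close>-derivative of the operator with symbol \<open>\<sigma>\<close> is the operator with this symbol.\<close>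

definition xderiv :: "real^'n::finite => 'n symbol => 'n symbol" where
 "xderiv b \<sigma> p = dir_deriv (b, 0) \<sigma> p + \<i> * (of_real ((fst (snd p) + snd (snd p)) \<bullet> b) * \<sigma> p)"

lemma symb_xderiv:
 fixes \<sigma> :: "'n::finite symbol"
 assumes \<sigma>: "symb m (Suc N) B \<sigma>" and b: "b \<in> Basis"
 shows "symb (m + 1) N ((2 + real N) * B) (xderiv b \<sigma>)"
proof -
 have v: "(b, 0) \<in> (Basis :: ((real^'n) \<times> (real^'n) \<times> (real^'n)) set)" using b by (auto simp: Basis_prod_def)
 have "vord (b, 0) = 1" using b nonzero_Basis by (auto simp: vord_def)
 hence 1: "symb (m + 1) N B (dir_deriv (b, 0) \<sigma>)" using symb_dir_deriv[OF \<sigma> v] by simp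
 let ?l = "%p :: (real^'n) \<times> (real^'n) \<times> (real^'n). (fst (snd p) + snd (snd p)) \<bullet> b"
 have bl: "bounded_linear ?l"
  by (intro bounded_linear_intros)
 have "symb (m + 1) N ((1 + real N) * B) (%p. of_real (?l p) * \<sigma> p)"
 proof (rule symb_mult_linear[OF bl])
  show "symb m N B \<sigma>" by (rule symb_mono[OF \<sigma>]) auto
  show "\<bar>?l (x, \<nu>)\<bar> <= wt \<nu>" for x \<nu>
  proof -
   have "\<bar>?l (x, \<nu>)\<bar> <= norm (fst \<nu> + snd \<nu>) * norm b" using Cauchy_Schwarz_ineq2 by simp
   also have "... <= norm (fst \<nu>) + norm (snd \<nu>)" using b norm_triangle_ineq by simp
   finally show ?thesis by (simp add: wt_def)
  qed
  show "\<bar>?l v\<bar> <= 1" if "v \<in> Basis" for v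
   using that b by (auto simp: Basis_prod_def inner_Basis)
  show "?l v = 0" if "v \<in> Basis" "fst v ~= 0" for v
   using that by (auto simp: Basis_prod_def)
 qed
 hence "symb (m + 1) N ((1 + real N) * B) (%p. \<i> * (of_real (?l p) * \<sigma> p))" by (rule symb_cmult) simp
 from symb_add[OF 1 this] show ?thesis unfolding xderiv_def[abs_def] by (simp add: algebra_simps)
qed

section \<open>Kernels of frequency-localised symbols\<close>

text \<open>A function supported in frequencies up to R 2^j whose derivatives cost 2^-j each has a
  transform that decays at the scale 2^-j; the volume of the support supplies the factor 2^(j DIM)
  of \<open>ker\<close>.\<close>

lemma ift_localized:
 fixes b :: "'a::euclidean_space => complex"
 assumes b: "smooth b" and R: "R > 0" "!!z. norm z > R * 2 ^ j ==> b z = 0"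
  and M: "!!v k z. v \<in> Basis ==> k <= N ==> norm (foldr dir_deriv (replicate k v) b z) <= M / (2 ^ j) ^ k"
 shows "norm (ift b y) <= ((real DIM('a) + 1) ^ Suc N * (unit_ball_vol (real DIM('a)) * R ^ DIM('a))) * M * ker N j y"
proof -
 define V where "V = unit_ball_vol (real DIM('a)) * R ^ DIM('a)"
 have M0: "M >= 0" using M[of "SOME v. v \<in> Basis" 0 0] by (auto simp: SOME_Basis intro: order_trans[OF norm_ge_zero])
 have int: "L1 (foldr dir_deriv (replicate k v) b)"
  and le: "(LBINT z. norm (foldr dir_deriv (replicate k v) b z)) <= M / (2 ^ j) ^ k * (V * (2 ^ j) ^ DIM('a))"
  if v: "v \<in> Basis" and k: "k <= N" for v k
 proof -
  let ?D = "foldr dir_deriv (replicate k v) b"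
  have [measurable]: "?D \<in> Borel"
   by (intro smooth_imp_measurable smooth_iter_deriv b) (use v in auto)
  have z: "?D z = 0" if "norm z > R * 2 ^ j" for z
   by (rule iter_deriv_zero[of "{z. norm z > R * 2 ^ j}"]) (use R that in \<open>auto intro!: open_Collect_less continuous_intros\<close>)
  have ii: "L1 (%z. M / (2 ^ j) ^ k * indicator (cball (0::'a) (R * 2 ^ j)) z)"
   by (intro integrable_mult_right) (auto simp: integrable_indicator_iff emeasure_cball R(1) less_imp_le)
  have bd: "norm (?D z) <= M / (2 ^ j) ^ k * indicator (cball (0::'a) (R * 2 ^ j)) z" for z
   using M[OF v k, of z] z[of z] by (cases "norm z <= R * 2 ^ j") (auto simp del: foldr_replicate)
  show 1: "L1 ?D"
  proof (rule Bochner_Integration.integrable_bound[OF ii])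
   show "AE z in lborel. norm (?D z) <= norm (M / (2 ^ j) ^ k * indicator (cball (0::'a) (R * 2 ^ j)) z)"
    by (rule AE_I2, rule order_trans[OF bd], simp only: real_norm_def abs_ge_self)
  qed measurable
  have "(LBINT z. norm (?D z)) <= (LBINT z. M / (2 ^ j) ^ k * indicator (cball (0::'a) (R * 2 ^ j)) z)"
   by (rule integral_mono[OF integrable_norm[OF 1] ii bd])
  also have "... = M / (2 ^ j) ^ k * (V * (2 ^ j) ^ DIM('a))"
   using R(1) by (simp add: content_cball V_def power_mult_distrib)
  finally show "(LBINT z. norm (?D z)) <= M / (2 ^ j) ^ k * (V * (2 ^ j) ^ DIM('a))" .
 qed
 have "(1 + 2 ^ j * norm y) ^ N * norm (ift b y) <= (real DIM('a) + 1) ^ Suc N * (M * (V * (2 ^ j) ^ DIM('a)))"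
 proof (rule ift_decay[OF b int])
  show "(LBINT z. norm (b z)) <= M * (V * (2 ^ j) ^ DIM('a))"
   using le[of "SOME v. v \<in> Basis" 0] by (simp add: SOME_Basis)
  show "(2 ^ j) ^ N * (LBINT z. norm (foldr dir_deriv (replicate N v) b z)) <= M * (V * (2 ^ j) ^ DIM('a))" if "v \<in> Basis" for v
   using mult_left_mono[OF le[OF that order_refl], of "(2 ^ j) ^ N"] by (simp del: foldr_replicate)
 qed auto
 moreover have "(1 + 2 ^ j * norm y) ^ N > 0" by (intro zero_less_power add_pos_nonneg) auto
 ultimately show ?thesis unfolding V_def[symmetric]
  by (simp add: ker_def pos_le_divide_eq mult_ac power_mult)
qed

abbreviation wave :: "'a::real_inner => 'a \<times> 'a => complex" where "wave x \<nu> \<equiv> iexp ((x, x) \<bullet> \<nu>)"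

text \<open>\<open>F\<close> is an arbitrary function of both frequencies, so that frequency cutoffs
  act on \<open>F\<close> and leave the symbol alone. The normalising constant is moved into the
  symbol in \<open>bilinear_op_eq\<close>.\<close>

definition Bil :: "'n::finite symbol => ((real^'n) \<times> (real^'n) => complex) => real^'n => complex" where
 "Bil \<sigma> F x = (LBINT \<nu>. \<sigma> (x, \<nu>) * F \<nu> * wave x \<nu>)"

lemma iter_deriv_slice:
 fixes \<sigma> :: "'n::finite symbol"
 assumes "smooth \<sigma>" "set vs \<subseteq> Basis"
 shows "foldr dir_deriv vs (%\<nu>. \<sigma> (x, \<nu>)) = (%\<nu>. foldr dir_deriv (map (Pair 0) vs) \<sigma> (x, \<nu>))"
 using assms(2)
proof (induction vs)
 case (Cons v vs)
 have B: "set (map (Pair (0::real^'n)) vs) \<subseteq> Basis" using Cons.prems by (auto simp: Basis_prod_def)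
 have "dir_deriv v (%\<nu>. foldr dir_deriv (map (Pair 0) vs) \<sigma> ((0, \<nu>) + (x, 0))) = (%\<nu>. 1 *\<^sub>R dir_deriv (0, v) (foldr dir_deriv (map (Pair 0) vs) \<sigma>) ((0, \<nu>) + (x, 0)))"
  by (rule dir_deriv_affine[OF _ smooth_iter_deriv[OF assms(1) B]]) (auto intro: bounded_linear_intros)
 thus ?case using Cons by simp
qed simp

lemma smooth_slice:
 fixes \<sigma> :: "'n::finite symbol"
 assumes "smooth \<sigma>" shows "smooth (%\<nu>. \<sigma> (x, \<nu>))"
proof -
 have "smooth (%\<nu>. \<sigma> ((0, \<nu>) + (x, 0)))"
 proof (rule smooth_affine[OF _ assms])
  show "\<exists>c e. (0::real^'n, b) = c *\<^sub>R e \<and> e \<in> Basis" if "b \<in> Basis" for b :: "(real^'n) \<times> (real^'n)"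
   using that by (intro exI[of _ 1] exI[of _ "(0, b)"]) (auto simp: Basis_prod_def)
 qed (auto intro: bounded_linear_intros)
 thus ?thesis by simp
qed

lemma ker_prod:
 fixes y z :: "real^'n::finite"
 shows "ker (2 * L) j (y, z) <= ker L j y * ker L j z"
proof -
 let ?a = "1 + 2 ^ j * norm y" and ?b = "1 + 2 ^ j * norm z" and ?c = "1 + 2 ^ j * norm (y, z)"
 have "norm y <= norm (y, z)" "norm z <= norm (y, z)" by (auto simp: norm_Pair real_le_rsqrt)
 hence "?a ^ L * ?b ^ L <= ?c ^ L * ?c ^ L"
  by (intro mult_mono power_mono add_left_mono mult_left_mono) auto
 moreover have "?a ^ L * ?b ^ L > 0" by (intro mult_pos_pos zero_less_power add_pos_nonneg) auto
 ultimately have "1 / (?c ^ L * ?c ^ L) <= 1 / (?a ^ L * ?b ^ L)" by (intro divide_left_mono) auto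
 hence "2 ^ (j * (2 * CARD('n))) * (1 / (?c ^ L * ?c ^ L)) <= 2 ^ (j * (2 * CARD('n))) * (1 / (?a ^ L * ?b ^ L))"
  by (rule mult_left_mono) simp
 thus ?thesis by (simp add: ker_def mult_2 power_add distrib_left)
qed

context LP
begin

text \<open>Lives where the larger of the two frequencies is between 1/4 and 3, and is 1 when it is
  between 1/2 and 2. The flag \<open>b\<close> marks the scale j = 0, where the origin is not
  removed.\<close>

definition chi_base :: "bool => (real^'n) \<times> (real^'n) => complex" where
 "chi_base b \<nu> = dil (1/2) (fst \<nu>) * dil (1/2) (snd \<nu>) - (if b then 0 else dil 4 (fst \<nu>) * dil 4 (snd \<nu>))"

definition chi :: "nat => (real^'n) \<times> (real^'n) => complex" where
 "chi j \<nu> = chi_base (j = 0) ((1 / 2 ^ j) *\<^sub>R \<nu>)"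

lemma smooth_dil_comp:
 "smooth (%\<nu> :: (real^'n) \<times> (real^'n). dil c (fst \<nu>))" "smooth (%\<nu> :: (real^'n) \<times> (real^'n). dil c (snd \<nu>))"
proof -
 obtain e :: "real^'n" where e: "e \<in> Basis" using nonempty_Basis by blast
 have "\<exists>c u. fst b = c *\<^sub>R u \<and> u \<in> Basis" "\<exists>c u. snd b = c *\<^sub>R u \<and> u \<in> Basis" if b: "b \<in> Basis" for b :: "(real^'n) \<times> (real^'n)"
 proof -
  from b consider u where "b = (u, 0)" "u \<in> Basis" | u where "b = (0, u)" "u \<in> Basis" by (auto simp: Basis_prod_def)
  thus "\<exists>c u. fst b = c *\<^sub>R u \<and> u \<in> Basis" "\<exists>c u. snd b = c *\<^sub>R u \<and> u \<in> Basis"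
   using e by (metis fst_conv snd_conv scaleR_one scaleR_zero_left)+
 qed
 note ex = this
 have "smooth (%\<nu> :: (real^'n) \<times> (real^'n). dil c (fst \<nu> + 0))"
  by (rule smooth_affine[OF bounded_linear_fst smooth_dil ex(1)])
 moreover have "smooth (%\<nu> :: (real^'n) \<times> (real^'n). dil c (snd \<nu> + 0))"
  by (rule smooth_affine[OF bounded_linear_snd smooth_dil ex(2)])
 ultimately show "smooth (%\<nu> :: (real^'n) \<times> (real^'n). dil c (fst \<nu>))" "smooth (%\<nu> :: (real^'n) \<times> (real^'n). dil c (snd \<nu>))" by simp_all
qed

lemma smooth_chi_base: "smooth (chi_base b)"
proof -
 have "smooth (%\<nu>. dil (1/2) (fst \<nu>) * dil (1/2) (snd \<nu>) + (- (if b then 0 else 1)) * (dil 4 (fst \<nu>) * dil 4 (snd \<nu>)))"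
  by (intro smooth_add smooth_mult smooth_dil_comp smooth_const)
 thus ?thesis by (simp add: chi_base_def[abs_def] split: if_splits)
qed

lemma chi_base_zero:
 "norm (fst \<nu>) > 3 \<or> norm (snd \<nu>) > 3 ==> chi_base b \<nu> = 0"
 "norm (fst \<nu>) <= 1/4 ==> norm (snd \<nu>) <= 1/4 ==> chi_base False \<nu> = 0"
 by (auto simp: chi_base_def dil_zero dil_one)

text \<open>There are finitely many lists of length at most \<open>N\<close> and two profiles, with
  derivatives bounded by compact support; dilation supplies 2^-j per derivative.\<close>

lemma chi_deriv_bound:
 obtains A where "A >= 0" "!!vs j \<nu>. set vs \<subseteq> Basis ==> length vs <= N ==> norm (foldr dir_deriv vs (chi j) \<nu>) <= A * (1 / 2 ^ j) ^ length vs"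
proof -
 have "\<exists>C. \<forall>\<nu>. norm (foldr dir_deriv vs (chi_base b) \<nu>) <= C" if "set vs \<subseteq> Basis" for vs b
 proof -
  have "chi_base b \<nu> = 0" if "norm \<nu> > 6" for \<nu>
  proof (rule chi_base_zero)
   have "norm \<nu> <= norm (fst \<nu>) + norm (snd \<nu>)" by (cases \<nu>) (simp add: norm_Pair sqrt_sum_squares_le_sum)
   thus "norm (fst \<nu>) > 3 \<or> norm (snd \<nu>) > 3" using that by linarith
  qed
  from smooth_compact_support_bounded[OF smooth_chi_base this that] show ?thesis by metis
 qed
 then obtain C where C: "!!vs b \<nu>. set vs \<subseteq> Basis ==> norm (foldr dir_deriv vs (chi_base b) \<nu>) <= C vs b" by metis
 define S where "S = {vs :: ((real^'n) \<times> (real^'n)) list. set vs \<subseteq> Basis \<and> length vs <= N}"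
 have fS: "finite S" unfolding S_def by (rule finite_lists_length_le) simp
 define A where "A = (\<Sum>vs\<in>S. \<bar>C vs True\<bar> + \<bar>C vs False\<bar>)"
 have A: "norm (foldr dir_deriv vs (chi_base b) \<nu>) <= A" if "set vs \<subseteq> Basis" "length vs <= N" for vs b \<nu>
 proof -
  have "norm (foldr dir_deriv vs (chi_base b) \<nu>) <= C vs b" by (rule C[OF that(1)])
  also have "... <= \<bar>C vs True\<bar> + \<bar>C vs False\<bar>" by (cases b) auto
  also have "... <= A" unfolding A_def using that fS by (intro member_le_sum) (auto simp: S_def)
  finally show ?thesis .
 qed
 show thesis
 proof (rule that[of A])
  show "A >= 0" unfolding A_def by (intro sum_nonneg) auto
  fix vs :: "((real^'n) \<times> (real^'n)) list" and j and \<nu> :: "(real^'n) \<times> (real^'n)" assume vs: "set vs \<subseteq> Basis" "length vs <= N"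
  have "foldr dir_deriv us (chi j) = (%\<nu>. (1 / 2 ^ j) ^ length us *\<^sub>R foldr dir_deriv us (chi_base (j = 0)) ((1 / 2 ^ j) *\<^sub>R \<nu> + 0))" if "set us \<subseteq> Basis" for us
   using that
  proof (induction us)
   case (Cons u us)
   let ?g = "foldr dir_deriv us (chi_base (j = 0))"
   have sm: "smooth ?g" using Cons.prems by (intro smooth_iter_deriv smooth_chi_base) auto
   have "dir_deriv u (%\<nu>. (1 / 2 ^ j) ^ length us *\<^sub>R ?g ((1 / 2 ^ j) *\<^sub>R \<nu> + 0)) = (%\<nu>. (1 / 2 ^ j) *\<^sub>R dir_deriv u (%y. (1 / 2 ^ j) ^ length us *\<^sub>R ?g y) ((1 / 2 ^ j) *\<^sub>R \<nu> + 0))"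
    by (rule dir_deriv_affine[OF bounded_linear_scaleR_right smooth_bounded_linear[OF bounded_linear_scaleR_right sm]]) simp
   thus ?case using Cons by (simp add: dir_deriv_bounded_linear[OF bounded_linear_scaleR_right sm])
  qed (simp add: chi_def[abs_def])
  thus "norm (foldr dir_deriv vs (chi j) \<nu>) <= A * (1 / 2 ^ j) ^ length vs"
   using A[OF vs, of "j = 0" "(1 / 2 ^ j) *\<^sub>R \<nu>"] vs(1) by (simp add: divide_right_mono)
 qed
qed

lemma smooth_chi: "smooth (chi j)"
proof -
 have "smooth (%\<nu>. chi_base (j = 0) ((1 / 2 ^ j) *\<^sub>R \<nu> + 0))"
  by (rule smooth_affine[OF bounded_linear_scaleR_right smooth_chi_base]) (use exI in blast)
 thus ?thesis by (simp add: chi_def[abs_def])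
qed

lemma powr_wt_bound:
 assumes "2 ^ j / 8 <= wt \<nu>" "wt \<nu> <= 8 * 2 ^ j"
 shows "wt \<nu> powr e <= 8 powr \<bar>e\<bar> * (2 ^ j) powr e"
proof -
 have w: "wt \<nu> > 0" using wt_ge_1[of \<nu>] by linarith
 show ?thesis
 proof (cases "e >= 0")
  case True
  have "wt \<nu> powr e <= (8 * 2 ^ j) powr e" using assms w True by (intro powr_mono2) auto
  thus ?thesis using True by (simp add: powr_mult)
 next
  case False
  have "wt \<nu> powr e <= (2 ^ j / 8) powr e" using assms w False by (intro powr_mono2') auto
  moreover have "8 powr \<bar>e\<bar> = 1 / 8 powr e" using False by (simp add: powr_minus_divide)
  ultimately show ?thesis by (simp add: powr_divide)
 qed
qed

text \<open>On the support of \<open>chi j\<close> the weight \<open>wt\<close> is within a factor 8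
  of 2^j, so each frequency derivative of the localised symbol costs 2^-j and
  \<open>ift_localized\<close> applies.\<close>

lemma symb_chi_kernel:
 obtains C where "C > 0" "!!\<sigma> B x j y. symb m N B \<sigma> ==>
  norm (ift (%\<nu>. \<sigma> (x, \<nu>) * chi j \<nu>) y) <= C * (B * (2 ^ j) powr m) * ker N j y"
proof -
 obtain A where A: "A >= 0" "!!vs j \<nu>. set vs \<subseteq> Basis ==> length vs <= N ==> norm (foldr dir_deriv vs (chi j) \<nu>) <= A * (1 / 2 ^ j) ^ length vs"
  using chi_deriv_bound[where N=N] by metis
 define D where "D = 2 ^ N * 8 powr (\<bar>m\<bar> + real N) * A"
 have D: "D >= 0" using A(1) by (simp add: D_def)
 define K where "K = (real DIM((real^'n) \<times> (real^'n)) + 1) ^ Suc N * (unit_ball_vol (real DIM((real^'n) \<times> (real^'n))) * 6 ^ DIM((real^'n) \<times> (real^'n)))"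
 have K: "K > 0" unfolding K_def by (intro mult_pos_pos zero_less_power) auto
 have main: "norm (ift (%\<nu>. \<sigma> (x, \<nu>) * chi j \<nu>) y) <= K * (D * (B * (2 ^ j) powr m)) * ker N j y"
  if \<sigma>: "symb m N B \<sigma>" for \<sigma> B x j and y :: "(real^'n) \<times> (real^'n)"
 proof -
  let ?b = "%\<nu>. \<sigma> (x, \<nu>) * chi j \<nu>"
  have B: "B >= 0" by (rule symb_nonneg[OF \<sigma>])
  have sm: "smooth (%\<nu>. \<sigma> (x, \<nu>))" by (rule smooth_slice[OF symb_smooth[OF \<sigma>]])
  \<comment> \<open>An open set on which the product vanishes, together with its derivatives; off
    this set the two-sided bound for \<open>wt\<close> holds.\<close>
  define S where "S = {\<nu> :: (real^'n) \<times> (real^'n). norm (fst \<nu>) > 3 * 2 ^ j} \<union> {\<nu>. norm (snd \<nu>) > 3 * 2 ^ j}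
    \<union> (if j = 0 then {} else {\<nu>. norm (fst \<nu>) < 2 ^ j / 4} \<inter> {\<nu>. norm (snd \<nu>) < 2 ^ j / 4})"
  have "open S" unfolding S_def by (auto intro!: open_Un open_Int open_Collect_less continuous_intros)
  have S0: "?b \<nu> = 0" if "\<nu> \<in> S" for \<nu>
   using that chi_base_zero[of "(1 / 2 ^ j) *\<^sub>R \<nu>"] by (auto simp: S_def chi_def field_simps split: if_splits)
  have bound: "norm (foldr dir_deriv vs ?b \<nu>) <= D * (B * (2 ^ j) powr m) / (2 ^ j) ^ length vs" if vs: "set vs \<subseteq> Basis" "length vs <= N" for vs \<nu>
  proof (cases "\<nu> \<in> S")
   case True
   thus ?thesis using iter_deriv_zero[OF \<open>open S\<close> S0 True, where vs=vs] D B by simp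
  next
   case False
   hence f: "norm (fst \<nu>) <= 3 * 2 ^ j" "norm (snd \<nu>) <= 3 * 2 ^ j" "j = 0 \<or> 2 ^ j / 4 <= norm (fst \<nu>) \<or> 2 ^ j / 4 <= norm (snd \<nu>)"
    by (auto simp: S_def not_less split: if_splits)
   have p: "1 <= (2::real) ^ j" by simp
   have w: "wt \<nu> <= 8 * 2 ^ j" unfolding wt_def using f(1,2) p by linarith
   have w': "2 ^ j / 8 <= wt \<nu>" unfolding wt_def
    using f(3) p norm_ge_zero[of "fst \<nu>"] norm_ge_zero[of "snd \<nu>"] by (elim disjE) (simp, linarith+)
   have "norm (foldr dir_deriv vs ?b \<nu>) <= 2 ^ length vs * (B * (8 powr (\<bar>m\<bar> + real N) * (2 ^ j) powr m)) * A * (1 / 2 ^ j) ^ length vs"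
   proof (rule iter_deriv_mult_bound[OF sm smooth_chi vs(1)])
    fix ws assume ws: "set ws \<subseteq> set vs" "length ws <= length vs"
    have Bs: "set ws \<subseteq> Basis" "set (map (Pair (0::real^'n)) ws) \<subseteq> Basis" using ws vs by (auto simp: Basis_prod_def)
    have "sum_list (map vord (map (Pair 0) ws)) = - real (length ws)" by (induction ws) (auto simp: vord_def)
    hence "norm (foldr dir_deriv ws (%\<nu>. \<sigma> (x, \<nu>)) \<nu>) <= B * wt \<nu> powr (m - real (length ws))"
     using symbD[OF \<sigma> Bs(2), of x \<nu>] ws vs iter_deriv_slice[OF symb_smooth[OF \<sigma>] Bs(1), of x] by simp
    also have "wt \<nu> powr (m - real (length ws)) <= 8 powr \<bar>m - real (length ws)\<bar> * (2 ^ j) powr (m - real (length ws))"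
     by (rule powr_wt_bound[OF w' w])
    also have "8 powr \<bar>m - real (length ws)\<bar> <= 8 powr (\<bar>m\<bar> + real N)"
     using ws vs by (intro powr_mono) auto
    also have "(2 ^ j) powr (m - real (length ws)) = (2 ^ j) powr m * (1 / 2 ^ j) ^ length ws"
     by (simp add: powr_diff powr_realpow power_one_over)
    finally show "norm (foldr dir_deriv ws (%\<nu>. \<sigma> (x, \<nu>)) \<nu>) <= B * (8 powr (\<bar>m\<bar> + real N) * (2 ^ j) powr m) * (1 / 2 ^ j) ^ length ws"
     using B by (simp add: mult.assoc mult_left_mono mult_right_mono)
    show "norm (foldr dir_deriv ws (chi j) \<nu>) <= A * (1 / 2 ^ j) ^ length ws"
     by (rule A(2)[OF Bs(1)]) (use ws vs in auto)
   qed (use A B in auto)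
   also have "... <= 2 ^ N * (B * (8 powr (\<bar>m\<bar> + real N) * (2 ^ j) powr m)) * A * (1 / 2 ^ j) ^ length vs"
    using A B vs by (intro mult_right_mono power_increasing) auto
   finally show ?thesis by (simp add: D_def power_one_over mult_ac)
  qed
  show ?thesis unfolding K_def
  proof (rule ift_localized)
   show "smooth ?b" by (rule smooth_mult[OF sm smooth_chi])
   fix \<nu> :: "(real^'n) \<times> (real^'n)" assume z: "norm \<nu> > 6 * 2 ^ j"
   have "norm \<nu> <= norm (fst \<nu>) + norm (snd \<nu>)" by (cases \<nu>) (simp add: norm_Pair sqrt_sum_squares_le_sum)
   hence "\<nu> \<in> S" using z unfolding S_def by auto
   thus "?b \<nu> = 0" by (rule S0)
  next
   fix v :: "(real^'n) \<times> (real^'n)" and k \<nu> assume "v \<in> Basis" "k <= N"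
   thus "norm (foldr dir_deriv (replicate k v) ?b \<nu>) <= D * (B * (2 ^ j) powr m) / (2 ^ j) ^ k"
    using bound[of "replicate k v" \<nu>] by (simp add: set_replicate_conv_if del: foldr_replicate)
  qed simp
 qed
 show thesis
 \<comment> \<open>\<open>D\<close> may be zero; adding 1 keeps the constant positive.\<close>
 proof (rule that[of "K * D + 1"])
  show "K * D + 1 > 0" using K D by (simp add: add_nonneg_pos)
  fix \<sigma> :: "'n symbol" and B j and x :: "real^'n" and y :: "(real^'n) \<times> (real^'n)" assume \<sigma>: "symb m N B \<sigma>"
  have "K * (D * (B * (2 ^ j) powr m)) * ker N j y <= (K * D + 1) * (B * (2 ^ j) powr m) * ker N j y"
   using symb_nonneg[OF \<sigma>] by (intro mult_right_mono) (auto simp: algebra_simps)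
  thus "norm (ift (%\<nu>. \<sigma> (x, \<nu>) * chi j \<nu>) y) <= (K * D + 1) * (B * (2 ^ j) powr m) * ker N j y"
   using main[OF \<sigma>, of x j y] by linarith
 qed
qed

end

section \<open>Changes of scale in kernel averages and the Peetre trick\<close>

lemma ker_submult:
 fixes x y z :: "'a::euclidean_space"
 assumes "i <= j"
 shows "ker D i (x - y) <= (1 + 2 ^ j * norm (y - z)) ^ D * ker D i (x - z)"
proof -
 have "norm (x - z) <= norm (x - y) + norm (y - z)" using norm_triangle_ineq[of "x - y" "y - z"] by simp
 hence "2 ^ i * norm (x - z) <= 2 ^ i * norm (x - y) + 2 ^ i * norm (y - z)"
  by (metis distrib_left mult_left_mono zero_le_power zero_le_numeral)
 also have "2 ^ i * norm (y - z) <= 2 ^ j * norm (y - z)"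
  using assms by (intro mult_right_mono power_increasing) auto
 finally have *: "2 ^ i * norm (x - z) <= 2 ^ i * norm (x - y) + 2 ^ j * norm (y - z)" by simp
 have "1 + 2 ^ i * norm (x - z) <= (1 + 2 ^ j * norm (y - z)) * (1 + 2 ^ i * norm (x - y))"
 proof -
  have "0 <= (2 ^ j * norm (y - z)) * (2 ^ i * norm (x - y))" by (intro mult_nonneg_nonneg) auto
  moreover have "(1 + 2 ^ j * norm (y - z)) * (1 + 2 ^ i * norm (x - y)) = 1 + 2 ^ j * norm (y - z) + 2 ^ i * norm (x - y) + (2 ^ j * norm (y - z)) * (2 ^ i * norm (x - y))"
   by (simp add: algebra_simps)
  ultimately show ?thesis using * by linarith
 qed
 hence "(1 + 2 ^ i * norm (x - z)) ^ D <= (1 + 2 ^ j * norm (y - z)) ^ D * (1 + 2 ^ i * norm (x - y)) ^ D"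
  unfolding power_mult_distrib[symmetric] by (intro power_mono) auto
 moreover have "(1 + 2 ^ i * norm (x - z)) ^ D > 0" "(1 + 2 ^ i * norm (x - y)) ^ D > 0"
  by (intro zero_less_power add_pos_nonneg; simp)+
 ultimately show ?thesis by (simp add: ker_def divide_simps)
qed

lemma ker_add: "ker (A + D) i x = ker D i x * (1 / (1 + 2 ^ i * norm x) ^ A)"
 by (simp add: ker_def power_add)

lemma ker_absorb:
 assumes "i <= j" shows "ker (A + D) j x * (1 + 2 ^ i * norm x) ^ A <= ker D j x"
proof -
 have pos: "(1 + 2 ^ j * norm x) ^ A > 0" by (intro zero_less_power add_pos_nonneg) auto
 have "(1 + 2 ^ i * norm x) ^ A <= (1 + 2 ^ j * norm x) ^ A"
  using assms by (intro power_mono add_left_mono mult_right_mono power_increasing) auto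
 hence "1 / (1 + 2 ^ j * norm x) ^ A * (1 + 2 ^ i * norm x) ^ A <= 1" using pos by (simp add: divide_simps)
 hence "ker D j x * (1 / (1 + 2 ^ j * norm x) ^ A * (1 + 2 ^ i * norm x) ^ A) <= ker D j x * 1"
  by (rule mult_left_mono) simp
 thus ?thesis by (simp add: ker_add mult.assoc)
qed

text \<open>The source of slowly varying majorants: moving the centre of the kernel from y to x
  costs only a power of 1 + 2^j |x - y|.\<close>

lemma kavg_slow:
 assumes [measurable]: "h \<in> Borel"
 shows "kavg D j h y <= ennreal ((1 + 2 ^ j * norm (x - y)) ^ D) * kavg D j h (x :: 'a::euclidean_space)"
proof -
 have nn: "0 <= (1 + 2 ^ j * norm (x - y)) ^ D" by simp
 have "kavg D j h y <= (\<integral>z. ennreal ((1 + 2 ^ j * norm (x - y)) ^ D) * (ennreal (ker D j (x - z)) * h z))"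
  unfolding kavg_def
 proof (rule nn_integral_mono)
  fix z
  have "ker D j (y - z) <= (1 + 2 ^ j * norm (x - y)) ^ D * ker D j (x - z)"
   using ker_submult[of j j D z y x] by (simp add: ker_minus(2) norm_minus_commute)
  hence "ennreal (ker D j (y - z)) <= ennreal ((1 + 2 ^ j * norm (x - y)) ^ D) * ennreal (ker D j (x - z))"
   using nn by (simp add: ennreal_leI flip: ennreal_mult)
  thus "ennreal (ker D j (y - z)) * h z <= ennreal ((1 + 2 ^ j * norm (x - y)) ^ D) * (ennreal (ker D j (x - z)) * h z)"
   by (simp add: mult_right_mono flip: mult.assoc)
 qed
 also have "... = ennreal ((1 + 2 ^ j * norm (x - y)) ^ D) * kavg D j h x"
  unfolding kavg_def by (rule nn_integral_cmult) measurable
 finally show ?thesis .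
qed

text \<open>Of the order \<open>D + D\<close> of the fine kernel, one \<open>D\<close> pays for
  moving the coarse kernel from \<open>y\<close> to \<open>z\<close>, and the other is
  integrable.\<close>

lemma kavg_kavg:
 fixes h :: "'a::euclidean_space => ennreal"
 assumes D: "D > DIM('a)" and kj: "k <= j" and [measurable]: "h \<in> Borel"
 shows "kavg D k (kavg (D + D) j h) x <= ennreal (ker_const TYPE('a) D) * kavg D k h x"
proof -
 have "kavg D k (kavg (D + D) j h) x = (\<integral>y. \<integral>z. ennreal (ker D k (x - y)) * (ennreal (ker (D + D) j (y - z)) * h z))"
  unfolding kavg_def by (simp add: nn_integral_cmult)
 also have "... = (\<integral>z. \<integral>y. ennreal (ker D k (x - y)) * (ennreal (ker (D + D) j (y - z)) * h z))"
  by (rule lborel_pair.Fubini') measurable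
 also have "... <= (\<integral>z. \<integral>y. (ennreal (ker D k (x - z)) * h z) * ennreal (ker D j (z - y)))"
 proof (intro nn_integral_mono)
  fix z y
  have "ker D k (x - y) * ker (D + D) j (y - z) <= ((1 + 2 ^ j * norm (y - z)) ^ D * ker D k (x - z)) * ker (D + D) j (y - z)"
   by (intro mult_right_mono ker_submult kj) simp
  also have "... <= ker D k (x - z) * ker D j (z - y)"
   using mult_left_mono[OF ker_absorb[OF order_refl, of D D j "y - z"], of "ker D k (x - z)"] by (simp add: mult_ac ker_minus(2)[of D j z])
  finally have "ennreal (ker D k (x - y)) * ennreal (ker (D + D) j (y - z)) <= ennreal (ker D k (x - z)) * ennreal (ker D j (z - y))"
   by (simp add: ennreal_leI flip: ennreal_mult)
  hence "ennreal (ker D k (x - y)) * ennreal (ker (D + D) j (y - z)) * h z <= ennreal (ker D k (x - z)) * ennreal (ker D j (z - y)) * h z"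
   by (rule mult_right_mono) simp
  thus "ennreal (ker D k (x - y)) * (ennreal (ker (D + D) j (y - z)) * h z) <= (ennreal (ker D k (x - z)) * h z) * ennreal (ker D j (z - y))"
   by (simp add: mult_ac)
 qed
 also have "... <= (\<integral>z. (ennreal (ker D k (x - z)) * h z) * ennreal (ker_const TYPE('a) D))"
  by (subst nn_integral_cmult) (auto intro!: nn_integral_mono mult_left_mono nn_integral_ker D)
 also have "... = ennreal (ker_const TYPE('a) D) * kavg D k h x"
  unfolding kavg_def by (subst nn_integral_multc) (auto simp: mult.commute)
 finally show ?thesis .
qed

text \<open>The Plancherel-Polya-Nikolskij trick: the inequality self-improves by absorbing a power of the
 Peetre maximal function.\<close>

lemma Peetre_bound:
 fixes u :: "'a::euclidean_space => complex"
 assumes t: "0 < t" "t < 1" and A: "real D <= t * real A"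
  and [measurable]: "u \<in> Borel" and bd: "!!x. norm (u x) <= M0" and C: "C > 0"
  and u: "!!x. enorm (u x) <= ennreal C * kavg A j (%y. enorm (u y)) x"
 shows "epowr (enorm (u x)) t <= ennreal C * kavg D j (%y. epowr (enorm (u y)) t) x"
proof -
 \<comment> \<open>The exponent of the Peetre maximal function. Its t-th power has weight exponent
   D, and a <= A lets the kernel of order \<open>A\<close> compensate the shift of the
   weight.\<close>
 define a where "a = real D / t"
 have a: "a >= 0" "a * t = real D" "a <= real A" using t A by (auto simp: a_def field_simps)
 define w where "w = (%y. 1 + 2 ^ j * norm (x - y))"
 have w: "w y >= 1" for y by (simp add: w_def)
 define M where "M = (SUP y. ennreal (norm (u y) * w y powr (- a)))"
 have uM: "enorm (u y) <= ennreal (w y powr a) * M" for y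
 proof -
  have "enorm (u y) = ennreal (w y powr a) * ennreal (norm (u y) * w y powr (- a))"
   using w[of y] powr_add[of "w y" a "- a"] by (simp add: mult_ac flip: ennreal_mult)
  also have "... <= ennreal (w y powr a) * M" unfolding M_def by (intro mult_left_mono SUP_upper) auto
  finally show ?thesis .
 qed
 have M0: "M0 >= 0" using bd norm_ge_zero order_trans by blast
 \<comment> \<open>Boundedness of \<open>u\<close> makes the Peetre maximal function finite, so that
   its power 1 - t can be cancelled at the end.\<close>
 have Mfin: "M < top"
 proof -
  have "norm (u y) * w y powr (- a) <= M0 * 1" for y
   using bd[of y] w[of y] a M0 powr_mono[of "- a" 0 "w y"] by (intro mult_mono) auto
  hence "M <= ennreal M0" unfolding M_def by (intro SUP_least ennreal_leI) simp
  thus ?thesis using le_less_trans ennreal_less_top by blast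
 qed
 let ?E = "kavg D j (%y. epowr (enorm (u y)) t) x"
 have "ennreal (norm (u y) * w y powr (- a)) <= epowr M (1 - t) * (ennreal C * ?E)" for y
 proof -
  have "ennreal (norm (u y) * w y powr (- a)) = ennreal (w y powr (- a)) * enorm (u y)"
   by (simp add: mult.commute flip: ennreal_mult)
  also have "... <= ennreal (w y powr (- a)) * (ennreal C * kavg A j (%y. enorm (u y)) y)"
   by (intro mult_left_mono u) simp
  also have "... = ennreal C * (\<integral>z. ennreal (w y powr (- a)) * (ennreal (ker A j (y - z)) * enorm (u z)))"
   unfolding kavg_def by (simp add: nn_integral_cmult mult.left_commute)
  also have "... <= ennreal C * (\<integral>z. epowr M (1 - t) * (ennreal (ker D j (x - z)) * epowr (enorm (u z)) t))"
  proof (intro mult_left_mono nn_integral_mono)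
   fix z
   let ?v = "enorm (u z)" let ?s = "1 + 2 ^ j * norm (y - z)"
   have v: "?v <= ennreal (w z powr (a * (1 - t))) * epowr M (1 - t) * epowr ?v t"
   proof -
    \<comment> \<open>Only the power 1 - t is estimated by the maximal function; the power t stays
      under the integral.\<close>
    have "?v = epowr ?v (1 - t) * epowr ?v t" using epowr_add[of "1 - t" t ?v] t by simp
    also have "epowr ?v (1 - t) <= epowr (ennreal (w z powr a) * M) (1 - t)" using t by (intro epowr_mono uM) auto
    also have "... = ennreal (w z powr (a * (1 - t))) * epowr M (1 - t)" using t by (simp add: epowr_mult epowr_ennreal powr_powr)
    finally show ?thesis by (simp add: mult_right_mono)
   qed
   have k: "w y powr (- a) * ker A j (y - z) * w z powr (a * (1 - t)) <= ker D j (x - z)"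
   proof -
    have s: "?s >= 1" by simp
    have "w z <= w y * ?s"
    proof -
     have "norm (x - z) <= norm (x - y) + norm (y - z)" using norm_triangle_ineq[of "x - y" "y - z"] by simp
     hence "2 ^ j * norm (x - z) <= 2 ^ j * norm (x - y) + 2 ^ j * norm (y - z)"
      by (metis distrib_left mult_left_mono zero_le_power zero_le_numeral)
     moreover have "1 + c' <= (1 + a') * (1 + b')" if "c' <= a' + b'" "0 <= a'" "0 <= b'" for a' b' c' :: real
      using that(1) mult_nonneg_nonneg[OF that(2,3)] unfolding distrib_left distrib_right by linarith
     ultimately show ?thesis unfolding w_def by simp
    qed
    hence "(w y * ?s) powr (- a) <= w z powr (- a)" using a w[of z] by (intro powr_mono2') auto
    moreover have "?s powr (- real A) <= ?s powr (- a)" using s a by (intro powr_mono) auto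
    ultimately have 1: "w y powr (- a) * ?s powr (- real A) <= w z powr (- a)"
     using w[of y] s by (simp add: powr_mult) (meson mult_left_mono order_trans powr_ge_zero)
    have kk: "ker A j (y - z) = 2 ^ (j * DIM('a)) * ?s powr (- real A)" "ker D j (x - z) = 2 ^ (j * DIM('a)) * w z powr (- real D)"
     using s w[of z] by (simp_all add: ker_def w_def powr_minus powr_realpow add_pos_nonneg divide_inverse)
    have "w y powr (- a) * ker A j (y - z) * w z powr (a * (1 - t)) = 2 ^ (j * DIM('a)) * ((w y powr (- a) * ?s powr (- real A)) * w z powr (a * (1 - t)))"
     by (simp add: kk)
    also have "... <= 2 ^ (j * DIM('a)) * (w z powr (- a) * w z powr (a * (1 - t)))"
     using 1 by (intro mult_left_mono mult_right_mono) auto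
    also have "w z powr (- a) * w z powr (a * (1 - t)) = w z powr (- real D)"
     using w[of z] a(2) by (simp add: powr_add[symmetric] algebra_simps)
    finally show ?thesis by (simp add: kk)
   qed
   have "ennreal (w y powr (- a)) * (ennreal (ker A j (y - z)) * ?v) <= ennreal (w y powr (- a)) * (ennreal (ker A j (y - z)) * (ennreal (w z powr (a * (1 - t))) * epowr M (1 - t) * epowr ?v t))"
    by (intro mult_left_mono v) auto
   also have "... = ennreal (w y powr (- a) * ker A j (y - z) * w z powr (a * (1 - t))) * (epowr M (1 - t) * epowr ?v t)"
    by (simp add: ennreal_mult mult_ac)
   also have "... <= ennreal (ker D j (x - z)) * (epowr M (1 - t) * epowr ?v t)"
    by (intro mult_right_mono ennreal_leI k) auto
   finally show "ennreal (w y powr (- a)) * (ennreal (ker A j (y - z)) * ?v) <= epowr M (1 - t) * (ennreal (ker D j (x - z)) * epowr ?v t)"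
    by (simp add: mult_ac)
  qed auto
  also have "... = epowr M (1 - t) * (ennreal C * ?E)"
   unfolding kavg_def by (simp add: nn_integral_cmult mult_ac)
  finally show ?thesis .
 qed
 hence "M <= epowr M (1 - t) * (ennreal C * ?E)" unfolding M_def[symmetric]
  by (subst (1) M_def) (rule SUP_least)
 moreover have "M = epowr M (1 - t) * epowr M t" using epowr_add[of "1 - t" t M] t by simp
 ultimately have le: "epowr M (1 - t) * epowr M t <= epowr M (1 - t) * (ennreal C * ?E)" by simp
 have "epowr M t <= ennreal C * ?E"
 proof (cases "M = 0")
  case False
  have "epowr M (1 - t) ~= 0" "epowr M (1 - t) ~= top" using False Mfin by auto
  thus ?thesis using le by (simp add: ennreal_mult_le_mult_iff)
 qed simp
 moreover have "enorm (u x) <= M" using uM[of x] by (simp add: w_def)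
 hence "epowr (enorm (u x)) t <= epowr M t" by (rule epowr_mono[OF t(1)])
 ultimately show ?thesis by (rule order_trans[rotated])
qed

text \<open>A function that is slowly varying at scale \<open>2 ^ - j\<close> satisfies a reverse Hoelder inequality
 on coarser scales, at the price of the number of small balls per large ball.\<close>

lemma kavg_slow_coarse:
 assumes t: "0 < t" "t < 1" and L: "real D <= t * real L"
 obtains C where "C > 0" "!!(H :: 'a::euclidean_space => ennreal) j k x. H \<in> Borel ==> k <= j ==>
   (!!y z. H y <= ennreal ((1 + 2 ^ j * norm (z - y)) ^ A) * H z) ==>
   epowr (kavg L k H x) t <= ennreal (C * 2 powr (real (j - k) * real DIM('a) * (1 - t))) * kavg D k (%y. epowr (H y) t) x"
proof -
 define d where "d = DIM('a)"
 define V where "V = unit_ball_vol (real d)"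
 have V: "V > 0" by (simp add: V_def)
 define c where "c = (2 ^ L * 2 ^ A :: real)"
 have c: "c > 0" by (simp add: c_def)
 define C where "C = (c powr t / V) powr (1 - t)"
 show thesis
 proof (rule that[of C])
  show "C > 0" using c V by (simp add: C_def)
  fix H :: "'a => ennreal" and j k and x :: 'a
  assume [measurable]: "H \<in> Borel" and kj: "k <= j"
   and H: "!!y z. H y <= ennreal ((1 + 2 ^ j * norm (z - y)) ^ A) * H z"
  define s where "s = (%z. 1 + 2 ^ k * norm (x - z))"
  have s: "s z > 0" "s z >= 1" for z by (auto simp: s_def add_pos_nonneg)
  \<comment> \<open>The integrand of the coarse average without its normalisation. As k <= j, it is
    nearly constant on balls of radius 2^-j, like \<open>H\<close>.\<close>
  define G where "G = (%z. ennreal (1 / s z ^ L) * H z)"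
  have [measurable]: "s \<in> Borel" unfolding s_def by measurable
  have [measurable]: "G \<in> Borel" unfolding G_def by measurable
  define I where "I = (\<integral>z. epowr (G z) t)"
  have Gslow: "G z <= ennreal c * G z'" if zz: "norm (z' - z) <= 1 / 2 ^ j" for z z'
  proof -
   have n1: "2 ^ j * norm (z' - z) <= 1" using zz by (simp add: field_simps)
   have "2 ^ k * norm (z' - z) <= 2 ^ j * norm (z' - z)" using kj by (intro mult_right_mono power_increasing) auto
   hence "2 ^ k * norm (z' - z) <= 1" using n1 by linarith
   moreover have "norm (x - z') <= norm (x - z) + norm (z' - z)" using norm_triangle_ineq4[of "x - z" "z' - z"] by simp
   hence "2 ^ k * norm (x - z') <= 2 ^ k * norm (x - z) + 2 ^ k * norm (z' - z)"
    by (metis distrib_left mult_left_mono zero_le_power zero_le_numeral)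
   moreover have "0 <= 2 ^ k * norm (x - z)" by simp
   moreover have "1 + c' <= 2 * (1 + b')" if "a' <= 1" "c' <= b' + a'" "0 <= b'" for a' b' c' :: real
    using that unfolding distrib_left by linarith
   ultimately have "s z' <= 2 * s z" unfolding s_def by blast
   hence "s z' ^ L <= (2 * s z) ^ L" using s[of z'] by (intro power_mono) auto
   hence "1 / s z ^ L <= 2 ^ L * (1 / s z' ^ L)" using s[of z] s[of z'] by (simp add: power_mult_distrib divide_simps)
   moreover have "H z <= ennreal (2 ^ A) * H z'"
    by (rule order_trans[OF H[of z z'] mult_right_mono]) (use n1 in \<open>auto intro!: ennreal_leI power_mono\<close>)
   ultimately have "G z <= ennreal (2 ^ L * (1 / s z' ^ L)) * (ennreal (2 ^ A) * H z')"
    unfolding G_def by (intro mult_mono ennreal_leI) auto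
   also have "... = ennreal c * G z'" unfolding G_def c_def
    using s[of z'] by (subst (1 2) ennreal_mult) (auto simp del: times_divide_eq_right simp: mult_ac)
   finally show ?thesis .
  qed
  \<comment> \<open>A value of G^t is at most a constant times its mean over the ball of radius
    2^-j, hence at most a constant times 2^(j n) times the full integral.\<close>
  have pw: "epowr (G z) t <= ennreal (c powr t / V * 2 ^ (j * d)) * I" for z
  proof -
   let ?B = "cball z (1 / 2 ^ j)"
   have eB: "emeasure lborel ?B = ennreal (V / 2 ^ (j * d))"
    by (simp add: emeasure_cball V_def d_def power_mult divide_inverse power_inverse)
   have "epowr (G z) t * emeasure lborel ?B = (\<integral>z'. epowr (G z) t * indicator ?B z')"
    by (simp add: nn_integral_cmult_indicator)
   also have "... <= (\<integral>z'. ennreal (c powr t) * epowr (G z') t)"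
   proof (rule nn_integral_mono)
    fix z'
    show "epowr (G z) t * indicator ?B z' <= ennreal (c powr t) * epowr (G z') t"
    proof (cases "z' \<in> ?B")
     case True
     hence "epowr (G z) t <= epowr (ennreal c * G z') t" using t
      by (intro epowr_mono Gslow) (auto simp: dist_norm norm_minus_commute)
     thus ?thesis using True t c by (simp add: epowr_mult epowr_ennreal)
    qed simp
   qed
   also have "... = ennreal (c powr t) * I" unfolding I_def by (simp add: nn_integral_cmult)
   finally have "epowr (G z) t * ennreal (V / 2 ^ (j * d)) <= ennreal (c powr t) * I" unfolding eB .
   hence "epowr (G z) t <= ennreal (c powr t) * I / ennreal (V / 2 ^ (j * d))"
    using V by (subst ennreal_le_divide_iff) auto
   also have "... = ennreal (c powr t / V * 2 ^ (j * d)) * I"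
   proof -
    have "inverse (ennreal (V / 2 ^ (j * d))) = ennreal (2 ^ (j * d) / V)" using V by (subst inverse_ennreal) auto
    moreover have "c powr t / V * 2 ^ (j * d) = c powr t * (2 ^ (j * d) / V)" by simp
    ultimately show ?thesis using V by (simp only: divide_ennreal_def) (simp add: ennreal_mult mult_ac del: times_divide_eq_right times_divide_eq_left)
   qed
   finally show ?thesis .
  qed
  define K where "K = c powr t / V * 2 ^ (j * d)"
  have K: "K > 0" using c V by (simp add: K_def)
  \<comment> \<open>G = G^t G^(1-t), with the second factor bounded by the preceding step. The power
    1 - t of 2^(j n), together with the normalisation 2^(k n) of the kernel, leaves 2^((j-k) n
    (1-t)).\<close>
  have "epowr (\<integral>z. G z) t <= ennreal (K powr (1 - t)) * I"
  proof -
   have "G z <= epowr (G z) t * epowr (ennreal K * I) ((1 - t) / t)" for z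
   proof -
    have "G z = epowr (G z) t * epowr (G z) (1 - t)" using epowr_add[of t "1 - t" "G z"] t by simp
    also have "epowr (G z) (1 - t) = epowr (epowr (G z) t) ((1 - t) / t)" using t by (simp add: epowr_epowr)
    also have "... <= epowr (ennreal K * I) ((1 - t) / t)" using pw[of z] t unfolding K_def by (intro epowr_mono) auto
    finally show ?thesis by (simp add: mult_left_mono)
   qed
   hence "(\<integral>z. G z) <= (\<integral>z. epowr (G z) t * epowr (ennreal K * I) ((1 - t) / t))" by (rule nn_integral_mono)
   also have "... = I * epowr (ennreal K * I) ((1 - t) / t)" unfolding I_def by (rule nn_integral_multc) measurable
   finally have "epowr (\<integral>z. G z) t <= epowr (I * epowr (ennreal K * I) ((1 - t) / t)) t" by (rule epowr_mono[OF t(1)])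
   also have "... = epowr I t * (ennreal (K powr (1 - t)) * epowr I (1 - t))"
    using t K by (simp add: epowr_mult epowr_epowr epowr_ennreal powr_powr)
   also have "... = ennreal (K powr (1 - t)) * (epowr I t * epowr I (1 - t))" by (simp add: mult_ac)
   also have "epowr I t * epowr I (1 - t) = I" using epowr_add[of t "1 - t" I] t by simp
   finally show ?thesis .
  qed
  moreover have "kavg L k H x = ennreal (2 ^ (k * d)) * (\<integral>z. G z)"
   unfolding kavg_def G_def by (subst nn_integral_cmult[symmetric]) (auto simp: ker_def s_def d_def mult.assoc[symmetric] simp flip: ennreal_mult)
  moreover have "ennreal (2 ^ (k * d)) * I <= kavg D k (%y. epowr (H y) t) x"
  proof -
   have "epowr (G z) t <= ennreal (1 / s z ^ D) * epowr (H z) t" for z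
   proof -
    have "(1 / s z ^ L) powr t = s z powr (- (t * real L))"
     using s[of z] by (simp add: powr_divide powr_minus_divide powr_powr mult.commute flip: powr_realpow)
    also have "... <= s z powr (- real D)" using s[of z] L by (intro powr_mono) auto
    also have "... = 1 / s z ^ D" using s[of z] by (simp add: powr_minus_divide powr_realpow)
    finally have "(1 / s z ^ L) powr t <= 1 / s z ^ D" .
    thus ?thesis unfolding G_def using t s[of z] by (simp add: epowr_mult epowr_ennreal mult_right_mono ennreal_leI)
   qed
   hence "ennreal (2 ^ (k * d)) * I <= ennreal (2 ^ (k * d)) * (\<integral>z. ennreal (1 / s z ^ D) * epowr (H z) t)"
    unfolding I_def by (intro mult_left_mono nn_integral_mono) auto
   also have "... = kavg D k (%y. epowr (H y) t) x"
    unfolding kavg_def by (subst nn_integral_cmult[symmetric]) (auto simp: ker_def s_def d_def mult.assoc[symmetric] simp flip: ennreal_mult)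
   finally show ?thesis .
  qed
  ultimately have "epowr (kavg L k H x) t <= ennreal ((2 ^ (k * d)) powr t) * (ennreal (K powr (1 - t)) * I)"
   using t by (simp add: epowr_mult epowr_ennreal mult_left_mono)
  also have "... = ennreal (C * 2 powr (real (j - k) * real d * (1 - t))) * (ennreal (2 ^ (k * d)) * I)"
  proof -
   have p: "(2::real) ^ n = 2 powr real n" for n by (simp add: powr_realpow)
   have "(2 ^ (k * d)) powr t * K powr (1 - t) = C * (2 powr (real (k * d) * t) * 2 powr (real (j * d) * (1 - t)))"
    using c V by (simp add: K_def C_def powr_mult powr_powr p powr_divide)
   also have "2 powr (real (k * d) * t) * 2 powr (real (j * d) * (1 - t)) = 2 powr (real (j - k) * real d * (1 - t)) * 2 ^ (k * d)"
    using kj by (simp add: p powr_add[symmetric] of_nat_diff algebra_simps)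
   finally have "(2 ^ (k * d)) powr t * K powr (1 - t) = C * 2 powr (real (j - k) * real d * (1 - t)) * 2 ^ (k * d)" by simp
   hence "ennreal ((2 ^ (k * d)) powr t) * ennreal (K powr (1 - t)) = ennreal (C * 2 powr (real (j - k) * real d * (1 - t))) * ennreal (2 ^ (k * d))"
    by (simp add: C_def flip: ennreal_mult)
   thus ?thesis by (simp flip: mult.assoc)
  qed
  also have "... <= ennreal (C * 2 powr (real (j - k) * real d * (1 - t))) * kavg D k (%y. epowr (H y) t) x"
   by (rule mult_left_mono) (use \<open>ennreal (2 ^ (k * d)) * I <= _\<close> in auto)
  finally show "epowr (kavg L k H x) t <= ennreal (C * 2 powr (real (j - k) * real DIM('a) * (1 - t))) * kavg D k (%y. epowr (H y) t) x"
   unfolding d_def .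
 qed
qed

section \<open>Littlewood-Paley pieces of Schwartz functions\<close>

lemma smooth_diff:
 fixes f g :: "'a::euclidean_space => complex"
 assumes "smooth f" "smooth g" shows "smooth (%x. f x - g x)"
 using smooth_add[OF assms(1) smooth_mult[OF smooth_const[of "- 1"] assms(2)]] by simp

lemma integrable_conv_self:
 fixes k h :: "'a::euclidean_space => complex"
 assumes "L1 k" "L1 h" and [measurable]: "conv k h \<in> Borel"
 shows "L1 (conv k h)"
proof (rule integrableI_bounded)
 have [measurable]: "k \<in> Borel" "h \<in> Borel" using assms by auto
 have "(\<integral>x. enorm (conv k h x)) <= (\<integral>x. \<integral>y. enorm (k (x - y)) * enorm (h y))"
  by (intro nn_integral_mono norm_conv_le) auto
 also have "... = (\<integral>y. \<integral>x. enorm (k (x - y)) * enorm (h y))"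
  by (rule lborel_pair.Fubini') measurable
 also have "... = (\<integral>y. (\<integral>x. enorm (k (x - y))) * enorm (h y))"
  by (intro nn_integral_cong nn_integral_multc) measurable
 also have "... = (\<integral>y. (\<integral>x. enorm (k x)) * enorm (h y))"
 proof (rule nn_integral_cong)
  fix y
  have "(\<integral>x. enorm (k x)) = (\<integral>\<^sup>+x. enorm (k x) \<partial>distr lborel borel ((+) (- y)))"
   using lborel_distr_plus[of "- y"] by simp
  also have "... = (\<integral>x. enorm (k (x - y)))" by (subst nn_integral_distr) auto
  finally show "(\<integral>x. enorm (k (x - y))) * enorm (h y) = (\<integral>x. enorm (k x)) * enorm (h y)" by simp
 qed
 also have "... = (\<integral>x. enorm (k x)) * (\<integral>y. enorm (h y))"
  by (rule nn_integral_cmult) measurable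
 also have "... < \<infinity>" using assms(1,2) by (auto simp: integrable_iff_bounded ennreal_mult_less_top)
 finally show "(\<integral>x. enorm (conv k h x)) < \<infinity>" .
qed simp

lemma conv_inv_fourier:
 fixes a U :: "real^'n::finite => complex"
 assumes "L1 a" "L1 U"
 shows "conv (inv_fourier a) U x = of_real ((2 * pi) powr (- real CARD('n))) * ift (%\<xi>. a \<xi> * fourier U \<xi>) x"
proof -
 have "conv (inv_fourier a) U x = (LBINT y. of_real ((2 * pi) powr (- real CARD('n))) * (ift a (x - y) * U y))"
  by (simp add: conv_def inv_fourier_eq_ift mult.assoc)
 also have "... = of_real ((2 * pi) powr (- real CARD('n))) * (LBINT y. ift a (x - y) * U y)" by simp
 also have "(LBINT y. ift a (x - y) * U y) = (LBINT z. a z * ift U (- z) * iexp (x \<bullet> z))"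
  by (rule ift_mult_ift[OF assms, symmetric])
 finally show ?thesis by (simp add: ift_def[of "%\<xi>. a \<xi> * ift U (- \<xi>)"] fourier_eq_ift)
qed

lemma ift_continuous:
 fixes f :: "real^'n::finite => complex"
 assumes "f \<in> schwartz" shows "continuous_on UNIV (ift f)"
proof -
 have m: "f \<in> Borel" using schwartz_integrable[OF assms] by simp
 have "(ift f has_derivative (%u. ift (%z. \<i> * of_real (u \<bullet> z) * f z) y)) (at y)" for y
  by (rule has_derivative_ift[OF m]) (use schwartz_integrable_deriv(1)[OF assms, of "[]"] in simp)
 thus ?thesis by (auto intro!: continuous_at_imp_continuous_on has_derivative_continuous)
qed

lemma schwartz_measurable [measurable_dest]:
 fixes f :: "real^'n::finite => complex"
 shows "f \<in> schwartz ==> f \<in> Borel"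
 using schwartz_integrable[of f] by auto

lemma inv_fourier_schwartz_decay:
 fixes a :: "real^'n::finite => complex"
 assumes a: "a \<in> schwartz"
 obtains C where "C > 0" "!!k y. norm (inv_fourier (%\<xi>. a ((1 / 2 ^ k) *\<^sub>R \<xi>)) y) <= C * ker N k y"
proof -
 obtain C where C: "C > 0" "!!y. norm (ift a y) <= C * ker N 0 y" using ift_schwartz_decay[OF a] by metis
 let ?c = "(2 * pi) powr (- real CARD('n))"
 show thesis
 proof (rule that[of "?c * C"])
  show "?c * C > 0" using C by simp
  fix k and y :: "real^'n"
  have "ift (%\<xi>. a ((1 / 2 ^ k) *\<^sub>R \<xi>)) y = of_real ((2 ^ k) ^ CARD('n)) * ift a ((2 ^ k) *\<^sub>R y)"
  proof -
   have "a \<in> Borel" by (rule schwartz_measurable[OF a])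
   hence "(%\<xi>. a ((1 / 2 ^ k) *\<^sub>R \<xi>) * iexp (y \<bullet> \<xi>)) \<in> Borel" by measurable
   from lborel_integral_affine(1)[OF this, of "2 ^ k" 0] show ?thesis
    by (simp add: ift_def scaleR_conv_of_real[where 'a=complex])
  qed
  moreover have "ker N k y = (2 ^ k) ^ CARD('n) * ker N 0 ((2 ^ k) *\<^sub>R y)"
   by (simp add: ker_def power_mult)
  ultimately show "norm (inv_fourier (%\<xi>. a ((1 / 2 ^ k) *\<^sub>R \<xi>)) y) <= ?c * C * ker N k y"
   using C(2)[of "(2 ^ k) *\<^sub>R y"] by (simp add: inv_fourier_eq_ift norm_mult norm_power mult_left_mono mult.left_commute)
 qed
qed

lemma norm_conv_ker_le:
 fixes k h :: "'a::euclidean_space => complex"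
 assumes [measurable]: "k \<in> Borel" "h \<in> Borel" and k: "!!y. norm (k y) <= C * ker N j y" and C: "C >= 0"
 shows "enorm (conv k h x) <= ennreal C * kavg N j (%y. enorm (h y)) x"
proof -
 have "enorm (conv k h x) <= (\<integral>y. enorm (k (x - y)) * enorm (h y))"
  by (rule norm_conv_le) auto
 also have "... <= (\<integral>y. ennreal C * (ennreal (ker N j (x - y)) * enorm (h y)))"
  unfolding mult.assoc[symmetric] using C k by (intro nn_integral_mono mult_right_mono) (auto simp flip: ennreal_mult intro!: ennreal_leI)
 also have "... = ennreal C * kavg N j (%y. enorm (h y)) x"
  unfolding kavg_def by (rule nn_integral_cmult) measurable
 finally show ?thesis .
qed

context LP begin

text \<open>Two profiles suffice, the one with \<open>b\<close> true for j = 0: all other cutoffs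
  are dilates of one annular function.\<close>

definition psi0 :: "bool => real^'n => complex" where
 "psi0 b \<xi> = (if b then dil 1 \<xi> else dil 1 \<xi> - dil 2 \<xi>)"

definition psi :: "nat => real^'n => complex" where
 "psi j \<xi> = psi0 (j = 0) ((1 / 2 ^ j) *\<^sub>R \<xi>)"

lemma dil_scale: "dil c (d *\<^sub>R \<xi>) = dil (c * d) \<xi>"
 by (simp add: dil_def)

lemma psi_simps: "psi 0 = dil 1" "psi (Suc j) = (%\<xi>. dil (1 / 2 ^ Suc j) \<xi> - dil (1 / 2 ^ j) \<xi>)"
 by (simp_all add: psi_def[abs_def] psi0_def[abs_def] dil_scale)

lemma LP_cutoff_eq: "of_real (LP_cutoff \<phi>0 j \<xi>) = psi j \<xi>"
proof -
 have "2 powr (- real j) = 1 / 2 ^ j" by (simp add: powr_minus_divide powr_realpow)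
 thus ?thesis by (simp add: LP_cutoff_def psi_def psi0_def dil_def Let_def)
qed

lemma psi0_schwartz: "psi0 b \<in> schwartz"
 by (rule smooth_compact_support_schwartz[where R="3/2"], cases b)
   (auto simp: psi0_def[abs_def] dil_zero smooth_diff smooth_dil)

lemma psi_zero: "norm \<xi> > 3/2 * 2 ^ j ==> psi j \<xi> = 0" "j > 0 ==> norm \<xi> < 2 ^ j / 2 ==> psi j \<xi> = 0"
proof -
 assume a: "norm \<xi> > 3/2 * 2 ^ j"
 have "dil 1 ((1 / 2 ^ j) *\<^sub>R \<xi>) = 0" "dil 2 ((1 / 2 ^ j) *\<^sub>R \<xi>) = 0"
  using a norm_ge_zero[of \<xi>] by (intro dil_zero; simp add: field_simps; linarith?)+
 thus "psi j \<xi> = 0" by (cases j) (auto simp: psi_def psi0_def)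
next
 assume a: "j > 0" "norm \<xi> < 2 ^ j / 2"
 have "dil 1 ((1 / 2 ^ j) *\<^sub>R \<xi>) = 1" "dil 2 ((1 / 2 ^ j) *\<^sub>R \<xi>) = 1"
  using a norm_ge_zero[of \<xi>] by (intro dil_one; simp add: field_simps; linarith?)+
 thus "psi j \<xi> = 0" using a by (simp add: psi_def psi0_def)
qed

lemma psi_schwartz: "psi j \<in> schwartz"
proof (rule smooth_compact_support_schwartz[where R="3/2 * 2 ^ j"])
 show "smooth (psi j)"
  by (cases j) (auto simp: psi_simps intro!: smooth_diff smooth_dil)
 show "norm \<xi> > 3/2 * 2 ^ j ==> psi j \<xi> = 0" for \<xi> by (rule psi_zero)
qed

definition cv :: "(real^'n => complex) => (real^'n => complex) => real^'n => complex" where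
 "cv a f = conv (inv_fourier a) f"

lemma LP_piece_cv:
 assumes "h \<in> Borel" "!!x. norm (h x) <= B"
 shows "LP_piece \<phi>0 j (dist_of h) = cv (psi j) h"
 unfolding LP_piece_def cv_def LP_cutoff_eq by (rule LP_piece_eq(1)[OF psi_schwartz assms])

lemma integrable_inv_fourier:
 assumes a: "a \<in> schwartz" shows "L1 (inv_fourier a :: real^'n => complex)"
proof -
 obtain C where C: "C > 0" "!!k y. norm (inv_fourier (%\<xi>. a ((1 / 2 ^ k) *\<^sub>R \<xi>)) y) <= C * ker (CARD('n) + 1) k y"
  using inv_fourier_schwartz_decay[OF a, where N="CARD('n) + 1"] by metis
 show ?thesis
 proof (rule Bochner_Integration.integrable_bound)
  show "L1 (%y :: real^'n. C * ker (CARD('n) + 1) 0 y)" by (intro integrable_mult_right integrable_ker) simp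
  have "ift a \<in> Borel" by (intro measurable_ift schwartz_measurable a)
  thus "inv_fourier a \<in> borel_measurable lborel" by (simp add: inv_fourier_eq_ift[abs_def])
  show "AE y in lborel. norm (inv_fourier a y) <= norm (C * ker (CARD('n) + 1) 0 y)"
   using C(2)[of 0] C(1) by (simp add: abs_of_nonneg)
 qed
qed

text \<open>The last fact is Fourier inversion for the product of \<open>a\<close> with the
  transform of \<open>f\<close>: its \<open>ift\<close> is a multiple of \<open>cv a f\<close>,
  which is integrable as a convolution of integrable functions.\<close>

lemma cv_facts:
 assumes a: "a \<in> schwartz" and f: "f \<in> schwartz"
 shows "continuous_on UNIV (cv a f)" "L1 (cv a f)" "\<exists>M. \<forall>x. norm (cv a f x) <= M"
  "fourier (cv a f) = (%\<xi>. a \<xi> * fourier f \<xi>)"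
proof -
 note ai = schwartz_integrable[OF a] and fi = schwartz_integrable[OF f]
 show c: "continuous_on UNIV (cv a f)"
  unfolding cv_def by (rule LP_piece_eq(2)[OF a schwartz_measurable[OF f] schwartz_bounded[OF f]])
 show i: "L1 (cv a f)" unfolding cv_def
  by (rule integrable_conv_self[OF integrable_inv_fourier[OF a] fi]) (use borel_measurable_continuous_onI[OF c] in \<open>simp add: cv_def\<close>)
 show "\<exists>M. \<forall>x. norm (cv a f x) <= M"
  unfolding cv_def using conv_bounded[OF integrable_inv_fourier[OF a] schwartz_measurable[OF f] schwartz_bounded[OF f]] by blast
 define h where "h = (%\<xi>. a \<xi> * fourier f \<xi>)"
 define c :: real where "c = (2 * pi) powr (- real CARD('n))"
 have "c * (2 * pi) powr real CARD('n) = 1" unfolding c_def powr_add[symmetric] by simp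
 hence cp: "c > 0" "c * (2 * pi) ^ CARD('n) = 1" by (simp_all only: c_def powr_realpow pi_gt_zero mult_pos_pos zero_less_numeral powr_gt_zero) simp
 have ch: "continuous_on UNIV (fourier f)" unfolding fourier_eq_ift[abs_def]
  by (rule continuous_on_compose2[OF ift_continuous[OF f]]) (auto intro!: continuous_intros)
 have fb: "norm (fourier f \<xi>) <= (LBINT z. norm (f z))" for \<xi> unfolding fourier_eq_ift by (rule norm_ift_le[OF fi])
 have cvh: "cv a f x = of_real c * ift h x" for x
  unfolding cv_def h_def c_def by (rule conv_inv_fourier[OF ai fi])
 have "ift h = (%x. of_real ((2 * pi) ^ CARD('n)) * cv a f x)"
 proof
  fix x
  have "of_real ((2 * pi) ^ CARD('n)) * (of_real c * ift h x) = of_real (c * (2 * pi) ^ CARD('n)) * ift h x"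
   by (simp only: of_real_mult mult_ac)
  thus "ift h x = of_real ((2 * pi) ^ CARD('n)) * cv a f x" unfolding cvh cp(2) by simp
 qed
 hence hi: "L1 (ift h)" using i by simp
 have h: "L1 h" "continuous_on UNIV h" "norm (h x) <= schwartz_bound a 0 * (LBINT z. norm (f z))" for x
 proof -
  show "L1 h" unfolding h_def
   by (rule integrable_bounded_mult(1)[OF ai _ fb]) (use borel_measurable_continuous_onI[OF ch] in simp)
  show "continuous_on UNIV h" unfolding h_def
   by (intro continuous_intros ch smooth_imp_continuous schwartz_smooth[OF a])
  show "norm (h x) <= schwartz_bound a 0 * (LBINT z. norm (f z))"
   unfolding h_def norm_mult by (intro mult_mono fb schwartz_bounded[OF a]) (use order_trans[OF norm_ge_zero schwartz_bounded[OF a]] in auto)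
 qed
 show "fourier (cv a f) = h"
 proof
  fix \<xi>
  have "fourier (cv a f) \<xi> = of_real c * ift (ift h) (- \<xi>)"
   unfolding fourier_eq_ift by (simp add: ift_def[of "cv a f"] ift_def[of "ift h"] cvh mult.assoc)
  also have "ift (ift h) (- \<xi>) = of_real ((2 * pi) ^ DIM(real^'n)) * h \<xi>" by (rule fourier_inversion(2)[OF h hi])
  finally have "fourier (cv a f) \<xi> = of_real (c * (2 * pi) ^ CARD('n)) * h \<xi>"
   by (simp only: of_real_mult mult_ac) simp
  thus "fourier (cv a f) \<xi> = h \<xi>" unfolding cp(2) by simp
 qed
qed

lemma cv_measurable: "a \<in> schwartz ==> f \<in> schwartz ==> cv a f \<in> Borel"
 using cv_facts(1) by (rule borel_measurable_continuous_onI)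

lemma cv_cv:
 assumes "a \<in> schwartz" "b \<in> schwartz" "f \<in> schwartz" "!!\<xi>. b \<xi> * a \<xi> = a \<xi>"
 shows "cv b (cv a f) = cv a f"
proof
 fix x
 have "(%\<xi>. b \<xi> * fourier (cv a f) \<xi>) = (%\<xi>. a \<xi> * fourier f \<xi>)"
  by (simp add: cv_facts(4)[OF assms(1,3)] assms(4) flip: mult.assoc)
 thus "cv b (cv a f) x = cv a f x"
  unfolding cv_def[of b] cv_def[of a f]
  by (simp add: conv_inv_fourier schwartz_integrable assms cv_facts(2)[unfolded cv_def])
qed

lemma cv_add:
 assumes "a \<in> schwartz" "b \<in> schwartz" "f \<in> schwartz"
 shows "cv (%\<xi>. a \<xi> + b \<xi>) f x = cv a f x + cv b f x"
proof -
 have i: "L1 (%\<xi>. c \<xi> * fourier f \<xi> * iexp (x \<bullet> \<xi>))" if "c \<in> schwartz" for c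
 proof (rule integrable_iexp, rule integrable_bounded_mult(1)[OF schwartz_integrable[OF that]])
  show "norm (fourier f \<xi>) <= (LBINT z. norm (f z))" for \<xi>
   unfolding fourier_eq_ift by (rule norm_ift_le[OF schwartz_integrable[OF assms(3)]])
  have "ift f \<in> Borel" by (intro measurable_ift schwartz_measurable assms)
  hence "(%\<xi>. ift f (- \<xi>)) \<in> Borel" by measurable
  thus "fourier f \<in> borel_measurable lborel" by (simp add: fourier_eq_ift[abs_def])
 qed
 have "L1 (%\<xi>. a \<xi> + b \<xi>)" using assms by (intro Bochner_Integration.integrable_add schwartz_integrable)
 thus ?thesis
  using i[OF assms(1)] i[OF assms(2)] assms
  by (simp add: cv_def conv_inv_fourier schwartz_integrable ift_def distrib_right distrib_left)
qed

lemma cv_dil_sum: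
 assumes f: "f \<in> schwartz" shows "cv (dil (1 / 2 ^ J)) f x = (\<Sum>j\<le>J. cv (psi j) f x)"
proof (induction J)
 case (Suc J)
 have "cv (dil (1 / 2 ^ Suc J)) f x = cv (%\<xi>. dil (1 / 2 ^ J) \<xi> + psi (Suc J) \<xi>) f x"
  by (simp add: psi_simps)
 also have "... = cv (dil (1 / 2 ^ J)) f x + cv (psi (Suc J)) f x"
  by (rule cv_add) (auto intro: dil_schwartz psi_schwartz f)
 finally show ?case using Suc by simp
qed (simp add: psi_simps)

text \<open>A piece reproduces itself under a wider cutoff that is 1 on its frequencies. It is
  therefore dominated by its own average with a kernel of any order, which is the hypothesis of
  \<open>Peetre_bound\<close>.\<close>

lemma psi_Peetre:
 assumes t: "0 < t" "t < 1"
 obtains C where "C > 0" "!!f j x. f \<in> schwartz ==>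
  epowr (enorm (cv (psi j) f x)) t <= ennreal C * kavg D j (%y. epowr (enorm (cv (psi j) f y)) t) x"
proof -
 \<comment> \<open>The kernel order that \<open>Peetre_bound\<close> asks for, D <= t A.\<close>
 define A where "A = nat \<lceil>real D / t\<rceil>"
 have "real D / t <= real A" unfolding A_def by (rule real_nat_ceiling_ge)
 hence A: "real D <= t * real A" using t by (simp add: pos_divide_le_eq mult.commute)
 obtain C where C: "C > 0" "!!k y. norm (inv_fourier (%\<xi>. dil (1/2) ((1 / 2 ^ k) *\<^sub>R \<xi>)) y) <= C * ker A k y"
  using inv_fourier_schwartz_decay[of "dil (1/2)" A] dil_schwartz[of "1/2"] by (metis half_gt_zero_iff less_irrefl zero_less_one)
 show thesis
 proof (rule that[OF C(1)])
  fix f :: "real^'n => complex" and j and x :: "real^'n" assume f: "f \<in> schwartz"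
  let ?b = "%\<xi>. dil (1/2) ((1 / 2 ^ j) *\<^sub>R \<xi>) :: complex"
  have b: "?b \<in> schwartz" unfolding dil_scale by (rule dil_schwartz) simp
  have rep: "cv ?b (cv (psi j) f) = cv (psi j) f"
  proof (rule cv_cv[OF psi_schwartz b f])
   fix \<xi> show "?b \<xi> * psi j \<xi> = psi j \<xi>"
   proof (cases "norm \<xi> > 3/2 * 2 ^ j")
    case False
    hence "norm \<xi> <= 2 * 2 ^ j" using zero_le_power[of "2::real" j] by linarith
    hence "dil (1/2) ((1 / 2 ^ j) *\<^sub>R \<xi>) = 1" by (intro dil_one) (simp add: field_simps)
    thus ?thesis by simp
   qed (simp add: psi_zero)
  qed
  have m: "cv (psi j) f \<in> Borel" by (rule cv_measurable[OF psi_schwartz f])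
  obtain M where M: "!!x. norm (cv (psi j) f x) <= M" using cv_facts(3)[OF psi_schwartz f] by blast
  show "epowr (enorm (cv (psi j) f x)) t <= ennreal C * kavg D j (%y. epowr (enorm (cv (psi j) f y)) t) x"
  proof (rule Peetre_bound[OF t A m M C(1)])
   fix x
   have "enorm (cv (psi j) f x) = enorm (cv ?b (cv (psi j) f) x)" by (simp only: rep)
   also have "... <= ennreal C * kavg A j (%y. enorm (cv (psi j) f y)) x"
    unfolding cv_def[of ?b] using C b m
    by (intro norm_conv_ker_le) (auto intro: borel_measurable_integrable[OF integrable_inv_fourier, simplified] less_imp_le)
   finally show "enorm (cv (psi j) f x) <= ennreal C * kavg A j (%y. enorm (cv (psi j) f y)) x" .
  qed
 qed
qed

end

section \<open>Integration by parts for output frequencies above the input frequencies\<close>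

text \<open>The quotient rule raises the power of |\<xi>|^2 by one and leaves a numerator of the
  same kind, smooth and zero near the origin. The class with arbitrary powers is therefore closed
  under derivatives.\<close>

lemma smooth_divide_norm:
 fixes \<theta> :: "'a::euclidean_space => complex"
 assumes "smooth \<theta>" and \<delta>: "\<delta> > 0" and "!!\<xi>. norm \<xi> < \<delta> ==> \<theta> \<xi> = 0"
 shows "smooth (%\<xi>. \<theta> \<xi> / of_real ((norm \<xi>)\<^sup>2) ^ k)"
proof (rule smooth_coinduct[where P="%f. \<exists>k \<theta>. smooth \<theta> \<and> (\<forall>\<xi>. norm \<xi> < \<delta> --> \<theta> \<xi> = 0) \<and> f = (%\<xi>. \<theta> \<xi> / of_real (\<xi> \<bullet> \<xi>) ^ k)"])
 let ?f = "%(\<theta> :: 'a => complex) k \<xi>. \<theta> \<xi> / of_real (\<xi> \<bullet> \<xi>) ^ k"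
 let ?N = "%\<xi>::'a. \<xi> \<bullet> \<xi>"
 have der: "((?f \<theta> k) has_derivative
   (%v. (of_real (?N \<xi>) * dir_deriv v \<theta> \<xi> - 2 * of_nat k * of_real (\<xi> \<bullet> v) * \<theta> \<xi>) / of_real (?N \<xi>) ^ Suc k)) (at \<xi>)"
  if \<theta>: "smooth \<theta>" "\<forall>\<xi>. norm \<xi> < \<delta> --> \<theta> \<xi> = 0" for k and \<theta> :: "'a => complex" and \<xi>
 proof (cases "norm \<xi> < \<delta>")
  case True
  have o: "open {\<xi>::'a. norm \<xi> < \<delta>}" by (intro open_Collect_less continuous_intros)
  have "((%\<xi>. 0) has_derivative (%v. 0)) (at \<xi>)" by simp
  hence "((?f \<theta> k) has_derivative (%v. 0)) (at \<xi>)"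
   by (rule has_derivative_transform_within_open[OF _ o]) (use True \<theta>(2) in auto)
  moreover have "dir_deriv v \<theta> \<xi> = 0" for v
   using iter_deriv_zero[OF o, of \<theta> \<xi> "[v]"] True \<theta>(2) by auto
  ultimately show ?thesis using \<theta>(2) True by simp
 next
  case False
  hence nz: "\<xi> \<bullet> \<xi> ~= 0" using \<delta> by auto
  have q: "((%\<xi>. complex_of_real ((?N \<xi>) ^ k)) has_derivative (%v. of_real (real k * (?N \<xi>) ^ (k - 1) * (2 * (\<xi> \<bullet> v))))) (at \<xi>)"
  proof (rule bounded_linear.has_derivative[OF bounded_linear_of_real])
   show "((%\<xi>. (?N \<xi>) ^ k) has_derivative (%v. real k * (?N \<xi>) ^ (k - 1) * (2 * (\<xi> \<bullet> v)))) (at \<xi>)"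
    by (auto intro!: derivative_eq_intros simp: inner_commute)
  qed
  show ?thesis
  proof (rule has_derivative_eq_rhs)
   show "((?f \<theta> k) has_derivative
     (%v. (dir_deriv v \<theta> \<xi> * of_real ((?N \<xi>) ^ k) - \<theta> \<xi> * of_real (real k * (?N \<xi>) ^ (k - 1) * (2 * (\<xi> \<bullet> v)))) / (of_real ((?N \<xi>) ^ k) * of_real ((?N \<xi>) ^ k)))) (at \<xi>)"
    using has_derivative_divide'[OF smooth_imp_has_derivative[OF \<theta>(1), of \<xi>] q] nz by simp
   show "(%v. (dir_deriv v \<theta> \<xi> * of_real ((?N \<xi>) ^ k) - \<theta> \<xi> * of_real (real k * (?N \<xi>) ^ (k - 1) * (2 * (\<xi> \<bullet> v)))) / (of_real ((?N \<xi>) ^ k) * of_real ((?N \<xi>) ^ k))) =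
     (%v. (of_real (?N \<xi>) * dir_deriv v \<theta> \<xi> - 2 * of_nat k * of_real (\<xi> \<bullet> v) * \<theta> \<xi>) / of_real (?N \<xi>) ^ Suc k)"
    using nz by (cases k) (auto simp: fun_eq_iff field_simps)
  qed
 qed
 fix f :: "'a => complex"
 assume "\<exists>k \<theta>. smooth \<theta> \<and> (\<forall>\<xi>. norm \<xi> < \<delta> --> \<theta> \<xi> = 0) \<and> f = (?f \<theta> k)"
 then obtain k \<theta> where \<theta>: "smooth \<theta>" "\<forall>\<xi>. norm \<xi> < \<delta> --> \<theta> \<xi> = 0" and f: "f = (?f \<theta> k)" by blast
 show "f differentiable (at \<xi>)" for \<xi> unfolding f using der[OF \<theta>] by (rule differentiableI)
 fix b :: 'a assume b: "b \<in> Basis"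
 define \<theta>' where "\<theta>' = (%\<xi>. of_real (?N \<xi>) * dir_deriv b \<theta> \<xi> - (2 * of_nat k * of_real (\<xi> \<bullet> b)) * \<theta> \<xi>)"
 have lin: "smooth (%\<xi>. complex_of_real (\<xi> \<bullet> c))" for c :: 'a
  by (intro smooth_linear bounded_linear_compose[OF bounded_linear_of_real bounded_linear_inner_left])
 have sq: "smooth (%\<xi> :: 'a. complex_of_real (?N \<xi>))"
  by (subst euclidean_inner) (auto intro!: smooth_sum smooth_mult lin)
 have "smooth \<theta>'" unfolding \<theta>'_def
  by (intro smooth_diff smooth_mult sq smooth_dir_deriv \<theta> b smooth_const lin)
 moreover have "\<theta>' \<xi> = 0" if "norm \<xi> < \<delta>" for \<xi>
 proof -
  have o: "open {\<xi>::'a. norm \<xi> < \<delta>}" by (intro open_Collect_less continuous_intros)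
  have "dir_deriv b \<theta> \<xi> = 0" using iter_deriv_zero[OF o, of \<theta> \<xi> "[b]"] that \<theta>(2) by auto
  thus ?thesis using that \<theta>(2) by (simp add: \<theta>'_def)
 qed
 moreover have "dir_deriv b f = (%\<xi>. \<theta>' \<xi> / of_real (?N \<xi>) ^ Suc k)"
  unfolding f \<theta>'_def by (rule ext, rule dir_derivI[OF der[OF \<theta>]])
 ultimately show "\<exists>k \<theta>. smooth \<theta> \<and> (\<forall>\<xi>. norm \<xi> < \<delta> --> \<theta> \<xi> = 0) \<and> dir_deriv b f = (?f \<theta> k)" by blast
qed (use assms in \<open>auto simp: power2_norm_eq_inner\<close>)

definition annular :: "('a::euclidean_space => complex) => bool" where
 "annular \<theta> \<longleftrightarrow> smooth \<theta> \<and> (\<forall>\<xi>. norm \<xi> < 1/4 \<or> norm \<xi> > 2 --> \<theta> \<xi> = 0)"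

text \<open>The squares of the coordinates sum to |\<xi>|^2, and division by |\<xi>|^2 is harmless
  away from the origin. So the cutoff is a combination of the factors i \<xi>_b, which act as
  derivatives.\<close>

lemma annular_decomp:
 fixes \<theta> :: "'a::euclidean_space => complex"
 assumes \<theta>: "annular \<theta>"
 obtains \<theta>b where "!!b. annular (\<theta>b b)" "!!\<xi>. \<theta> \<xi> = (\<Sum>b\<in>Basis. \<i> * of_real (\<xi> \<bullet> b) * \<theta>b b \<xi>)"
proof
 let ?\<theta>b = "%b \<xi>. (- \<i> * of_real (\<xi> \<bullet> b) * \<theta> \<xi>) / of_real ((norm \<xi>)\<^sup>2) ^ 1"
 show "annular (?\<theta>b b)" for b
 proof -
  have "smooth (%\<xi>. complex_of_real (\<xi> \<bullet> b))"
   by (intro smooth_linear bounded_linear_compose[OF bounded_linear_of_real bounded_linear_inner_left])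
  hence "smooth (?\<theta>b b)" using \<theta>
   by (intro smooth_divide_norm[where \<delta>="1/4"] smooth_mult smooth_const) (auto simp: annular_def)
  thus ?thesis using \<theta> by (auto simp: annular_def)
 qed
 fix \<xi>
 have "(\<Sum>b\<in>Basis. \<i> * of_real (\<xi> \<bullet> b) * ?\<theta>b b \<xi>) = (\<Sum>b\<in>Basis. of_real ((\<xi> \<bullet> b) * (\<xi> \<bullet> b)) * (\<theta> \<xi> / of_real ((norm \<xi>)\<^sup>2)))"
 proof (rule sum.cong[OF refl])
  fix b
  have "\<i> * a * (- \<i> * a * T / N ^ 1) = - (\<i> * \<i>) * ((a * a) * (T / N))" for a T N :: complex
   by (simp only: power_one_right mult_minus_left mult_minus_right divide_inverse mult_ac)
  thus "\<i> * of_real (\<xi> \<bullet> b) * ?\<theta>b b \<xi> = of_real ((\<xi> \<bullet> b) * (\<xi> \<bullet> b)) * (\<theta> \<xi> / of_real ((norm \<xi>)\<^sup>2))" by simp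
 qed
 also have "... = of_real ((norm \<xi>)\<^sup>2) * (\<theta> \<xi> / of_real ((norm \<xi>)\<^sup>2))"
  unfolding sum_distrib_right[symmetric] of_real_sum[symmetric] power2_norm_eq_inner euclidean_inner[of \<xi> \<xi>, symmetric] ..
 also have "... = \<theta> \<xi>" using \<theta> by (cases "\<xi> = 0") (auto simp: annular_def)
 finally show "\<theta> \<xi> = (\<Sum>b\<in>Basis. \<i> * of_real (\<xi> \<bullet> b) * ?\<theta>b b \<xi>)" by simp
qed

text \<open>Integrability against every power of \<open>wt\<close> makes \<open>Bil\<close>
  absolutely convergent for symbols of any order, and bounded cutoffs preserve it.\<close>

definition rapid :: "((real^'n::finite) \<times> (real^'n) => complex) => bool" where
 "rapid F \<longleftrightarrow> F \<in> Borel \<and> (\<forall>a. L1 (%\<nu>. wt \<nu> powr a * norm (F \<nu>)))"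

lemma rapid_mult:
 assumes F: "rapid F" and [measurable]: "b \<in> Borel" and b: "!!\<nu>. norm (b \<nu>) <= K"
 shows "rapid (%\<nu>. b \<nu> * F \<nu>)"
 unfolding rapid_def
proof (intro conjI allI)
 let ?F = "%a \<nu>. wt \<nu> powr a * norm (F \<nu>)"
 have [measurable]: "F \<in> Borel" using F by (simp add: rapid_def)
 show "(%\<nu>. b \<nu> * F \<nu>) \<in> Borel" by measurable
 fix a
 have i: "L1 (%\<nu>. wt \<nu> powr a * norm (F \<nu>))" using F by (simp add: rapid_def)
 show "L1 (%\<nu>. wt \<nu> powr a * norm (b \<nu> * F \<nu>))"
 proof (rule Bochner_Integration.integrable_bound)
  show "L1 (%\<nu>. K * (?F a \<nu>))" using i by simp
  have "(%\<nu>. (?F a \<nu>) * norm (b \<nu>)) \<in> borel_measurable lborel"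
   using borel_measurable_integrable[OF i] by measurable
  thus "(%\<nu>. wt \<nu> powr a * norm (b \<nu> * F \<nu>)) \<in> borel_measurable lborel" by (simp add: norm_mult mult_ac)
  show "AE \<nu> in lborel. norm (wt \<nu> powr a * norm (b \<nu> * F \<nu>)) <= norm (K * (?F a \<nu>))"
  proof (rule AE_I2)
   fix \<nu>
   have "norm (b \<nu>) * (?F a \<nu>) <= K * (?F a \<nu>)" by (intro mult_right_mono b) simp
   thus "norm (wt \<nu> powr a * norm (b \<nu> * F \<nu>)) <= norm (K * (?F a \<nu>))" by (simp add: norm_mult mult_ac)
  qed
 qed
qed

lemma wt_measurable [measurable]: "wt \<in> Borel"
 unfolding wt_def[abs_def] by (intro borel_measurable_continuous_onI continuous_intros)

lemma rapid_fourier: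
 fixes f g :: "real^'n::finite => complex"
 assumes f: "f \<in> schwartz" and g: "g \<in> schwartz"
 shows "rapid (%\<nu>. fourier f (fst \<nu>) * fourier g (snd \<nu>))"
 unfolding rapid_def
proof (intro conjI allI)
 have [measurable]: "fourier h \<in> Borel" if "h \<in> schwartz" for h :: "real^'n => complex"
  unfolding fourier_eq_ift[abs_def] using measurable_ift[OF schwartz_measurable[OF that]] by measurable
 note [measurable] = this[OF f] this[OF g]
 show m: "(%\<nu>. fourier f (fst \<nu>) * fourier g (snd \<nu>)) \<in> Borel" unfolding borel_prod[symmetric] by measurable
 fix a :: real
 define N where "N = nat \<lceil>\<bar>a\<bar>\<rceil>"
 define D where "D = CARD('n) + 1"
 obtain C1 where C1: "C1 > 0" "!!y. norm (ift f y) <= C1 * ker (D + N) 0 y" using ift_schwartz_decay[OF f] by metis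
 obtain C2 where C2: "C2 > 0" "!!y. norm (ift g y) <= C2 * ker (D + N) 0 y" using ift_schwartz_decay[OF g] by metis
 have i: "L1 (%x :: real^'n. C * ker D 0 x)" for C
  by (intro integrable_mult_right integrable_ker) (simp add: D_def)
 have "integrable (lborel \<Otimes>\<^sub>M lborel) (%(x :: real^'n, y :: real^'n). complex_of_real (C1 * ker D 0 x) * complex_of_real (C2 * ker D 0 y))"
  by (intro integrable_prod_mult integrable_of_real i)
 hence ii: "L1 (%\<nu> :: (real^'n) \<times> (real^'n). complex_of_real (C1 * ker D 0 (fst \<nu>)) * complex_of_real (C2 * ker D 0 (snd \<nu>)))"
  by (simp add: lborel_prod case_prod_beta')
 show "L1 (%\<nu>. wt \<nu> powr a * norm (fourier f (fst \<nu>) * fourier g (snd \<nu>)))"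
 proof (rule Bochner_Integration.integrable_bound[OF ii])
  show "(%\<nu>. wt \<nu> powr a * norm (fourier f (fst \<nu>) * fourier g (snd \<nu>))) \<in> borel_measurable lborel" using m by measurable
  show "AE \<nu> in lborel. norm (wt \<nu> powr a * norm (fourier f (fst \<nu>) * fourier g (snd \<nu>))) \<le>
   norm (complex_of_real (C1 * ker D 0 (fst \<nu>)) * complex_of_real (C2 * ker D 0 (snd \<nu>)))"
  proof (rule AE_I2)
   fix \<nu> :: "(real^'n) \<times> (real^'n)"
   obtain \<xi> \<eta> where z: "\<nu> = (\<xi>, \<eta>)" by fastforce
   have "wt \<nu> powr a <= wt \<nu> powr real N" using wt_ge_1[of \<nu>] by (intro powr_mono) (auto simp: N_def intro: order_trans[OF abs_ge_self])
   also have "... = wt \<nu> ^ N" using wt_ge_1[of \<nu>] by (simp add: powr_realpow)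
   also have "... <= ((1 + norm \<xi>) * (1 + norm \<eta>)) ^ N"
    using wt_ge_1[of \<nu>] by (intro power_mono) (auto simp: wt_def z algebra_simps)
   finally have w: "wt \<nu> powr a <= (1 + norm \<xi>) ^ N * (1 + norm \<eta>) ^ N" by (simp add: power_mult_distrib)
   have k: "(1 + norm y) ^ N * (C * ker (D + N) 0 y) = C * ker D 0 y" for C and y :: "real^'n"
    using add_pos_nonneg[OF zero_less_one norm_ge_zero[of y]] by (simp add: ker_def power_add)
   have "norm (fourier f \<xi>) <= C1 * ker (D + N) 0 \<xi>" "norm (fourier g \<eta>) <= C2 * ker (D + N) 0 \<eta>"
    using C1(2)[of "- \<xi>"] C2(2)[of "- \<eta>"] by (simp_all add: fourier_eq_ift ker_minus)
   hence "wt \<nu> powr a * (norm (fourier f \<xi>) * norm (fourier g \<eta>)) \<le>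
     ((1 + norm \<xi>) ^ N * (1 + norm \<eta>) ^ N) * ((C1 * ker (D + N) 0 \<xi>) * (C2 * ker (D + N) 0 \<eta>))"
    using C1(1) C2(1) by (intro mult_mono w) auto
   also have "... = ((1 + norm \<xi>) ^ N * (C1 * ker (D + N) 0 \<xi>)) * ((1 + norm \<eta>) ^ N * (C2 * ker (D + N) 0 \<eta>))" by (simp only: mult_ac)
   also have "... = (C1 * ker D 0 \<xi>) * (C2 * ker D 0 \<eta>)" by (simp only: k)
   finally show "norm (wt \<nu> powr a * norm (fourier f (fst \<nu>) * fourier g (snd \<nu>))) \<le>
    norm (complex_of_real (C1 * ker D 0 (fst \<nu>)) * complex_of_real (C2 * ker D 0 (snd \<nu>)))"
    using C1(1) C2(1) by (simp add: z norm_mult abs_of_nonneg)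
  qed
 qed
qed

text \<open>Fubini writes the smoothed operator as a pairing of \<open>F\<close> with a function of
  \<nu> that grows at most like \<open>wt \<nu> powr m\<close>. At fixed \<nu> this admits
  integration by parts in \<open>y\<close>; in \<open>F\<close> it admits dominated
  convergence.\<close>

lemma conv_Bil:
 fixes \<sigma> :: "'n::finite symbol"
 assumes \<sigma>: "symb m N B \<sigma>" and F: "rapid F" and k: "L1 k"
 shows "Bil \<sigma> F \<in> Borel" "norm (Bil \<sigma> F x) <= B * (LBINT \<nu>. wt \<nu> powr m * norm (F \<nu>))"
  "conv k (Bil \<sigma> F) x = (LBINT \<nu>. F \<nu> * (LBINT y. k (x - y) * (\<sigma> (y, \<nu>) * wave y \<nu>)))"
  "norm (LBINT y. k (x - y) * (\<sigma> (y, \<nu>) * wave y \<nu>)) <= (LBINT y. norm (k y)) * B * wt \<nu> powr m"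
  "(%\<nu>. LBINT y. k (x - y) * (\<sigma> (y, \<nu>) * wave y \<nu>)) \<in> Borel"
proof -
 let ?G = "%\<nu>. LBINT y. k (x - y) * (\<sigma> (y, \<nu>) * wave y \<nu>)"
 let ?F = "%\<nu>. wt \<nu> powr m * norm (F \<nu>)"
 have Fm[measurable]: "F \<in> Borel" and [measurable]: "k \<in> Borel" using F k by (auto simp: rapid_def)
 have i: "L1 (%\<nu>. wt \<nu> powr m * norm (F \<nu>))" using F by (simp add: rapid_def)
 have sm[measurable]: "\<sigma> \<in> Borel" by (rule smooth_imp_measurable[OF symb_smooth[OF \<sigma>]])
 have em[measurable]: "(%p :: (real^'n) \<times> (real^'n) \<times> (real^'n). iexp ((fst p, fst p) \<bullet> snd p)) \<in> Borel"
  by (intro borel_measurable_continuous_onI continuous_intros)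
 have B: "B >= 0" by (rule symb_nonneg[OF \<sigma>])
 note sb = symb_bound[OF \<sigma>]
 have pm[measurable]: "(%(y, \<nu>). \<sigma> (y, \<nu>) * F \<nu> * wave y \<nu>) \<in> borel_measurable (borel \<Otimes>\<^sub>M borel)"
 proof -
  have "(%p. \<sigma> p * F (snd p) * iexp ((fst p, fst p) \<bullet> snd p)) \<in> Borel"
   by (intro borel_measurable_times sm em measurable_compose[OF _ Fm] borel_measurable_continuous_onI continuous_intros)
  thus ?thesis by (simp add: borel_prod case_prod_beta')
 qed
 hence "(%(y, \<nu>). \<sigma> (y, \<nu>) * F \<nu> * wave y \<nu>) \<in> borel_measurable (borel \<Otimes>\<^sub>M lborel)" by simp
 thus "Bil \<sigma> F \<in> Borel" unfolding Bil_def[abs_def] by (rule lborel.borel_measurable_lebesgue_integral)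
 have iB: "L1 (%\<nu>. B * (?F \<nu>))" using i by simp
 have "norm (Bil \<sigma> F x) <= (LBINT \<nu>. B * (?F \<nu>))"
  unfolding Bil_def
 proof (rule Bochner_Integration.integral_norm_bound_integral[OF _ iB])
  have 1: "norm (\<sigma> (x, \<nu>) * F \<nu> * wave x \<nu>) <= B * (?F \<nu>)" for \<nu>
   using mult_right_mono[OF sb[of x \<nu>] norm_ge_zero[of "F \<nu>"]] by (simp add: norm_mult mult.assoc)
  thus "!!\<nu>. \<nu> \<in> space lborel ==> norm (\<sigma> (x, \<nu>) * F \<nu> * wave x \<nu>) <= B * (?F \<nu>)" by blast
  show "L1 (%\<nu>. \<sigma> (x, \<nu>) * F \<nu> * wave x \<nu>)"
  proof (rule Bochner_Integration.integrable_bound[OF iB])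
   show "(%\<nu>. \<sigma> (x, \<nu>) * F \<nu> * wave x \<nu>) \<in> borel_measurable lborel"
    using measurable_compose[OF measurable_Pair1'[of x borel borel] pm] by simp
  qed (rule AE_I2, unfold real_norm_def, rule order_trans[OF 1 abs_ge_self])
 qed
 thus "norm (Bil \<sigma> F x) <= B * (LBINT \<nu>. wt \<nu> powr m * norm (F \<nu>))" using i by simp
 let ?f = "%(y, \<nu>). k (x - y) * (\<sigma> (y, \<nu>) * F \<nu> * wave y \<nu>)"
 have kx: "L1 (%y. k (x - y))" using lborel_integral_reflect(2)[of k x] k by simp
 have int: "integrable (lborel \<Otimes>\<^sub>M lborel) ?f"
 proof (rule Bochner_Integration.integrable_bound)
  show "integrable (lborel \<Otimes>\<^sub>M lborel) (%(y, \<nu>). k (x - y) * complex_of_real (B * (?F \<nu>)))"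
   by (rule integrable_prod_mult[OF kx integrable_of_real[OF iB]])
  have "(%p. k (x - fst p) * (case p of (y, \<nu>) => \<sigma> (y, \<nu>) * F \<nu> * wave y \<nu>)) \<in> borel_measurable (borel \<Otimes>\<^sub>M borel)"
   by measurable
  thus "?f \<in> borel_measurable (lborel \<Otimes>\<^sub>M lborel)" by (simp add: case_prod_beta')
  show "AE p in lborel \<Otimes>\<^sub>M lborel. norm (?f p) <= norm (case p of (y, \<nu>) => k (x - y) * complex_of_real (B * (?F \<nu>)))"
  proof (rule AE_I2)
   fix p :: "(real^'n) \<times> (real^'n) \<times> (real^'n)"
   obtain y \<nu> where p: "p = (y, \<nu>)" by (cases p)
   have "norm (\<sigma> (y, \<nu>)) * norm (F \<nu>) <= B * wt \<nu> powr m * norm (F \<nu>)" by (intro mult_right_mono sb) simp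
   hence "norm (k (x - y)) * (norm (\<sigma> (y, \<nu>)) * norm (F \<nu>)) <= norm (k (x - y)) * (B * wt \<nu> powr m * norm (F \<nu>))"
    by (rule mult_left_mono) simp
   thus "norm (?f p) <= norm (case p of (y, \<nu>) => k (x - y) * complex_of_real (B * (?F \<nu>)))"
    using B by (simp add: p norm_mult mult.assoc)
  qed
 qed
 have "conv k (Bil \<sigma> F) x = (LBINT y. LBINT \<nu>. k (x - y) * (\<sigma> (y, \<nu>) * F \<nu> * wave y \<nu>))"
  by (simp add: conv_def Bil_def)
 also have "... = (LBINT \<nu>. LBINT y. k (x - y) * (\<sigma> (y, \<nu>) * F \<nu> * wave y \<nu>))"
  by (rule lborel_pair.Fubini_integral[OF int, symmetric])
 also have "... = (LBINT \<nu>. LBINT y. F \<nu> * (k (x - y) * (\<sigma> (y, \<nu>) * wave y \<nu>)))"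
  by (simp only: mult_ac)
 finally show "conv k (Bil \<sigma> F) x = (LBINT \<nu>. F \<nu> * ?G \<nu>)"
  by simp
 show "norm (?G \<nu>) <= (LBINT y. norm (k y)) * B * wt \<nu> powr m"
 proof -
  have "norm (?G \<nu>) <= (LBINT y. norm (k (x - y)) * (B * wt \<nu> powr m))"
   by (rule order_trans[OF integral_norm_bound integral_mono'])
     (use kx B in \<open>auto simp: norm_mult intro!: mult_left_mono sb\<close>)
  also have "... = (LBINT y. norm (k y)) * (B * wt \<nu> powr m)"
   using lborel_integral_reflect(1)[of "%y. norm (k y)" x] by simp
  finally show ?thesis by (simp add: mult.assoc)
 qed
 have pm': "(%(y, \<nu>). \<sigma> (y, \<nu>) * wave y \<nu>) \<in> borel_measurable (borel \<Otimes>\<^sub>M borel)"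
  using borel_measurable_times[OF sm em] by (simp add: borel_prod case_prod_beta')
 have "(%p. k (x - snd p) * (case (snd p, fst p) of (y, \<nu>) => \<sigma> (y, \<nu>) * wave y \<nu>)) \<in> borel_measurable (borel \<Otimes>\<^sub>M lborel)"
  by (intro borel_measurable_times measurable_compose[OF _ pm']) measurable
 hence "(%(\<nu>, y). k (x - y) * (\<sigma> (y, \<nu>) * wave y \<nu>)) \<in> borel_measurable (borel \<Otimes>\<^sub>M lborel)"
  by (simp add: case_prod_beta')
 thus "(%\<nu>. LBINT y. k (x - y) * (\<sigma> (y, \<nu>) * wave y \<nu>)) \<in> Borel"
  by (rule lborel.borel_measurable_lebesgue_integral)
qed

lemma integrable_compact_support:
 fixes b :: "'a::euclidean_space => complex"
 assumes "continuous_on UNIV b" "!!z. norm z > R ==> b z = 0"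
 shows "L1 b"
proof -
 have "L1 (%z. indicator (cball 0 R) z *\<^sub>R b z)"
  by (rule borel_integrable_compact) (auto intro: continuous_on_subset[OF assms(1)])
 moreover have "(%z. indicator (cball 0 R) z *\<^sub>R b z) = b"
  using assms(2) by (auto simp: fun_eq_iff indicator_def not_le[symmetric])
 ultimately show ?thesis by simp
qed

lemma ift_prod:
 fixes u v :: "real^'n::finite => complex"
 assumes u: "L1 u" and v: "L1 v"
 shows "L1 (%p. u (fst p) * v (snd p))" "ift (%p. u (fst p) * v (snd p)) \<nu> = ift u (fst \<nu>) * ift v (snd \<nu>)"
proof -
 show "L1 (%p. u (fst p) * v (snd p))"
  using integrable_prod_mult[OF u v] by (simp add: lborel_prod case_prod_beta')
 let ?f = "%(y, z). (u y * iexp (fst \<nu> \<bullet> y)) * (v z * iexp (snd \<nu> \<bullet> z))"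
 have i: "integrable (lborel \<Otimes>\<^sub>M lborel) ?f" by (rule integrable_prod_mult[OF integrable_iexp[OF u] integrable_iexp[OF v]])
 have "ift (%p. u (fst p) * v (snd p)) \<nu> = integral\<^sup>L (lborel \<Otimes>\<^sub>M lborel) ?f"
  unfolding ift_def lborel_prod[symmetric]
  by (intro Bochner_Integration.integral_cong refl) (auto simp: inner_prod_def case_prod_beta' distrib_left exp_add mult_ac)
 also have "... = (LBINT y. LBINT z. ?f (y, z))" by (rule lborel_pair.integral_fst'[OF i, symmetric])
 finally show "ift (%p. u (fst p) * v (snd p)) \<nu> = ift u (fst \<nu>) * ift v (snd \<nu>)" by (simp add: ift_def)
qed

text \<open>The derivative of the kernel passes to symbol times wave. The wave contributes the sum
  of the two frequencies, and both contributions are collected in \<open>xderiv\<close>.\<close>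

lemma symbol_IBP:
 fixes \<sigma> :: "'n::finite symbol"
 assumes \<sigma>: "symb m (Suc N) B \<sigma>" and b: "b \<in> Basis"
  and K: "!!y. (K has_derivative K' y) (at y)" and K'c: "continuous_on UNIV (%y. K' y b)"
  and Ki: "L1 K" and K'i: "L1 (%y. K' y b)"
 shows "(LBINT y. K' (x - y) b * (\<sigma> (y, \<nu>) * wave y \<nu>)) =
  (LBINT y. K (x - y) * (xderiv b \<sigma> (y, \<nu>) * wave y \<nu>))"
proof -
 define e where "e = (%y. wave y \<nu>)"
 define E where "E = (%y. \<sigma> (y, \<nu>) * e y)"
 define E' where "E' = (%y v. \<sigma> (y, \<nu>) * (\<i> * of_real ((fst \<nu> + snd \<nu>) \<bullet> v) * e y) + dir_deriv (v, 0) \<sigma> (y, \<nu>) * e y)"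
 have e_eq: "e = (%y. iexp ((fst \<nu> + snd \<nu>) \<bullet> y))" by (auto simp: e_def inner_prod_def inner_add_right inner_commute)
 have E: "(E has_derivative E' y) (at y)" for y
 proof -
  have "((%y. \<sigma> (y, \<nu>)) has_derivative (%v. dir_deriv (v, 0) \<sigma> (y, \<nu>))) (at y)"
   by (rule has_derivative_compose[OF _ smooth_imp_has_derivative[OF symb_smooth[OF \<sigma>]], of "%y. (y, \<nu>)"]) (auto intro!: derivative_eq_intros)
  thus ?thesis unfolding E_def E'_def e_eq by (rule has_derivative_mult[OF _ has_derivative_iexp_inner])
 qed
 have E'b: "E' y b = xderiv b \<sigma> (y, \<nu>) * e y" for y
  by (simp add: E'_def xderiv_def algebra_simps)
 have sx: "symb (m + 1) N ((2 + real N) * B) (xderiv b \<sigma>)" by (rule symb_xderiv[OF \<sigma> b])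
 have cs: "continuous_on UNIV (%y. \<tau> (y, \<nu>))" if "smooth \<tau>" for \<tau> :: "'n symbol"
  by (rule continuous_on_compose2[OF smooth_imp_continuous[OF that, of UNIV]]) (auto intro!: continuous_intros)
 have ce: "continuous_on UNIV e" unfolding e_def by (intro continuous_intros)
 have cE: "continuous_on UNIV E" unfolding E_def by (intro continuous_intros cs symb_smooth[OF \<sigma>] ce)
 have cE': "continuous_on UNIV (%y. E' y b)" unfolding E'b by (intro continuous_intros cs symb_smooth[OF sx] ce)
 have Kc: "continuous_on UNIV K" using K by (auto intro!: continuous_at_imp_continuous_on has_derivative_continuous)
 have bE: "norm (E y) <= B * wt \<nu> powr m" "norm (E' y b) <= ((2 + real N) * B) * wt \<nu> powr (m + 1)" for y
  using symb_bound[OF \<sigma>, of y \<nu>] symb_bound[OF sx, of y \<nu>] by (simp_all add: E_def E'b norm_mult e_def)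
 have refl_i: "L1 (%y. h (x - y))" if "L1 h" for h :: "real^'n => complex"
  using lborel_integral_reflect(2)[of h x] that by simp
 have Em: "E \<in> borel_measurable lborel" "(%y. E' y b) \<in> borel_measurable lborel"
  using borel_measurable_continuous_onI[OF cE] borel_measurable_continuous_onI[OF cE'] by auto
 note i = integrable_bounded_mult(1)[OF refl_i[OF Ki] Em(1) bE(1)]
  integrable_bounded_mult(1)[OF refl_i[OF Ki] Em(2) bE(2)] integrable_bounded_mult(1)[OF refl_i[OF K'i] Em(1) bE(1)]
 define F' where "F' = (%y v. K (x - y) * E' y v + K' (x - y) (- v) * E y)"
 have minus: "K' (x - y) (- b) = - K' (x - y) b" for y
  using linear_neg[OF has_derivative_linear[OF K]] .
 have "(LBINT y. F' y b) = 0"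
 proof (rule integral_dir_deriv_eq_0)
  show "((%y. K (x - y) * E y) has_derivative F' y) (at y)" for y
   unfolding F'_def
   by (rule has_derivative_mult[OF _ E], rule has_derivative_compose[OF _ K, of "%y. x - y"]) (auto intro!: derivative_eq_intros)
  have "continuous_on UNIV (%y. K (x - y) * E' y b - K' (x - y) b * E y)"
   by (intro continuous_intros cE cE' continuous_on_compose2[OF Kc] continuous_on_compose2[OF K'c]) auto
  thus "continuous_on UNIV (%y. F' y b)" by (simp add: F'_def minus)
  show "L1 (%y. K (x - y) * E y)" by (rule i)
  show "L1 (%y. F' y b)" unfolding F'_def minus using i(2,3) by (intro Bochner_Integration.integrable_add) auto
 qed
 moreover have "(LBINT y. F' y b) = (LBINT y. K (x - y) * E' y b) - (LBINT y. K' (x - y) b * E y)"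
  unfolding F'_def minus using i(2,3) by simp
 ultimately show ?thesis by (simp add: E'b E_def[symmetric] e_def[symmetric]) (simp add: E_def e_def)
qed

context LP begin

text \<open>As \<open>chi j\<close> fixes \<open>F\<close>, the symbol may be replaced by its
  localised version. The operator is then a convolution of the tensor product of \<open>u\<close>
  and \<open>v\<close> on the product space, evaluated on the diagonal, and \<open>ker_prod\<close>
  separates the variables.\<close>

lemma Bil_bound:
 obtains C where "C > 0" "!!(\<sigma> :: 'n symbol) B u v j F x. symb m (2 * L) B \<sigma> ==> L1 u ==> L1 v ==>
  F = (%\<nu>. fourier u (fst \<nu>) * fourier v (snd \<nu>)) ==> (!!\<nu>. chi j \<nu> * F \<nu> = F \<nu>) ==>
  enorm (Bil \<sigma> F x) <= ennreal (C * B * (2 ^ j) powr m) * (kavg L j (%y. enorm (u y)) x * kavg L j (%y. enorm (v y)) x)"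
proof -
 show ?thesis
 proof (rule symb_chi_kernel[of m "2 * L"], goal_cases)
 case C: (1 C)
 show thesis
 proof (rule that[OF C(1)])
  fix \<sigma> :: "'n symbol" and B j F and x :: "real^'n" and u v :: "real^'n => complex"
  assume \<sigma>: "symb m (2 * L) B \<sigma>" and u: "L1 u" and v: "L1 v"
   and F: "F = (%\<nu>. fourier u (fst \<nu>) * fourier v (snd \<nu>))" and chi: "!!\<nu>. chi j \<nu> * F \<nu> = F \<nu>"
  have [measurable]: "u \<in> Borel" "v \<in> Borel" using u v by auto
  define b where "b = (%\<nu>. \<sigma> (x, \<nu>) * chi j \<nu>)"
  define U where "U = (%p. u (fst p) * v (snd p))"
  define K where "K = C * B * (2 ^ j) powr m"
  have K: "K >= 0" using C(1) symb_nonneg[OF \<sigma>] by (simp add: K_def)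
  have bc: "continuous_on UNIV b" unfolding b_def
   by (intro smooth_imp_continuous smooth_mult smooth_slice[OF symb_smooth[OF \<sigma>]] smooth_chi)
  have bi: "L1 b"
  proof (rule integrable_compact_support[OF bc, of "6 * 2 ^ j"])
   fix \<nu> :: "(real^'n) \<times> (real^'n)" assume z: "norm \<nu> > 6 * 2 ^ j"
   have "norm \<nu> <= norm (fst \<nu>) + norm (snd \<nu>)" by (cases \<nu>) (simp add: norm_Pair sqrt_sum_squares_le_sum)
   hence "norm (fst \<nu>) > 3 * 2 ^ j \<or> norm (snd \<nu>) > 3 * 2 ^ j" using z by linarith
   thus "b \<nu> = 0" using chi_base_zero(1)[of "(1 / 2 ^ j) *\<^sub>R \<nu>" "j = 0"] by (simp add: b_def chi_def field_simps)
  qed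
  note U = ift_prod[OF u v, folded U_def]
  have [measurable]: "U \<in> Borel" using U(1) by auto
  have "Bil \<sigma> F x = (LBINT \<nu>. b \<nu> * ift U (- \<nu>) * wave x \<nu>)"
  proof -
   have "\<sigma> (x, \<nu>) * F \<nu> = b \<nu> * ift U (- \<nu>)" for \<nu>
    using chi[of \<nu>] by (simp add: b_def U(2) F fourier_eq_ift mult.assoc)
   thus ?thesis by (simp add: Bil_def)
  qed
  also have "... = conv (ift b) U (x, x)" unfolding conv_def by (rule ift_mult_ift[OF bi U(1)])
  finally have "enorm (Bil \<sigma> F x) <= (\<integral>p. enorm (ift b ((x, x) - p)) * enorm (U p))"
   using bi by (auto intro!: norm_conv_le measurable_ift)
  also have "... <= (\<integral>p. ennreal K * ((ennreal (ker L j (x - fst p)) * enorm (u (fst p))) * (ennreal (ker L j (x - snd p)) * enorm (v (snd p)))))"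
  proof (rule nn_integral_mono)
   fix p :: "(real^'n) \<times> (real^'n)"
   have "norm (ift b ((x, x) - p)) <= K * ker (2 * L) j ((x, x) - p)" unfolding b_def K_def using C(2)[OF \<sigma>, of x j] by (simp add: mult.assoc)
   also have "... <= K * (ker L j (x - fst p) * ker L j (x - snd p))"
    using ker_prod[of L j "x - fst p" "x - snd p"] K by (cases p) (auto intro!: mult_left_mono)
   finally have "enorm (ift b ((x, x) - p)) * enorm (U p) <= ennreal (K * (ker L j (x - fst p) * ker L j (x - snd p))) * enorm (U p)"
    by (intro mult_right_mono ennreal_leI) auto
   also have "... = ennreal K * ((ennreal (ker L j (x - fst p)) * enorm (u (fst p))) * (ennreal (ker L j (x - snd p)) * enorm (v (snd p))))"
    using K by (simp add: U_def norm_mult ennreal_mult mult_ac)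
   finally show "enorm (ift b ((x, x) - p)) * enorm (U p) <= ..." .
  qed
  also have "... = (\<integral>y. \<integral>z. ennreal K * ((ennreal (ker L j (x - y)) * enorm (u y)) * (ennreal (ker L j (x - z)) * enorm (v z))))"
   unfolding lborel_prod[symmetric] by (subst lborel.nn_integral_fst[symmetric]) simp_all
  also have "... = (\<integral>y. (ennreal K * (ennreal (ker L j (x - y)) * enorm (u y))) * kavg L j (%y. enorm (v y)) x)"
   unfolding kavg_def mult.assoc[symmetric, of "ennreal K"] by (intro nn_integral_cong nn_integral_cmult) measurable
  also have "... = (\<integral>y. ennreal K * (ennreal (ker L j (x - y)) * enorm (u y))) * kavg L j (%y. enorm (v y)) x"
   by (rule nn_integral_multc) measurable
  also have "(\<integral>y. ennreal K * (ennreal (ker L j (x - y)) * enorm (u y))) = ennreal K * kavg L j (%y. enorm (u y)) x"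
   unfolding kavg_def by (rule nn_integral_cmult) measurable
  finally show "enorm (Bil \<sigma> F x) <= ennreal (C * B * (2 ^ j) powr m) * (kavg L j (%y. enorm (u y)) x * kavg L j (%y. enorm (v y)) x)"
   by (simp add: K_def mult.assoc)
 qed
 qed
qed

abbreviation scaled :: "(real^'n => complex) => nat => real^'n => complex" where
 "scaled \<theta> k \<equiv> (%\<xi>. \<theta> ((1 / 2 ^ k) *\<^sub>R \<xi>))"

lemma annular_scaled_schwartz:
 assumes \<theta>: "annular \<theta>" shows "scaled \<theta> k \<in> schwartz" "(%\<xi>. \<i> * of_real (b \<bullet> \<xi>) * scaled \<theta> k \<xi>) \<in> schwartz"
proof -
 have "smooth (%\<xi>. \<theta> ((1 / 2 ^ k) *\<^sub>R \<xi> + 0))"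
  by (rule smooth_affine[OF bounded_linear_scaleR_right]) (use \<theta> in \<open>auto simp: annular_def\<close>)
 hence sm: "smooth (scaled \<theta> k)" by simp
 have z: "norm \<xi> > 2 * 2 ^ k ==> scaled \<theta> k \<xi> = 0" for \<xi>
  using \<theta> by (simp add: annular_def field_simps)
 show "scaled \<theta> k \<in> schwartz" by (rule smooth_compact_support_schwartz[OF sm z])
 have "smooth (%\<xi>. complex_of_real (b \<bullet> \<xi>))"
  by (intro smooth_linear bounded_linear_compose[OF bounded_linear_of_real bounded_linear_inner_right])
 thus "(%\<xi>. \<i> * of_real (b \<bullet> \<xi>) * scaled \<theta> k \<xi>) \<in> schwartz"
  by (intro smooth_compact_support_schwartz[where R="2 * 2 ^ k"] smooth_mult sm smooth_const) (simp_all add: z)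
qed

text \<open>One integration by parts: a cutoff at frequency 2^k is 2^-k times a sum of derivatives
  of cutoffs of the same kind.\<close>

lemma annular_step:
 assumes \<theta>: "annular \<theta>"
 obtains \<theta>b where "!!b. annular (\<theta>b b)"
  "!!m N B (\<sigma> :: 'n symbol) F k x. symb m (Suc N) B \<sigma> ==> rapid F ==>
   cv (scaled \<theta> k) (Bil \<sigma> F) x = of_real (1 / 2 ^ k) * (\<Sum>b\<in>Basis. cv (scaled (\<theta>b b) k) (Bil (xderiv b \<sigma>) F) x)"
proof -
 obtain \<theta>b where \<theta>b: "!!b. annular (\<theta>b b)" "!!\<xi>. \<theta> \<xi> = (\<Sum>b\<in>Basis. \<i> * of_real (\<xi> \<bullet> b) * \<theta>b b \<xi>)"
  by (rule annular_decomp[OF \<theta>]) blast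
 show thesis
 proof (rule that[OF \<theta>b(1)])
  fix m N B k and F :: "(real^'n) \<times> (real^'n) => complex" and \<sigma> :: "'n symbol" and x :: "real^'n"
  assume \<sigma>: "symb m (Suc N) B \<sigma>" and F: "rapid F"
  define c where "c = complex_of_real ((2 * pi) powr (- real CARD('n)))"
  define K where "K = (%b. inv_fourier (scaled (\<theta>b b) k))"
  define K' where "K' = (%b y u. c * ift (%\<xi>. \<i> * of_real (u \<bullet> \<xi>) * scaled (\<theta>b b) k \<xi>) y)"
  have K_eq: "inv_fourier (scaled (\<theta>b b) k) = K b" for b by (simp add: K_def)
  have K'_eq: "(%y. K' b y b) = inv_fourier (%\<xi>. \<i> * of_real (b \<bullet> \<xi>) * scaled (\<theta>b b) k \<xi>)" for b
   by (simp add: K'_def c_def inv_fourier_eq_ift[abs_def])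
  note sch = annular_scaled_schwartz[OF \<theta>b(1)]
  have K'i: "L1 (%y. K' b y b)" for b unfolding K'_eq by (rule integrable_inv_fourier[OF sch(2)])
  have Ki: "L1 (K b)" for b unfolding K_def by (rule integrable_inv_fourier[OF sch(1)])
  have K'c: "continuous_on UNIV (%y. K' b y b)" for b unfolding K'_def by (intro continuous_intros ift_continuous sch)
  have K: "(K b has_derivative K' b y) (at y)" for b y
   unfolding K_def K'_def c_def inv_fourier_eq_ift[abs_def]
   by (intro has_derivative_mult_right has_derivative_ift schwartz_measurable sch(1))
     (use schwartz_integrable_deriv(1)[OF sch(1), of "[]"] in simp)
  note G = conv_Bil(1,2)[OF \<sigma> F Ki[of 0]]
  have sc: "scaled \<theta> k \<xi> = of_real (1 / 2 ^ k) * (\<Sum>b\<in>Basis. \<i> * of_real (b \<bullet> \<xi>) * scaled (\<theta>b b) k \<xi>)" for \<xi>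
   unfolding \<theta>b(2) by (simp add: sum_distrib_left inner_commute mult_ac)
  have ker: "inv_fourier (scaled \<theta> k) y = of_real (1 / 2 ^ k) * (\<Sum>b\<in>Basis. K' b y b)" for y
  proof -
   have "inv_fourier (scaled \<theta> k) y = c * ift (scaled \<theta> k) y" by (simp add: inv_fourier_eq_ift c_def)
   also have "ift (scaled \<theta> k) y = (LBINT \<xi>. of_real (1 / 2 ^ k) * (\<Sum>b\<in>Basis. (\<i> * of_real (b \<bullet> \<xi>) * scaled (\<theta>b b) k \<xi>) * iexp (y \<bullet> \<xi>)))"
    unfolding ift_def sc by (simp only: sum_distrib_right mult.assoc)
   also have "... = of_real (1 / 2 ^ k) * (LBINT \<xi>. (\<Sum>b\<in>Basis. (\<i> * of_real (b \<bullet> \<xi>) * scaled (\<theta>b b) k \<xi>) * iexp (y \<bullet> \<xi>)))"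
    by (rule integral_mult_right_zero)
   also have "(LBINT \<xi>. (\<Sum>b\<in>Basis. (\<i> * of_real (b \<bullet> \<xi>) * scaled (\<theta>b b) k \<xi>) * iexp (y \<bullet> \<xi>))) =
     (\<Sum>b\<in>Basis. ift (%\<xi>. \<i> * of_real (b \<bullet> \<xi>) * scaled (\<theta>b b) k \<xi>) y)"
    unfolding ift_def by (intro Bochner_Integration.integral_sum integrable_iexp schwartz_integrable sch(2))
   finally show ?thesis by (simp add: K'_def sum_distrib_left mult_ac)
  qed
  have "cv (scaled \<theta> k) (Bil \<sigma> F) x = (LBINT y. of_real (1 / 2 ^ k) * (\<Sum>b\<in>Basis. K' b (x - y) b * Bil \<sigma> F y))"
   unfolding cv_def conv_def ker by (simp only: sum_distrib_right mult.assoc)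
  also have "... = of_real (1 / 2 ^ k) * (LBINT y. (\<Sum>b\<in>Basis. K' b (x - y) b * Bil \<sigma> F y))" by (rule integral_mult_right_zero)
  also have "(LBINT y. (\<Sum>b\<in>Basis. K' b (x - y) b * Bil \<sigma> F y)) = (\<Sum>b\<in>Basis. conv (%y. K' b y b) (Bil \<sigma> F) x)"
   unfolding conv_def by (intro Bochner_Integration.integral_sum integrable_conv[OF K'i G])
  also have "... = (\<Sum>b\<in>Basis. cv (scaled (\<theta>b b) k) (Bil (xderiv b \<sigma>) F) x)"
  proof (rule sum.cong[OF refl])
   fix b :: "real^'n" assume b: "b \<in> Basis"
   show "conv (%y. K' b y b) (Bil \<sigma> F) x = cv (scaled (\<theta>b b) k) (Bil (xderiv b \<sigma>) F) x"
    unfolding cv_def K_eq conv_Bil(3)[OF \<sigma> F K'i] conv_Bil(3)[OF symb_xderiv[OF \<sigma> b] F Ki]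
     symbol_IBP[OF \<sigma> b K K'c Ki K'i] ..
  qed
  finally show "cv (scaled \<theta> k) (Bil \<sigma> F) x = of_real (1 / 2 ^ k) * (\<Sum>b\<in>Basis. cv (scaled (\<theta>b b) k) (Bil (xderiv b \<sigma>) F) x)" .
 qed
qed

text \<open>That the joint frequency has size 2^j is expressed by \<open>chi j\<close> leaving
  \<open>F\<close> unchanged, the form used by \<open>Bil_bound\<close>.\<close>

definition local_pair :: "nat => (real^'n => complex) => (real^'n => complex) => ((real^'n) \<times> (real^'n) => complex) => bool" where
 "local_pair j u v F \<longleftrightarrow> L1 u \<and> L1 v \<and> rapid F \<and>
   F = (%\<nu>. fourier u (fst \<nu>) * fourier v (snd \<nu>)) \<and> (\<forall>\<nu>. chi j \<nu> * F \<nu> = F \<nu>)"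

definition kavg2 :: "nat => nat => (real^'n => complex) => (real^'n => complex) => real^'n => ennreal" where
 "kavg2 L j u v y = kavg L j (%y. enorm (u y)) y * kavg L j (%y. enorm (v y)) y"

lemma cv_Bil_base:
 assumes \<theta>: "\<theta> \<in> schwartz"
 obtains C where "C > 0" "!!(\<sigma> :: 'n symbol) B u v j F k x. symb m (2 * L) B \<sigma> ==> local_pair j u v F ==>
  enorm (cv (scaled \<theta> k) (Bil \<sigma> F) x) <= ennreal (C * B * (2 ^ j) powr m) * kavg A k (kavg2 L j u v) x"
proof -
 show ?thesis
 proof (rule inv_fourier_schwartz_decay[OF \<theta>, of A], goal_cases)
 case C1: (1 C1)
 show ?thesis
 proof (rule Bil_bound[of m L], goal_cases)
 case C2: (1 C2)
 show thesis
 proof (rule that[of "C1 * C2"])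
  show "C1 * C2 > 0" using C1 C2 by simp
  fix \<sigma> :: "'n symbol" and B j F k and x :: "real^'n" and u v :: "real^'n => complex"
  assume \<sigma>: "symb m (2 * L) B \<sigma>" and lp: "local_pair j u v F"
  have lp': "L1 u" "L1 v" "F = (%\<nu>. fourier u (fst \<nu>) * fourier v (snd \<nu>))" "!!\<nu>. chi j \<nu> * F \<nu> = F \<nu>"
   using lp unfolding local_pair_def by blast+
  have [measurable]: "u \<in> Borel" "v \<in> Borel" using lp' by auto
  have [measurable]: "kavg2 L j u v \<in> Borel" unfolding kavg2_def by measurable
  have Gm[measurable]: "Bil \<sigma> F \<in> Borel" by (rule conv_Bil(1)[OF \<sigma> _ integrable_inv_fourier[OF \<theta>]]) (use lp in \<open>unfold local_pair_def, blast\<close>)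
  have "scaled \<theta> k \<in> Borel" using schwartz_measurable[OF \<theta>] by measurable
  hence km: "inv_fourier (scaled \<theta> k) \<in> Borel" unfolding inv_fourier_eq_ift[abs_def] by measurable
  have "enorm (cv (scaled \<theta> k) (Bil \<sigma> F) x) <= ennreal C1 * kavg A k (%y. enorm (Bil \<sigma> F y)) x"
   unfolding cv_def by (rule norm_conv_ker_le[OF km Gm C1(2)]) (use C1 in simp)
  also have "... <= ennreal C1 * kavg A k (%y. ennreal (C2 * B * (2 ^ j) powr m) * kavg2 L j u v y) x"
   unfolding kavg2_def by (intro mult_left_mono kavg_mono C2(2)[OF \<sigma>] lp') simp
  also have "... = ennreal C1 * (ennreal (C2 * B * (2 ^ j) powr m) * kavg A k (kavg2 L j u v) x)"
   by (subst kavg_cmult) auto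
  also have "... = ennreal (C1 * C2 * B * (2 ^ j) powr m) * kavg A k (kavg2 L j u v) x"
   using C1 C2 symb_nonneg[OF \<sigma>] by (simp add: ennreal_mult mult.assoc)
  finally show "enorm (cv (scaled \<theta> k) (Bil \<sigma> F) x) <= ..." .
 qed
 qed
 qed
qed

text \<open>Each of the \<open>M\<close> steps gains 2^-k from the cutoff and loses 2^j, because
  \<open>xderiv\<close> raises the order of the symbol by one. Profile and order change at every
  step, so the induction generalises over both.\<close>

lemma cv_Bil_decay:
 assumes "annular \<theta>"
 shows "\<exists>C>0. \<forall>(\<sigma> :: 'n symbol) B u v j F k x. symb m (2 * L + M) B \<sigma> --> local_pair j u v F -->
  enorm (cv (scaled \<theta> k) (Bil \<sigma> F) x) <= ennreal (C * B * (2 ^ j) powr m * (2 ^ j / 2 ^ k) ^ M) * kavg A k (kavg2 L j u v) x"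
 using assms
proof (induction M arbitrary: m \<theta>)
 case 0
 have "\<theta> \<in> schwartz" using annular_scaled_schwartz(1)[OF 0, of 0] by simp
 from cv_Bil_base[OF this, of m L A] show ?case by (metis add_0_right mult.right_neutral power_0)
next
 case (Suc M)
 obtain \<theta>b where \<theta>b: "!!b. annular (\<theta>b b)"
  "!!m N B (\<sigma> :: 'n symbol) F k x. symb m (Suc N) B \<sigma> ==> rapid F ==>
   cv (scaled \<theta> k) (Bil \<sigma> F) x = of_real (1 / 2 ^ k) * (\<Sum>b\<in>Basis. cv (scaled (\<theta>b b) k) (Bil (xderiv b \<sigma>) F) x)"
  by (rule annular_step[OF Suc.prems]) blast
 have "\<forall>b. \<exists>C>0. \<forall>(\<sigma> :: 'n symbol) B u v j F k x. symb (m + 1) (2 * L + M) B \<sigma> --> local_pair j u v F -->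
  enorm (cv (scaled (\<theta>b b) k) (Bil \<sigma> F) x) <= ennreal (C * B * (2 ^ j) powr (m + 1) * (2 ^ j / 2 ^ k) ^ M) * kavg A k (kavg2 L j u v) x"
  using Suc.IH[OF \<theta>b(1)] by blast
 from choice[OF this] obtain C where C: "!!b. C b > 0" "!!b (\<sigma> :: 'n symbol) B u v j F k x. symb (m + 1) (2 * L + M) B \<sigma> ==> local_pair j u v F ==>
  enorm (cv (scaled (\<theta>b b) k) (Bil \<sigma> F) x) <= ennreal (C b * B * (2 ^ j) powr (m + 1) * (2 ^ j / 2 ^ k) ^ M) * kavg A k (kavg2 L j u v) x"
  by metis
 define a where "a = 2 + real (2 * L + M)"
 define CC where "CC = (\<Sum>b\<in>Basis. C b) * a"
 have CC: "CC > 0" unfolding CC_def a_def by (intro mult_pos_pos sum_pos C) auto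
 show ?case
 proof (intro exI conjI allI impI, rule CC)
  fix \<sigma> :: "'n symbol" and B u v j F k and x :: "real^'n"
  assume \<sigma>: "symb m (2 * L + Suc M) B \<sigma>" and lp: "local_pair j u v F"
  have F: "rapid F" using lp unfolding local_pair_def by blast
  have \<sigma>': "symb m (Suc (2 * L + M)) B \<sigma>" using \<sigma> by simp
  have B: "B >= 0" by (rule symb_nonneg[OF \<sigma>])
  let ?k = "kavg A k (kavg2 L j u v) x"
  define r where "r = (2 ^ j) powr (m + 1) * (2 ^ j / 2 ^ k) ^ M"
  have r: "r >= 0" by (simp add: r_def)
  have "enorm (cv (scaled \<theta> k) (Bil \<sigma> F) x) = ennreal (1 / 2 ^ k) * enorm (\<Sum>b\<in>Basis. cv (scaled (\<theta>b b) k) (Bil (xderiv b \<sigma>) F) x)"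
   unfolding \<theta>b(2)[OF \<sigma>' F] norm_mult norm_of_real by (subst ennreal_mult) auto
  also have "... <= ennreal (1 / 2 ^ k) * (\<Sum>b\<in>Basis. enorm (cv (scaled (\<theta>b b) k) (Bil (xderiv b \<sigma>) F) x))"
   by (intro mult_left_mono) (auto simp: sum_ennreal intro!: ennreal_leI norm_sum)
  also have "... <= ennreal (1 / 2 ^ k) * (\<Sum>b\<in>(Basis :: (real^'n) set). ennreal (C b * (a * B) * r) * ?k)"
   unfolding r_def mult.assoc[symmetric]
   using C(2)[OF symb_xderiv[OF \<sigma>'] lp] by (intro mult_left_mono sum_mono) (auto simp: a_def mult.assoc)
  also have "(\<Sum>b\<in>(Basis :: (real^'n) set). ennreal (C b * (a * B) * r) * ?k) = ennreal (CC * B * r) * ?k"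
  proof -
   have "(\<Sum>b\<in>(Basis :: (real^'n) set). ennreal (C b * (a * B) * r)) = ennreal (\<Sum>b\<in>(Basis :: (real^'n) set). C b * (a * B) * r)"
    using C(1) B r by (intro sum_ennreal) (auto simp: a_def less_imp_le)
   also have "(\<Sum>b\<in>(Basis :: (real^'n) set). C b * (a * B) * r) = CC * B * r" by (simp add: CC_def sum_distrib_right sum_distrib_left mult_ac)
   finally show ?thesis by (simp only: sum_distrib_right[symmetric])
  qed
  also have "ennreal (1 / 2 ^ k) * (ennreal (CC * B * r) * ?k) = ennreal (CC * B * (2 ^ j) powr m * (2 ^ j / 2 ^ k) ^ Suc M) * ?k"
  proof -
   have "1 / 2 ^ k * (CC * B * r) = CC * B * (2 ^ j) powr m * (2 ^ j / 2 ^ k) ^ Suc M"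
    by (simp add: r_def powr_add mult_ac)
   moreover have "CC * B * r >= 0" using CC B r by simp
   ultimately show ?thesis by (metis ennreal_mult mult.assoc zero_le_divide_1_iff zero_le_numeral zero_le_power)
  qed
  finally show "enorm (cv (scaled \<theta> k) (Bil \<sigma> F) x) <= ennreal (CC * B * (2 ^ j) powr m * (2 ^ j / 2 ^ k) ^ Suc M) * ?k" .
 qed
qed

end

section \<open>One frequency pair at one output frequency\<close>

lemma kavg_order_mono: "D <= E ==> kavg E j h x <= kavg D j h x"
proof -
 assume DE: "D <= E"
 have "ker E j y <= ker D j y" for y :: 'a
 proof -
  have "(1 + 2 ^ j * norm y) ^ D <= (1 + 2 ^ j * norm y) ^ E" using DE by (intro power_increasing) auto
  thus ?thesis unfolding ker_def by (intro divide_left_mono mult_pos_pos zero_less_power add_pos_nonneg) auto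
 qed
 thus ?thesis unfolding kavg_def by (intro nn_integral_mono mult_right_mono ennreal_leI) auto
qed

text \<open>At scales finer than its own, a slowly varying function is nearly constant under the
  kernel; \<open>A\<close> orders of decay pay for its growth.\<close>

lemma kavg_slow_fine:
 fixes H :: "'a::euclidean_space => ennreal"
 assumes D: "D > DIM('a)" and jk: "j <= k"
  and H: "!!y z. H y <= ennreal ((1 + 2 ^ j * norm (z - y)) ^ A) * H z"
 shows "kavg (A + D) k H x <= ennreal (ker_const TYPE('a) D) * H x"
proof -
 have "kavg (A + D) k H x <= (\<integral>y. ennreal (ker D k (x - y)) * H x)"
  unfolding kavg_def
 proof (rule nn_integral_mono)
  fix y
  have "ennreal (ker (A + D) k (x - y)) * H y <= ennreal (ker (A + D) k (x - y)) * (ennreal ((1 + 2 ^ j * norm (x - y)) ^ A) * H x)"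
   by (intro mult_left_mono H) simp
  also have "... = ennreal (ker (A + D) k (x - y) * (1 + 2 ^ j * norm (x - y)) ^ A) * H x"
   by (subst ennreal_mult) (auto simp: mult.assoc)
  also have "... <= ennreal (ker D k (x - y)) * H x"
   by (intro mult_right_mono ennreal_leI ker_absorb jk) simp
  finally show "ennreal (ker (A + D) k (x - y)) * H y <= ennreal (ker D k (x - y)) * H x" .
 qed
 also have "... = (\<integral>y. ennreal (ker D k (x - y))) * H x" by (rule nn_integral_multc) measurable
 also have "... <= ennreal (ker_const TYPE('a) D) * H x" by (intro mult_right_mono nn_integral_ker D) simp
 finally show ?thesis .
qed

text \<open>For \<open>u\<close> with the property \<open>peetre\<close> below, a majorant of
  \<open>enorm (u x)\<close> up to a constant that varies slowly at scale 2^-j. The order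
  \<open>E + E\<close> is what \<open>kavg_kavg\<close> needs to leave a coarse average of order
  \<open>E\<close>.\<close>

definition slow :: "nat => real => nat => ('a::euclidean_space => complex) => 'a => ennreal" where
 "slow E t j u x = epowr (kavg (E + E) j (%y. epowr (enorm (u y)) t) x) (1 / t)"

definition peetre :: "nat => real => real => nat => ('a::euclidean_space => complex) => bool" where
 "peetre E t C j u \<longleftrightarrow> (\<forall>x. epowr (enorm (u x)) t <= ennreal C * kavg (E + E) j (%y. epowr (enorm (u y)) t) x)"

lemma slow_bound:
 assumes t: "t > 0" and C: "C > 0" and p: "peetre E t C j u"
 shows "enorm (u x) <= ennreal (C powr (1 / t)) * slow E t j u x"
proof -
 have "enorm (u x) = epowr (epowr (enorm (u x)) t) (1 / t)" using t by simp
 also have "... <= epowr (ennreal C * kavg (E + E) j (%y. epowr (enorm (u y)) t) x) (1 / t)"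
  using p t unfolding peetre_def by (intro epowr_mono) auto
 also have "... = ennreal (C powr (1 / t)) * slow E t j u x"
  using t C by (simp add: epowr_mult epowr_ennreal slow_def)
 finally show ?thesis .
qed

lemma slow_slow:
 assumes t: "t > 0" and A: "real (E + E) <= t * real A" and [measurable]: "u \<in> Borel"
 shows "slow E t j u y <= ennreal ((1 + 2 ^ j * norm (z - y)) ^ A) * slow E t j u z"
proof -
 let ?s = "1 + 2 ^ j * norm (z - y)"
 have s: "?s >= 1" by simp
 have "slow E t j u y <= epowr (ennreal (?s ^ (E + E)) * kavg (E + E) j (%y. epowr (enorm (u y)) t) z) (1 / t)"
  unfolding slow_def using t by (intro epowr_mono kavg_slow) auto
 also have "... = ennreal ((?s ^ (E + E)) powr (1 / t)) * slow E t j u z"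
  using t by (simp add: epowr_mult epowr_ennreal slow_def)
 also have "(?s ^ (E + E)) powr (1 / t) = ?s powr (real (E + E) / t)"
 proof -
  have "?s ^ (E + E) = ?s powr real (E + E)" using s by (intro powr_realpow[symmetric]) linarith
  thus ?thesis by (simp only: powr_powr) simp
 qed
 also have "... <= ?s powr real A" using s A t by (intro powr_mono) (auto simp: field_simps)
 also have "... = ?s ^ A" using s by (intro powr_realpow) linarith
 finally show ?thesis by (simp add: mult_right_mono ennreal_leI)
qed

text \<open>Coarse averages, k <= j, lose 2^((j-k) n (1-t)) by \<open>kavg_slow_coarse\<close>.
  Finer ones lose only a constant, in agreement with the truncated subtraction in
  \<open>real (j - k)\<close>.\<close>

lemma slow_kavg:
 assumes t: "0 < t" "t < 1" and A: "real (E + E) <= t * real A" and D: "D > DIM('a::euclidean_space)" "E >= D"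
 obtains C where "C > 0" "!!(u :: 'a => complex) j k x. u \<in> Borel ==>
  epowr (kavg (A + D) k (slow E t j u) x) t \<le>
   ennreal (C * 2 powr (real (j - k) * real DIM('a) * (1 - t))) * kavg E (min j k) (%y. epowr (enorm (u y)) t) x"
proof -
 have EL: "real E <= t * real (A + D)" using A t by (simp add: distrib_left add_increasing2)
 show ?thesis
 proof (rule kavg_slow_coarse[where 'a='a and A=A, OF t EL], goal_cases)
 case C: (1 C)
 define C' where "C' = C * ker_const TYPE('a) E + ker_const TYPE('a) D powr t"
 have kc: "ker_const TYPE('a) E > 0" "ker_const TYPE('a) D > 0" by (rule ker_const_pos)+
 have C': "C' > 0" using C(1) kc by (simp add: C'_def add_pos_nonneg)
 show thesis
 proof (rule that[OF C'])
  fix u :: "'a => complex" and j k and x :: 'a assume um[measurable]: "u \<in> Borel"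
  let ?u = "%y. epowr (enorm (u y)) t"
  have slt: "epowr (slow E t j u y) t = kavg (E + E) j ?u y" for y unfolding slow_def using t by simp
  have [measurable]: "slow E t j u \<in> Borel" unfolding slow_def[abs_def] by measurable
  note sl = slow_slow[OF t(1) A um, of j]
  show "epowr (kavg (A + D) k (slow E t j u) x) t <= ennreal (C' * 2 powr (real (j - k) * real DIM('a) * (1 - t))) * kavg E (min j k) ?u x"
  proof (cases "k <= j")
   case True
   let ?r = "2 powr (real (j - k) * real DIM('a) * (1 - t))"
   have "epowr (kavg (A + D) k (slow E t j u) x) t <= ennreal (C * ?r) * kavg E k (kavg (E + E) j ?u) x"
    using C(2)[OF _ True sl] by (simp add: slt)
   also have "... <= ennreal (C * ?r) * (ennreal (ker_const TYPE('a) E) * kavg E k ?u x)"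
    using D by (intro mult_left_mono kavg_kavg True) auto
   also have "... = ennreal (C * ?r * ker_const TYPE('a) E) * kavg E k ?u x"
    using C(1) kc by (subst ennreal_mult[of "C * ?r"]) (auto simp: mult.assoc)
   also have "... <= ennreal (C' * ?r) * kavg E k ?u x"
    by (intro mult_right_mono ennreal_leI) (auto simp: C'_def distrib_right mult_ac)
   finally show ?thesis using True by (simp add: min_absorb2)
  next
   case False
   hence jk: "j <= k" by simp
   have "epowr (kavg (A + D) k (slow E t j u) x) t <= epowr (ennreal (ker_const TYPE('a) D) * slow E t j u x) t"
    by (intro epowr_mono t kavg_slow_fine[OF D(1) jk] sl)
   also have "... = ennreal (ker_const TYPE('a) D powr t) * kavg (E + E) j ?u x"
    using t kc by (simp add: epowr_mult epowr_ennreal slt)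
   also have "... <= ennreal C' * kavg E j ?u x"
    using C(1) kc by (intro mult_mono ennreal_leI kavg_order_mono) (auto simp: C'_def)
   finally show ?thesis using jk by (simp add: min_absorb1)
  qed
 qed
 qed
qed

context LP begin

lemma psi_scaled: "psi k = scaled (psi0 (k = 0)) k"
 by (simp add: psi_def[abs_def])

lemma annular_psi0: "annular (psi0 False)"
proof -
 have "smooth (psi0 False)" using psi0_schwartz by (rule schwartz_smooth)
 moreover have "norm \<xi> < 1/4 \<or> norm \<xi> > 2 ==> psi0 False \<xi> = 0" for \<xi>
  by (auto simp: psi0_def dil_zero dil_one)
 ultimately show ?thesis by (auto simp: annular_def)
qed

lemma psi_Bil:
 assumes t: "0 < t" "t < 1" and Cp: "Cp > 0" and D: "D > CARD('n)" "E >= D"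
 obtains C N where "C > 0" "!!(\<sigma> :: 'n symbol) B u v j F k x V. symb m N B \<sigma> ==> local_pair j u v F \<or> local_pair j v u F ==>
  peetre E t Cp j u ==> (!!y. enorm (v y) <= V) ==>
  epowr (enorm (cv (psi k) (Bil \<sigma> F) x)) t \<le>
   ennreal (C * (B * (2 ^ j) powr m) powr t * 2 powr (real (j - k) * real CARD('n) * (1 - t) - real (k - j) * real M * t)) *
   (epowr V t * kavg E (min j k) (%y. epowr (enorm (u y)) t) x)"
proof -
 define A where "A = nat \<lceil>real (E + E) / t\<rceil>"
 have "real (E + E) / t <= real A" unfolding A_def by (rule real_nat_ceiling_ge)
 hence A: "real (E + E) <= t * real A" using t by (simp add: pos_divide_le_eq mult.commute)
 define L where "L = A + D"
 have DD: "D > DIM(real^'n)" using D by simp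
 define kc where "kc = ker_const TYPE(real^'n) D"
 have kc: "kc > 0" unfolding kc_def by (rule ker_const_pos)
 show thesis
 proof (rule slow_kavg[where 'a="real^'n", OF t A DD D(2)], goal_cases)
 case C1: (1 C1)
 obtain C2 where C2: "C2 > 0" "\<forall>(\<sigma> :: 'n symbol) B u v j F k x. symb m (2 * L + M) B \<sigma> --> local_pair j u v F -->
  enorm (cv (scaled (psi0 False) k) (Bil \<sigma> F) x) <= ennreal (C2 * B * (2 ^ j) powr m * (2 ^ j / 2 ^ k) ^ M) * kavg L k (kavg2 L j u v) x"
  using cv_Bil_decay[OF annular_psi0, of m L M L] by blast
 have "\<exists>C>0. \<forall>(\<sigma> :: 'n symbol) B u v j F k x. symb m (2 * L) B \<sigma> --> local_pair j u v F -->
  enorm (cv (scaled (psi0 b) k) (Bil \<sigma> F) x) <= ennreal (C * B * (2 ^ j) powr m) * kavg L k (kavg2 L j u v) x" for b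
  by (rule cv_Bil_base[OF psi0_schwartz[of b], of m L L]) blast
 then obtain C3 where C3: "!!b. C3 b > 0" "!!b (\<sigma> :: 'n symbol) B u v j F k x. symb m (2 * L) B \<sigma> ==> local_pair j u v F ==>
  enorm (cv (scaled (psi0 b) k) (Bil \<sigma> F) x) <= ennreal (C3 b * B * (2 ^ j) powr m) * kavg L k (kavg2 L j u v) x"
  by metis
 define C4 where "C4 = max C2 (max (C3 False) (C3 True))"
 have C4: "C4 > 0" "C2 <= C4" "C3 b <= C4" for b using C2(1) by (cases b; auto simp: C4_def)+
 define C5 where "C5 = kc * Cp powr (1 / t) * kc"
 have C5: "C5 > 0" using kc Cp by (simp add: C5_def)
 show thesis
 proof (rule that[of "(C4 * C5) powr t * C1" "2 * L + M"])
  show "(C4 * C5) powr t * C1 > 0" using C1(1) C4(1) C5 by simp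
  fix \<sigma> :: "'n symbol" and B u v j F k V and x :: "real^'n"
  assume \<sigma>: "symb m (2 * L + M) B \<sigma>" and lp: "local_pair j u v F \<or> local_pair j v u F"
   and pe: "peetre E t Cp j u" and V: "!!y. enorm (v y) <= V"
  have B: "B >= 0" by (rule symb_nonneg[OF \<sigma>])
  have um[measurable]: "u \<in> Borel" using lp unfolding local_pair_def by auto
  let ?H = "slow E t j u"
  have [measurable]: "?H \<in> Borel" unfolding slow_def[abs_def] by measurable
  define \<rho> where "\<rho> = 2 powr (- (real (k - j) * real M))"
  have \<rho>: "\<rho> > 0" by (simp add: \<rho>_def)
  let ?Z = "(C4 * (B * (2 ^ j) powr m) * \<rho>)"
  have k2: "kavg2 L j u v y <= (ennreal C5 * V) * ?H y" "kavg2 L j v u y <= (ennreal C5 * V) * ?H y" for y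
  proof -
   have "kavg L j (%y. enorm (u y)) y <= kavg L j (%y. ennreal (Cp powr (1 / t)) * ?H y) y"
    by (intro kavg_mono slow_bound t Cp pe)
   also have "... = ennreal (Cp powr (1 / t)) * kavg L j ?H y" by (rule kavg_cmult) measurable
   also have "... <= ennreal (Cp powr (1 / t)) * (ennreal kc * ?H y)"
    unfolding kc_def L_def by (intro mult_left_mono kavg_slow_fine[OF DD order_refl slow_slow[OF t(1) A um]]) auto
   finally have 1: "kavg L j (%y. enorm (u y)) y <= ennreal (Cp powr (1 / t)) * (ennreal kc * ?H y)" .
   have "kavg L j (%y. enorm (v y)) y <= kavg D j (%y. V) y"
    unfolding L_def by (rule order_trans[OF kavg_mono[OF V] kavg_order_mono]) simp
   also have "... <= ennreal kc * V" unfolding kc_def by (rule kavg_const[OF DD])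
   finally have 2: "kavg L j (%y. enorm (v y)) y <= ennreal kc * V" .
   have "kavg2 L j u v y <= ennreal (Cp powr (1 / t)) * (ennreal kc * ?H y) * (ennreal kc * V)"
    unfolding kavg2_def by (intro mult_mono 1 2) auto
   also have "... = (ennreal C5 * V) * ?H y" using kc by (simp add: C5_def ennreal_mult mult_ac)
   finally show "kavg2 L j u v y <= (ennreal C5 * V) * ?H y" .
   thus "kavg2 L j v u y <= (ennreal C5 * V) * ?H y" by (simp add: kavg2_def mult.commute)
  qed
  have "enorm (cv (psi k) (Bil \<sigma> F) x) <= ennreal ?Z * kavg L k (%y. (ennreal C5 * V) * ?H y) x"
  proof -
   \<comment> \<open>\<open>kavg2\<close> is symmetric in its two functions, so the order of the
     pair does not affect the bound.\<close>
   obtain a b where ab: "local_pair j a b F" "!!y. kavg2 L j a b y <= (ennreal C5 * V) * ?H y" using lp k2 by blast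
   have "enorm (cv (psi k) (Bil \<sigma> F) x) <= ennreal ?Z * kavg L k (kavg2 L j a b) x"
   proof (cases "k <= j")
    case True
    have "enorm (cv (psi k) (Bil \<sigma> F) x) <= ennreal (C3 (k = 0) * B * (2 ^ j) powr m) * kavg L k (kavg2 L j a b) x"
     unfolding psi_scaled by (rule C3(2)[OF _ ab(1)]) (rule symb_mono[OF \<sigma>], simp_all)
    also have "... <= ennreal ?Z * kavg L k (kavg2 L j a b) x"
     unfolding mult.assoc using True B C4(3)[of "k = 0"] by (intro mult_right_mono ennreal_leI) (auto simp: \<rho>_def intro!: mult_right_mono)
    finally show ?thesis .
   next
    case False
    \<comment> \<open>For k > j the output cutoff is not the one at k = 0, hence annular, and the
      repeated integration by parts applies.\<close>
    hence k0: "(k = 0) = False" and kj: "k = j + (k - j)" by auto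
    have "(2 ^ j / 2 ^ k) ^ M = \<rho>"
     by (subst kj, unfold power_add) (simp add: \<rho>_def powr_minus_divide power_one_over powr_realpow flip: power_mult of_nat_mult)
    thus ?thesis
     using C2(2)[rule_format, OF \<sigma> ab(1), of k x] B C4(2) \<rho> unfolding psi_scaled k0
     by (elim order_trans) (auto intro!: mult_right_mono ennreal_leI simp: mult.assoc)
   qed
   also have "... <= ennreal ?Z * kavg L k (%y. (ennreal C5 * V) * ?H y) x"
    by (intro mult_left_mono kavg_mono ab(2)) simp
   finally show ?thesis .
  qed
  also have "kavg L k (%y. (ennreal C5 * V) * ?H y) x = (ennreal C5 * V) * kavg L k ?H x"
   by (rule kavg_cmult) measurable
  finally have "epowr (enorm (cv (psi k) (Bil \<sigma> F) x)) t <= epowr (ennreal ?Z * ((ennreal C5 * V) * kavg L k ?H x)) t"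
   by (rule epowr_mono[OF t(1)])
  also have "... = ennreal (?Z powr t) * (ennreal (C5 powr t) * epowr V t * epowr (kavg L k ?H x) t)"
   using t C4(1) B C5 \<rho> by (simp add: epowr_mult epowr_ennreal)
  also have "... <= ennreal (?Z powr t) * (ennreal (C5 powr t) * epowr V t *
    (ennreal (C1 * 2 powr (real (j - k) * real DIM(real^'n) * (1 - t))) * kavg E (min j k) (%y. epowr (enorm (u y)) t) x))"
   unfolding L_def by (intro mult_left_mono C1(2) um) auto
  also have "... = ennreal ((?Z powr t * C5 powr t) * (C1 * 2 powr (real (j - k) * real DIM(real^'n) * (1 - t)))) *
    (epowr V t * kavg E (min j k) (%y. epowr (enorm (u y)) t) x)"
   using C1(1) by (simp only: ennreal_mult mult_nonneg_nonneg powr_ge_zero less_imp_le mult_ac)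
  also have "(?Z powr t * C5 powr t) * (C1 * 2 powr (real (j - k) * real DIM(real^'n) * (1 - t))) =
    (C4 * C5) powr t * C1 * (B * (2 ^ j) powr m) powr t * 2 powr (real (j - k) * real CARD('n) * (1 - t) - real (k - j) * real M * t)"
  proof -
   have "\<rho> powr t = 2 powr (- (real (k - j) * real M * t))" by (simp add: \<rho>_def powr_powr)
   thus ?thesis using C4(1) C5 B \<rho>
    by (simp add: powr_mult powr_diff powr_minus_divide)
  qed
  finally show "epowr (enorm (cv (psi k) (Bil \<sigma> F) x)) t \<le>
   ennreal ((C4 * C5) powr t * C1 * (B * (2 ^ j) powr m) powr t * 2 powr (real (j - k) * real CARD('n) * (1 - t) - real (k - j) * real M * t)) *
   (epowr V t * kavg E (min j k) (%y. epowr (enorm (u y)) t) x)" .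
 qed
 qed
qed

end

section \<open>Growth of the low-frequency factor\<close>

text \<open>For P > 1 the terms below a level l0 are merely counted, and above it x <= l0^(1-P) x^P.
  For P <= 1 every term is at most G, so x <= G^(1-P) x^P throughout.\<close>

lemma sum_le_of_sum_powr:
 fixes x :: "nat => real"
 assumes x: "!!k. x k >= 0" and P: "P > 0" and G: "G >= 0" "(\<Sum>k\<le>j. x k powr P) <= G powr P"
 shows "(\<Sum>k\<le>j. x k) <= 2 * (1 + real j) powr (1 - 1 / max 1 P) * G"
proof (cases "G = 0")
 case True
 hence "(\<Sum>k\<le>j. x k powr P) = 0" using G P by (simp add: antisym sum_nonneg)
 thus ?thesis using True x by (auto simp: sum_nonneg_eq_0_iff)
next
 case False
 hence G0: "G > 0" using G by simp
 \<comment> \<open>For P > 1 this level balances the two contributions, each being G (1+j)^(1 -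
   1/P).\<close>
 define l0 where "l0 = (if P > 1 then G * (1 + real j) powr (- 1 / P) else 0)"
 have "x k <= l0 + (if P > 1 then l0 else G) powr (1 - P) * x k powr P" if k: "k <= j" for k
 proof (cases "P > 1")
  case True
  have l: "l0 > 0" using G0 True by (simp add: l0_def)
  show ?thesis
  proof (cases "x k <= l0")
   case False
   hence "x k = x k powr (1 - P) * x k powr P" using l by (simp flip: powr_add)
   also have "... <= l0 powr (1 - P) * x k powr P" using False l True by (intro mult_right_mono powr_mono2') auto
   finally show ?thesis using l True by simp
  qed (use True in \<open>simp add: add_increasing2\<close>)
 next
  case False
  have "x k powr P <= (\<Sum>k\<le>j. x k powr P)" using k by (intro member_le_sum) auto
  hence "x k powr P <= G powr P" using G by simp
  hence "x k <= G" using G0 P x powr_less_mono2[of P G "x k"] by (meson less_imp_le not_le)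
  moreover have "x k = x k powr (1 - P) * x k powr P" using x[of k] by (cases "x k = 0") (simp_all flip: powr_add)
  ultimately have "x k <= G powr (1 - P) * x k powr P" using False x by (metis diff_ge_0_iff_ge mult_right_mono not_le powr_ge_zero powr_mono2)
  thus ?thesis using False by (simp add: l0_def)
 qed
 hence "(\<Sum>k\<le>j. x k) <= (\<Sum>k\<le>j. l0 + (if P > 1 then l0 else G) powr (1 - P) * x k powr P)" by (intro sum_mono) auto
 also have "... = (1 + real j) * l0 + (if P > 1 then l0 else G) powr (1 - P) * (\<Sum>k\<le>j. x k powr P)"
  by (simp add: sum.distrib sum_distrib_left)
 also have "... <= (1 + real j) * l0 + (if P > 1 then l0 else G) powr (1 - P) * G powr P"
  by (intro add_left_mono mult_left_mono G) simp
 also have "... <= 2 * (1 + real j) powr (1 - 1 / max 1 P) * G"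
 proof (cases "P > 1")
  case True
  have j: "(1 + real j) * (1 + real j) powr (- 1 / P) = (1 + real j) powr (1 - 1 / P)"
   using powr_add[of "1 + real j" 1 "- 1 / P"] by simp
  have "(- 1 / P) * (1 - P) = 1 - 1 / P" using True by (simp add: field_simps)
  hence "l0 powr (1 - P) * G powr P = G * (1 + real j) powr (1 - 1 / P)"
   using True G0 powr_add[of G "1 - P" P] by (simp add: l0_def powr_mult powr_powr)
  moreover have "(1 + real j) * l0 = G * (1 + real j) powr (1 - 1 / P)" using j True by (simp add: l0_def)
  ultimately show ?thesis using True by (simp add: max_def)
 next
  case False
  thus ?thesis using G0 powr_add[of G "1 - P" P] by (simp add: l0_def max_def)
 qed
 finally show ?thesis .
qed

context LP begin

definition wnorm :: "ennreal => ennreal => real => (real^'n => complex) => ennreal" where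
 "wnorm p q a g = tl_norm p q (%k y. ennreal (2 powr (real k * a) * norm (cv (psi k) g y)))"

lemma wnorm_measurable:
 "g \<in> schwartz ==> (%y. ennreal (c * norm (cv (psi k) g y))) \<in> Borel"
 using cv_measurable[OF psi_schwartz] by measurable

text \<open>The Peetre inequality is the single term j = k of \<open>Uop\<close>, where
  \<open>geo\<close> is 1, so \<open>tl_norm_linfty_pointwise\<close> applies to every
  piece.\<close>

lemma lowpass_infty:
 assumes q: "q > 0"
 obtains C where "C > 0" "!!g k x. g \<in> schwartz ==> enorm (cv (psi k) g x) <= ennreal C * wnorm \<infinity> q 0 g"
proof -
 define t where "t = (if q = \<infinity> then 1 / 2 else min 1 (enn2real q) / 2)"
 have t: "0 < t" "t < 1" using q by (auto simp: t_def enn2real_positive_iff less_top)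
 have "ennreal t <= q"
 proof (cases q)
  case (real r)
  thus ?thesis using q by (auto simp: t_def intro!: ennreal_leI)
 qed simp
 note t = t this
 define D where "D = CARD('n) + 1"
 have D: "D > CARD('n)" by (simp add: D_def)
 show ?thesis
 proof (rule psi_Peetre[OF t(1,2), where D=D], goal_cases)
 case C1: (1 C1)
 show thesis
 proof (rule tl_norm_linfty_pointwise[where 'n='n, OF D zero_less_one q t(1,3)], goal_cases)
 case C2: (1 C2)
 show thesis
 proof (rule that[of "C1 powr (1 / t) * C2"])
  show "C1 powr (1 / t) * C2 > 0" using C1 C2 by simp
  fix g :: "real^'n => complex" and k and x :: "real^'n" assume g: "g \<in> schwartz"
  let ?a = "%j y. ennreal (2 powr (real j * 0) * norm (cv (psi j) g y))"
  have [measurable]: "cv (psi k) g \<in> Borel" for k by (rule cv_measurable[OF psi_schwartz g])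
  \<comment> \<open>Normalised so that the constant in the Peetre inequality becomes 1.\<close>
  let ?y = "ennreal (C1 powr (- 1 / t)) * enorm (cv (psi k) g x)"
  have "epowr ?y t = ennreal (1 / C1) * epowr (enorm (cv (psi k) g x)) t"
  proof -
   have "(C1 powr (- 1 / t)) powr t = C1 powr (- 1)" unfolding powr_powr using t(1) by simp
   hence "(C1 powr (- 1 / t)) powr t = 1 / C1" using C1(1) by (simp add: powr_minus_divide)
   thus ?thesis using t by (simp add: epowr_mult epowr_ennreal)
  qed
  also have "... <= ennreal (1 / C1) * (ennreal C1 * kavg D k (%y. epowr (enorm (cv (psi k) g y)) t) x)"
   by (intro mult_left_mono C1 g) simp
  also have "... = kavg D k (%y. epowr (?a k y) t) x" using C1 by (simp flip: ennreal_mult mult.assoc)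
  also have "... <= Uop D 1 (%j x. epowr (?a j x) t) k x"
   unfolding Uop_def by (rule order_trans[OF _ suminf_member_le[of _ k]]) (simp add: geo_def)
  finally have "?y <= ennreal C2 * wnorm \<infinity> q 0 g" unfolding wnorm_def by (rule C2(2)[rotated]) measurable
  hence "ennreal (C1 powr (1 / t)) * ?y <= ennreal (C1 powr (1 / t)) * (ennreal C2 * wnorm \<infinity> q 0 g)" by (rule mult_left_mono) simp
  moreover have "ennreal (C1 powr (1 / t)) * ?y = enorm (cv (psi k) g x)"
   using C1 by (simp add: powr_minus_divide flip: ennreal_mult)
  ultimately show "enorm (cv (psi k) g x) <= ennreal (C1 powr (1 / t) * C2) * wnorm \<infinity> q 0 g"
   using C2(1) by (simp add: ennreal_mult mult.assoc)
 qed
 qed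
 qed
qed

text \<open>All frequencies are controlled at one point \<open>x\<close> by a single integrable function, the \<open>k\<close>-th one by
 its values on the annulus of radius \<open>2 ^ - k\<close> around \<open>x\<close>; the annuli are disjoint.\<close>

lemma lowpass_finite:
 assumes p: "0 < p" "p < \<infinity>" and q: "q > 0"
 obtains C where "C > 0" "!!g j x. g \<in> schwartz ==>
  (\<Sum>k\<le>j. epowr (enorm (cv (psi k) g x)) (enn2real p)) <= ennreal C * epowr (wnorm p q (real CARD('n) / enn2real p) g) (enn2real p)"
proof -
 define P where "P = enn2real p"
 have P: "P > 0" using p by (simp add: P_def enn2real_positive_iff)
 define n where "n = CARD('n)"
 define t where "t = min 1 P / 2"
 have t: "0 < t" "t < 1" "t < P" using P by (auto simp: t_def)
 define Q where "Q = P / t"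
 have Q: "Q > 1" using t by (simp add: Q_def)
 define D where "D = n + 1"
 have D: "D > DIM(real^'n)" by (simp add: D_def n_def)
 define kc where "kc = ker_const TYPE(real^'n) D"
 have kc: "kc > 0" unfolding kc_def by (rule ker_const_pos)
 show ?thesis
 proof (rule psi_Peetre[OF t(1,2), where D=D], goal_cases)
 case C1: (1 C1)
 show ?thesis
 proof (rule maximal_strong_type[where 'a="real^'n", OF Q], goal_cases)
 case C2: (1 C2)
 define K where "K = C1 * 2 ^ D * kc"
 have K: "K > 0" using C1 kc by (simp add: K_def)
 define V where "V = unit_ball_vol (real n)"
 have V: "V > 0" by (simp add: V_def)
 show thesis
 proof (rule that[of "K powr Q * (2 / V) * C2"])
  show "K powr Q * (2 / V) * C2 > 0" using K V C2 by simp
  fix g :: "real^'n => complex" and j and x :: "real^'n" assume g: "g \<in> schwartz"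
  have gm[measurable]: "cv (psi k) g \<in> Borel" for k by (rule cv_measurable[OF psi_schwartz g])
  define a where "a = (%k y. ennreal (2 powr (real k * (real n / P)) * norm (cv (psi k) g y)))"
  have [measurable]: "a k \<in> Borel" for k unfolding a_def by measurable
  define S where "S = (%y. SUP k. a k y)"
  have [measurable]: "S \<in> Borel" unfolding S_def by measurable
  define W where "W = (%y. epowr (maximal (%y. epowr (S y) t) y) Q)"
  have [measurable]: "W \<in> Borel" unfolding W_def by measurable
  have intW: "(\<integral>y. W y) <= ennreal C2 * epowr (wnorm p q (real n / P) g) P"
  proof -
   have "(\<integral>y. W y) <= ennreal C2 * (\<integral>y. epowr (epowr (S y) t) Q)"
    unfolding W_def by (rule C2(2)) measurable
   also have "... = ennreal C2 * (\<integral>y. epowr (S y) P)" using t Q by (simp add: epowr_epowr Q_def)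
   also have "... <= ennreal C2 * epowr (wnorm p q (real n / P) g) P"
    unfolding S_def P_def wnorm_def a_def by (intro mult_left_mono tl_norm_sup_le p q) (use wnorm_measurable[OF g] in auto)
   finally show ?thesis .
  qed
  define R where "R = (%k. ball x (1 / 2 ^ k) - ball x (1 / 2 ^ Suc k))"
  have [measurable]: "R k \<in> sets borel" for k by (simp add: R_def)
  have eR: "ennreal (V / 2 * (1 / 2 ^ k) ^ n) <= emeasure lborel (R k)" for k
  proof -
   have "emeasure lborel (R k) = emeasure lborel (ball x (1 / 2 ^ k)) - emeasure lborel (ball x (1 / 2 ^ Suc k))"
    unfolding R_def by (rule emeasure_Diff) (auto simp: emeasure_ball power_one_over divide_simps intro!: subset_ball)
   also have "... = ennreal (V * (1 / 2 ^ k) ^ n - V * (1 / 2 ^ Suc k) ^ n)"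
    using V by (simp add: emeasure_ball V_def n_def ennreal_minus)
   also have "... >= ennreal (V / 2 * (1 / 2 ^ k) ^ n)"
   proof -
    have "(1 / 2 ^ Suc k :: real) ^ n = (1 / 2 ^ k) ^ n * (1 / 2) ^ n" by (simp add: power_divide power_mult_distrib)
    also have "... <= (1 / 2 ^ k) ^ n * (1 / 2) ^ 1" by (intro mult_left_mono power_decreasing) (auto simp: n_def Suc_le_eq)
    finally have "V * (1 / 2 ^ Suc k) ^ n <= V * ((1 / 2 ^ k) ^ n * (1 / 2))" using V by simp
    thus ?thesis by (intro ennreal_leI) (simp add: field_simps)
   qed
   finally show ?thesis .
  qed
  have pt: "epowr (enorm (cv (psi k) g x)) P <= ennreal (K powr Q * (1 / 2 ^ k) ^ n) * W y" if y: "y \<in> R k" for k y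
  proof -
   let ?u = "%y. epowr (enorm (cv (psi k) g y)) t"
   define c where "c = 2 powr (- (real k * (real n / P) * t))"
   have u: "?u y <= ennreal c * epowr (S y) t" for y
   proof -
    have "enorm (cv (psi k) g y) = ennreal (2 powr (- (real k * (real n / P)))) * a k y"
     by (simp add: a_def powr_minus flip: ennreal_mult mult.assoc)
    also have "... <= ennreal (2 powr (- (real k * (real n / P)))) * S y" unfolding S_def by (intro mult_left_mono SUP_upper) auto
    finally have "?u y <= epowr (ennreal (2 powr (- (real k * (real n / P)))) * S y) t" by (rule epowr_mono[OF t(1)])
    also have "... = ennreal c * epowr (S y) t" using t by (simp add: epowr_mult epowr_ennreal powr_powr c_def)
    finally show ?thesis .
   qed
   \<comment> \<open>Passing from \<open>x\<close> to a point of the k-th annulus costs only 2^D, so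
     each of its points yields an upper bound for the value at \<open>x\<close>.\<close>
   have "2 ^ k * norm (y - x) <= 1" using y by (simp add: R_def dist_norm norm_minus_commute field_simps)
   hence s: "(1 + 2 ^ k * norm (y - x)) ^ D <= 2 ^ D" by (intro power_mono) auto
   have "?u x <= ennreal C1 * kavg D k ?u x" by (rule C1(2)[OF g])
   also have "... <= ennreal C1 * (ennreal (2 ^ D) * kavg D k ?u y)"
    by (intro mult_left_mono order_trans[OF kavg_slow[where x=y]] mult_right_mono ennreal_leI s) auto
   also have "... <= ennreal C1 * (ennreal (2 ^ D) * kavg D k (%y. ennreal c * epowr (S y) t) y)"
    by (intro mult_left_mono kavg_mono u) auto
   also have "kavg D k (%y. ennreal c * epowr (S y) t) y = ennreal c * kavg D k (%y. epowr (S y) t) y"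
    by (rule kavg_cmult) measurable
   also have "... <= ennreal c * (ennreal kc * maximal (%y. epowr (S y) t) y)"
    unfolding kc_def by (intro mult_left_mono kavg_le_maximal D) auto
   also have "ennreal C1 * (ennreal (2 ^ D) * (ennreal c * (ennreal kc * maximal (%y. epowr (S y) t) y))) = ennreal (K * c) * maximal (%y. epowr (S y) t) y"
    using C1 kc by (simp add: K_def c_def ennreal_mult mult_ac)
   finally have "epowr (?u x) Q <= epowr (ennreal (K * c) * maximal (%y. epowr (S y) t) y) Q"
    using Q by (intro epowr_mono) (auto simp: mult_left_mono)
   also have "... = ennreal (K powr Q * c powr Q) * W y"
    using Q K by (simp add: W_def epowr_mult epowr_ennreal c_def powr_mult)
   \<comment> \<open>The smoothness n / P enters here: 2^(-k n) is the volume of the annulus up to a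
     constant, so integration over the annulus removes this factor.\<close>
   also have "c powr Q = (1 / 2 ^ k) ^ n"
   proof -
    have "c powr Q = 2 powr (- real (k * n))" unfolding c_def Q_def powr_powr using t P by simp
    also have "... = (1 / 2 ^ k) ^ n" unfolding powr_minus_divide by (subst powr_realpow) (simp_all add: power_divide power_mult)
    finally show ?thesis .
   qed
   finally show ?thesis using t Q by (simp add: epowr_epowr Q_def)
  qed
  have one: "epowr (enorm (cv (psi k) g x)) P <= ennreal (K powr Q * (2 / V)) * (\<integral>y. W y * indicator (R k) y)" for k
  proof -
   let ?e = "epowr (enorm (cv (psi k) g x)) P"
   have "?e * ennreal (V / 2 * (1 / 2 ^ k) ^ n) <= ?e * emeasure lborel (R k)" by (intro mult_left_mono eR) simp
   also have "... = (\<integral>y. ?e * indicator (R k) y)" by (simp add: nn_integral_cmult_indicator)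
   also have "... <= (\<integral>y. ennreal (K powr Q * (1 / 2 ^ k) ^ n) * (W y * indicator (R k) y))"
    by (intro nn_integral_mono) (auto simp: indicator_def intro: pt)
   also have "... = ennreal (K powr Q * (1 / 2 ^ k) ^ n) * (\<integral>y. W y * indicator (R k) y)"
    by (rule nn_integral_cmult) measurable
   finally have le: "(?e * ennreal (V / 2 * (1 / 2 ^ k) ^ n)) * ennreal (2 / V * (2 ^ k) ^ n) \<le>
     (ennreal (K powr Q * (1 / 2 ^ k) ^ n) * (\<integral>y. W y * indicator (R k) y)) * ennreal (2 / V * (2 ^ k) ^ n)" by (rule mult_right_mono) simp
   have e1: "ennreal (V / 2 * (1 / 2 ^ k) ^ n) * ennreal (2 / V * (2 ^ k) ^ n) = 1"
    using V by (subst ennreal_mult[symmetric]) (auto simp: power_one_over)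
   have e2: "ennreal (K powr Q * (1 / 2 ^ k) ^ n) * ennreal (2 / V * (2 ^ k) ^ n) = ennreal (K powr Q * (2 / V))"
    using V by (subst ennreal_mult[symmetric]) (auto simp: power_one_over)
   have "a * (b * d) <= (c * d) * i" if "(a * b) * d <= (c * i) * d" for a b c d i :: ennreal using that by (simp only: mult_ac)
   from this[OF le] show ?thesis unfolding e1 e2 by simp
  qed
  have "(\<Sum>k\<le>j. epowr (enorm (cv (psi k) g x)) P) <= (\<Sum>k\<le>j. ennreal (K powr Q * (2 / V)) * (\<integral>y. W y * indicator (R k) y))"
   by (rule sum_mono) (rule one)
  also have "... = ennreal (K powr Q * (2 / V)) * (\<integral>y. (\<Sum>k\<le>j. W y * indicator (R k) y))"
   by (subst nn_integral_sum) (auto simp: sum_distrib_left)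
  also have "... <= ennreal (K powr Q * (2 / V)) * (\<integral>y. W y)"
  proof (intro mult_left_mono nn_integral_mono)
   fix y
   have "disjoint_family_on R {..j}"
    unfolding disjoint_family_on_def
   proof (intro ballI impI)
    have "R k \<inter> R l = {}" if "k < l" for k l
    proof -
     have "1 / 2 ^ l <= (1 / 2 ^ Suc k :: real)" using that by (intro divide_left_mono power_increasing) auto
     thus ?thesis by (auto simp: R_def)
    qed
    thus "R k \<inter> R l = {}" if "k ~= l" for k l using that by (metis inf_commute linorder_neqE_nat)
   qed
   hence "(\<Sum>k\<le>j. indicator (R k) y :: ennreal) = indicator (\<Union>k\<le>j. R k) y" by (subst indicator_UN_disjoint) auto
   also have "... <= 1" by (simp add: indicator_def)
   finally show "(\<Sum>k\<le>j. W y * indicator (R k) y) <= W y" unfolding sum_distrib_left[symmetric] using mult_left_mono[of _ 1 "W y"] by simp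
  qed auto
  also have "... <= ennreal (K powr Q * (2 / V)) * (ennreal C2 * epowr (wnorm p q (real n / P) g) P)"
   by (intro mult_left_mono intW) simp
  also have "... = ennreal (K powr Q * (2 / V) * C2) * epowr (wnorm p q (real n / P) g) P"
   unfolding mult.assoc[symmetric] using V C2(1) by (subst ennreal_mult'') auto
  finally show "(\<Sum>k\<le>j. epowr (enorm (cv (psi k) g x)) (enn2real p)) <= ennreal (K powr Q * (2 / V) * C2) * epowr (wnorm p q (real CARD('n) / enn2real p) g) (enn2real p)"
   by (simp only: P_def n_def)
 qed
 qed
 qed
qed

text \<open>There are 1 + j pieces to add: uniformly bounded ones give the exponent 1, those
  summable to the power P give 1 - 1 / max 1 P.\<close>

lemma lowpass:
 assumes p: "p > 0" "q > 0" and e: "p = \<infinity> ==> e >= 1" "p < \<infinity> ==> e >= 1 - 1 / max 1 (enn2real p)"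
 obtains C where "C > 0" "!!g j x. g \<in> schwartz ==>
  enorm (cv (dil (1 / 2 ^ j)) g x) <= ennreal (C * (1 + real j) powr e) * wnorm p q (enn2real (of_nat CARD('n) / p)) g"
proof (cases "p = \<infinity>")
 case True
 show ?thesis
 proof (rule lowpass_infty[OF p(2)], goal_cases)
 case C: (1 C)
 show thesis
 proof (rule that[OF C(1)])
  fix g :: "real^'n => complex" and j and x :: "real^'n" assume g: "g \<in> schwartz"
  have "enorm (cv (dil (1 / 2 ^ j)) g x) <= (\<Sum>k\<le>j. enorm (cv (psi k) g x))"
   unfolding cv_dil_sum[OF g] by (auto simp: sum_ennreal intro!: ennreal_leI norm_sum)
  also have "... <= (\<Sum>k\<le>j. ennreal C * wnorm \<infinity> q 0 g)" by (intro sum_mono C(2) g)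
  also have "... = ennreal (1 + real j) * (ennreal C * wnorm \<infinity> q 0 g)" by (simp add: ennreal_of_nat_eq_real_of_nat add.commute)
  also have "... <= ennreal ((1 + real j) powr e) * (ennreal C * wnorm \<infinity> q 0 g)"
   using e(1)[OF True] powr_mono[of 1 e "1 + real j"] by (intro mult_right_mono ennreal_leI) auto
  also have "... = ennreal (C * (1 + real j) powr e) * wnorm \<infinity> q 0 g" using C(1) by (simp add: ennreal_mult mult_ac)
  finally show "enorm (cv (dil (1 / 2 ^ j)) g x) <= ennreal (C * (1 + real j) powr e) * wnorm p q (enn2real (of_nat CARD('n) / p)) g"
   using True by simp
 qed
 qed
next
 case False
 hence p': "p < \<infinity>" by (simp add: less_top)
 define P where "P = enn2real p"
 have P: "P > 0" "p = ennreal P" using p p' by (simp_all add: P_def enn2real_positive_iff)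
 have a: "enn2real (of_nat CARD('n) / p) = real CARD('n) / P"
  using P by (simp add: divide_ennreal ennreal_of_nat_eq_real_of_nat)
 show ?thesis
 proof (rule lowpass_finite[OF p(1) p' p(2)], goal_cases)
 case C: (1 C)
 show thesis
 proof (rule that[of "2 * C powr (1 / P)"])
  show "2 * C powr (1 / P) > 0" using C by simp
  fix g :: "real^'n => complex" and j and x :: "real^'n" assume g: "g \<in> schwartz"
  let ?G = "wnorm p q (real CARD('n) / P) g"
  show "enorm (cv (dil (1 / 2 ^ j)) g x) <= ennreal (2 * C powr (1 / P) * (1 + real j) powr e) * wnorm p q (enn2real (of_nat CARD('n) / p)) g"
   unfolding a
  proof (cases ?G)
   case (real G)
   have "ennreal (\<Sum>k\<le>j. norm (cv (psi k) g x) powr P) <= ennreal (C * G powr P)"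
    using C(2)[OF g, of x j] real P C(1) by (simp add: P_def[symmetric] epowr_ennreal sum_ennreal ennreal_mult)
   hence "(\<Sum>k\<le>j. norm (cv (psi k) g x) powr P) <= (C powr (1 / P) * G) powr P"
    using C(1) P real by (simp add: ennreal_le_iff powr_mult powr_powr)
   from sum_le_of_sum_powr[OF _ P(1) _ this]
   have "(\<Sum>k\<le>j. norm (cv (psi k) g x)) <= 2 * (1 + real j) powr (1 - 1 / max 1 P) * (C powr (1 / P) * G)" using real by simp
   also have "... <= 2 * (1 + real j) powr e * (C powr (1 / P) * G)"
    using real e(2)[OF p'] by (intro mult_right_mono mult_left_mono powr_mono) (auto simp: P_def)
   finally have "norm (cv (dil (1 / 2 ^ j)) g x) <= 2 * C powr (1 / P) * (1 + real j) powr e * G"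
    unfolding cv_dil_sum[OF g] by (intro order_trans[OF norm_sum]) (simp add: mult_ac)
   thus "enorm (cv (dil (1 / 2 ^ j)) g x) <= ennreal (2 * C powr (1 / P) * (1 + real j) powr e) * ?G"
    using real by (simp add: ennreal_leI flip: ennreal_mult)
  next
   case top
   have "ennreal (2 * C powr (1 / P) * (1 + real j) powr e) ~= 0" using C by (simp add: ennreal_eq_0_iff not_le)
   thus "enorm (cv (dil (1 / 2 ^ j)) g x) <= ennreal (2 * C powr (1 / P) * (1 + real j) powr e) * ?G"
    using top by (simp add: ennreal_mult_top)
  qed
 qed
 qed
qed

section \<open>Decomposition into frequency pairs\<close>

text \<open>Comprises the pieces with index strictly below \<open>j\<close>: the diagonal pairs
  belong to the family \<open>hilo\<close>, so that every pair of pieces is counted once.\<close>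

definition low :: "nat => real^'n => complex" where
 "low j = (if j = 0 then (%\<xi>. 0) else dil (1 / 2 ^ (j - 1)))"

lemma low_schwartz: "low j \<in> schwartz"
proof (cases "j = 0")
 case True
 have "(%\<xi> :: real^'n. 0 :: complex) \<in> schwartz" by (rule smooth_compact_support_schwartz[where R=0]) (auto intro: smooth_const)
 thus ?thesis using True by (simp add: low_def)
qed (simp add: low_def dil_schwartz)

lemma low_bound:
 assumes C: "C > 0" "e >= 0" and b: "!!j x. enorm (cv (dil (1 / 2 ^ j)) g x) <= ennreal (C * (1 + real j) powr e) * G"
 shows "enorm (cv (low j) g x) <= ennreal (C * (1 + real j) powr e) * G"
proof (cases "j = 0")
 case True
 thus ?thesis by (simp add: low_def cv_def conv_def inv_fourier_def)
next
 case False
 have "enorm (cv (low j) g x) <= ennreal (C * (1 + real (j - 1)) powr e) * G" using b[of "j - 1" x] False by (simp add: low_def)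
 also have "... <= ennreal (C * (1 + real j) powr e) * G"
  using C by (intro mult_right_mono ennreal_leI mult_left_mono powr_mono2) auto
 finally show ?thesis .
qed

definition freq_pair :: "(real^'n => complex) => (real^'n => complex) => (real^'n => complex) => (real^'n => complex) => (real^'n) \<times> (real^'n) => complex" where
 "freq_pair a b f g \<nu> = (a (fst \<nu>) * b (snd \<nu>)) * (fourier f (fst \<nu>) * fourier g (snd \<nu>))"

abbreviation hilo where "hilo j \<equiv> freq_pair (psi j) (dil (1 / 2 ^ j))"
abbreviation lohi where "lohi j \<equiv> freq_pair (low j) (psi j)"
abbreviation tensor where "tensor f g \<equiv> (%\<nu>. fourier f (fst \<nu>) * fourier g (snd \<nu>))"

lemma chi_one:
 assumes "norm (fst \<nu>) <= 2 * 2 ^ j" "norm (snd \<nu>) <= 2 * 2 ^ j" "j = 0 \<or> norm (fst \<nu>) >= 2 ^ j / 2 \<or> norm (snd \<nu>) >= 2 ^ j / 2"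
 shows "chi j \<nu> = 1"
proof -
 have "dil (1/2) ((1 / 2 ^ j) *\<^sub>R \<xi>) = 1" if "norm \<xi> <= 2 * 2 ^ j" for \<xi> using that by (intro dil_one) (simp add: field_simps)
 moreover have "dil 4 ((1 / 2 ^ j) *\<^sub>R \<xi>) = 0" if "norm \<xi> >= 2 ^ j / 2" for \<xi>
 proof -
  have "norm \<xi> * 8 > 3 * 2 ^ j" using that zero_less_power[of "2::real" j] by linarith
  thus ?thesis by (intro dil_zero) (simp add: field_simps)
 qed
 ultimately show ?thesis using assms by (auto simp: chi_def chi_base_def)
qed

lemma local_pair_freq:
 assumes a: "a \<in> schwartz" and b: "b \<in> schwartz" and f: "f \<in> schwartz" and g: "g \<in> schwartz"
  and s: "!!\<xi>. norm \<xi> > 2 * 2 ^ j ==> a \<xi> = 0" "!!\<xi>. norm \<xi> > 2 * 2 ^ j ==> b \<xi> = 0"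
   "j = 0 \<or> (\<forall>\<xi>. norm \<xi> < 2 ^ j / 2 --> a \<xi> = 0) \<or> (\<forall>\<xi>. norm \<xi> < 2 ^ j / 2 --> b \<xi> = 0)"
 shows "local_pair j (cv a f) (cv b g) (freq_pair a b f g)"
 unfolding local_pair_def
proof (intro conjI allI)
 show "L1 (cv a f)" "L1 (cv b g)" using cv_facts(2) a b f g by auto
 show eq: "freq_pair a b f g = (%\<nu>. fourier (cv a f) (fst \<nu>) * fourier (cv b g) (snd \<nu>))"
  by (auto simp: fun_eq_iff freq_pair_def cv_facts(4)[OF a f] cv_facts(4)[OF b g])
 have [measurable]: "a \<in> Borel" "b \<in> Borel" using a b by (auto intro: schwartz_measurable)
 show "rapid (freq_pair a b f g)" unfolding freq_pair_def[abs_def]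
 proof (rule rapid_mult[OF rapid_fourier[OF f g]])
  show "(%\<nu>. a (fst \<nu>) * b (snd \<nu>)) \<in> Borel" unfolding borel_prod[symmetric] by measurable
  show "norm (a (fst \<nu>) * b (snd \<nu>)) <= schwartz_bound a 0 * schwartz_bound b 0" for \<nu> :: "(real^'n) \<times> (real^'n)"
   unfolding norm_mult by (intro mult_mono schwartz_bounded a b) (use order_trans[OF norm_ge_zero schwartz_bounded[OF a]] in auto)
 qed
 show "chi j \<nu> * freq_pair a b f g \<nu> = freq_pair a b f g \<nu>" for \<nu>
 proof (cases "freq_pair a b f g \<nu> = 0")
  case False
  hence "a (fst \<nu>) ~= 0" "b (snd \<nu>) ~= 0" by (auto simp: freq_pair_def)
  hence "chi j \<nu> = 1" using s by (intro chi_one) (auto simp: not_less[symmetric])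
  thus ?thesis by simp
 qed simp
qed

text \<open>The cutoffs \<open>psi j\<close>, \<open>low j\<close> and the dilate of index j vanish
  beyond 2 * 2^j, and \<open>psi j\<close> vanishes below 2^j / 2 unless j = 0. The remaining
  frequencies are those of \<open>chi_one\<close>.\<close>

lemma local_pair_psi:
 assumes f: "f \<in> schwartz" and g: "g \<in> schwartz"
 shows "local_pair j (cv (psi j) f) (cv (dil (1 / 2 ^ j)) g) (hilo j f g)"
  "local_pair j (cv (low j) f) (cv (psi j) g) (lohi j f g)"
proof -
 have z: "psi j \<xi> = 0" "dil (1 / 2 ^ j) \<xi> = 0" "low j \<xi> = 0" if "norm \<xi> > 2 * 2 ^ j" for \<xi>
 proof -
  have n: "norm \<xi> > 3/2 * 2 ^ j" using that zero_less_power[of "2::real" j] by linarith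
  thus "psi j \<xi> = 0" "dil (1 / 2 ^ j) \<xi> = 0" by (auto intro!: psi_zero dil_zero simp: field_simps)
  show "low j \<xi> = 0"
  proof (cases j)
   case (Suc i)
   have "norm \<xi> * 2 > 3 * 2 ^ i" using n norm_ge_zero[of \<xi>] unfolding Suc power_Suc by linarith
   thus ?thesis using Suc by (auto simp: low_def field_simps intro!: dil_zero)
  qed (simp add: low_def)
 qed
 have "j = 0 \<or> (\<forall>\<xi>. norm \<xi> < 2 ^ j / 2 --> psi j \<xi> = 0)" using psi_zero(2)[of j] by auto
 thus "local_pair j (cv (psi j) f) (cv (dil (1 / 2 ^ j)) g) (hilo j f g)"
  "local_pair j (cv (low j) f) (cv (psi j) g) (lohi j f g)"
  using z by (auto intro!: local_pair_freq psi_schwartz low_schwartz dil_schwartz f g)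
qed

text \<open>Telescoping: if D_j is the cutoff of all pieces up to j, then D_j(\<xi>) D_j(\<eta>) -
  D_(j-1)(\<xi>) D_(j-1)(\<eta>) equals psi_j(\<xi>) D_j(\<eta>) + D_(j-1)(\<xi>)
  psi_j(\<eta>).\<close>

lemma sum_freq_pair:
 "(\<Sum>j\<le>J. hilo j f g \<nu> + lohi j f g \<nu>) = freq_pair (dil (1 / 2 ^ J)) (dil (1 / 2 ^ J)) f g \<nu>"
proof (induction J)
 case (Suc J)
 thus ?case by (simp only: sum.atMost_Suc) (simp add: freq_pair_def low_def psi_simps algebra_simps)
qed (simp add: freq_pair_def low_def psi_simps)

text \<open>Partial sums correspond to cutting \<open>F\<close> off at frequency 2^J, and dominated
  convergence in the pairing of \<open>conv_Bil\<close> gives the limit. For t <= 1 the t-th power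
  is subadditive, so the pairs can be estimated one by one.\<close>

lemma cv_Bil_decomp:
 fixes \<sigma> :: "'n symbol"
 assumes \<sigma>: "symb m N B \<sigma>" and a: "a \<in> schwartz" and f: "f \<in> schwartz" and g: "g \<in> schwartz" and t: "0 < t" "t <= 1"
 shows "epowr (enorm (cv a (Bil \<sigma> (tensor f g)) x)) t \<le>
  (\<Sum>j. epowr (enorm (cv a (Bil \<sigma> (hilo j f g)) x)) t +
     epowr (enorm (cv a (Bil \<sigma> (lohi j f g)) x)) t)"
proof -
 let ?F = "tensor f g"
 define G where "G = (%\<nu>. LBINT y. inv_fourier a (x - y) * (\<sigma> (y, \<nu>) * wave y \<nu>))"
 define K where "K = (LBINT y. norm (inv_fourier a y)) * B"
 note ai = integrable_inv_fourier[OF a]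
 note rF = rapid_fourier[OF f g]
 note cb = conv_Bil[OF \<sigma> _ ai, folded cv_def]
 have cv: "cv a (Bil \<sigma> F) x = (LBINT \<nu>. F \<nu> * G \<nu>)" if "rapid F" for F unfolding G_def by (rule cb(3)[OF that])
 have G: "norm (G \<nu>) <= K * wt \<nu> powr m" for \<nu> unfolding G_def K_def by (rule cb(4)[OF rF])
 have Gm[measurable]: "G \<in> Borel" unfolding G_def by (rule cb(5)[OF rF])
 have K: "K >= 0" unfolding K_def using symb_nonneg[OF \<sigma>] by (simp add: integral_nonneg_AE)
 have int: "L1 (%\<nu>. F \<nu> * G \<nu>)" and int': "L1 (%\<nu>. K * (wt \<nu> powr m * norm (F \<nu>)))" if F: "rapid F" for F
 proof -
  have [measurable]: "F \<in> Borel" using F by (simp add: rapid_def)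
  show i: "L1 (%\<nu>. K * (wt \<nu> powr m * norm (F \<nu>)))" using F by (simp add: rapid_def)
  show "L1 (%\<nu>. F \<nu> * G \<nu>)"
  proof (rule Bochner_Integration.integrable_bound[OF i])
   show "AE \<nu> in lborel. norm (F \<nu> * G \<nu>) <= norm (K * (wt \<nu> powr m * norm (F \<nu>)))"
    using mult_left_mono[OF G norm_ge_zero] K by (intro AE_I2) (simp add: norm_mult mult_ac)
  qed measurable
 qed
 have rA: "rapid (hilo j f g)" and rB: "rapid (lohi j f g)" for j
  using local_pair_psi[OF f g, of j] unfolding local_pair_def by blast+
 define A where "A = (%j. cv a (Bil \<sigma> (hilo j f g)) x + cv a (Bil \<sigma> (lohi j f g)) x)"
 have A: "(\<Sum>j\<le>J. A j) = (LBINT \<nu>. freq_pair (dil (1 / 2 ^ J)) (dil (1 / 2 ^ J)) f g \<nu> * G \<nu>)" for J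
 proof -
  have "(\<Sum>j\<le>J. A j) = (\<Sum>j\<le>J. LBINT \<nu>. (hilo j f g \<nu> * G \<nu> + lohi j f g \<nu> * G \<nu>))"
   unfolding A_def cv[OF rA] cv[OF rB] by (intro sum.cong refl Bochner_Integration.integral_add[symmetric] int rA rB)
  also have "... = (LBINT \<nu>. (\<Sum>j\<le>J. hilo j f g \<nu> * G \<nu> + lohi j f g \<nu> * G \<nu>))"
   by (intro Bochner_Integration.integral_sum[symmetric] Bochner_Integration.integrable_add int rA rB)
  finally show ?thesis by (simp only: sum_distrib_right[symmetric] distrib_right[symmetric] sum_freq_pair)
 qed
 have lim: "(%J. \<Sum>j\<le>J. A j) \<longlonglongrightarrow> cv a (Bil \<sigma> ?F) x"
  unfolding A cv[OF rF]
 proof (rule integral_dominated_convergence)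
  show "L1 (%\<nu>. K * (wt \<nu> powr m * norm (?F \<nu>)))" by (rule int'[OF rF])
  show "(%\<nu>. ?F \<nu> * G \<nu>) \<in> borel_measurable lborel" by (rule borel_measurable_integrable[OF int[OF rF]])
  have r: "rapid (freq_pair (dil (1 / 2 ^ J)) (dil (1 / 2 ^ J)) f g)" for J
   unfolding freq_pair_def[abs_def]
  proof (rule rapid_mult[OF rF])
   have [measurable]: "dil c \<in> Borel" for c by (rule smooth_imp_measurable[OF smooth_dil])
   show "(%\<nu> :: (real^'n) \<times> (real^'n). dil (1 / 2 ^ J) (fst \<nu>) * dil (1 / 2 ^ J) (snd \<nu>)) \<in> Borel" unfolding borel_prod[symmetric] by measurable
   show "norm (dil (1 / 2 ^ J) (fst \<nu>) * dil (1 / 2 ^ J) (snd \<nu>)) <= 1" for \<nu> :: "(real^'n) \<times> (real^'n)"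
    unfolding norm_mult by (intro mult_le_one norm_dil_le) auto
  qed
  show "(%\<nu>. freq_pair (dil (1 / 2 ^ J)) (dil (1 / 2 ^ J)) f g \<nu> * G \<nu>) \<in> borel_measurable lborel" for J
   by (rule borel_measurable_integrable[OF int[OF r]])
  show "AE \<nu> in lborel. (%J. freq_pair (dil (1 / 2 ^ J)) (dil (1 / 2 ^ J)) f g \<nu> * G \<nu>) \<longlonglongrightarrow> ?F \<nu> * G \<nu>"
  proof (rule AE_I2, rule tendsto_eventually)
   fix \<nu> :: "(real^'n) \<times> (real^'n)"
   obtain J0 where J0: "norm (fst \<nu>) + norm (snd \<nu>) < 2 ^ J0" using real_arch_pow[of 2 "norm (fst \<nu>) + norm (snd \<nu>)"] by auto
   show "\<forall>\<^sub>F J in sequentially. freq_pair (dil (1 / 2 ^ J)) (dil (1 / 2 ^ J)) f g \<nu> * G \<nu> = ?F \<nu> * G \<nu>"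
    unfolding eventually_sequentially
   proof (intro exI allI impI)
    fix J assume "J0 <= J"
    hence "(2::real) ^ J0 <= 2 ^ J" by (intro power_increasing) auto
    hence "norm (fst \<nu>) <= 2 ^ J" "norm (snd \<nu>) <= 2 ^ J" using J0 norm_ge_zero[of "fst \<nu>"] norm_ge_zero[of "snd \<nu>"] by linarith+
    hence "dil (1 / 2 ^ J) (fst \<nu>) = 1" "dil (1 / 2 ^ J) (snd \<nu>) = 1" by (auto intro!: dil_one simp: field_simps)
    thus "freq_pair (dil (1 / 2 ^ J)) (dil (1 / 2 ^ J)) f g \<nu> * G \<nu> = ?F \<nu> * G \<nu>" by (simp add: freq_pair_def)
   qed
  qed
  show "AE \<nu> in lborel. norm (freq_pair (dil (1 / 2 ^ J)) (dil (1 / 2 ^ J)) f g \<nu> * G \<nu>) <= K * (wt \<nu> powr m * norm (?F \<nu>))" for J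
  proof (rule AE_I2)
   fix \<nu> :: "(real^'n) \<times> (real^'n)"
   have "norm (dil (1 / 2 ^ J) (fst \<nu>) * dil (1 / 2 ^ J) (snd \<nu>)) <= 1" unfolding norm_mult by (intro mult_le_one norm_dil_le) auto
   hence "norm (dil (1 / 2 ^ J) (fst \<nu>) * dil (1 / 2 ^ J) (snd \<nu>)) * (norm (?F \<nu>) * norm (G \<nu>)) <= 1 * (norm (?F \<nu>) * (K * wt \<nu> powr m))"
    by (intro mult_mono G) auto
   thus "norm (freq_pair (dil (1 / 2 ^ J)) (dil (1 / 2 ^ J)) f g \<nu> * G \<nu>) <= K * (wt \<nu> powr m * norm (?F \<nu>))"
    by (simp add: freq_pair_def norm_mult mult_ac)
  qed
 qed
 have "enorm (cv a (Bil \<sigma> ?F) x) <= (\<Sum>j. enorm (A j))"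
 proof (rule LIMSEQ_le_const2)
  show "(%J. enorm (\<Sum>j\<le>J. A j)) \<longlonglongrightarrow> enorm (cv a (Bil \<sigma> ?F) x)"
   by (intro tendsto_ennrealI tendsto_norm lim)
  show "\<exists>N. \<forall>J\<ge>N. enorm (\<Sum>j\<le>J. A j) <= (\<Sum>j. enorm (A j))"
  proof (intro exI allI impI)
   fix J
   have "enorm (\<Sum>j\<le>J. A j) <= (\<Sum>j\<le>J. enorm (A j))" by (auto simp: sum_ennreal intro!: ennreal_leI norm_sum)
   also have "... <= (\<Sum>j. enorm (A j))" by (rule sum_le_suminf) (auto intro: summableI)
   finally show "enorm (\<Sum>j\<le>J. A j) <= (\<Sum>j. enorm (A j))" .
  qed
 qed
 hence "epowr (enorm (cv a (Bil \<sigma> ?F) x)) t <= epowr (\<Sum>j. enorm (A j)) t" by (rule epowr_mono[OF t(1)])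
 also have "... <= (\<Sum>j. epowr (enorm (A j)) t)" by (rule epowr_suminf_le[OF t])
 also have "... <= (\<Sum>j. epowr (enorm (cv a (Bil \<sigma> (hilo j f g)) x)) t +
     epowr (enorm (cv a (Bil \<sigma> (lohi j f g)) x)) t)"
 proof (rule suminf_le)
  fix j
  have "epowr (enorm (A j)) t <= epowr (enorm (cv a (Bil \<sigma> (hilo j f g)) x) +
     enorm (cv a (Bil \<sigma> (lohi j f g)) x)) t"
   unfolding A_def by (intro epowr_mono t) (auto simp flip: ennreal_plus intro!: ennreal_leI norm_triangle_ineq)
  also have "... <= epowr (enorm (cv a (Bil \<sigma> (hilo j f g)) x)) t +
     epowr (enorm (cv a (Bil \<sigma> (lohi j f g)) x)) t" by (rule epowr_add_le[OF t])
  finally show "epowr (enorm (A j)) t <= ..." .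
 qed (auto intro: summableI)
 finally show ?thesis .
qed

end

section \<open>Summation over all frequency pairs\<close>

lemma polynomial_le_geometric:
 assumes "a >= 0" "b > 0"
 obtains C where "C > 0" "!!i::nat. (1 + real i) powr a <= C * 2 powr (b * real i)"
proof -
 \<comment> \<open>From 1 + d i <= exp (d i): this d is small enough that the power a of the
   exponential stays below 2^(b i). The \<open>a + 1\<close> allows a = 0.\<close>
 define d where "d = min 1 (b * ln 2 / (a + 1))"
 have d: "0 < d" "d <= 1" "a * d <= b * ln 2"
 proof -
  show "0 < d" "d <= 1" using assms by (auto simp: d_def)
  have "a * d <= a * (b * ln 2 / (a + 1))" using assms by (intro mult_left_mono) (auto simp: d_def)
  also have "... <= b * ln 2" using assms by (simp add: field_simps)
  finally show "a * d <= b * ln 2" .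
 qed
 show thesis
 proof (rule that[of "(1 / d) powr a"])
  show "(1 / d) powr a > 0" using d by simp
  fix i :: nat
  have "d * (1 + real i) <= 1 + d * real i" using d by (simp add: distrib_left)
  also have "... <= exp (d * real i)" by (rule exp_ge_add_one_self)
  finally have "1 + real i <= (1 / d) * exp (d * real i)" using d by (simp add: field_simps)
  hence "(1 + real i) powr a <= ((1 / d) * exp (d * real i)) powr a" using assms by (intro powr_mono2) auto
  also have "... = (1 / d) powr a * exp (a * d * real i)" using d by (subst powr_mult) (auto simp: powr_def mult_ac)
  also have "exp (a * d * real i) <= exp (b * ln 2 * real i)" using d(3) by (simp add: mult_right_mono)
  also have "exp (b * ln 2 * real i) = 2 powr (b * real i)" by (simp add: powr_def mult_ac)
  finally show "(1 + real i) powr a <= (1 / d) powr a * 2 powr (b * real i)" using d by (simp add: mult_left_mono)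
 qed
qed

text \<open>For k < j the loss is beaten because s t - n (1-t) = 2 e0 > 0; for k > j the number
  \<open>M\<close> of integrations by parts is chosen large enough. Of the resulting decay 2 e0 in
  |k - j|, one half pays for the quotient of the weights and the other half remains.\<close>

lemma scale_bound:
 fixes s t n e :: real
 assumes "t > 0" "s * t > n * (1 - t)" "e >= 0"
 obtains C M e0 where "C > 0" "e0 > 0" "!!j k::nat.
  2 powr (real k * s * t) * 2 powr (real (j - k) * n * (1 - t) - real (k - j) * real M * t) * ((1 + real j) / (1 + real k)) powr (e * t)
   <= C * 2 powr (real j * s * t) * 2 powr (- e0 * \<bar>real k - real j\<bar>)"
proof -
 define e0 where "e0 = (s * t - n * (1 - t)) / 2"
 have e0: "e0 > 0" using assms by (simp add: e0_def)
 define M where "M = nat \<lceil>s + 2 * e0 / t\<rceil>"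
 have "s + 2 * e0 / t <= real M" unfolding M_def by (rule real_nat_ceiling_ge)
 hence "(s + 2 * e0 / t) * t <= real M * t" using assms by (intro mult_right_mono) auto
 hence M: "s * t + 2 * e0 <= real M * t" using assms by (simp add: distrib_right)
 obtain C where C: "C > 0" "!!i::nat. (1 + real i) powr (e * t) <= C * 2 powr (e0 * real i)"
  by (rule polynomial_le_geometric[of "e * t" e0]) (use assms e0 in auto)
 show thesis
 proof (rule that[OF C(1) e0])
  fix j k :: nat
  let ?E = "(real (j - k) * n * (1 - t) - real (k - j) * real M * t)"
  define i where "i = (if j <= k then k - j else j - k)"
  have i: "\<bar>real k - real j\<bar> = real i" by (auto simp: i_def of_nat_diff)
  \<comment> \<open>Bounds the quotient of the weights by the distance i of the scales
    alone.\<close>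
  have "(1 + real j) <= (1 + real i) * (1 + real k)"
  proof -
   have "real j <= real i + real k" using i by linarith
   moreover have "0 <= real i * real k" by simp
   ultimately show ?thesis unfolding distrib_left distrib_right by linarith
  qed
  hence "((1 + real j) / (1 + real k)) powr (e * t) <= (1 + real i) powr (e * t)"
   using assms by (intro powr_mono2) (auto simp: pos_divide_le_eq)
  also have "... <= C * 2 powr (e0 * real i)" by (rule C(2))
  finally have 1: "((1 + real j) / (1 + real k)) powr (e * t) <= C * 2 powr (e0 * real i)" .
  have x: "real k * s * t + ?E <= real j * s * t - 2 * e0 * real i"
  proof (cases "j <= k")
   case True
   have "real i * (s * t + 2 * e0) <= real i * (real M * t)" by (rule mult_left_mono[OF M]) simp
   moreover have "real i * (s * t + 2 * e0) = real i * (s * t) + 2 * e0 * real i" by (simp add: distrib_left)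
   moreover have e: "real (j - k) = 0" "real (k - j) = real i" using True by (simp_all add: i_def)
   moreover have "real k * s * t = real j * s * t + real i * (s * t)"
   proof -
    have "real k = real j + real i" using True by (simp add: i_def)
    thus ?thesis by (simp only: distrib_right mult.assoc)
   qed
   ultimately show ?thesis unfolding e mult.assoc[of "real i"] by linarith
  next
   case False
   hence "real (k - j) = 0" "real (j - k) = real i" by (simp_all add: i_def)
   moreover have "real j * s * t = real k * s * t + real i * (s * t)"
   proof -
    have "real j = real k + real i" using False by (simp add: i_def)
    thus ?thesis by (simp only: distrib_right mult.assoc)
   qed
   moreover have "2 * e0 = s * t - n * (1 - t)" by (simp add: e0_def)
   hence "2 * e0 * real i = real i * (s * t) - real i * n * (1 - t)" by (simp only:) (simp add: algebra_simps)
   ultimately show ?thesis by simp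
  qed
  have "2 powr (real k * s * t) * 2 powr ?E <= 2 powr (real j * s * t - 2 * e0 * real i)"
   unfolding powr_add[symmetric] by (rule powr_mono[OF x]) simp
  hence "2 powr (real k * s * t) * 2 powr ?E * ((1 + real j) / (1 + real k)) powr (e * t)
   <= 2 powr (real j * s * t - 2 * e0 * real i) * (C * 2 powr (e0 * real i))"
   by (intro mult_mono 1) auto
  also have "... = C * (2 powr (real j * s * t - 2 * e0 * real i) * 2 powr (e0 * real i))" by (rule mult.left_commute)
  also have "2 powr (real j * s * t - 2 * e0 * real i) * 2 powr (e0 * real i) = 2 powr (real j * s * t) * 2 powr (- e0 * real i)"
   by (simp add: powr_add[symmetric])
  finally show "2 powr (real k * s * t) * 2 powr ?E * ((1 + real j) / (1 + real k)) powr (e * t)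
   <= C * 2 powr (real j * s * t) * 2 powr (- e0 * \<bar>real k - real j\<bar>)" unfolding i by simp
 qed
qed

context LP begin

definition pair_norm :: "ennreal => ennreal => real => ennreal => ennreal => ennreal => ennreal => (real^'n => complex) => (real^'n => complex) => ennreal" where
 "pair_norm p q s p1 q1 p2 q2 f g = wnorm p q s f * wnorm p1 q1 (enn2real (of_nat CARD('n) / p1)) g +
   wnorm p2 q2 (enn2real (of_nat CARD('n) / p2)) f * wnorm p q s g"

text \<open>The pointwise conclusion for p infinite serves the separate low-frequency term of
  \<open>F_norm\<close>, which \<open>tl_norm\<close> does not contain.\<close>

lemma Bil_tl_norm:
 assumes t: "0 < t" "t < 1" "ennreal t < p" "ennreal t < q" and s: "s * t > real CARD('n) * (1 - t)"
  and p1: "p1 > 0" "q1 > 0" "p1 = \<infinity> ==> e >= 1" "p1 < \<infinity> ==> e >= 1 - 1 / max 1 (enn2real p1)"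
  and p2: "p2 > 0" "q2 > 0" "p2 = \<infinity> ==> e >= 1" "p2 < \<infinity> ==> e >= 1 - 1 / max 1 (enn2real p2)"
  and e: "e >= 0" and Cw: "Cw > 0"
 obtains C N where "C > 0" "!!(\<sigma> :: 'n symbol) B f g W b R. symb m N B \<sigma> ==> f \<in> schwartz ==> g \<in> schwartz ==>
  (!!k. 0 <= W k \<and> W k <= Cw * (1 + real k) powr (- e)) ==>
  b = (%k x. ennreal (2 powr (real k * s) * W k * norm (cv (psi k) (Bil \<sigma> (tensor f g)) x))) ==>
  R = ennreal (C * B) * pair_norm p q (s + m) p1 q1 p2 q2 f g ==>
  tl_norm p q b <= R \<and> (p = \<infinity> --> (\<forall>k x. b k x <= R))"
proof -
 have pq: "p > 0" "q > 0" using t by (auto intro: le_less_trans)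
 define D where "D = CARD('n) + 1"
 have D: "D > CARD('n)" by (simp add: D_def)
 \<comment> \<open>The Peetre averages have order \<open>E + E\<close>; after
   \<open>slow_kavg\<close> the order \<open>E\<close>, that is \<open>2 * D\<close>, remains, as
   \<open>tl_norm_Uop\<close> requires.\<close>
 define E where "E = 2 * D"
 show thesis
 proof (rule scale_bound[OF t(1) s e], goal_cases)
 case Cs: (1 Cs M e0)
 show thesis
 proof (rule psi_Peetre[OF t(1,2), where D="E + E"], goal_cases)
 case Cp: (1 Cp)
 show thesis
 proof (rule psi_Bil[OF t(1,2) Cp(1) D, of E m M], simp add: E_def, goal_cases)
 case C1: (1 C1 N)
 show thesis
 proof (rule lowpass[OF p1], assumption, assumption, goal_cases)
 case Ca: (1 Ca)
 show thesis
 proof (rule lowpass[OF p2], assumption, assumption, goal_cases)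
 case Cb: (1 Cb)
 define C2 where "C2 = max Ca Cb"
 have C2: "C2 > 0" "Ca <= C2" "Cb <= C2" using Ca(1) by (auto simp: C2_def)
 \<comment> \<open>The t-th root of the collected constants; the factor 2 leaves 1/2 for each of the
   two families of pairs.\<close>
 define K where "K = (2 * C1 * (Cw * C2) powr t * Cs) powr (1 / t)"
 have K: "K > 0" "K powr t = 2 * C1 * (Cw * C2) powr t * Cs" using t C1(1) C2(1) Cs(1) Cw by (auto simp: K_def powr_powr)
 show thesis
 proof (rule tl_norm_Uop[where 'n='n, OF D Cs(2) t(1,3,4)], goal_cases)
 case C3: (1 C3)
 show ?thesis
 proof (rule tl_norm_linfty_pointwise[where 'n='n, OF trans_less_add1[OF D, of D] Cs(2) pq(2) t(1) less_imp_le[OF t(4)], folded mult_2], goal_cases)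
 case C4: (1 C4)
 show thesis
 proof (rule tl_norm_add[where 'n='n, OF pq], goal_cases)
 case C5: (1 C5)
 define C6 where "C6 = max C3 C4"
 have C6: "C6 > 0" "C3 <= C6" "C4 <= C6" using C3(1) by (auto simp: C6_def)
 show thesis
 proof (rule that[of "C6 * C5 * K" N])
  show "C6 * C5 * K > 0" using C6 C5 K by simp
  fix \<sigma> :: "'n symbol" and B f g W b R
  assume \<sigma>: "symb m N B \<sigma>" and f: "f \<in> schwartz" and g: "g \<in> schwartz"
   and W: "!!k::nat. 0 <= W k \<and> W k <= Cw * (1 + real k) powr (- e)"
   and b: "b = (%k x. ennreal (2 powr (real k * s) * W k * norm (cv (psi k) (Bil \<sigma> (tensor f g)) x)))"
   and R: "R = ennreal (C6 * C5 * K * B) * pair_norm p q (s + m) p1 q1 p2 q2 f g"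
  let ?T = "Bil \<sigma> (tensor f g)"
  define Gg where "Gg = wnorm p1 q1 (enn2real (of_nat CARD('n) / p1)) g"
  define Gf where "Gf = wnorm p2 q2 (enn2real (of_nat CARD('n) / p2)) f"
  \<comment> \<open>Constants and low-frequency norms are put inside the sequences, so that the
    bounds for the pairs become terms of \<open>Uop\<close> for the t-th powers of
    \<open>X + Y\<close>.\<close>
  define X where "X = (%j y. (ennreal (K * B) * Gg) * ennreal (2 powr (real j * (s + m)) * norm (cv (psi j) f y)))"
  define Y where "Y = (%j y. (ennreal (K * B) * Gf) * ennreal (2 powr (real j * (s + m)) * norm (cv (psi j) g y)))"
  have B: "B >= 0" by (rule symb_nonneg[OF \<sigma>])
  have XY[measurable]: "X j \<in> Borel" "Y j \<in> Borel" for j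
   unfolding X_def Y_def using wnorm_measurable[OF f] wnorm_measurable[OF g] by measurable
  note T = conv_Bil(1,2)[OF \<sigma> rapid_fourier[OF f g] integrable_inv_fourier[OF psi_schwartz[of 0]]]
  have "cv (psi k) ?T \<in> Borel" for k
   unfolding cv_def by (rule borel_measurable_continuous_onI[OF LP_piece_eq(2)[OF psi_schwartz T]])
  hence bm: "b k \<in> Borel" for k unfolding b by measurable
  have piece: "ennreal ((2 powr (real k * s) * W k) powr t) * epowr (enorm (cv (psi k) (Bil \<sigma> F) x)) t \<le>
    ennreal (1 / 2) * (geo e0 k j * kavg (2 * D) (min j k) (%y. epowr ((ennreal (K * B) * G) * ennreal (2 powr (real j * (s + m)) * norm (u y))) t) x)"
   if lp: "local_pair j u v F \<or> local_pair j v u F" and pe: "peetre E t Cp j u" and v: "!!y. enorm (v y) <= ennreal (C2 * (1 + real j) powr e) * G"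
   for j u v F G k x
  proof -
   have [measurable]: "u \<in> Borel" using lp unfolding local_pair_def by auto
   let ?k = "kavg E (min j k) (%y. epowr (enorm (u y)) t) x"
   define \<rho> where "\<rho> = 2 powr (real (j - k) * real CARD('n) * (1 - t) - real (k - j) * real M * t)"
   have \<rho>: "\<rho> >= 0" by (simp add: \<rho>_def)
   let ?C = "(C1 * (B * (2 ^ j) powr m) powr t * \<rho>)"
   let ?K = "((K * B) powr t * 2 powr (real j * (s + m) * t))"
   have "ennreal ((2 powr (real k * s) * W k) powr t) * epowr (enorm (cv (psi k) (Bil \<sigma> F) x)) t
    <= ennreal ((2 powr (real k * s) * W k) powr t) * (ennreal ?C * (epowr (ennreal (C2 * (1 + real j) powr e) * G) t * ?k))"
    unfolding \<rho>_def by (intro mult_left_mono C1(2)[OF \<sigma> lp pe v]) simp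
   also have "... = ennreal ((2 powr (real k * s) * W k) powr t * ?C * (C2 * (1 + real j) powr e) powr t) * (epowr G t * ?k)"
   proof -
    have "epowr (ennreal (C2 * (1 + real j) powr e) * G) t = ennreal ((C2 * (1 + real j) powr e) powr t) * epowr G t"
     using t C2(1) by (simp add: epowr_mult epowr_ennreal)
    moreover have "ennreal a * (ennreal b * ((ennreal c * g) * k)) = ennreal (a * b * c) * (g * k)" if "a >= 0" "b >= 0" "c >= 0" for a b c g k
     using that by (simp add: ennreal_mult mult_ac)
    ultimately show ?thesis using C1(1) \<rho> by simp
   qed
   also have "... <= ennreal (1 / 2 * 2 powr (- e0 * \<bar>real k - real j\<bar>) * ?K) * (epowr G t * ?k)"
   proof (intro mult_right_mono ennreal_leI)
    have "(2 powr (real k * s) * W k) powr t <= (2 powr (real k * s) * (Cw * (1 + real k) powr (- e))) powr t"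
     using W[of k] t by (intro powr_mono2 mult_left_mono) auto
    also have "... = 2 powr (real k * s * t) * (Cw powr t * (1 + real k) powr (- (e * t)))"
     using Cw by (simp add: powr_mult powr_powr)
    finally have "(2 powr (real k * s) * W k) powr t * ?C * (C2 * (1 + real j) powr e) powr t \<le>
     2 powr (real k * s * t) * (Cw powr t * (1 + real k) powr (- (e * t))) * ?C * (C2 * (1 + real j) powr e) powr t"
     using C1(1) \<rho> by (intro mult_right_mono) auto
    also have "... = C1 * (Cw * C2) powr t * B powr t * 2 powr (real j * m * t) * (2 powr (real k * s * t) * \<rho> * ((1 + real j) / (1 + real k)) powr (e * t))"
    proof -
     have "(2 ^ j) powr m = 2 powr (real j * m)" by (simp add: powr_powr flip: powr_realpow)
     moreover have "((1 + real j) / (1 + real k)) powr (e * t) = (1 + real j) powr (e * t) * (1 + real k) powr (- (e * t))"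
      by (simp add: powr_divide powr_minus_divide)
     ultimately show ?thesis using Cw C2(1) B by (simp add: powr_mult powr_powr mult_ac)
    qed
    also have "... <= C1 * (Cw * C2) powr t * B powr t * 2 powr (real j * m * t) * (Cs * 2 powr (real j * s * t) * 2 powr (- e0 * \<bar>real k - real j\<bar>))"
     unfolding \<rho>_def using C1(1) by (intro mult_left_mono Cs(3)) auto
    also have "... = 1 / 2 * 2 powr (- e0 * \<bar>real k - real j\<bar>) * ?K"
     using K B by (simp add: powr_mult distrib_left distrib_right powr_add mult_ac)
    finally show "(2 powr (real k * s) * W k) powr t * ?C * (C2 * (1 + real j) powr e) powr t <= ..." .
   qed auto
   also have "... = ennreal (1 / 2) * (geo e0 k j * (ennreal ?K * (epowr G t * ?k)))"
    by (simp only: geo_def ennreal_mult' ennreal_mult'' mult.assoc zero_le_divide_1_iff zero_le_numeral powr_ge_zero mult_nonneg_nonneg)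
   also have "ennreal ?K * (epowr G t * ?k) =
     kavg E (min j k) (%y. (ennreal ?K * epowr G t) * epowr (enorm (u y)) t) x"
    by (subst kavg_cmult) (auto simp: mult.assoc)
   also have "(%y. (ennreal ?K * epowr G t) * epowr (enorm (u y)) t) =
     (%y. epowr ((ennreal (K * B) * G) * ennreal (2 powr (real j * (s + m)) * norm (u y))) t)"
   proof
    fix y
    let ?a = "2 powr (real j * (s + m))"
    have "epowr ((ennreal (K * B) * G) * ennreal (?a * norm (u y))) t = (epowr (ennreal (K * B)) t * epowr G t) * (epowr (ennreal ?a) t * epowr (enorm (u y)) t)"
     using t(1) by (simp only: ennreal_mult powr_ge_zero norm_ge_zero epowr_mult)
    also have "epowr (ennreal (K * B)) t = ennreal ((K * B) powr t)" using K(1) B by (intro epowr_ennreal) simp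
    also have "epowr (ennreal ?a) t = ennreal (2 powr (real j * (s + m) * t))" by (simp add: epowr_ennreal powr_powr)
    finally show "(ennreal ?K * epowr G t) * epowr (enorm (u y)) t =
     epowr ((ennreal (K * B) * G) * ennreal (?a * norm (u y))) t" by (simp add: ennreal_mult mult_ac)
   qed
   finally show ?thesis unfolding E_def .
  qed
  have pe: "peetre E t Cp j (cv (psi j) h)" if "h \<in> schwartz" for h j
   unfolding peetre_def using Cp(2)[OF that] by blast
  have lowg: "enorm (cv (dil (1 / 2 ^ j)) g y) <= ennreal (C2 * (1 + real j) powr e) * Gg" for j y
   unfolding Gg_def by (rule order_trans[OF Ca(2)[OF g] mult_right_mono]) (use C2 in \<open>auto intro!: ennreal_leI mult_right_mono\<close>)
  have "enorm (cv (dil (1 / 2 ^ j)) f y) <= ennreal (C2 * (1 + real j) powr e) * Gf" for j y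
   unfolding Gf_def by (rule order_trans[OF Cb(2)[OF f] mult_right_mono]) (use C2 in \<open>auto intro!: ennreal_leI mult_right_mono\<close>)
  note lowf = low_bound[OF C2(1) e this]
  have U: "epowr (b k x) t <= Uop (2 * D) e0 (%j y. epowr (X j y + Y j y) t) k x" for k x
  proof -
   let ?A = "%j. epowr (enorm (cv (psi k) (Bil \<sigma> (hilo j f g)) x)) t"
   let ?B = "%j. epowr (enorm (cv (psi k) (Bil \<sigma> (lohi j f g)) x)) t"
   let ?c = "ennreal ((2 powr (real k * s) * W k) powr t)"
   have "epowr (b k x) t = ?c * epowr (enorm (cv (psi k) ?T x)) t"
   proof -
    have A: "2 powr (real k * s) * W k >= 0" using W[of k] by simp
    show ?thesis unfolding b ennreal_mult[OF A norm_ge_zero] epowr_mult[OF t(1)] epowr_ennreal[OF A] ..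
   qed
   also have "... <= ?c * (\<Sum>j. ?A j + ?B j)"
    using t by (intro mult_left_mono cv_Bil_decomp[OF \<sigma> psi_schwartz f g]) auto
   also have "... = (\<Sum>j. ?c * ?A j + ?c * ?B j)"
    unfolding ennreal_suminf_cmult[symmetric] by (simp add: distrib_left)
   also have "... <= Uop (2 * D) e0 (%j y. epowr (X j y + Y j y) t) k x"
    unfolding Uop_def
   proof (rule suminf_le)
    fix j
    let ?Z = "geo e0 k j * kavg (2 * D) (min j k) (%y. epowr (X j y + Y j y) t) x"
    have "?c * ?A j <= ennreal (1 / 2) * ?Z"
     using piece[OF disjI1[OF local_pair_psi(1)[OF f g]] pe[OF f] lowg, where k=k and x=x]
     by (rule order_trans) (intro mult_left_mono kavg_mono epowr_mono t, auto simp: X_def)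
    moreover have "?c * ?B j <= ennreal (1 / 2) * ?Z"
     using piece[OF disjI2[OF local_pair_psi(2)[OF f g]] pe[OF g] lowf, where k=k and x=x]
     by (rule order_trans) (intro mult_left_mono kavg_mono epowr_mono t, auto simp: Y_def)
    ultimately have "?c * ?A j + ?c * ?B j <= ennreal (1 / 2) * ?Z + ennreal (1 / 2) * ?Z"
     by (rule add_mono)
    also have "... = (ennreal (1 / 2) + ennreal (1 / 2)) * ?Z" by (rule distrib_right[symmetric])
    also have "ennreal (1 / 2) + ennreal (1 / 2) = 1" by (subst ennreal_plus[symmetric]) auto
    also have "1 * ?Z = ?Z" by simp
    finally show "?c * ?A j + ?c * ?B j <= ?Z" .
   qed (auto intro: summableI)
   finally show ?thesis .
  qed
  have XYm: "(%y. X j y + Y j y) \<in> Borel" for j by measurable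
  have tXY: "ennreal C6 * tl_norm p q (%j y. X j y + Y j y) <= R"
  proof -
   have "tl_norm p q (%j y. X j y + Y j y) <= ennreal C5 * (tl_norm p q X + tl_norm p q Y)" by (rule C5(2)) measurable
   also have "... <= ennreal C5 * ((ennreal (K * B) * Gg) * wnorm p q (s + m) f + (ennreal (K * B) * Gf) * wnorm p q (s + m) g)"
    unfolding X_def Y_def wnorm_def
    by (intro mult_left_mono add_mono tl_norm_cmult_le pq wnorm_measurable f g) simp
   finally have "ennreal C6 * tl_norm p q (%j y. X j y + Y j y) \<le>
    ennreal C6 * (ennreal C5 * ((ennreal (K * B) * Gg) * wnorm p q (s + m) f + (ennreal (K * B) * Gf) * wnorm p q (s + m) g))" by (rule mult_left_mono) simp
   also have "... = ennreal (C6 * C5 * (K * B)) * (wnorm p q (s + m) f * Gg + Gf * wnorm p q (s + m) g)"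
    using C6(1) C5(1) K(1) B by (simp add: ennreal_mult distrib_left mult_ac)
   finally show ?thesis unfolding R pair_norm_def Gf_def Gg_def by (simp only: mult.assoc)
  qed
  have "tl_norm p q b <= ennreal C3 * tl_norm p q (%j y. X j y + Y j y)" by (rule C3(2)[OF XYm bm U])
  also have "... <= ennreal C6 * tl_norm p q (%j y. X j y + Y j y)" using C6 by (intro mult_right_mono ennreal_leI) auto
  also note tXY
  finally have 1: "tl_norm p q b <= R" .
  moreover have "b k x <= R" if "p = \<infinity>" for k x
  proof -
   have "b k x <= ennreal C4 * tl_norm \<infinity> q (%j y. X j y + Y j y)" by (rule C4(2)[OF XYm U])
   also have "... <= ennreal C6 * tl_norm p q (%j y. X j y + Y j y)" unfolding that using C6 by (intro mult_right_mono ennreal_leI) auto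
   also note tXY
   finally show ?thesis .
  qed
  ultimately show "tl_norm p q b <= R \<and> (p = \<infinity> --> (\<forall>k x. b k x <= R))" by blast
 qed
 qed
 qed
 qed
 qed
 qed
 qed
 qed
 qed
qed

end

section \<open>From sequences to Triebel-Lizorkin quasi-norms\<close>

text \<open>Scaling by c is undone by scaling by 1/c, so one inequality gives both.\<close>

lemma esssup_cmult_ennreal:
 fixes f :: "'a => ennreal"
 assumes [measurable]: "f \<in> borel_measurable M" and c: "c > (0::real)"
 shows "esssup M (%x. ennreal c * f x) = ennreal c * esssup M f"
proof (rule antisym)
 have le: "esssup M (%x. ennreal d * g x) <= ennreal d * esssup M g" if "g \<in> borel_measurable M" for d g
  by (rule esssup_least) (use that esssup_AE[of g M] in \<open>auto elim!: eventually_mono intro!: mult_left_mono\<close>)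
 show "esssup M (%x. ennreal c * f x) <= ennreal c * esssup M f" by (rule le) fact
 have inv: "ennreal c * (ennreal (1 / c) * z) = z" "ennreal (1 / c) * (ennreal c * z) = z" for z
  using c by (simp_all flip: ennreal_mult mult.assoc)
 have "esssup M (%x. ennreal (1 / c) * (ennreal c * f x)) <= ennreal (1 / c) * esssup M (%x. ennreal c * f x)"
  by (rule le) measurable
 hence "ennreal c * esssup M f <= ennreal c * (ennreal (1 / c) * esssup M (%x. ennreal c * f x))"
  by (intro mult_left_mono) (simp_all add: inv)
 thus "ennreal c * esssup M f <= esssup M (%x. ennreal c * f x)" unfolding inv .
qed

lemma F_norm_eq:
 fixes u :: "'n::finite functional"
 assumes u: "tempered_distribution u" and w: "!!j::nat. w (2 powr (- real j)) > 0" and pq: "p > 0" "q > 0"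
  and m: "!!j. LP_piece \<phi>0 j u \<in> Borel"
 shows "F_norm \<phi>0 s w p q u = (if p = \<infinity> \<and> q < \<infinity> then Linf_norm (LP_piece \<phi>0 0 u) else 0) +
  tl_norm p q (%j x. ennreal (2 powr (real j * s) * w (2 powr (- real j)) * norm (LP_piece \<phi>0 j u x)))"
proof -
 define a where "a = (%j x. ennreal (2 powr (real j * s) * w (2 powr (- real j)) * norm (LP_piece \<phi>0 j u x)))"
 have b: "ennreal (2 powr (real j * s * r) * w (2 powr (- real j)) powr r * norm (LP_piece \<phi>0 j u x) powr r) = epowr (a j x) r" for j r x
 proof -
  have "w (2 powr (- real j)) >= 0" using w[of j] by simp
  thus ?thesis unfolding a_def by (subst epowr_ennreal) (auto simp: powr_mult powr_powr)
 qed
 have e: "epowr (epowr S (1 / enn2real q)) (enn2real p) = epowr S (enn2real p / enn2real q)" if "p < \<infinity>" "q < \<infinity>" for S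
  using that pq by (subst epowr_epowr) (auto simp: enn2real_positive_iff)
 have s: "ennreal (2 powr (real j * s) * w (2 powr (- real j))) * Linf_norm (LP_piece \<phi>0 j u) = esssup lborel (a j)" for j
 proof -
  have "(%x. enorm (LP_piece \<phi>0 j u x)) \<in> borel_measurable lborel" using m[of j] by measurable
  hence "ennreal (2 powr (real j * s) * w (2 powr (- real j))) * Linf_norm (LP_piece \<phi>0 j u) =
    esssup lborel (%x. ennreal (2 powr (real j * s) * w (2 powr (- real j))) * enorm (LP_piece \<phi>0 j u x))"
   unfolding Linf_norm_def using w[of j] by (intro esssup_cmult_ennreal[symmetric]) auto
  thus ?thesis unfolding a_def using w[of j] by (subst ennreal_mult) auto
 qed
 show ?thesis
  unfolding F_norm_def Let_def b tl_norm_def a_def[symmetric] using u by (auto simp: e s[symmetric] less_top[symmetric])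
qed

context LP begin

lemma dist_of_schwartz: "f \<in> schwartz ==> tempered_distribution (dist_of f)"
 by (rule dist_of_tempered[OF schwartz_measurable schwartz_bounded])

lemma wnorm_le_F_norm:
 assumes f: "f \<in> schwartz" and pq: "p > 0" "q > 0"
 shows "wnorm p q a f <= F_norm \<phi>0 a (%_. 1) p q (dist_of f)"
proof -
 have L: "LP_piece \<phi>0 j (dist_of f) = cv (psi j) f" for j
  by (rule LP_piece_cv[OF schwartz_measurable[OF f] schwartz_bounded[OF f]])
 show ?thesis
  using cv_measurable[OF psi_schwartz f] pq unfolding wnorm_def
  by (subst F_norm_eq[OF dist_of_schwartz[OF f]]) (auto simp: L)
qed

text \<open>The normalising constant is put into the symbol: its modulus is at most 1, so the bound
  of the symbol does not grow.\<close>

lemma bilinear_op_eq: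
 fixes \<sigma> :: "'n symbol"
 shows "bilinear_op \<sigma> f g = Bil (%p. of_real ((2 * pi) powr (- 2 * real CARD('n))) * \<sigma> p) (tensor f g)"
proof
 fix x :: "real^'n"
 have "Bil (%p. of_real ((2 * pi) powr (- 2 * real CARD('n))) * \<sigma> p) (tensor f g) x =
  of_real ((2 * pi) powr (- 2 * real CARD('n))) * (LBINT \<nu>. \<sigma> (x, \<nu>) * (fourier f (fst \<nu>) * fourier g (snd \<nu>)) * wave x \<nu>)"
  unfolding Bil_def by (simp only: mult.assoc integral_mult_right_zero)
 thus "bilinear_op \<sigma> f g x = Bil (%p. of_real ((2 * pi) powr (- 2 * real CARD('n))) * \<sigma> p) (tensor f g) x"
  by (simp add: bilinear_op_def case_prod_beta' inner_prod_def inner_add_right mult.assoc)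
qed

text \<open>Isolates what remains to be chosen: an admissible power \<open>t\<close>, and an
  exponent \<open>e\<close> that dominates the growth of both low-frequency factors.\<close>

theorem bilinear_op_F_norm:
 assumes t: "0 < t" "t < 1" "ennreal t < p" "ennreal t < q" and s: "s * t > real CARD('n) * (1 - t)"
  and p1: "p1 > 0" "q1 > 0" "p1 = \<infinity> ==> e >= 1" "p1 < \<infinity> ==> e >= 1 - 1 / max 1 (enn2real p1)"
  and p2: "p2 > 0" "q2 > 0" "p2 = \<infinity> ==> e >= 1" "p2 < \<infinity> ==> e >= 1 - 1 / max 1 (enn2real p2)"
  and e: "e >= 0" and w: "!!t. t > 0 ==> w t = (1 + log_plus (1 / t)) powr e"
 shows "\<exists>C>0. \<exists>N>0. \<forall>\<sigma>\<in>BS11 m. \<forall>f\<in>schwartz. \<forall>g\<in>schwartz.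
  F_norm \<phi>0 s (%t. 1 / w t) p q (dist_of (bilinear_op \<sigma> f g)) <= ennreal C * BS11_norm m N \<sigma> *
    (F_norm \<phi>0 (s + m) (%_. 1) p q (dist_of f) * F_norm \<phi>0 (enn2real (of_nat CARD('n) / p1)) (%_. 1) p1 q1 (dist_of g)
     + F_norm \<phi>0 (enn2real (of_nat CARD('n) / p2)) (%_. 1) p2 q2 (dist_of f) * F_norm \<phi>0 (s + m) (%_. 1) p q (dist_of g))"
proof -
 have pq: "p > 0" "q > 0" using t by (auto intro: le_less_trans)
 define W where "W = (%k::nat. 1 / w (2 powr (- real k)))"
 have wk: "w (2 powr (- real k)) = (1 + real k * ln 2) powr e" for k :: nat
 proof -
  have "ln (1 / 2 powr (- real k)) = real k * ln 2" by (simp add: powr_minus_divide)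
  moreover have "0 <= real k * ln 2" by simp
  ultimately show ?thesis by (simp add: w log_plus_def)
 qed
 have pos: "1 + real k * ln 2 > 0" for k :: nat by (simp add: add_pos_nonneg)
 \<comment> \<open>At 2^-k the logarithm is k ln 2 >= k / 2, whence the constant 2^e in comparison
   with a power of 1 + k.\<close>
 have W: "0 < W k" "W k <= 2 powr e * (1 + real k) powr (- e)" for k
 proof -
  show "0 < W k" unfolding W_def wk using pos[of k] by simp
  have "real k * (1 / 2) <= real k * ln 2" using ln2_ge_two_thirds by (intro mult_left_mono) auto
  hence "((1 + real k) / 2) powr e <= (1 + real k * ln 2) powr e" using e by (intro powr_mono2) (auto simp: field_simps)
  hence "1 / (1 + real k * ln 2) powr e <= 1 / ((1 + real k) / 2) powr e" using pos[of k] by (intro divide_left_mono) auto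
  also have "... = 2 powr e * (1 + real k) powr (- e)" by (simp add: powr_divide powr_minus_divide)
  finally show "W k <= 2 powr e * (1 + real k) powr (- e)" unfolding W_def wk .
 qed
 have W0: "W 0 = 1" by (simp add: W_def wk[of 0, simplified])
 have Cw: "2 powr e > (0::real)" by simp
 show ?thesis
 proof (rule Bil_tl_norm[OF t s p1 p2 e Cw, where m=m], assumption, assumption, assumption, assumption, goal_cases)
 case C: (1 C N)
 show ?thesis
 proof (intro exI conjI ballI)
  \<comment> \<open>The factor 2 covers the low-frequency term beside \<open>tl_norm\<close>, and
    \<open>Suc N\<close> provides a positive number of derivatives.\<close>
  show "2 * C > 0" using C by simp
  show "Suc N > 0" by simp
  fix \<sigma> :: "'n symbol" and f g :: "real^'n => complex" assume \<sigma>: "\<sigma> \<in> BS11 m" and f: "f \<in> schwartz" and g: "g \<in> schwartz"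
  define B where "B = enn2real (BS11_norm m (Suc N) \<sigma>)"
  have BB: "BS11_norm m (Suc N) \<sigma> = ennreal B" using BS11_symb(1)[OF \<sigma>, of "Suc N"] by (simp add: B_def)
  define \<tau> where "\<tau> = (%p. of_real ((2 * pi) powr (- 2 * real CARD('n))) * \<sigma> p)"
  have c: "norm (complex_of_real ((2 * pi) powr (- 2 * real CARD('n)))) <= 1"
   using powr_mono[of "- 2 * real CARD('n)" 0 "2 * pi"] pi_ge_two by simp
  have \<tau>: "symb m N B \<tau>" unfolding \<tau>_def B_def
   by (rule symb_cmult[OF symb_mono[OF BS11_symb(2)[OF \<sigma>, of "Suc N"]] c]) auto
  define T where "T = Bil \<tau> (tensor f g)"
  have T: "bilinear_op \<sigma> f g = T" unfolding T_def \<tau>_def by (rule bilinear_op_eq)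
  note Tb = conv_Bil(1,2)[OF \<tau> rapid_fourier[OF f g] integrable_inv_fourier[OF psi_schwartz[of 0]], folded T_def]
  have L: "LP_piece \<phi>0 j (dist_of T) = cv (psi j) T" for j by (rule LP_piece_cv[OF Tb])
  have Lm: "cv (psi j) T \<in> Borel" for j
   unfolding cv_def by (rule borel_measurable_continuous_onI[OF LP_piece_eq(2)[OF psi_schwartz Tb]])
  define b where "b = (%k x. ennreal (2 powr (real k * s) * W k * norm (cv (psi k) T x)))"
  define R where "R = ennreal (C * B) * pair_norm p q (s + m) p1 q1 p2 q2 f g"
  have R: "tl_norm p q b <= R" "p = \<infinity> ==> b k x <= R" for k x
   using C(2)[OF \<tau> f g _ b_def[unfolded T_def] R_def] W by (auto simp: less_imp_le)
  have "F_norm \<phi>0 s (%t. 1 / w t) p q (dist_of T) = (if p = \<infinity> \<and> q < \<infinity> then Linf_norm (cv (psi 0) T) else 0) + tl_norm p q b"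
   using W(1) by (subst F_norm_eq[OF dist_of_tempered[OF Tb] _ pq]) (auto simp: L Lm b_def W_def)
  also have "... <= R + R"
  proof (intro add_mono R(1))
   have "Linf_norm (cv (psi 0) T) <= R" if "p = \<infinity>" unfolding Linf_norm_def
   proof (rule esssup_least)
    show "(%x. enorm (cv (psi 0) T x)) \<in> borel_measurable lborel" using Lm[of 0] by measurable
    show "AE x in lborel. enorm (cv (psi 0) T x) <= R" using R(2)[OF that, of 0] by (auto simp: b_def W0)
   qed
   thus "(if p = \<infinity> \<and> q < \<infinity> then Linf_norm (cv (psi 0) T) else 0) <= R" by simp
  qed
  also have "... = ennreal (2 * C) * BS11_norm m (Suc N) \<sigma> * pair_norm p q (s + m) p1 q1 p2 q2 f g"
  proof -
   have "ennreal (2 * C) * ennreal B = ennreal (C * B) + ennreal (C * B)"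
    using C(1) symb_nonneg[OF \<tau>] by (simp flip: ennreal_mult ennreal_plus)
   thus ?thesis unfolding BB R_def by (simp only: distrib_right)
  qed
  also have "... <= ennreal (2 * C) * BS11_norm m (Suc N) \<sigma> *
    (F_norm \<phi>0 (s + m) (%_. 1) p q (dist_of f) * F_norm \<phi>0 (enn2real (of_nat CARD('n) / p1)) (%_. 1) p1 q1 (dist_of g)
     + F_norm \<phi>0 (enn2real (of_nat CARD('n) / p2)) (%_. 1) p2 q2 (dist_of f) * F_norm \<phi>0 (s + m) (%_. 1) p q (dist_of g))"
   unfolding pair_norm_def by (intro mult_left_mono add_mono mult_mono wnorm_le_F_norm f g pq p1 p2) auto
  finally show "F_norm \<phi>0 s (%t. 1 / w t) p q (dist_of (bilinear_op \<sigma> f g)) <= ..." unfolding T .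
 qed
 qed
qed

end

section \<open>Choice of the power t and of the exponent of the weight\<close>

theorem theorem4p3:
  fixes \<phi>0 :: "real ^ 'n::finite \<Rightarrow> real"
    and p q p1 q1 p2 q2 r r' :: ennreal
    and m s :: real
    and w :: "real \<Rightarrow> real"
  assumes "LP_generator \<phi>0"
    and "0 < p" and "0 < q"
    and "s > real CARD('n) * (1 / enn2real (min 1 (min p q)) - 1)"
    and "(0 < p1 \<and> p1 < \<infinity> \<and> 0 < q1) \<or> (p1 = \<infinity> \<and> 0 < q1 \<and> q1 \<le> 2)"
    and "(0 < p2 \<and> p2 < \<infinity> \<and> 0 < q2) \<or> (p2 = \<infinity> \<and> 0 < q2 \<and> q2 \<le> 2)"
    and "r = max 1 (max p1 p2)"
    and "1 / r' = 1 - 1 / r"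
    and "\<And>t. t > 0 \<Longrightarrow> w t = (1 + log_plus (1 / t)) powr enn2real (1 / r')"
  shows "\<exists>C>0. \<exists>N>0. \<forall>\<sigma>\<in>BS11 m. \<forall>f\<in>schwartz. \<forall>g\<in>schwartz.
    F_norm \<phi>0 s (\<lambda>t. 1 / w t) p q (dist_of (bilinear_op \<sigma> f g))
      \<le> ennreal C * BS11_norm m N \<sigma> *
        (F_norm \<phi>0 (s + m) (\<lambda>_. 1) p q (dist_of f)
           * F_norm \<phi>0 (enn2real (of_nat CARD('n) / p1)) (\<lambda>_. 1) p1 q1 (dist_of g)
         + F_norm \<phi>0 (enn2real (of_nat CARD('n) / p2)) (\<lambda>_. 1) p2 q2 (dist_of f)
           * F_norm \<phi>0 (s + m) (\<lambda>_. 1) p q (dist_of g))"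
proof -
 interpret LP \<phi>0 by unfold_locales fact
 have pq: "p > 0" "q > 0" and p1: "p1 > 0" "q1 > 0" and p2: "p2 > 0" "q2 > 0" using assms(2,3,5,6) by auto
 define e where "e = enn2real (1 / r')"
 have r: "r >= 1" using assms(7) by simp
 \<comment> \<open>The exponent 1/r' as a real number; for infinite r, 1 / r = 0 in the extended
   reals gives e = 1.\<close>
 have e: "e = 1 \<and> r = \<infinity> \<or> (\<exists>\<rho>\<ge>1. r = ennreal \<rho> \<and> e = 1 - 1 / \<rho>)"
 proof (cases r)
  case (real \<rho>)
  hence \<rho>: "\<rho> >= 1" using r by simp
  have "1 / r = ennreal (1 / \<rho>)" using real \<rho> by (simp add: divide_ennreal flip: ennreal_1)
  hence "1 / r' = ennreal (1 - 1 / \<rho>)" using assms(8) \<rho> by (simp add: ennreal_minus flip: ennreal_1)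
  thus ?thesis using real \<rho> by (auto simp: e_def)
 qed (use assms(8) in \<open>simp add: e_def\<close>)
 \<comment> \<open>1 - 1/P increases with P, so the exponent belonging to r serves both
   \<open>p1\<close> and \<open>p2\<close>.\<close>
 have e_ge: "(P = \<infinity> --> e >= 1) \<and> (P < \<infinity> --> e >= 1 - 1 / max 1 (enn2real P))" if P: "P <= r" for P
 proof (cases "r = \<infinity>")
  case False
  then obtain \<rho> where \<rho>: "\<rho> >= 1" "r = ennreal \<rho>" "e = 1 - 1 / \<rho>" using e by auto
  hence "P < \<infinity>" "enn2real P <= \<rho>" using P le_less_trans[OF P] enn2real_mono[OF P] by auto
  hence "1 / \<rho> <= 1 / max 1 (enn2real P)" using \<rho> by (intro divide_left_mono) auto
  thus ?thesis using \<open>P < \<infinity>\<close> \<rho> by auto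
 qed (use e in auto)
 define \<mu> where "\<mu> = enn2real (min 1 (min p q))"
 have "0 < min 1 (min p q)" "min 1 (min p q) < \<infinity>" using pq by (auto simp: min_less_iff_disj)
 hence \<mu>: "\<mu> > 0" "ennreal \<mu> = min 1 (min p q)" by (simp_all add: \<mu>_def enn2real_positive_iff)
 hence \<mu>1: "\<mu> <= 1" "ennreal \<mu> <= p" "ennreal \<mu> <= q" by (simp_all add: min_le_iff_disj flip: ennreal_le_1)
 define n where "n = real CARD('n)"
 \<comment> \<open>Positive by the hypothesis on \<open>s\<close>. As \<open>t\<close> must be
   strictly below \<open>\<mu>\<close>, it measures the room that is left.\<close>
 define \<delta> where "\<delta> = s * \<mu> - n * (1 - \<mu>)"
 have "n * (1 / \<mu> - 1) * \<mu> < s * \<mu>" using assms(4) \<mu>(1) by (simp add: \<mu>_def n_def)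
 moreover have "n * (1 / \<mu> - 1) * \<mu> = n * (1 - \<mu>)" using \<mu>(1) by (simp add: field_simps)
 ultimately have \<delta>: "\<delta> > 0" by (simp add: \<delta>_def)
 have n: "n > 0" by (simp add: n_def)
 \<comment> \<open>Lowering t from \<mu> by \<epsilon> changes s t - n (1-t) by (n + s) \<epsilon>,
   which this choice keeps at or below half of \<delta>.\<close>
 define \<epsilon> where "\<epsilon> = min (\<mu> / 2) (\<delta> / (2 * (n + \<bar>s\<bar>)))"
 have \<epsilon>: "0 < \<epsilon>" "\<epsilon> < \<mu>" "\<epsilon> <= \<delta> / (2 * (n + \<bar>s\<bar>))" using \<mu>(1) \<delta> n by (auto simp: \<epsilon>_def add_pos_nonneg)
 define t where "t = \<mu> - \<epsilon>"
 have "(n + s) * \<epsilon> <= (n + \<bar>s\<bar>) * \<epsilon>" using \<epsilon>(1) by (intro mult_right_mono) auto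
 also have "... <= \<delta> / 2" using \<epsilon>(3) n by (simp add: field_simps add_pos_nonneg)
 finally have "(n + s) * \<epsilon> < \<delta>" using \<delta> by simp
 hence st: "s * t > real CARD('n) * (1 - t)" by (simp add: t_def \<delta>_def n_def[symmetric] algebra_simps)
 have t: "0 < t" "t < 1" "ennreal t < p" "ennreal t < q"
 proof -
  show "0 < t" "t < 1" using \<epsilon> \<mu>1 by (auto simp: t_def)
  have "ennreal t < ennreal \<mu>" using \<epsilon> by (simp add: t_def ennreal_less_iff)
  thus "ennreal t < p" "ennreal t < q" using \<mu>1 by (auto intro: less_le_trans)
 qed
 have P: "p1 <= r" "p2 <= r" using assms(7) by (simp_all add: le_max_iff_disj)
 have e0: "e >= 0" by (simp add: e_def)
 show ?thesis
  by (rule bilinear_op_F_norm[OF t st p1 _ _ p2 _ _ e0]) (use e_ge P assms(9) in \<open>auto simp: e_def[symmetric]\<close>)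
qed

end
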